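(* Schoenberg correspondence holds on every dual semigroup: for every dual semigroup $(\mathcal B,\Delta)$, every positive $\odot$-independence, and every conditionally positive linear functional $\psi$ on $\mathcal B$, the convolution exponential $\exp_\star\psi$ is a state on $\mathcal B$. Consequently, for a positive $\odot$-independence, the continuous convolution semigroups of states on $\mathcal B$ are exactly the families $(\exp_\star(t\psi))_{t\ge0}$ with $\psi$ conditionally positive on $\mathcal B$.
   Context: $\sqcup$ is the non-unital free product of algebras with embeddings $i_1,i_2$; $j_1\amalg j_2$ denotes the induced homomorphism between free products. A dual semigroup is a $*$-algebra $\mathcal B$ with a $*$-homomorphism $\Delta:\mathcal B\to\mathcal B\sqcup\mathcal B$, coassociative ($(\Delta\amalg\mathrm{id})\Delta=(\mathrm{id}\amalg\Delta)\Delta$), with $(0\sqcup\mathrm{id})\Delta=\mathrm{id}=(\mathrm{id}\sqcup0)\Delta$. A $\odot$-independence is a product of linear functionals on free products satisfying (A1) $(\phi_1\odot\phi_2)\circ i_k=\phi_k$, (A2) associativity, (A3) $(\phi_1\circ j_1)\odot(\phi_2\circ j_2)=(\phi_1\odot\phi_2)\circ(j_1\amalg j_2)$; it is positive if the $\odot$-product of two states is a state. Convolution $\phi_1\star\phi_2=(\phi_1\odot\phi_2)\circ\Delta$. The convolution exponential $\exp_\star\psi$ is the restriction to $\mathcal B$ of the coalgebra exponential $\sum_{n\ge0}D(\psi)^{\star n}/n!$ on the commutative $*$-bialgebra $\mathrm S(\mathcal B)$ (symmetric tensor $*$-algebra over $\mathcal B$ with comultiplication induced by the independence and $\Delta$),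 where $D(\psi)$ equals $\psi$ on $\mathcal B$ and vanishes on $\mathbf 1$ and on symmetric tensors of degree $\ge2$; equivalently it is the pointwise limit of $(\psi/n)^{\star n}$. A linear functional $\psi$ on a $*$-algebra $\mathcal A$ is conditionally positive if $\psi(a^* )=\overline{\psi(a)}$ and $\psi(a^*a)\ge0$ for all $a\in\mathcal A$; it is a state if its extension $\widetilde\psi$ to $\mathbb C\mathbf 1\oplus\mathcal A$ with $\widetilde\psi(\mathbf 1)=1$ satisfies $\widetilde\psi(x^*x)\ge0$ for all $x$. A continuous convolution semigroup is a family $(\phi_t)_{t\ge0}$ with $\phi_{s+t}=\phi_s\star\phi_t$, $\phi_0=0$, and $\phi_t\to0$ pointwise as $t\to0^+$. *)

theory Defs
  imports "HOL-Analysis.Analysis"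
begin

text \<open>An algebra is given by a carrier set inside a fixed universe type together with
  its operations.  Algebras are complex, associative and non-unital.\<close>

record 'v salg =
  sa_carrier :: "'v set"
  sa_add :: "'v \<Rightarrow> 'v \<Rightarrow> 'v"
  sa_mul :: "'v \<Rightarrow> 'v \<Rightarrow> 'v"
  sa_smul :: "complex \<Rightarrow> 'v \<Rightarrow> 'v"
  sa_star :: "'v \<Rightarrow> 'v"
  sa_zero :: "'v"

definition is_alg :: "'v salg \<Rightarrow> bool" where
  "is_alg A \<longleftrightarrow>
     sa_zero A \<in> sa_carrier A \<and>
     (\<forall>a\<in>sa_carrier A. \<forall>b\<in>sa_carrier A. sa_add A a b \<in> sa_carrier A) \<and>
     (\<forall>a\<in>sa_carrier A. \<forall>b\<in>sa_carrier A. sa_mul A a b \<in> sa_carrier A) \<and>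
     (\<forall>c. \<forall>a\<in>sa_carrier A. sa_smul A c a \<in> sa_carrier A) \<and>
     (\<forall>a\<in>sa_carrier A. \<forall>b\<in>sa_carrier A. \<forall>c\<in>sa_carrier A.
        sa_add A (sa_add A a b) c = sa_add A a (sa_add A b c)) \<and>
     (\<forall>a\<in>sa_carrier A. \<forall>b\<in>sa_carrier A. sa_add A a b = sa_add A b a) \<and>
     (\<forall>a\<in>sa_carrier A. sa_add A a (sa_zero A) = a) \<and>
     (\<forall>a\<in>sa_carrier A. \<exists>b\<in>sa_carrier A. sa_add A a b = sa_zero A) \<and>
     (\<forall>a\<in>sa_carrier A. sa_smul A 1 a = a) \<and>
     (\<forall>c d. \<forall>a\<in>sa_carrier A. sa_smul A (c * d) a = sa_smul A c (sa_smul A d a)) \<and>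
     (\<forall>c d. \<forall>a\<in>sa_carrier A. sa_smul A (c + d) a = sa_add A (sa_smul A c a) (sa_smul A d a)) \<and>
     (\<forall>c. \<forall>a\<in>sa_carrier A. \<forall>b\<in>sa_carrier A.
        sa_smul A c (sa_add A a b) = sa_add A (sa_smul A c a) (sa_smul A c b)) \<and>
     (\<forall>a\<in>sa_carrier A. \<forall>b\<in>sa_carrier A. \<forall>c\<in>sa_carrier A.
        sa_mul A (sa_mul A a b) c = sa_mul A a (sa_mul A b c)) \<and>
     (\<forall>a\<in>sa_carrier A. \<forall>b\<in>sa_carrier A. \<forall>c\<in>sa_carrier A.
        sa_mul A a (sa_add A b c) = sa_add A (sa_mul A a b) (sa_mul A a c)) \<and>
     (\<forall>a\<in>sa_carrier A. \<forall>b\<in>sa_carrier A. \<forall>c\<in>sa_carrier A.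
        sa_mul A (sa_add A a b) c = sa_add A (sa_mul A a c) (sa_mul A b c)) \<and>
     (\<forall>c. \<forall>a\<in>sa_carrier A. \<forall>b\<in>sa_carrier A.
        sa_smul A c (sa_mul A a b) = sa_mul A (sa_smul A c a) b \<and>
        sa_smul A c (sa_mul A a b) = sa_mul A a (sa_smul A c b))"

definition is_star_alg :: "'v salg \<Rightarrow> bool" where
  "is_star_alg A \<longleftrightarrow> is_alg A \<and>
     (\<forall>a\<in>sa_carrier A. sa_star A a \<in> sa_carrier A) \<and>
     (\<forall>a\<in>sa_carrier A. sa_star A (sa_star A a) = a) \<and>
     (\<forall>a\<in>sa_carrier A. \<forall>b\<in>sa_carrier A.
        sa_star A (sa_add A a b) = sa_add A (sa_star A a) (sa_star A b)) \<and>
     (\<forall>c. \<forall>a\<in>sa_carrier A. sa_star A (sa_smul A c a) = sa_smul A (cnj c) (sa_star A a)) \<and>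
     (\<forall>a\<in>sa_carrier A. \<forall>b\<in>sa_carrier A.
        sa_star A (sa_mul A a b) = sa_mul A (sa_star A b) (sa_star A a))"

definition alg_hom :: "'v salg \<Rightarrow> 'v salg \<Rightarrow> ('v \<Rightarrow> 'v) \<Rightarrow> bool" where
  "alg_hom A C f \<longleftrightarrow>
     (\<forall>a\<in>sa_carrier A. f a \<in> sa_carrier C) \<and>
     (\<forall>a\<in>sa_carrier A. \<forall>b\<in>sa_carrier A. f (sa_add A a b) = sa_add C (f a) (f b)) \<and>
     (\<forall>a\<in>sa_carrier A. \<forall>b\<in>sa_carrier A. f (sa_mul A a b) = sa_mul C (f a) (f b)) \<and>
     (\<forall>c. \<forall>a\<in>sa_carrier A. f (sa_smul A c a) = sa_smul C c (f a))"

definition star_hom :: "'v salg \<Rightarrow> 'v salg \<Rightarrow> ('v \<Rightarrow> 'v) \<Rightarrow> bool" where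
  "star_hom A C f \<longleftrightarrow> alg_hom A C f \<and>
     (\<forall>a\<in>sa_carrier A. f (sa_star A a) = sa_star C (f a))"

type_synonym 'v fprod = "'v salg \<times> ('v \<Rightarrow> 'v) \<times> ('v \<Rightarrow> 'v)"

definition is_free_product :: "'v salg \<Rightarrow> 'v salg \<Rightarrow> 'v fprod \<Rightarrow> bool" where
  "is_free_product A1 A2 P \<longleftrightarrow> (case P of (F, i1, i2) \<Rightarrow>
     is_alg A1 \<and> is_alg A2 \<and> is_alg F \<and> alg_hom A1 F i1 \<and> alg_hom A2 F i2 \<and>
     (\<forall>C f1 f2. is_alg C \<and> alg_hom A1 C f1 \<and> alg_hom A2 C f2 \<longrightarrow>
        (\<exists>f. alg_hom F C f \<and> (\<forall>a\<in>sa_carrier A1. f (i1 a) = f1 a) \<and>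
             (\<forall>a\<in>sa_carrier A2. f (i2 a) = f2 a)) \<and>
        (\<forall>f g. alg_hom F C f \<and> (\<forall>a\<in>sa_carrier A1. f (i1 a) = f1 a) \<and>
             (\<forall>a\<in>sa_carrier A2. f (i2 a) = f2 a) \<and>
             alg_hom F C g \<and> (\<forall>a\<in>sa_carrier A1. g (i1 a) = f1 a) \<and>
             (\<forall>a\<in>sa_carrier A2. g (i2 a) = f2 a) \<longrightarrow>
             (\<forall>x\<in>sa_carrier F. f x = g x))))"

definition is_star_free_product :: "'v salg \<Rightarrow> 'v salg \<Rightarrow> 'v fprod \<Rightarrow> bool" where
  "is_star_free_product A1 A2 P \<longleftrightarrow> is_free_product A1 A2 P \<and>
     (case P of (F, i1, i2) \<Rightarrow> is_star_alg A1 \<and> is_star_alg A2 \<and> is_star_alg F \<and>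
        star_hom A1 F i1 \<and> star_hom A2 F i2)"

text \<open>The homomorphism \<open>F \<rightarrow> C\<close> induced by \<open>f1\<close>, \<open>f2\<close> (unique on the carrier).\<close>
definition fp_lift :: "'v salg \<Rightarrow> 'v salg \<Rightarrow> 'v fprod \<Rightarrow> 'v salg \<Rightarrow>
    ('v \<Rightarrow> 'v) \<Rightarrow> ('v \<Rightarrow> 'v) \<Rightarrow> ('v \<Rightarrow> 'v)" where
  "fp_lift A1 A2 P C f1 f2 = (case P of (F, i1, i2) \<Rightarrow>
     (SOME f. alg_hom F C f \<and> (\<forall>a\<in>sa_carrier A1. f (i1 a) = f1 a) \<and>
        (\<forall>a\<in>sa_carrier A2. f (i2 a) = f2 a)))"

definition fp_map :: "'v salg \<Rightarrow> 'v salg \<Rightarrow> 'v fprod \<Rightarrow> 'v fprod \<Rightarrow>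
    ('v \<Rightarrow> 'v) \<Rightarrow> ('v \<Rightarrow> 'v) \<Rightarrow> ('v \<Rightarrow> 'v)" where
  "fp_map A1 A2 P P' j1 j2 = (case P' of (F', i1', i2') \<Rightarrow>
     fp_lift A1 A2 P F' (i1' \<circ> j1) (i2' \<circ> j2))"

text \<open>Canonical isomorphism \<open>(A1 \<sqcup> A2) \<sqcup> A3 \<rightarrow> A1 \<sqcup> (A2 \<sqcup> A3)\<close>, where
  \<open>P12\<close> is a free product of \<open>A1,A2\<close>, \<open>G\<close> one of \<open>F12,A3\<close>, \<open>P23\<close> one of \<open>A2,A3\<close> and
  \<open>H\<close> one of \<open>A1,F23\<close>.\<close>
definition fp_assoc :: "'v salg \<Rightarrow> 'v salg \<Rightarrow> 'v salg \<Rightarrow> 'v fprod \<Rightarrow> 'v fprod \<Rightarrow>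
    'v fprod \<Rightarrow> 'v fprod \<Rightarrow> ('v \<Rightarrow> 'v)" where
  "fp_assoc A1 A2 A3 P12 G P23 H =
     fp_lift (fst P12) A3 G (fst H)
       (fp_lift A1 A2 P12 (fst H) (fst (snd H))
          (snd (snd H) \<circ> fst (snd P23)))
       (snd (snd H) \<circ> snd (snd P23))"

definition lin_fun :: "'v salg \<Rightarrow> ('v \<Rightarrow> complex) \<Rightarrow> bool" where
  "lin_fun A \<phi> \<longleftrightarrow>
     (\<forall>a\<in>sa_carrier A. \<forall>b\<in>sa_carrier A. \<phi> (sa_add A a b) = \<phi> a + \<phi> b) \<and>
     (\<forall>c. \<forall>a\<in>sa_carrier A. \<phi> (sa_smul A c a) = c * \<phi> a)"

definition nonneg_complex :: "complex \<Rightarrow> bool" where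
  "nonneg_complex z \<longleftrightarrow> (\<exists>r::real. r \<ge> 0 \<and> z = complex_of_real r)"

text \<open>\<open>\<psi>\<close> is a state: the unital extension \<open>\<psi>~\<close> to \<open>\<complex>1 \<oplus> A\<close> with \<open>\<psi>~(1) = 1\<close>
  is positive.  For \<open>x = \<lambda>1 + a\<close> one has \<open>x*x = |\<lambda>|\<^sup>2 1 + cnj \<lambda> a + \<lambda> a* + a*a\<close>.\<close>
definition is_state :: "'v salg \<Rightarrow> ('v \<Rightarrow> complex) \<Rightarrow> bool" where
  "is_state A \<psi> \<longleftrightarrow> lin_fun A \<psi> \<and>
     (\<forall>c. \<forall>a\<in>sa_carrier A. nonneg_complex
        (c * cnj c + cnj c * \<psi> a + c * \<psi> (sa_star A a) + \<psi> (sa_mul A (sa_star A a) a)))"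

definition cond_pos :: "'v salg \<Rightarrow> ('v \<Rightarrow> complex) \<Rightarrow> bool" where
  "cond_pos A \<psi> \<longleftrightarrow> lin_fun A \<psi> \<and>
     (\<forall>a\<in>sa_carrier A. \<psi> (sa_star A a) = cnj (\<psi> a)) \<and>
     (\<forall>a\<in>sa_carrier A. nonneg_complex (\<psi> (sa_mul A (sa_star A a) a)))"

text \<open>A product operation: \<open>odot A1 A2 P \<phi>1 \<phi>2\<close> is the functional \<open>\<phi>1 \<odot> \<phi>2\<close> on the
  free product \<open>P\<close> of \<open>A1\<close> and \<open>A2\<close>.\<close>
type_synonym 'v uprod =
  "'v salg \<Rightarrow> 'v salg \<Rightarrow> 'v fprod \<Rightarrow> ('v \<Rightarrow> complex) \<Rightarrow> ('v \<Rightarrow> complex) \<Rightarrow> ('v \<Rightarrow> complex)"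

definition is_independence :: "'v uprod \<Rightarrow> bool" where
  "is_independence odot \<longleftrightarrow>
     \<comment> \<open>well-defined: a product of linear functionals, depending only on them on the carriers\<close>
     (\<forall>A1 A2 P \<phi>1 \<phi>2. is_free_product A1 A2 P \<and> lin_fun A1 \<phi>1 \<and> lin_fun A2 \<phi>2 \<longrightarrow>
        lin_fun (fst P) (odot A1 A2 P \<phi>1 \<phi>2)) \<and>
     (\<forall>A1 A2 P \<phi>1 \<phi>2 \<chi>1 \<chi>2. is_free_product A1 A2 P \<and>
        (\<forall>a\<in>sa_carrier A1. \<phi>1 a = \<chi>1 a) \<and> (\<forall>a\<in>sa_carrier A2. \<phi>2 a = \<chi>2 a) \<longrightarrow>
        (\<forall>x\<in>sa_carrier (fst P). odot A1 A2 P \<phi>1 \<phi>2 x = odot A1 A2 P \<chi>1 \<chi>2 x)) \<and>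
     \<comment> \<open>(A1)\<close>
     (\<forall>A1 A2 P \<phi>1 \<phi>2. is_free_product A1 A2 P \<and> lin_fun A1 \<phi>1 \<and> lin_fun A2 \<phi>2 \<longrightarrow>
        (\<forall>a\<in>sa_carrier A1. odot A1 A2 P \<phi>1 \<phi>2 (fst (snd P) a) = \<phi>1 a) \<and>
        (\<forall>a\<in>sa_carrier A2. odot A1 A2 P \<phi>1 \<phi>2 (snd (snd P) a) = \<phi>2 a)) \<and>
     \<comment> \<open>(A2) associativity, modulo the canonical identification\<close>
     (\<forall>A1 A2 A3 P12 G P23 H \<phi>1 \<phi>2 \<phi>3.
        is_free_product A1 A2 P12 \<and> is_free_product (fst P12) A3 G \<and>
        is_free_product A2 A3 P23 \<and> is_free_product A1 (fst P23) H \<and>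
        lin_fun A1 \<phi>1 \<and> lin_fun A2 \<phi>2 \<and> lin_fun A3 \<phi>3 \<longrightarrow>
        (\<forall>x\<in>sa_carrier (fst G).
           odot (fst P12) A3 G (odot A1 A2 P12 \<phi>1 \<phi>2) \<phi>3 x =
           odot A1 (fst P23) H \<phi>1 (odot A2 A3 P23 \<phi>2 \<phi>3)
             (fp_assoc A1 A2 A3 P12 G P23 H x))) \<and>
     \<comment> \<open>(A3) naturality\<close>
     (\<forall>A1 A2 A1' A2' P P' j1 j2 \<phi>1 \<phi>2.
        is_free_product A1 A2 P \<and> is_free_product A1' A2' P' \<and>
        alg_hom A1 A1' j1 \<and> alg_hom A2 A2' j2 \<and> lin_fun A1' \<phi>1 \<and> lin_fun A2' \<phi>2 \<longrightarrow>
        (\<forall>x\<in>sa_carrier (fst P).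
           odot A1 A2 P (\<phi>1 \<circ> j1) (\<phi>2 \<circ> j2) x =
           odot A1' A2' P' \<phi>1 \<phi>2 (fp_map A1 A2 P P' j1 j2 x)))"

definition positive_independence :: "'v uprod \<Rightarrow> bool" where
  "positive_independence odot \<longleftrightarrow> is_independence odot \<and>
     (\<forall>A1 A2 P \<phi>1 \<phi>2. is_star_free_product A1 A2 P \<and> is_state A1 \<phi>1 \<and> is_state A2 \<phi>2 \<longrightarrow>
        is_state (fst P) (odot A1 A2 P \<phi>1 \<phi>2))"

definition dual_semigroup :: "'v salg \<Rightarrow> 'v fprod \<Rightarrow> ('v \<Rightarrow> 'v) \<Rightarrow> bool" where
  "dual_semigroup B P \<Delta> \<longleftrightarrow>
     is_star_alg B \<and> is_star_free_product B B P \<and> star_hom B (fst P) \<Delta> \<and>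
     \<comment> \<open>coassociativity\<close>
     (\<forall>G H. is_free_product (fst P) B G \<and> is_free_product B (fst P) H \<longrightarrow>
        (\<forall>b\<in>sa_carrier B.
           fp_assoc B B B P G P H (fp_map B B P G \<Delta> id (\<Delta> b)) =
           fp_map B B P H id \<Delta> (\<Delta> b))) \<and>
     \<comment> \<open>counit\<close>
     (\<forall>b\<in>sa_carrier B. fp_lift B B P B (\<lambda>_. sa_zero B) id (\<Delta> b) = b) \<and>
     (\<forall>b\<in>sa_carrier B. fp_lift B B P B id (\<lambda>_. sa_zero B) (\<Delta> b) = b)"

definition convolution :: "'v uprod \<Rightarrow> 'v salg \<Rightarrow> 'v fprod \<Rightarrow> ('v \<Rightarrow> 'v) \<Rightarrow>
    ('v \<Rightarrow> complex) \<Rightarrow> ('v \<Rightarrow> complex) \<Rightarrow> ('v \<Rightarrow> complex)" where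
  "convolution odot B P \<Delta> \<phi>1 \<phi>2 = (\<lambda>b. odot B B P \<phi>1 \<phi>2 (\<Delta> b))"

fun conv_pow :: "'v uprod \<Rightarrow> 'v salg \<Rightarrow> 'v fprod \<Rightarrow> ('v \<Rightarrow> 'v) \<Rightarrow>
    ('v \<Rightarrow> complex) \<Rightarrow> nat \<Rightarrow> ('v \<Rightarrow> complex)" where
  "conv_pow odot B P \<Delta> \<psi> 0 = (\<lambda>_. 0)"
| "conv_pow odot B P \<Delta> \<psi> (Suc n) = convolution odot B P \<Delta> \<psi> (conv_pow odot B P \<Delta> \<psi> n)"

definition conv_exp :: "'v uprod \<Rightarrow> 'v salg \<Rightarrow> 'v fprod \<Rightarrow> ('v \<Rightarrow> 'v) \<Rightarrow>
    ('v \<Rightarrow> complex) \<Rightarrow> ('v \<Rightarrow> complex)" where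
  "conv_exp odot B P \<Delta> \<psi> =
     (\<lambda>b. lim (\<lambda>n. conv_pow odot B P \<Delta> (\<lambda>x. \<psi> x / of_nat n) n b))"

definition conv_exp_exists :: "'v uprod \<Rightarrow> 'v salg \<Rightarrow> 'v fprod \<Rightarrow> ('v \<Rightarrow> 'v) \<Rightarrow>
    ('v \<Rightarrow> complex) \<Rightarrow> bool" where
  "conv_exp_exists odot B P \<Delta> \<psi> \<longleftrightarrow>
     (\<forall>b\<in>sa_carrier B. convergent (\<lambda>n. conv_pow odot B P \<Delta> (\<lambda>x. \<psi> x / of_nat n) n b))"

definition cont_conv_semigroup :: "'v uprod \<Rightarrow> 'v salg \<Rightarrow> 'v fprod \<Rightarrow> ('v \<Rightarrow> 'v) \<Rightarrow>
    (real \<Rightarrow> 'v \<Rightarrow> complex) \<Rightarrow> bool" where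
  "cont_conv_semigroup odot B P \<Delta> \<phi> \<longleftrightarrow>
     (\<forall>t\<ge>0. lin_fun B (\<phi> t)) \<and>
     (\<forall>s\<ge>0. \<forall>t\<ge>0. \<forall>b\<in>sa_carrier B.
        \<phi> (s + t) b = convolution odot B P \<Delta> (\<phi> s) (\<phi> t) b) \<and>
     (\<forall>b\<in>sa_carrier B. \<phi> 0 b = 0) \<and>
     (\<forall>b\<in>sa_carrier B. ((\<lambda>t. \<phi> t b) \<longlongrightarrow> 0) (at_right 0))"

end

theory Submission
  imports Defs "HOL-Library.Poly_Mapping"
begin

text \<open>Naturality forces \<open>(\<phi>\<^sub>1 \<odot> \<phi>\<^sub>2)(x)\<close> to be a polynomial in finitely many values of \<open>\<phi>\<^sub>1\<close> and \<open>\<phi>\<^sub>2\<close>.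
  Together with coassociativity, convolution by \<open>\<phi>\<close> then acts on finite-dimensional spaces of functions
  of functionals by matrices polynomial in \<open>\<phi>\<close>. Hence the \<open>n\<close>-th convolution power of \<open>\<phi>\<^sub>n\<close> converges to
  the convolution exponential of \<open>\<psi>\<close> whenever \<open>n \<phi>\<^sub>n\<close> converges to \<open>\<psi>\<close> pointwise, and continuous semigroups
  have generators.

  It remains to write a conditionally positive \<open>\<psi>\<close> as a limit of \<open>n \<phi>\<^sub>n\<close> with states \<open>\<phi>\<^sub>n\<close>. Instead of
  looking for such states on \<open>B\<close> itself, one lifts \<open>\<Delta>\<close> to the free \<open>*\<close>-algebra over a basis of Hermitian
  elements of \<open>B\<close>. There vacuum expectations of words in symmetric operators on \<open>\<complex> \<oplus> B\<close> (multiplication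
  by \<open>x\<close> plus a field operator of size \<open>1/\<surd>n\<close>) provide them. Their convolution powers are states, and the limit
  descends to \<open>B\<close>.\<close>

section \<open>Algebras on carrier sets\<close>

text \<open>An independence multiplies functionals only on algebras carried by subsets of the one
  type \<open>'v\<close>, so every auxiliary algebra has to be copied into \<open>'v\<close>. A
  nonzero element of \<open>B\<close> puts a copy of the complex numbers into \<open>'v\<close>;
  this makes \<open>'v\<close> large enough for the free algebra on \<open>'v \<times> nat\<close>,
  and thereby for all free products in use. The zero algebra, where this may fail, is treated apart.

  The vacuum functionals do not live on \<open>B\<close>, because an operator \<open>J(x)\<close>
  with a field term is not multiplicative in \<open>x\<close>; it only extends from free generators.
  Freeness allows any coproduct of the generators that lies over \<open>\<Delta>\<close>, but an
  arbitrary choice would be neither coassociative nor compatible with the involution. The choice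
  made is the normal form of \<open>\<Delta> x\<close>: \<open>B \<squnion> B\<close> acts on words
  through the first letter, and applying an element to the empty word spells it in alternating words
  of basis letters. Normal forms are computed by representations, so identities on iterated free
  products carry over to them; the involution is respected because left and right multiplication
  commute.\<close>

locale calg =
  fixes A :: "'c salg"
  assumes is_alg: "is_alg A"
begin

lemma zero_closed [simp, intro]: "sa_zero A \<in> sa_carrier A"
  and add_closed [simp, intro]: "\<lbrakk>a \<in> sa_carrier A; b \<in> sa_carrier A\<rbrakk> \<Longrightarrow> sa_add A a b \<in> sa_carrier A"
  and mul_closed [simp, intro]: "\<lbrakk>a \<in> sa_carrier A; b \<in> sa_carrier A\<rbrakk> \<Longrightarrow> sa_mul A a b \<in> sa_carrier A"
  and smul_closed [simp, intro]: "a \<in> sa_carrier A \<Longrightarrow> sa_smul A c a \<in> sa_carrier A"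
  by (use is_alg in \<open>simp_all add: is_alg_def\<close>)

lemma add_assoc: "\<lbrakk>a \<in> sa_carrier A; b \<in> sa_carrier A; c \<in> sa_carrier A\<rbrakk> \<Longrightarrow>
    sa_add A (sa_add A a b) c = sa_add A a (sa_add A b c)"
  by (rule is_alg[unfolded is_alg_def, THEN conjunct2, THEN conjunct2, THEN conjunct2, THEN conjunct2, THEN conjunct1, rule_format])

lemma add_comm: "\<lbrakk>a \<in> sa_carrier A; b \<in> sa_carrier A\<rbrakk> \<Longrightarrow> sa_add A a b = sa_add A b a"
  by (rule is_alg[unfolded is_alg_def, THEN conjunct2, THEN conjunct2, THEN conjunct2, THEN conjunct2, THEN conjunct2, THEN conjunct1, rule_format])

lemma add_zero [simp]: "a \<in> sa_carrier A \<Longrightarrow> sa_add A a (sa_zero A) = a"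
  by (rule is_alg[unfolded is_alg_def, THEN conjunct2, THEN conjunct2, THEN conjunct2, THEN conjunct2, THEN conjunct2, THEN conjunct2, THEN conjunct1, rule_format])

lemma add_inverse: "a \<in> sa_carrier A \<Longrightarrow> \<exists>b\<in>sa_carrier A. sa_add A a b = sa_zero A"
  by (rule is_alg[unfolded is_alg_def, THEN conjunct2, THEN conjunct2, THEN conjunct2, THEN conjunct2, THEN conjunct2, THEN conjunct2, THEN conjunct2, THEN conjunct1, rule_format])

lemma smul_one [simp]: "a \<in> sa_carrier A \<Longrightarrow> sa_smul A 1 a = a"
  and smul_smul: "a \<in> sa_carrier A \<Longrightarrow> sa_smul A c (sa_smul A d a) = sa_smul A (c * d) a"
  and smul_add_left: "a \<in> sa_carrier A \<Longrightarrow>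
    sa_smul A (c + d) a = sa_add A (sa_smul A c a) (sa_smul A d a)"
  and smul_add_right: "\<lbrakk>a \<in> sa_carrier A; b \<in> sa_carrier A\<rbrakk> \<Longrightarrow>
    sa_smul A c (sa_add A a b) = sa_add A (sa_smul A c a) (sa_smul A c b)"
  by (use is_alg in \<open>simp_all add: is_alg_def\<close>)

lemma mul_assoc: "\<lbrakk>a \<in> sa_carrier A; b \<in> sa_carrier A; c \<in> sa_carrier A\<rbrakk> \<Longrightarrow>
    sa_mul A (sa_mul A a b) c = sa_mul A a (sa_mul A b c)"
  and distrib_left: "\<lbrakk>a \<in> sa_carrier A; b \<in> sa_carrier A; c \<in> sa_carrier A\<rbrakk> \<Longrightarrow>
    sa_mul A a (sa_add A b c) = sa_add A (sa_mul A a b) (sa_mul A a c)"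
  and distrib_right: "\<lbrakk>a \<in> sa_carrier A; b \<in> sa_carrier A; c \<in> sa_carrier A\<rbrakk> \<Longrightarrow>
    sa_mul A (sa_add A a b) c = sa_add A (sa_mul A a c) (sa_mul A b c)"
  by (use is_alg in \<open>simp_all add: is_alg_def\<close>)

lemma smul_mul_left: "\<lbrakk>a \<in> sa_carrier A; b \<in> sa_carrier A\<rbrakk> \<Longrightarrow>
    sa_mul A (sa_smul A c a) b = sa_smul A c (sa_mul A a b)"
  using is_alg unfolding is_alg_def by metis

lemma smul_mul_right: "\<lbrakk>a \<in> sa_carrier A; b \<in> sa_carrier A\<rbrakk> \<Longrightarrow>
    sa_mul A a (sa_smul A c b) = sa_smul A c (sa_mul A a b)"
  using is_alg unfolding is_alg_def by metis

lemma zero_add [simp]: "a \<in> sa_carrier A \<Longrightarrow> sa_add A (sa_zero A) a = a"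
  by (metis add_comm add_zero zero_closed)

lemma add_left_commute: "\<lbrakk>a \<in> sa_carrier A; b \<in> sa_carrier A; c \<in> sa_carrier A\<rbrakk> \<Longrightarrow>
    sa_add A a (sa_add A b c) = sa_add A b (sa_add A a c)"
  by (metis add_assoc add_comm)

lemmas add_ac = add_assoc add_comm add_left_commute

lemma add_cancel_left:
  assumes "a \<in> sa_carrier A" "b \<in> sa_carrier A" "c \<in> sa_carrier A"
    and "sa_add A a b = sa_add A a c"
  shows "b = c"
  by (metis (no_types, lifting) add_assoc add_comm add_inverse assms zero_add)

lemma smul_zero_scalar [simp]: "a \<in> sa_carrier A \<Longrightarrow> sa_smul A 0 a = sa_zero A"
  by (metis add_cancel_left add_zero smul_add_left smul_closed zero_closed add.right_neutral)

lemma smul_zero [simp]: "sa_smul A c (sa_zero A) = sa_zero A"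
  by (metis add_cancel_left add_zero smul_add_right smul_closed zero_closed)

lemma mul_zero [simp]: "a \<in> sa_carrier A \<Longrightarrow> sa_mul A a (sa_zero A) = sa_zero A"
  by (metis smul_mul_right smul_zero_scalar mul_closed zero_closed)

lemma zero_mul [simp]: "a \<in> sa_carrier A \<Longrightarrow> sa_mul A (sa_zero A) a = sa_zero A"
  by (metis smul_mul_left smul_zero_scalar mul_closed zero_closed)

end

text \<open>\<open>alg_hom\<close> relates algebras over one type. The same notion across types is
  needed for maps into polynomials, function spaces and algebras of operators.\<close>

definition xhom :: "'a salg \<Rightarrow> 'b salg \<Rightarrow> ('a \<Rightarrow> 'b) \<Rightarrow> bool" where
  "xhom A C f \<longleftrightarrow>
     (\<forall>a\<in>sa_carrier A. f a \<in> sa_carrier C) \<and>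
     (\<forall>a\<in>sa_carrier A. \<forall>b\<in>sa_carrier A. f (sa_add A a b) = sa_add C (f a) (f b)) \<and>
     (\<forall>a\<in>sa_carrier A. \<forall>b\<in>sa_carrier A. f (sa_mul A a b) = sa_mul C (f a) (f b)) \<and>
     (\<forall>c. \<forall>a\<in>sa_carrier A. f (sa_smul A c a) = sa_smul C c (f a))"

lemma alg_hom_iff_xhom: "alg_hom A C f \<longleftrightarrow> xhom A C f"
  unfolding alg_hom_def xhom_def ..

lemma xhomI:
  assumes "\<And>a. a \<in> sa_carrier A \<Longrightarrow> f a \<in> sa_carrier C"
    and "\<And>a b. a \<in> sa_carrier A \<Longrightarrow> b \<in> sa_carrier A \<Longrightarrow> f (sa_add A a b) = sa_add C (f a) (f b)"
    and "\<And>a b. a \<in> sa_carrier A \<Longrightarrow> b \<in> sa_carrier A \<Longrightarrow> f (sa_mul A a b) = sa_mul C (f a) (f b)"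
    and "\<And>c a. a \<in> sa_carrier A \<Longrightarrow> f (sa_smul A c a) = sa_smul C c (f a)"
  shows "xhom A C f"
  using assms unfolding xhom_def by blast

lemma xhom_closed: "xhom A C f \<Longrightarrow> a \<in> sa_carrier A \<Longrightarrow> f a \<in> sa_carrier C"
  and xhom_add: "xhom A C f \<Longrightarrow> a \<in> sa_carrier A \<Longrightarrow> b \<in> sa_carrier A \<Longrightarrow>
    f (sa_add A a b) = sa_add C (f a) (f b)"
  and xhom_mul: "xhom A C f \<Longrightarrow> a \<in> sa_carrier A \<Longrightarrow> b \<in> sa_carrier A \<Longrightarrow>
    f (sa_mul A a b) = sa_mul C (f a) (f b)"
  and xhom_smul: "xhom A C f \<Longrightarrow> a \<in> sa_carrier A \<Longrightarrow> f (sa_smul A c a) = sa_smul C c (f a)"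
  unfolding xhom_def by blast+

lemma xhom_zero:
  assumes "is_alg A" "is_alg C" "xhom A C f"
  shows "f (sa_zero A) = sa_zero C"
proof -
  interpret A: calg A by (standard, fact)
  interpret C: calg C by (standard, fact)
  have "f (sa_zero A) = f (sa_smul A 0 (sa_zero A))" by simp
  also have "\<dots> = sa_zero C" using assms(3) by (simp add: xhom_smul xhom_closed del: A.smul_zero_scalar A.smul_zero)
  finally show ?thesis .
qed

lemma xhom_comp: "xhom A C f \<Longrightarrow> xhom C E g \<Longrightarrow> xhom A E (g \<circ> f)"
  unfolding xhom_def by auto

lemma xhom_id: "xhom A A id"
  unfolding xhom_def by auto

lemma xhom_cong: "(\<And>a. a \<in> sa_carrier A \<Longrightarrow> f a = g a) \<Longrightarrow> is_alg A \<Longrightarrow> xhom A C f \<Longrightarrow> xhom A C g"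
  unfolding xhom_def by (auto simp: is_alg_def)

lemma xhom_const_zero: "is_alg C \<Longrightarrow> xhom A C (\<lambda>_. sa_zero C)"
proof -
  assume "is_alg C" then interpret C: calg C by unfold_locales
  show ?thesis by (auto simp: xhom_def)
qed

text \<open>Apart from the existence of negatives, the axioms are closure conditions and identities,
  and an identity can be tested after applying a jointly injective family of homomorphisms; the
  negative of \<open>a\<close> is its multiple by -1. Transported algebras, subalgebras and products
  of algebras are all covered this way.\<close>

lemma is_alg_of_faithful_family:
  fixes A :: "'c salg" and C :: "'i \<Rightarrow> 'd salg"
  assumes C: "\<And>i. i \<in> I \<Longrightarrow> is_alg (C i)"
    and h: "\<And>i. i \<in> I \<Longrightarrow> xhom A (C i) (h i)"
    and inj: "\<And>a b. a \<in> sa_carrier A \<Longrightarrow> b \<in> sa_carrier A \<Longrightarrow> (\<And>i. i \<in> I \<Longrightarrow> h i a = h i b) \<Longrightarrow> a = b"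
    and closed: "sa_zero A \<in> sa_carrier A"
      "\<And>a b. a \<in> sa_carrier A \<Longrightarrow> b \<in> sa_carrier A \<Longrightarrow> sa_add A a b \<in> sa_carrier A"
      "\<And>a b. a \<in> sa_carrier A \<Longrightarrow> b \<in> sa_carrier A \<Longrightarrow> sa_mul A a b \<in> sa_carrier A"
      "\<And>c a. a \<in> sa_carrier A \<Longrightarrow> sa_smul A c a \<in> sa_carrier A"
    and zero: "\<And>i. i \<in> I \<Longrightarrow> h i (sa_zero A) = sa_zero (C i)"
  shows "is_alg A"
proof -
  have cl: "i \<in> I \<Longrightarrow> a \<in> sa_carrier A \<Longrightarrow> h i a \<in> sa_carrier (C i)" for i a
    using h xhom_closed by metis
  have calg: "i \<in> I \<Longrightarrow> calg (C i)" for i using C by (simp add: calg_def)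
  note hs = xhom_add[OF h] xhom_mul[OF h] xhom_smul[OF h] zero cl closed
    calg.add_assoc[OF calg] calg.smul_add_left[OF calg] calg.smul_add_right[OF calg]
    calg.add_zero[OF calg] calg.mul_assoc[OF calg] calg.distrib_left[OF calg]
    calg.distrib_right[OF calg] calg.smul_mul_left[OF calg] calg.smul_mul_right[OF calg]
    calg.smul_one[OF calg] calg.smul_smul[OF calg]
  have comm: "sa_add A a b = sa_add A b a" if "a \<in> sa_carrier A" "b \<in> sa_carrier A" for a b
    by (rule inj) (use that in \<open>auto simp: hs calg.add_comm[OF calg]\<close>)
  have neg: "sa_add A a (sa_smul A (-1) a) = sa_zero A" if a: "a \<in> sa_carrier A" for a
  proof (rule inj)
    fix i assume i: "i \<in> I"
    have "sa_add (C i) (h i a) (sa_smul (C i) (-1) (h i a)) = sa_smul (C i) (1 + -1) (h i a)"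
      using a i by (simp only: calg.smul_add_left[OF calg] calg.smul_one[OF calg] cl)
    then show "h i (sa_add A a (sa_smul A (-1) a)) = h i (sa_zero A)"
      using a i by (simp add: hs calg.smul_zero_scalar[OF calg])
  qed (use a closed in auto)
  show ?thesis unfolding is_alg_def
    apply (intro conjI ballI allI)
    subgoal by (rule closed)
    subgoal by (rule closed)
    subgoal by (rule closed)
    subgoal by (rule closed)
    subgoal by (rule inj) (auto simp: hs)
    subgoal by (rule comm)
    subgoal by (rule inj) (auto simp: hs)
    subgoal using neg closed by blast
    subgoal by (rule inj) (auto simp: hs)
    subgoal by (rule inj) (auto simp: hs)
    subgoal by (rule inj) (auto simp: hs)
    subgoal by (rule inj) (auto simp: hs)
    subgoal by (rule inj) (auto simp: hs)
    subgoal by (rule inj) (auto simp: hs)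
    subgoal by (rule inj) (auto simp: hs)
    subgoal by (rule inj) (auto simp: hs)
    subgoal by (rule inj) (auto simp: hs)
    done
qed

section \<open>Linear extension from a basis\<close>

context calg begin

text \<open>Commutativity of the addition is known on the carrier only. The guard on the accumulator
  makes the folded functions commute on the whole type.\<close>

definition asum :: "('k \<Rightarrow> 'c) \<Rightarrow> 'k set \<Rightarrow> 'c" where
  "asum f S = Finite_Set.fold (\<lambda>i acc. if acc \<in> sa_carrier A then sa_add A (f i) acc else acc) (sa_zero A) S"

lemma asum_empty [simp]: "asum f {} = sa_zero A"
  by (simp add: asum_def)

lemma asum_insert_closed:
  assumes f: "\<And>k. f k \<in> sa_carrier A" and "finite S"
  shows "asum f S \<in> sa_carrier A \<and> (\<forall>k. k \<notin> S \<longrightarrow> asum f (insert k S) = sa_add A (f k) (asum f S))"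
proof -
  interpret comp_fun_commute "\<lambda>i acc. if acc \<in> sa_carrier A then sa_add A (f i) acc else acc"
    by standard (auto simp: fun_eq_iff f add_left_commute)
  have "asum f S \<in> sa_carrier A" using \<open>finite S\<close>
    by (induction S) (auto simp: asum_def f)
  then show ?thesis using \<open>finite S\<close> by (auto simp: asum_def)
qed

lemmas asum_closed = asum_insert_closed[THEN conjunct1]
lemmas asum_insert = asum_insert_closed[THEN conjunct2, rule_format]

lemma asum_add:
  assumes f: "\<And>k. f k \<in> sa_carrier A" and g: "\<And>k. g k \<in> sa_carrier A" and "finite S"
  shows "asum (\<lambda>k. sa_add A (f k) (g k)) S = sa_add A (asum f S) (asum g S)"
  using \<open>finite S\<close>
proof (induction S)
  case (insert k S)
  have "asum f S \<in> sa_carrier A" "asum g S \<in> sa_carrier A" using asum_closed f g insert by auto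
  then show ?case using insert
    by (simp add: asum_insert f g add_closed add_assoc add_left_commute)
qed simp

lemma asum_mono_neutral:
  assumes f: "\<And>k. f k \<in> sa_carrier A" and "finite T" "S \<subseteq> T" "\<And>k. k \<in> T - S \<Longrightarrow> f k = sa_zero A"
  shows "asum f T = asum f S"
proof -
  have "finite S" using assms finite_subset by blast
  have "asum f (S \<union> D) = asum f S" if "finite D" "D \<inter> S = {}" "\<And>k. k \<in> D \<Longrightarrow> f k = sa_zero A" for D
    using that
  proof (induction D)
    case (insert k D)
    then show ?case using asum_insert[OF f, of "S \<union> D" k] \<open>finite S\<close> asum_closed[OF f \<open>finite S\<close>] by auto
  qed simp
  from this[of "T - S"] show ?thesis using assms
    by (metis (no_types, lifting) Diff_disjoint Diff_partition Int_commute finite_Diff)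
qed

definition lext :: "('k \<Rightarrow> 'c) \<Rightarrow> ('k \<Rightarrow>\<^sub>0 complex) \<Rightarrow> 'c" where
  "lext g p = asum (\<lambda>k. sa_smul A (Poly_Mapping.lookup p k) (g k)) (Poly_Mapping.keys p)"

lemma lext_superset:
  assumes "\<And>k. g k \<in> sa_carrier A" "finite S" "Poly_Mapping.keys p \<subseteq> S"
  shows "lext g p = asum (\<lambda>k. sa_smul A (Poly_Mapping.lookup p k) (g k)) S"
  unfolding lext_def using assms
  by (intro asum_mono_neutral[symmetric]) (auto simp: in_keys_iff)

lemma lext_closed: "(\<And>k. g k \<in> sa_carrier A) \<Longrightarrow> lext g p \<in> sa_carrier A"
  unfolding lext_def by (rule asum_closed) auto

lemma lext_zero [simp]: "lext g 0 = sa_zero A"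
  by (simp add: lext_def)

lemma lext_add:
  assumes g: "\<And>k. g k \<in> sa_carrier A"
  shows "lext g (p + q) = sa_add A (lext g p) (lext g q)"
proof -
  let ?S = "Poly_Mapping.keys p \<union> Poly_Mapping.keys q"
  have "lext g (p + q) = asum (\<lambda>k. sa_smul A (Poly_Mapping.lookup (p + q) k) (g k)) ?S"
    using g Poly_Mapping.keys_add[of p q] by (intro lext_superset) auto
  also have "\<dots> = asum (\<lambda>k. sa_add A (sa_smul A (Poly_Mapping.lookup p k) (g k)) (sa_smul A (Poly_Mapping.lookup q k) (g k))) ?S"
    by (simp add: lookup_add smul_add_left g)
  also have "\<dots> = sa_add A (asum (\<lambda>k. sa_smul A (Poly_Mapping.lookup p k) (g k)) ?S) (asum (\<lambda>k. sa_smul A (Poly_Mapping.lookup q k) (g k)) ?S)"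
    by (rule asum_add) (auto simp: g)
  also have "\<dots> = sa_add A (lext g p) (lext g q)"
    using lext_superset[OF g, of ?S p] lext_superset[OF g, of ?S q] by simp
  finally show ?thesis .
qed

lemma lext_single:
  assumes g: "\<And>k. g k \<in> sa_carrier A"
  shows "lext g (Poly_Mapping.single k c) = sa_smul A c (g k)"
proof -
  have "lext g (Poly_Mapping.single k c) = asum (\<lambda>j. sa_smul A (Poly_Mapping.lookup (Poly_Mapping.single k c) j) (g j)) {k}"
    using g by (intro lext_superset) auto
  also have "\<dots> = sa_smul A c (g k)"
    using asum_insert[of "\<lambda>j. sa_smul A (Poly_Mapping.lookup (Poly_Mapping.single k c) j) (g j)" "{}" k] g by simp
  finally show ?thesis .
qed

end

section \<open>Free algebras as polynomials over words\<close>

text \<open>The wrapper makes concatenation the addition of a \<open>monoid_add\<close>, so that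
  multiplication of finitely supported functions on words is the product of noncommutative
  polynomials.\<close>

datatype 'l word = W (letters: "'l list")

instantiation word :: (type) monoid_add
begin
definition zero_word_def: "0 = W []"
definition plus_word_def: "u + v = W (letters u @ letters v)"
instance by standard (auto simp: zero_word_def plus_word_def)
end

lemma letters_zero [simp]: "letters 0 = []"
  and letters_plus [simp]: "letters (u + v) = letters u @ letters v"
  by (auto simp: zero_word_def plus_word_def)

lemma W_plus: "W u + W v = W (u @ v)"
  by (simp add: plus_word_def)

lemma letters_eq_Nil_iff [simp]: "letters w = [] \<longleftrightarrow> w = 0"
  by (cases w) (simp add: zero_word_def)

lemma W_eq_zero_iff [simp]: "W l = 0 \<longleftrightarrow> l = []"
  by (simp add: zero_word_def)

lemma plus_word_eq_zero_iff [simp]: "(u::'l word) + v = 0 \<longleftrightarrow> u = 0 \<and> v = 0"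
  by (metis append_is_Nil_conv letters_eq_Nil_iff letters_plus)

type_synonym 'l fa = "'l word \<Rightarrow>\<^sub>0 complex"

abbreviation (input) coef :: "('k \<Rightarrow>\<^sub>0 complex) \<Rightarrow> 'k \<Rightarrow> complex" where
  "coef \<equiv> Poly_Mapping.lookup"

definition cst :: "complex \<Rightarrow> 'l fa" where "cst c = Poly_Mapping.single 0 c"
definition mon :: "'l list \<Rightarrow> 'l fa" where "mon w = Poly_Mapping.single (W w) 1"

lemma cst_mult_single: "cst c * Poly_Mapping.single w d = Poly_Mapping.single w (c * d)"
  and single_mult_cst: "Poly_Mapping.single w d * cst c = Poly_Mapping.single w (c * d)"
  by (simp_all add: cst_def mult_single mult.commute)

lemma single_eq_cst_mon: "Poly_Mapping.single w c = cst c * mon (letters w)"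
  by (simp add: mon_def cst_mult_single)

lemma mon_append: "mon (u @ v) = mon u * mon v"
  by (simp add: mon_def mult_single W_plus)

lemma mon_Nil [simp]: "mon [] = 1"
  by (simp add: mon_def zero_word_def[symmetric])

lemma mon_Cons: "mon (a # v) = mon [a] * mon v"
  using mon_append[of "[a]" v] by simp

lemma cst_1 [simp]: "cst 1 = 1"
  and cst_0 [simp]: "cst 0 = 0"
  and cst_mult: "cst (c * d) = cst c * cst d"
  and cst_add: "cst (c + d) = cst c + cst d"
  by (simp_all add: cst_def mult_single single_add)

lemma pm_induct_on [consumes 1, case_names zero single add]:
  fixes p :: "'k \<Rightarrow>\<^sub>0 complex"
  assumes "Poly_Mapping.keys p \<subseteq> K"
    and zero: "Q 0"
    and single: "\<And>k c. k \<in> K \<Longrightarrow> Q (Poly_Mapping.single k c)"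
    and add: "\<And>p q. Q p \<Longrightarrow> Q q \<Longrightarrow> Q (p + q)"
  shows "Q p"
proof -
  have "p = (\<Sum>k\<in>Poly_Mapping.keys p. Poly_Mapping.single k (coef p k))"
    by (rule poly_mapping_eqI) (simp add: lookup_sum lookup_single when_def in_keys_iff)
  moreover have "Q (\<Sum>k\<in>S. Poly_Mapping.single k (coef p k))" if "finite S" "S \<subseteq> K" for S
    using that by (induction S) (auto intro: zero single add)
  ultimately show ?thesis using assms(1) by (metis finite_keys)
qed

lemma pm_induct [case_names zero single add]:
  fixes p :: "'k \<Rightarrow>\<^sub>0 complex"
  assumes "Q 0" "\<And>k c. Q (Poly_Mapping.single k c)" "\<And>p q. Q p \<Longrightarrow> Q q \<Longrightarrow> Q (p + q)"
  shows "Q p"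
  by (rule pm_induct_on[of p UNIV]) (use assms in auto)

lemma cst_commute: "cst c * p = p * cst c"
  by (induction p rule: pm_induct)
     (auto simp: cst_mult_single single_mult_cst algebra_simps)

lemma cst_left_commute: "p * (cst c * q) = cst c * (p * q)"
  by (metis cst_commute mult.assoc)

definition pmsum :: "('k \<Rightarrow> complex \<Rightarrow> 'b::comm_monoid_add) \<Rightarrow> ('k \<Rightarrow>\<^sub>0 complex) \<Rightarrow> 'b" where
  "pmsum f p = (\<Sum>k\<in>Poly_Mapping.keys p. f k (coef p k))"

lemma pmsum_zero [simp]: "pmsum f 0 = 0"
  by (simp add: pmsum_def)

lemma pmsum_single: "(\<And>k. f k 0 = 0) \<Longrightarrow> pmsum f (Poly_Mapping.single k c) = f k c"
  by (simp add: pmsum_def)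

lemma pmsum_add:
  assumes "\<And>k. f k 0 = 0" "\<And>k a b. f k (a + b) = f k a + f k b"
  shows "pmsum f (p + q) = pmsum f p + pmsum f q"
proof -
  let ?S = "Poly_Mapping.keys p \<union> Poly_Mapping.keys q"
  have *: "pmsum f r = (\<Sum>k\<in>?S. f k (coef r k))" if "Poly_Mapping.keys r \<subseteq> ?S" for r
    unfolding pmsum_def by (rule sum.mono_neutral_left) (use that assms(1) in \<open>auto simp: in_keys_iff\<close>)
  show ?thesis
    using *[of p] *[of q] *[of "p + q"] Poly_Mapping.keys_add[of p q]
    by (simp add: lookup_add assms(2) sum.distrib)
qed

definition lin :: "('k \<Rightarrow> 'l fa) \<Rightarrow> ('k \<Rightarrow>\<^sub>0 complex) \<Rightarrow> 'l fa" where
  "lin h = pmsum (\<lambda>k c. cst c * h k)"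

lemma lin_zero [simp]: "lin h 0 = 0"
  and lin_single: "lin h (Poly_Mapping.single k c) = cst c * h k"
  and lin_add: "lin h (p + q) = lin h p + lin h q"
  unfolding lin_def by (auto simp: pmsum_single pmsum_add cst_add algebra_simps)

lemma lin_mon [simp]: "lin h (mon w) = h (W w)"
  by (simp add: mon_def lin_single)

lemma lin_cst: "lin h (cst c * p) = cst c * lin h p"
  by (induction p rule: pm_induct)
     (auto simp: cst_mult_single lin_single lin_add cst_mult mult.assoc distrib_left)

text \<open>Letters are self-adjoint for this involution. A star-homomorphism to \<open>B\<close>
  must therefore send them to Hermitian elements, which is why a Hermitian basis is chosen
  later.\<close>

definition fstar :: "'l fa \<Rightarrow> 'l fa" where
  "fstar = pmsum (\<lambda>w c. Poly_Mapping.single (W (rev (letters w))) (cnj c))"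

lemma fstar_zero [simp]: "fstar 0 = 0"
  and fstar_single: "fstar (Poly_Mapping.single w c) = Poly_Mapping.single (W (rev (letters w))) (cnj c)"
  and fstar_add: "fstar (p + q) = fstar p + fstar q"
  unfolding fstar_def by (auto simp: pmsum_single pmsum_add single_add)

lemma fstar_mult: "fstar (p * q) = fstar q * fstar p"
proof (induction p rule: pm_induct)
  case (single u c)
  show ?case
    by (induction q rule: pm_induct)
       (auto simp: mult_single fstar_single W_plus fstar_add algebra_simps)
qed (auto simp: algebra_simps fstar_add)

lemma fstar_fstar [simp]: "fstar (fstar p) = p"
  by (induction p rule: pm_induct) (auto simp: fstar_single fstar_add)

lemma fstar_cst: "fstar (cst c) = cst (cnj c)"
  by (simp add: cst_def fstar_single zero_word_def)

lemma fstar_mon: "fstar (mon w) = mon (rev w)"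
  by (simp add: mon_def fstar_single)

lemma fstar_1 [simp]: "fstar 1 = 1"
  using fstar_mon[of "[]"] by simp

lemma fstar_cst_mult: "fstar (cst c * p) = cst (cnj c) * fstar p"
  by (simp add: fstar_mult fstar_cst cst_commute)

text \<open>Leaving out the empty word gives the non-unital free algebra, as non-unital free
  products require; the ambient polynomials still contain 1, which later serves as the
  vacuum.\<close>

definition FA :: "'l set \<Rightarrow> 'l fa salg" where
  "FA Y = \<lparr>sa_carrier = {p. \<forall>w\<in>Poly_Mapping.keys p. w \<noteq> 0 \<and> set (letters w) \<subseteq> Y},
           sa_add = (+), sa_mul = (*), sa_smul = (\<lambda>c p. cst c * p), sa_star = fstar, sa_zero = 0\<rparr>"

lemma FA_simps [simp]: "sa_add (FA Y) = (+)" "sa_mul (FA Y) = (*)"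
    "sa_smul (FA Y) = (\<lambda>c p. cst c * p)" "sa_star (FA Y) = fstar" "sa_zero (FA Y) = 0"
  by (simp_all add: FA_def)

lemma FA_carrier: "p \<in> sa_carrier (FA Y) \<longleftrightarrow> Poly_Mapping.keys p \<subseteq> {w. w \<noteq> 0 \<and> set (letters w) \<subseteq> Y}"
  by (auto simp: FA_def)

lemma FA_zero: "0 \<in> sa_carrier (FA Y)"
  by (simp add: FA_carrier)

lemma FA_add: "p \<in> sa_carrier (FA Y) \<Longrightarrow> q \<in> sa_carrier (FA Y) \<Longrightarrow> p + q \<in> sa_carrier (FA Y)"
  using Poly_Mapping.keys_add[of p q] unfolding FA_carrier by blast

lemma FA_single: "w \<noteq> 0 \<Longrightarrow> set (letters w) \<subseteq> Y \<Longrightarrow> Poly_Mapping.single w c \<in> sa_carrier (FA Y)"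
  by (simp add: FA_carrier)

lemma FA_mon: "w \<noteq> [] \<Longrightarrow> set w \<subseteq> Y \<Longrightarrow> mon w \<in> sa_carrier (FA Y)"
  unfolding mon_def by (intro FA_single) (auto simp: zero_word_def)

lemma FA_mult: "p \<in> sa_carrier (FA Y) \<Longrightarrow> q \<in> sa_carrier (FA Y) \<Longrightarrow> p * q \<in> sa_carrier (FA Y)"
  using Poly_Mapping.keys_mult[of p q] unfolding FA_carrier by fastforce

lemma FA_cst: "p \<in> sa_carrier (FA Y) \<Longrightarrow> cst c * p \<in> sa_carrier (FA Y)"
  using Poly_Mapping.keys_mult[of "cst c" p] unfolding FA_carrier cst_def by (fastforce split: if_splits)

lemma FA_induct [consumes 1, case_names zero single add]:
  assumes "p \<in> sa_carrier (FA Y)" "Q 0"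
    and "\<And>w c. w \<noteq> 0 \<Longrightarrow> set (letters w) \<subseteq> Y \<Longrightarrow> Q (Poly_Mapping.single w c)"
    and "\<And>p q. Q p \<Longrightarrow> Q q \<Longrightarrow> Q (p + q)"
  shows "Q p"
  by (rule pm_induct_on[OF assms(1)[unfolded FA_carrier]]) (use assms in auto)

lemma FA_fstar: "p \<in> sa_carrier (FA Y) \<Longrightarrow> fstar p \<in> sa_carrier (FA Y)"
  by (induction p rule: FA_induct)
     (auto simp: FA_zero fstar_add fstar_single FA_add intro!: FA_single)

lemma is_alg_FA: "is_alg (FA Y)"
  unfolding is_alg_def FA_simps
proof (intro conjI ballI allI)
  fix a assume "a \<in> sa_carrier (FA Y)"
  then show "\<exists>b\<in>sa_carrier (FA Y). a + b = 0"
    by (intro bexI[of _ "- a"]) (auto simp: FA_carrier)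
next
  show "cst c * (a * b) = a * (cst c * b)" for c and a b :: "'a fa" by (metis cst_left_commute)
qed (auto simp: FA_zero FA_add FA_mult FA_cst distrib_left distrib_right mult.assoc add.assoc
  add.commute cst_mult cst_add)

lemma is_star_alg_FA: "is_star_alg (FA Y)"
  unfolding is_star_alg_def
  by (simp add: is_alg_FA FA_fstar fstar_add fstar_cst fstar_mult) (metis cst_commute)

lemma FA_mon_induct [consumes 1, case_names letter zero add smul mult]:
  assumes "p \<in> sa_carrier (FA Y)"
    and letter: "\<And>l. l \<in> Y \<Longrightarrow> Q (mon [l])" and zero: "Q 0"
    and add: "\<And>p q. p \<in> sa_carrier (FA Y) \<Longrightarrow> q \<in> sa_carrier (FA Y) \<Longrightarrow> Q p \<Longrightarrow> Q q \<Longrightarrow> Q (p + q)"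
    and smul: "\<And>p c. p \<in> sa_carrier (FA Y) \<Longrightarrow> Q p \<Longrightarrow> Q (cst c * p)"
    and mult: "\<And>p q. p \<in> sa_carrier (FA Y) \<Longrightarrow> q \<in> sa_carrier (FA Y) \<Longrightarrow> Q p \<Longrightarrow> Q q \<Longrightarrow> Q (p * q)"
  shows "Q p"
proof -
  have mon: "Q (mon w)" if "w \<noteq> []" "set w \<subseteq> Y" for w using that
  proof (induction w)
    case (Cons a w)
    show ?case
    proof (cases "w = []")
      case True then show ?thesis using Cons letter by simp
    next
      case False
      then show ?thesis using Cons letter[of a] mult[of "mon [a]" "mon w"] FA_mon[of w Y] FA_mon[of "[a]" Y]
        by (simp add: mon_Cons[of a w])
    qed
  qed simp
  have "p \<in> sa_carrier (FA Y) \<and> Q p" using assms(1)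
  proof (induction p rule: FA_induct)
    case (single w c)
    then show ?case unfolding single_eq_cst_mon
      using mon[of "letters w"] smul[of "mon (letters w)" c] FA_mon[of "letters w" Y] by (auto simp: FA_cst)
  qed (auto intro: zero add FA_add FA_zero)
  then show ?thesis by simp
qed

section \<open>Homomorphic extension from the letters of a free algebra\<close>

context calg begin

text \<open>Without a unit there is no natural empty product. The zero is a default value, and the
  laws for cons and append ask for nonempty lists.\<close>

fun lprod :: "'c list \<Rightarrow> 'c" where
  "lprod [] = sa_zero A"
| "lprod [a] = a"
| "lprod (a # b # l) = sa_mul A a (lprod (b # l))"

lemma lprod_Cons: "l \<noteq> [] \<Longrightarrow> lprod (a # l) = sa_mul A a (lprod l)"
  by (cases l) auto

lemma lprod_closed: "set l \<subseteq> sa_carrier A \<Longrightarrow> lprod l \<in> sa_carrier A"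
  by (induction l rule: lprod.induct) auto

lemma lprod_append: "\<lbrakk>set u \<subseteq> sa_carrier A; set v \<subseteq> sa_carrier A; u \<noteq> []; v \<noteq> []\<rbrakk> \<Longrightarrow>
    lprod (u @ v) = sa_mul A (lprod u) (lprod v)"
proof (induction u)
  case (Cons a u)
  then show ?case
    by (cases "u = []") (auto simp: lprod_Cons mul_assoc lprod_closed)
qed simp

definition fext :: "('l \<Rightarrow> 'c) \<Rightarrow> 'l fa \<Rightarrow> 'c" where
  "fext g = lext (\<lambda>w. lprod (map g (letters w)))"

context
  fixes g :: "'l \<Rightarrow> 'c"
  assumes g: "\<And>l. g l \<in> sa_carrier A"
begin

lemma lprod_map_closed: "lprod (map g w) \<in> sa_carrier A"
  by (rule lprod_closed) (use g in auto)

lemma fext_closed: "fext g p \<in> sa_carrier A"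
  and fext_zero: "fext g 0 = sa_zero A"
  and fext_add: "fext g (p + q) = sa_add A (fext g p) (fext g q)"
  and fext_single: "fext g (Poly_Mapping.single w c) = sa_smul A c (lprod (map g (letters w)))"
  unfolding fext_def by (simp_all add: lext_closed lext_add lext_single lprod_map_closed)

lemma fext_mon: "fext g (mon w) = lprod (map g w)"
  by (simp add: mon_def fext_single lprod_map_closed)

lemma fext_smul: "fext g (cst c * p) = sa_smul A c (fext g p)"
  by (induction p rule: pm_induct)
     (auto simp: fext_zero cst_mult_single fext_single algebra_simps fext_add smul_smul smul_add_right
       lprod_map_closed fext_closed)

lemma fext_mult:
  assumes "p \<in> sa_carrier (FA Y)" "q \<in> sa_carrier (FA Y)"
  shows "fext g (p * q) = sa_mul A (fext g p) (fext g q)"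
  using assms
proof (induction p rule: FA_induct)
  case (single u c)
  from single(3) show ?case
  proof (induction q rule: FA_induct)
    case (single v d)
    have "lprod (map g (letters u) @ map g (letters v)) = sa_mul A (lprod (map g (letters u))) (lprod (map g (letters v)))"
      using \<open>u \<noteq> 0\<close> \<open>v \<noteq> 0\<close> g by (intro lprod_append) auto
    then show ?case
      by (simp add: mult_single fext_single smul_mul_left smul_mul_right lprod_map_closed smul_smul mult.commute)
  qed (simp_all add: fext_zero fext_closed fext_add algebra_simps distrib_left)
qed (simp_all add: fext_zero fext_closed fext_add algebra_simps distrib_right)

lemma xhom_fext: "xhom (FA Y) A (fext g)"
  by (rule xhomI) (auto simp: fext_closed fext_add fext_smul fext_mult)

end

end

lemma FA_xhom_unique:
  assumes "is_alg C" "xhom (FA Y) C f" "xhom (FA Y) C h" "\<And>l. l \<in> Y \<Longrightarrow> f (mon [l]) = h (mon [l])"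
    and "p \<in> sa_carrier (FA Y)"
  shows "f p = h p"
  using assms(5)
proof (induction p rule: FA_mon_induct)
  case zero
  show ?case using xhom_zero[OF is_alg_FA assms(1,2)] xhom_zero[OF is_alg_FA assms(1,3)] by simp
next
  case (add p q)
  then show ?case using xhom_add[OF assms(2), of p q] xhom_add[OF assms(3), of p q] by simp
next
  case (smul p c)
  then show ?case using xhom_smul[OF assms(2), of p c] xhom_smul[OF assms(3), of p c] by simp
next
  case (mult p q)
  then show ?case using xhom_mul[OF assms(2), of p q] xhom_mul[OF assms(3), of p q] by simp
qed (use assms in auto)

lemma FA_extend:
  fixes C :: "'c salg" and g :: "'l \<Rightarrow> 'c"
  assumes "is_alg C" "\<And>l. l \<in> Y \<Longrightarrow> g l \<in> sa_carrier C"
  obtains f where "xhom (FA Y) C f" "\<And>l. l \<in> Y \<Longrightarrow> f (mon [l]) = g l"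
proof -
  interpret C: calg C by (standard, fact)
  define g' where "g' l = (if l \<in> Y then g l else sa_zero C)" for l
  have g': "g' l \<in> sa_carrier C" for l using assms by (simp add: g'_def)
  show ?thesis
    by (rule that[OF C.xhom_fext[where g = g', OF g']]) (simp add: C.fext_mon[where g = g', OF g'] g'_def)
qed

section \<open>Coding algebras inside the universe type\<close>

definition transport :: "('c \<Rightarrow> 'v) \<Rightarrow> 'c salg \<Rightarrow> 'v salg" where
  "transport code C = (let dec = inv_into (sa_carrier C) code in
     \<lparr>sa_carrier = code ` sa_carrier C, sa_add = (\<lambda>x y. code (sa_add C (dec x) (dec y))),
      sa_mul = (\<lambda>x y. code (sa_mul C (dec x) (dec y))), sa_smul = (\<lambda>c x. code (sa_smul C c (dec x))),
      sa_star = (\<lambda>x. code (sa_star C (dec x))), sa_zero = code (sa_zero C)\<rparr>)"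

lemma transport:
  assumes C: "is_alg C" and inj: "inj_on code (sa_carrier C)"
  shows is_alg_transport: "is_alg (transport code C)"
    and xhom_code: "xhom C (transport code C) code"
    and xhom_dec: "xhom (transport code C) C (inv_into (sa_carrier C) code)"
    and star_code: "\<And>a. a \<in> sa_carrier C \<Longrightarrow> code (sa_star C a) = sa_star (transport code C) (code a)"
proof -
  interpret C: calg C by (standard, fact)
  note [simp] = inv_into_f_f[OF inj]
  show hd: "xhom (transport code C) C (inv_into (sa_carrier C) code)"
    by (rule xhomI) (auto simp: transport_def Let_def)
  show "xhom C (transport code C) code"
    by (rule xhomI) (auto simp: transport_def Let_def)
  show "\<And>a. a \<in> sa_carrier C \<Longrightarrow> code (sa_star C a) = sa_star (transport code C) (code a)"
    by (auto simp: transport_def Let_def)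
  show "is_alg (transport code C)"
    by (rule is_alg_of_faithful_family[where I = UNIV and C = "\<lambda>_. C" and h = "\<lambda>_. inv_into (sa_carrier C) code"])
       (use C hd in \<open>auto simp: transport_def Let_def\<close>)
qed

lemma carrier_transport: "sa_carrier (transport code C) = code ` sa_carrier C"
  by (simp add: transport_def Let_def)

lemma is_star_alg_transport:
  assumes C: "is_star_alg C" and inj: "inj_on code (sa_carrier C)"
  shows "is_star_alg (transport code C)"
proof -
  have alg: "is_alg C" using C by (simp add: is_star_alg_def)
  interpret C: calg C by (standard, fact)
  have st: "sa_star C a \<in> sa_carrier C" if "a \<in> sa_carrier C" for a using C that by (simp add: is_star_alg_def)
  note h = xhom_code[OF alg inj]
  note s = star_code[OF alg inj, symmetric] xhom_add[OF h, symmetric] xhom_mul[OF h, symmetric] xhom_smul[OF h, symmetric]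
  show ?thesis unfolding is_star_alg_def
    using C[unfolded is_star_alg_def]
    by (auto simp: is_alg_transport[OF alg inj] carrier_transport s st)
qed

lemma is_alg_sub:
  assumes C: "is_alg C" and "S \<subseteq> sa_carrier C" "sa_zero C \<in> S"
    "\<And>a b. a \<in> S \<Longrightarrow> b \<in> S \<Longrightarrow> sa_add C a b \<in> S" "\<And>a b. a \<in> S \<Longrightarrow> b \<in> S \<Longrightarrow> sa_mul C a b \<in> S"
    "\<And>c a. a \<in> S \<Longrightarrow> sa_smul C c a \<in> S"
  shows "is_alg (C\<lparr>sa_carrier := S\<rparr>)"
  by (rule is_alg_of_faithful_family[where I = UNIV and C = "\<lambda>_. C" and h = "\<lambda>_. id"])
     (use assms in \<open>auto simp: xhom_def\<close>)

text \<open>The image of a free algebra fits into the universe as soon as the free algebra does.\<close>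

locale coding =
  fixes enc :: "('v \<times> nat) fa \<Rightarrow> 'v"
  assumes inj_enc: "inj enc"
begin

lemma image_coded:
  fixes C :: "'c salg" and Y :: "('v \<times> nat) set"
  assumes C: "is_alg C" and h: "xhom (FA Y) C h"
  obtains K :: "'v salg" and code dec where "is_alg K" "xhom K C dec"
    "xhom (C\<lparr>sa_carrier := h ` sa_carrier (FA Y)\<rparr>) K code"
    "\<And>z. z \<in> h ` sa_carrier (FA Y) \<Longrightarrow> dec (code z) = z"
    "sa_carrier K = code ` h ` sa_carrier (FA Y)"
proof -
  let ?S = "h ` sa_carrier (FA Y)"
  let ?C = "C\<lparr>sa_carrier := ?S\<rparr>"
  interpret C: calg C by (standard, fact)
  have sub: "is_alg ?C"
  proof (rule is_alg_sub[OF C])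
    show "?S \<subseteq> sa_carrier C" using h by (auto simp: xhom_closed)
    show "sa_zero C \<in> ?S" using xhom_zero[OF is_alg_FA C h] FA_zero by (force simp: image_iff)
    show "sa_add C a b \<in> ?S" if "a \<in> ?S" "b \<in> ?S" for a b
      using that xhom_add[OF h, symmetric] by (force intro: FA_add)
    show "sa_mul C a b \<in> ?S" if "a \<in> ?S" "b \<in> ?S" for a b
      using that xhom_mul[OF h, symmetric] by (force intro: FA_mult)
    show "sa_smul C c a \<in> ?S" if "a \<in> ?S" for c a
      using that xhom_smul[OF h, symmetric] by (force intro: FA_cst)
  qed
  \<comment> \<open>Each element of the image is named by a preimage in the free algebra. Since
    choosing preimages is injective, so is the code, whatever the type of \<open>C\<close>.\<close>
  define code where "code z = enc (inv_into (sa_carrier (FA Y)) h z)" for z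
  have inj: "inj_on code (sa_carrier ?C)"
    unfolding code_def using inj_enc inj_on_inv_into[of ?S h "sa_carrier (FA Y)"]
    by (auto simp: inj_on_def dest!: injD[OF inj_enc])
  let ?dec = "inv_into (sa_carrier ?C) code"
  have "xhom (transport code ?C) C ?dec"
    using xhom_dec[OF sub inj] h unfolding xhom_def by auto
  then show ?thesis
    using that[OF is_alg_transport[OF sub inj] _ xhom_code[OF sub inj], of ?dec] inv_into_f_f[OF inj]
    by (simp add: carrier_transport)
qed

end

section \<open>Free products\<close>

lemma is_free_product_algs:
  assumes "is_free_product A1 A2 P"
  shows "is_alg A1" "is_alg A2" "is_alg (fst P)"
    "xhom A1 (fst P) (fst (snd P))" "xhom A2 (fst P) (snd (snd P))"
  using assms unfolding is_free_product_def by (auto simp: alg_hom_iff_xhom split: prod.splits)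

lemma fp_universal:
  fixes A1 A2 C :: "'v salg"
  assumes P: "is_free_product A1 A2 (F, i1, i2)" and C: "is_alg C" "xhom A1 C f1" "xhom A2 C f2"
  shows "\<exists>f. xhom F C f \<and> (\<forall>a\<in>sa_carrier A1. f (i1 a) = f1 a) \<and> (\<forall>a\<in>sa_carrier A2. f (i2 a) = f2 a)"
    and "\<And>f g x. \<lbrakk>xhom F C f; \<And>a. a \<in> sa_carrier A1 \<Longrightarrow> f (i1 a) = f1 a; \<And>a. a \<in> sa_carrier A2 \<Longrightarrow> f (i2 a) = f2 a;
      xhom F C g; \<And>a. a \<in> sa_carrier A1 \<Longrightarrow> g (i1 a) = f1 a; \<And>a. a \<in> sa_carrier A2 \<Longrightarrow> g (i2 a) = f2 a;
      x \<in> sa_carrier F\<rbrakk> \<Longrightarrow> f x = g x"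
proof -
  have "\<forall>(C :: 'v salg) f1 f2. is_alg C \<and> xhom A1 C f1 \<and> xhom A2 C f2 \<longrightarrow>
        (\<exists>f. xhom F C f \<and> (\<forall>a\<in>sa_carrier A1. f (i1 a) = f1 a) \<and> (\<forall>a\<in>sa_carrier A2. f (i2 a) = f2 a)) \<and>
        (\<forall>f g. xhom F C f \<and> (\<forall>a\<in>sa_carrier A1. f (i1 a) = f1 a) \<and> (\<forall>a\<in>sa_carrier A2. f (i2 a) = f2 a) \<and>
             xhom F C g \<and> (\<forall>a\<in>sa_carrier A1. g (i1 a) = f1 a) \<and> (\<forall>a\<in>sa_carrier A2. g (i2 a) = f2 a) \<longrightarrow>
             (\<forall>x\<in>sa_carrier F. f x = g x))"
    using P unfolding is_free_product_def alg_hom_iff_xhom prod.case by (elim conjE)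
  note u = this[THEN spec, THEN spec, THEN spec, THEN mp, OF conjI[OF C(1) conjI[OF C(2,3)]]]
  show "\<exists>f. xhom F C f \<and> (\<forall>a\<in>sa_carrier A1. f (i1 a) = f1 a) \<and> (\<forall>a\<in>sa_carrier A2. f (i2 a) = f2 a)"
    by (rule u[THEN conjunct1])
  show "f x = g x" if "xhom F C f" "\<And>a. a \<in> sa_carrier A1 \<Longrightarrow> f (i1 a) = f1 a" "\<And>a. a \<in> sa_carrier A2 \<Longrightarrow> f (i2 a) = f2 a"
      "xhom F C g" "\<And>a. a \<in> sa_carrier A1 \<Longrightarrow> g (i1 a) = f1 a" "\<And>a. a \<in> sa_carrier A2 \<Longrightarrow> g (i2 a) = f2 a"
      "x \<in> sa_carrier F" for f g x
    by (rule u[THEN conjunct2, THEN spec, THEN spec, THEN mp, THEN bspec, of f g]) (use that in auto)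
qed

lemma fp_extend:
  fixes A1 A2 C :: "'v salg"
  assumes "is_free_product A1 A2 P" "is_alg C" "xhom A1 C f1" "xhom A2 C f2"
  obtains f where "xhom (fst P) C f" "\<And>a. a \<in> sa_carrier A1 \<Longrightarrow> f (fst (snd P) a) = f1 a"
    "\<And>a. a \<in> sa_carrier A2 \<Longrightarrow> f (snd (snd P) a) = f2 a"
proof -
  obtain F i1 i2 where P: "P = (F, i1, i2)" by (metis prod_cases3)
  show ?thesis using fp_universal(1)[OF assms(1)[unfolded P] assms(2-4)] that by (auto simp: P)
qed

lemma fp_unique:
  fixes A1 A2 C :: "'v salg"
  assumes "is_free_product A1 A2 P" "is_alg C" "xhom (fst P) C f" "xhom (fst P) C h"
    "\<And>a. a \<in> sa_carrier A1 \<Longrightarrow> f (fst (snd P) a) = h (fst (snd P) a)"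
    "\<And>a. a \<in> sa_carrier A2 \<Longrightarrow> f (snd (snd P) a) = h (snd (snd P) a)"
    "x \<in> sa_carrier (fst P)"
  shows "f x = h x"
proof -
  obtain F i1 i2 where P: "P = (F, i1, i2)" by (metis prod_cases3)
  have "xhom A1 C (f \<circ> i1)" "xhom A2 C (f \<circ> i2)"
    using is_free_product_algs[OF assms(1)] assms(3) unfolding P by (auto intro: xhom_comp)
  from fp_universal(2)[OF assms(1)[unfolded P] assms(2) this] show ?thesis
    using assms(3-) by (simp add: P)
qed

lemma fp_lift:
  fixes A1 A2 C :: "'v salg"
  assumes "is_free_product A1 A2 P" "is_alg C" "xhom A1 C f1" "xhom A2 C f2"
  shows xhom_fp_lift: "xhom (fst P) C (fp_lift A1 A2 P C f1 f2)"
    and fp_lift_1: "\<And>a. a \<in> sa_carrier A1 \<Longrightarrow> fp_lift A1 A2 P C f1 f2 (fst (snd P) a) = f1 a"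
    and fp_lift_2: "\<And>a. a \<in> sa_carrier A2 \<Longrightarrow> fp_lift A1 A2 P C f1 f2 (snd (snd P) a) = f2 a"
proof -
  obtain F i1 i2 where P: "P = (F, i1, i2)" by (metis prod_cases3)
  obtain f where "alg_hom F C f \<and> (\<forall>a\<in>sa_carrier A1. f (i1 a) = f1 a) \<and> (\<forall>a\<in>sa_carrier A2. f (i2 a) = f2 a)"
    using fp_extend[OF assms] unfolding P alg_hom_iff_xhom by (metis fst_conv snd_conv)
  from someI[where P = "\<lambda>f. alg_hom F C f \<and> (\<forall>a\<in>sa_carrier A1. f (i1 a) = f1 a) \<and> (\<forall>a\<in>sa_carrier A2. f (i2 a) = f2 a)", OF this]
  show "xhom (fst P) C (fp_lift A1 A2 P C f1 f2)"
    "\<And>a. a \<in> sa_carrier A1 \<Longrightarrow> fp_lift A1 A2 P C f1 f2 (fst (snd P) a) = f1 a"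
    "\<And>a. a \<in> sa_carrier A2 \<Longrightarrow> fp_lift A1 A2 P C f1 f2 (snd (snd P) a) = f2 a"
    unfolding fp_lift_def P by (auto simp: alg_hom_iff_xhom)
qed

lemma fp_map:
  assumes "is_free_product A1 A2 P" "is_free_product A1' A2' P'" "xhom A1 A1' j1" "xhom A2 A2' j2"
  shows xhom_fp_map: "xhom (fst P) (fst P') (fp_map A1 A2 P P' j1 j2)"
    and fp_map_1: "\<And>a. a \<in> sa_carrier A1 \<Longrightarrow> fp_map A1 A2 P P' j1 j2 (fst (snd P) a) = fst (snd P') (j1 a)"
    and fp_map_2: "\<And>a. a \<in> sa_carrier A2 \<Longrightarrow> fp_map A1 A2 P P' j1 j2 (snd (snd P) a) = snd (snd P') (j2 a)"
proof -
  note P' = is_free_product_algs[OF assms(2)]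
  have eq: "fp_map A1 A2 P P' j1 j2 = fp_lift A1 A2 P (fst P') (fst (snd P') \<circ> j1) (snd (snd P') \<circ> j2)"
    by (simp add: fp_map_def split: prod.splits)
  note l = fp_lift[OF assms(1) P'(3) xhom_comp[OF assms(3) P'(4)] xhom_comp[OF assms(4) P'(5)]]
  from l show "xhom (fst P) (fst P') (fp_map A1 A2 P P' j1 j2)"
    "\<And>a. a \<in> sa_carrier A1 \<Longrightarrow> fp_map A1 A2 P P' j1 j2 (fst (snd P) a) = fst (snd P') (j1 a)"
    "\<And>a. a \<in> sa_carrier A2 \<Longrightarrow> fp_map A1 A2 P P' j1 j2 (snd (snd P) a) = snd (snd P') (j2 a)"
    unfolding eq by auto
qed

text \<open>The elements with \<open>Q\<close> form a subalgebra through which both embeddings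
  factor. The induced homomorphism into it agrees with the identity on the two copies, hence
  everywhere, so the subalgebra is the whole free product.\<close>

lemma fp_induct [consumes 2, case_names left right add smul mul]:
  assumes P: "is_free_product A1 A2 P" and x: "x \<in> sa_carrier (fst P)"
    and left: "\<And>a. a \<in> sa_carrier A1 \<Longrightarrow> Q (fst (snd P) a)"
    and right: "\<And>a. a \<in> sa_carrier A2 \<Longrightarrow> Q (snd (snd P) a)"
    and add: "\<And>x y. \<lbrakk>x \<in> sa_carrier (fst P); y \<in> sa_carrier (fst P); Q x; Q y\<rbrakk> \<Longrightarrow> Q (sa_add (fst P) x y)"
    and smul: "\<And>c x. \<lbrakk>x \<in> sa_carrier (fst P); Q x\<rbrakk> \<Longrightarrow> Q (sa_smul (fst P) c x)"
    and mul: "\<And>x y. \<lbrakk>x \<in> sa_carrier (fst P); y \<in> sa_carrier (fst P); Q x; Q y\<rbrakk> \<Longrightarrow> Q (sa_mul (fst P) x y)"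
  shows "Q x"
proof -
  note a = is_free_product_algs[OF P]
  interpret F: calg "fst P" by (standard, rule a)
  interpret A: calg A1 by (standard, rule a)
  let ?S = "{x \<in> sa_carrier (fst P). Q x}"
  let ?C = "(fst P)\<lparr>sa_carrier := ?S\<rparr>"
  have z: "Q (sa_zero (fst P))"
    using left[of "sa_zero A1"] xhom_zero[OF a(1,3,4)] by simp
  have C: "is_alg ?C"
    by (rule is_alg_sub[OF a(3)]) (auto intro: z add smul mul)
  have h1: "xhom A1 ?C (fst (snd P))" and h2: "xhom A2 ?C (snd (snd P))"
    by (rule xhomI; simp add: a(4,5)[THEN xhom_closed] a(4,5)[THEN xhom_add] a(4,5)[THEN xhom_mul]
      a(4,5)[THEN xhom_smul] left right)+
  obtain f where f: "xhom (fst P) ?C f"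
    and fa: "\<And>a. a \<in> sa_carrier A1 \<Longrightarrow> f (fst (snd P) a) = fst (snd P) a"
    "\<And>a. a \<in> sa_carrier A2 \<Longrightarrow> f (snd (snd P) a) = snd (snd P) a"
    by (rule fp_extend[OF P C h1 h2]) blast
  have "xhom (fst P) (fst P) f" using f unfolding xhom_def by simp
  from fp_unique[OF P a(3) this xhom_id _ _ x] have "f x = id x" using fa by simp
  with xhom_closed[OF f x] show ?thesis by simp
qed

text \<open>Letters of a word in a free product of \<open>A1\<close> and \<open>A2\<close> are tagged by \<open>0\<close> and \<open>1\<close>.\<close>

definition fp_letters :: "'v salg \<Rightarrow> 'v salg \<Rightarrow> ('v \<times> nat) set" where
  "fp_letters A1 A2 = sa_carrier A1 \<times> {0} \<union> sa_carrier A2 \<times> {1}"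

definition fp_emb :: "('v \<Rightarrow> 'c) \<Rightarrow> ('v \<Rightarrow> 'c) \<Rightarrow> 'v \<times> nat \<Rightarrow> 'c" where
  "fp_emb f1 f2 l = (if snd l = 0 then f1 (fst l) else f2 (fst l))"

lemma fp_surj:
  assumes P: "is_free_product A1 A2 P" and g: "xhom (FA (fp_letters A1 A2)) (fst P) g"
    and gl: "\<And>l. l \<in> fp_letters A1 A2 \<Longrightarrow> g (mon [l]) = fp_emb (fst (snd P)) (snd (snd P)) l"
    and x: "x \<in> sa_carrier (fst P)"
  shows "x \<in> g ` sa_carrier (FA (fp_letters A1 A2))"
  using P x
proof (induction x rule: fp_induct)
  case (left a)
  then show ?case using gl[of "(a, 0)"] by (intro image_eqI[of _ _ "mon [(a, 0)]"]) (auto simp: fp_emb_def fp_letters_def intro!: FA_mon)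
next
  case (right a)
  then show ?case using gl[of "(a, 1)"] by (intro image_eqI[of _ _ "mon [(a, 1)]"]) (auto simp: fp_emb_def fp_letters_def intro!: FA_mon)
next
  case (add x y)
  then show ?case using xhom_add[OF g, symmetric] by (force intro: FA_add)
next
  case (smul c x)
  then show ?case using xhom_smul[OF g, symmetric] by (force intro: FA_cst)
next
  case (mul x y)
  then show ?case using xhom_mul[OF g, symmetric] by (force intro: FA_mult)
qed

lemma fp_word_induct [consumes 2, case_names word add smul]:
  assumes P: "is_free_product A1 A2 P" and x: "x \<in> sa_carrier (fst P)"
    and word: "\<And>w. w \<noteq> [] \<Longrightarrow> set w \<subseteq> fp_letters A1 A2 \<Longrightarrow>
      Q (calg.lprod (fst P) (map (fp_emb (fst (snd P)) (snd (snd P))) w))"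
    and add: "\<And>x y. \<lbrakk>x \<in> sa_carrier (fst P); y \<in> sa_carrier (fst P); Q x; Q y\<rbrakk> \<Longrightarrow> Q (sa_add (fst P) x y)"
    and smul: "\<And>c x. \<lbrakk>x \<in> sa_carrier (fst P); Q x\<rbrakk> \<Longrightarrow> Q (sa_smul (fst P) c x)"
  shows "Q x"
proof -
  note a = is_free_product_algs[OF P]
  interpret F: calg "fst P" by (standard, rule a)
  interpret A: calg A1 by (standard, rule a)
  define e where "e l = (if l \<in> fp_letters A1 A2 then fp_emb (fst (snd P)) (snd (snd P)) l else sa_zero (fst P))" for l
  have e: "e l \<in> sa_carrier (fst P)" for l
    using a by (auto simp: e_def fp_letters_def fp_emb_def xhom_closed)
  obtain p where p: "p \<in> sa_carrier (FA (fp_letters A1 A2))" "x = F.fext e p"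
    using fp_surj[OF P F.xhom_fext[where g = e, OF e] _ x] by (auto simp: F.fext_mon[where g = e, OF e] e_def)
  have w: "Q (F.lprod (map e w))" if "w \<noteq> []" "set w \<subseteq> fp_letters A1 A2" for w
  proof -
    have eq: "map e w = map (fp_emb (fst (snd P)) (snd (snd P))) w"
      using that(2) unfolding map_eq_conv e_def by (metis subsetD)
    show ?thesis unfolding eq by (rule word[OF that])
  qed
  have z: "(sa_zero A1, 0) \<in> fp_letters A1 A2" by (simp add: fp_letters_def)
  from p(1) have "Q (F.fext e p)"
  proof (induction p rule: FA_induct)
    case zero
    \<comment> \<open>No word spells the zero polynomial, so it is reached as zero times a
      one-letter word.\<close>
    have "Q (sa_smul (fst P) 0 (F.lprod (map e [(sa_zero A1, 0)])))"
      by (rule smul) (use w[of "[(sa_zero A1, 0)]"] z e in auto)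
    then show ?case using e by (simp add: F.fext_zero[where g = e, OF e])
  next
    case (single w c)
    then show ?case using w[of "letters w"] smul F.lprod_map_closed[where g = e, OF e] by (simp add: F.fext_single[where g = e, OF e])
  next
    case (add p q)
    then show ?case by (simp add: F.fext_add[where g = e, OF e] F.fext_closed[where g = e, OF e] assms(4))
  qed
  then show ?thesis using p by simp
qed

context coding begin

text \<open>The universal property quantifies over targets inside \<open>'v\<close> only. The part
  of \<open>C\<close> generated by the images of \<open>f1\<close> and \<open>f2\<close> is an image
  of a free algebra, so it can be coded in \<open>'v\<close>, extended into there, and
  decoded.\<close>

lemma fp_extend_any:
  fixes C :: "'c salg" and P :: "'v fprod"
  assumes P: "is_free_product A1 A2 P" and C: "is_alg C" and f1: "xhom A1 C f1" and f2: "xhom A2 C f2"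
  obtains f where "xhom (fst P) C f" "\<And>a. a \<in> sa_carrier A1 \<Longrightarrow> f (fst (snd P) a) = f1 a"
    "\<And>a. a \<in> sa_carrier A2 \<Longrightarrow> f (snd (snd P) a) = f2 a"
proof -
  let ?Y = "fp_letters A1 A2"
  have "fp_emb f1 f2 l \<in> sa_carrier C" if "l \<in> ?Y" for l
    using that f1 f2 by (auto simp: fp_emb_def fp_letters_def xhom_closed)
  then obtain h where h: "xhom (FA ?Y) C h" "\<And>l. l \<in> ?Y \<Longrightarrow> h (mon [l]) = fp_emb f1 f2 l"
    by (rule FA_extend[where Y = ?Y and g = "fp_emb f1 f2", OF C]) (assumption | (rule that; assumption))+
  let ?S = "h ` sa_carrier (FA ?Y)"
  obtain K :: "'v salg" and code dec where K: "is_alg K" "xhom K C dec" "xhom (C\<lparr>sa_carrier := ?S\<rparr>) K code"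
    "\<And>z. z \<in> ?S \<Longrightarrow> dec (code z) = z"
    by (rule image_coded[OF C h(1)]) (rule that; assumption)
  have in1: "f1 a \<in> ?S" if "a \<in> sa_carrier A1" for a
    using that h(2)[of "(a,0)"] by (intro image_eqI[of _ _ "mon [(a, 0)]"]) (auto simp: fp_emb_def fp_letters_def intro!: FA_mon)
  have in2: "f2 a \<in> ?S" if "a \<in> sa_carrier A2" for a
    using that h(2)[of "(a,1)"] by (intro image_eqI[of _ _ "mon [(a, 1)]"]) (auto simp: fp_emb_def fp_letters_def intro!: FA_mon)
  have "xhom A1 (C\<lparr>sa_carrier := ?S\<rparr>) f1" "xhom A2 (C\<lparr>sa_carrier := ?S\<rparr>) f2"
    using f1 f2 in1 in2 unfolding xhom_def by auto
  then have "xhom A1 K (code \<circ> f1)" "xhom A2 K (code \<circ> f2)" using xhom_comp[OF _ K(3)] by auto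
  from fp_extend[OF P K(1) this] obtain f where f: "xhom (fst P) K f" "\<And>a. a \<in> sa_carrier A1 \<Longrightarrow> f (fst (snd P) a) = code (f1 a)"
    "\<And>a. a \<in> sa_carrier A2 \<Longrightarrow> f (snd (snd P) a) = code (f2 a)"
    unfolding comp_def by blast
  show ?thesis
    by (rule that[OF xhom_comp[OF f(1) K(2)]]) (use f in1 in2 K(4) in auto)
qed

text \<open>In the product of all pairs of homomorphisms into algebras over \<open>'v\<close>, the
  subalgebra generated by the two tautological images is universal: existence of extensions is a
  projection, uniqueness is generation. It is an image of the free algebra on tagged elements, hence
  small enough for a code in \<open>'v\<close>.\<close>

lemma free_product_exists:
  fixes A1 A2 :: "'v salg"
  assumes A1: "is_alg A1" and A2: "is_alg A2"
  obtains P where "is_free_product A1 A2 P"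
proof -
  interpret A1: calg A1 by (standard, fact)
  interpret A2: calg A2 by (standard, fact)
  define I :: "('v salg \<times> ('v \<Rightarrow> 'v) \<times> ('v \<Rightarrow> 'v)) set" where
    "I = {(C, f1, f2). is_alg C \<and> xhom A1 C f1 \<and> xhom A2 C f2}"
  \<comment> \<open>Pinning the values outside \<open>I\<close> to \<open>undefined\<close> makes
    the evaluations at points of \<open>I\<close> jointly injective on the carrier.\<close>
  define R :: "(('v salg \<times> ('v \<Rightarrow> 'v) \<times> ('v \<Rightarrow> 'v)) \<Rightarrow> 'v) salg" where
    "R = \<lparr>sa_carrier = {z. \<forall>i. if i \<in> I then z i \<in> sa_carrier (fst i) else z i = undefined},
      sa_add = (\<lambda>z y i. if i \<in> I then sa_add (fst i) (z i) (y i) else undefined),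
      sa_mul = (\<lambda>z y i. if i \<in> I then sa_mul (fst i) (z i) (y i) else undefined),
      sa_smul = (\<lambda>c z i. if i \<in> I then sa_smul (fst i) c (z i) else undefined),
      sa_star = undefined, sa_zero = (\<lambda>i. if i \<in> I then sa_zero (fst i) else undefined)\<rparr>"
  have I: "calg (fst i)" "xhom A1 (fst i) (fst (snd i))" "xhom A2 (fst i) (snd (snd i))" if "i \<in> I" for i
    using that by (auto simp: I_def calg_def)
  have ev: "xhom R (fst i) (\<lambda>z. z i)" if "i \<in> I" for i
    by (rule xhomI) (use that in \<open>auto simp: R_def simp del: split_paired_All dest: spec[of _ i]\<close>)
  have R: "is_alg R"
  proof (rule is_alg_of_faithful_family[where I = I and C = fst and h = "\<lambda>i z. z i"])
    show "a = b" if "a \<in> sa_carrier R" "b \<in> sa_carrier R" "\<And>i. i \<in> I \<Longrightarrow> a i = b i" for a b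
    proof
      fix i show "a i = b i" using that by (cases "i \<in> I") (auto simp: R_def simp del: split_paired_All dest!: spec[of _ i])
    qed
  qed (use I ev in \<open>auto simp: R_def calg_def calg.zero_closed calg.add_closed calg.mul_closed calg.smul_closed
    simp del: split_paired_All\<close>)
  define e1 where "e1 a = (\<lambda>i. if i \<in> I then fst (snd i) a else undefined)" for a
  define e2 where "e2 a = (\<lambda>i. if i \<in> I then snd (snd i) a else undefined)" for a
  have e1: "xhom A1 R e1" and e2: "xhom A2 R e2"
    by (rule xhomI; use I in \<open>auto simp: R_def e1_def e2_def fun_eq_iff xhom_def simp del: split_paired_All\<close>)+
  let ?Y = "fp_letters A1 A2"
  have "fp_emb e1 e2 l \<in> sa_carrier R" if "l \<in> ?Y" for l
    using that e1 e2 by (auto simp: fp_emb_def fp_letters_def xhom_closed)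
  then obtain h where h: "xhom (FA ?Y) R h" "\<And>l. l \<in> ?Y \<Longrightarrow> h (mon [l]) = fp_emb e1 e2 l"
    by (rule FA_extend[where Y = ?Y and g = "fp_emb e1 e2", OF R]) (assumption | (rule that; assumption))+
  let ?S = "h ` sa_carrier (FA ?Y)"
  obtain K :: "'v salg" and code dec where K: "is_alg K" "xhom K R dec" "xhom (R\<lparr>sa_carrier := ?S\<rparr>) K code"
    "\<And>z. z \<in> ?S \<Longrightarrow> dec (code z) = z" "sa_carrier K = code ` ?S"
    by (rule image_coded[OF R h(1)]) (rule that; assumption)
  have in1: "e1 a \<in> ?S" "h (mon [(a, 0)]) = e1 a" if "a \<in> sa_carrier A1" for a
    using that h(2)[of "(a,0)"] by (auto simp: fp_emb_def fp_letters_def intro!: FA_mon image_eqI[of _ _ "mon [(a, 0)]"])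
  have in2: "e2 a \<in> ?S" "h (mon [(a, 1)]) = e2 a" if "a \<in> sa_carrier A2" for a
    using that h(2)[of "(a,1)"] by (auto simp: fp_emb_def fp_letters_def intro!: FA_mon image_eqI[of _ _ "mon [(a, 1)]"])
  have "xhom A1 (R\<lparr>sa_carrier := ?S\<rparr>) e1" "xhom A2 (R\<lparr>sa_carrier := ?S\<rparr>) e2"
    using e1 e2 in1 in2 unfolding xhom_def by auto
  then have hom: "xhom A1 K (code \<circ> e1)" "xhom A2 K (code \<circ> e2)" using xhom_comp[OF _ K(3)] by auto
  have hS: "xhom (FA ?Y) (R\<lparr>sa_carrier := ?S\<rparr>) h" using h(1) unfolding xhom_def by auto
  have ex: "\<exists>f. xhom K C f \<and> (\<forall>a\<in>sa_carrier A1. f (code (e1 a)) = f1 a) \<and> (\<forall>a\<in>sa_carrier A2. f (code (e2 a)) = f2 a)"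
    if "is_alg C" "xhom A1 C f1" "xhom A2 C f2" for C :: "'v salg" and f1 f2
  proof -
    have i: "(C, f1, f2) \<in> I" using that by (simp add: I_def)
    have "xhom K C ((\<lambda>z. z (C, f1, f2)) \<circ> dec)" using xhom_comp[OF K(2) ev[OF i]] by simp
    then show ?thesis
      by (intro exI conjI) (use i in1 in2 in \<open>auto simp: K(4) e1_def e2_def\<close>)
  qed
  have un: "f x = f' x" if C: "is_alg C" and f: "xhom K C f" "xhom K C f'"
    and eq: "\<forall>a\<in>sa_carrier A1. f (code (e1 a)) = f' (code (e1 a))" "\<forall>a\<in>sa_carrier A2. f (code (e2 a)) = f' (code (e2 a))"
    and x: "x \<in> sa_carrier K" for C :: "'v salg" and f f' x
  proof -
    obtain p where p: "p \<in> sa_carrier (FA ?Y)" "x = code (h p)" using x K(5) by auto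
    note hc = xhom_comp[OF hS K(3)]
    have "(f \<circ> (code \<circ> h)) p = (f' \<circ> (code \<circ> h)) p"
    proof (rule FA_xhom_unique[OF C xhom_comp[OF hc f(1)] xhom_comp[OF hc f(2)] _ p(1)])
      fix l assume "l \<in> ?Y"
      then show "(f \<circ> (code \<circ> h)) (mon [l]) = (f' \<circ> (code \<circ> h)) (mon [l])"
        using eq in1(2) in2(2) by (auto simp: fp_letters_def)
    qed
    then show ?thesis using p by simp
  qed
  have "is_free_product A1 A2 (K, code \<circ> e1, code \<circ> e2)"
    unfolding is_free_product_def alg_hom_iff_xhom prod.case
  proof (intro conjI allI impI A1 A2 K(1) hom, goal_cases)
    case (1 C f1 f2)
    then show ?case using ex[of C f1 f2] by simp
  next
    case (2 C f1 f2 f g)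
    show ?case by (rule ballI, rule un[of C]) (use 2 in auto)
  qed
  then show ?thesis by (rule that)
qed

end

section \<open>The universe of a nontrivial algebra is large\<close>

text \<open>The multiples of \<open>b\<close> embed the complex numbers into \<open>'v\<close>.
  Hence \<open>'v\<close> is infinite and admits a pairing function; lists, words and finally the
  finite graphs of polynomials are then coded by iterating it.\<close>

lemma coding_exists:
  fixes B :: "'v salg"
  assumes B: "is_alg B" and b: "b \<in> sa_carrier B" "b \<noteq> sa_zero B"
  obtains enc :: "('v \<times> nat) fa \<Rightarrow> 'v" where "coding enc"
proof -
  interpret B: calg B by (standard, fact)
  define cc where "cc c = sa_smul B c b" for c
  have cc: "inj cc"
  proof (rule injI)
    fix c d assume eq: "cc c = cc d"
    have "cc (c - d) = sa_add B (cc c) (cc (- d))" using B.smul_add_left[OF b(1), of c "-d"] by (simp add: cc_def)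
    also have "\<dots> = sa_add B (cc d) (cc (- d))" by (simp only: eq)
    also have "\<dots> = cc (d + - d)" using B.smul_add_left[OF b(1), of d "-d"] by (simp only: cc_def)
    finally have *: "cc (c - d) = sa_zero B" using b by (simp add: cc_def)
    show "c = d"
    proof (rule ccontr)
      assume "c \<noteq> d"
      then have "sa_smul B (inverse (c - d)) (cc (c - d)) = b" using b by (simp add: cc_def B.smul_smul)
      then show False using * b by simp
    qed
  qed
  define nt :: "nat \<Rightarrow> 'v" where "nt n = cc (of_nat n)" for n
  have nt: "inj nt" by (auto simp: nt_def intro!: injI dest!: injD[OF cc])
  have "infinite (UNIV :: 'v set)"
    using nt finite_imageD[of nt UNIV] finite_subset[of "range nt" UNIV] by auto
  from card_of_Times_same_infinite[OF this] obtain pr0 :: "'v \<times> 'v \<Rightarrow> 'v" where "bij_betw pr0 (UNIV \<times> UNIV) UNIV"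
    unfolding card_of_ordIso[symmetric] by blast
  then have pr0: "inj pr0" by (simp add: bij_betw_def)
  define pr where "pr x y = pr0 (x, y)" for x y
  have pr [simp]: "pr x y = pr x' y' \<longleftrightarrow> x = x' \<and> y = y'" for x y x' y'
    using pr0 by (auto simp: pr_def dest: injD)
  have nt' [simp]: "nt m = nt n \<longleftrightarrow> m = n" for m n using nt by (auto dest: injD)
  have cc' [simp]: "cc m = cc n \<longleftrightarrow> m = n" for m n using cc by (auto dest: injD)
  \<comment> \<open>The leading \<open>nt 0\<close> or \<open>nt 1\<close> distinguishes the empty
    list from a cons cell, so that lists of different lengths receive different codes.\<close>
  define lc where "lc xs = rec_list (pr (nt 0) (nt 0)) (\<lambda>x _ y. pr (nt 1) (pr x y)) xs" for xs :: "'v list"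
  have lc_simps: "lc [] = pr (nt 0) (nt 0)" "lc (x # xs) = pr (nt 1) (pr x (lc xs))" for x xs
    by (simp_all add: lc_def)
  have lc: "lc xs = lc ys \<Longrightarrow> xs = ys" for xs ys
    by (induction xs arbitrary: ys) (case_tac ys; force simp: lc_simps)+
  define wc where "wc w = lc (map (\<lambda>(v, n). pr v (nt n)) (letters w))" for w :: "('v \<times> nat) word"
  have wc: "wc u = wc w \<Longrightarrow> u = w" for u w
  proof -
    assume "wc u = wc w"
    then have "map (\<lambda>(v, n). pr v (nt n)) (letters u) = map (\<lambda>(v, n). pr v (nt n)) (letters w)"
      using lc by (simp add: wc_def)
    then have "letters u = letters w" by (rule map_injective) (auto simp: inj_on_def)
    then show "u = w" by (rule word.expand)
  qed
  define gr where "gr p = (\<lambda>w. (w, coef p w)) ` Poly_Mapping.keys p" for p :: "('v \<times> nat) fa"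
  define enum where "enum p = (SOME l. set l = gr p)" for p
  have enum: "set (enum p) = gr p" for p
    unfolding enum_def by (rule someI_ex) (simp add: gr_def finite_list)
  define enc where "enc p = lc (map (\<lambda>(w, c). pr (wc w) (cc c)) (enum p))" for p
  have "inj enc"
  proof (rule injI)
    fix p q assume "enc p = enc q"
    then have "map (\<lambda>(w, c). pr (wc w) (cc c)) (enum p) = map (\<lambda>(w, c). pr (wc w) (cc c)) (enum q)"
      using lc by (simp add: enc_def)
    then have "enum p = enum q" by (rule map_injective) (auto simp: inj_on_def wc)
    then have gr: "gr p = gr q" using enum by metis
    show "p = q"
    proof (rule poly_mapping_eqI)
      fix w
      have *: "coef r w = (if \<exists>c. (w, c) \<in> gr r then THE c. (w, c) \<in> gr r else 0)" for r
        by (auto simp: gr_def in_keys_iff image_iff)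
      show "coef p w = coef q w" using *[of p] *[of q] gr by simp
    qed
  qed
  then show ?thesis using that by (simp add: coding_def)
qed

section \<open>Universal products are polynomial in the moments\<close>

text \<open>A function of the moments \<open>m\<close> of a tuple of noncommuting variables (indexed by words) that is
  additive and homogeneous in each variable is a polynomial in finitely many moments.\<close>

definition additive_at :: "'l \<Rightarrow> (('l list \<Rightarrow> complex) \<Rightarrow> complex) \<Rightarrow> bool" where
  "additive_at i g \<longleftrightarrow> (\<forall>m m1 m2. (\<forall>w. i \<notin> set w \<longrightarrow> m w = m1 w \<and> m w = m2 w) \<and>
     (\<forall>w. count_list w i = 1 \<longrightarrow> m w = m1 w + m2 w) \<longrightarrow> g m = g m1 + g m2)"

definition homogeneous_at :: "'l \<Rightarrow> (('l list \<Rightarrow> complex) \<Rightarrow> complex) \<Rightarrow> bool" where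
  "homogeneous_at i g \<longleftrightarrow> (\<forall>m c. g (\<lambda>w. c ^ count_list w i * m w) = c * g m)"

definition depends_on :: "'l set \<Rightarrow> (('l list \<Rightarrow> complex) \<Rightarrow> complex) \<Rightarrow> bool" where
  "depends_on I g \<longleftrightarrow> (\<forall>m m'. (\<forall>w. w \<noteq> [] \<longrightarrow> set w \<subseteq> I \<longrightarrow> m w = m' w) \<longrightarrow> g m = g m')"

lemma additive_atD: "additive_at i g \<Longrightarrow> (\<And>w. i \<notin> set w \<Longrightarrow> m w = m1 w) \<Longrightarrow> (\<And>w. i \<notin> set w \<Longrightarrow> m w = m2 w) \<Longrightarrow>
    (\<And>w. count_list w i = 1 \<Longrightarrow> m w = m1 w + m2 w) \<Longrightarrow> g m = g m1 + g m2"
  unfolding additive_at_def by blast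

lemma depends_onD: "depends_on I g \<Longrightarrow> (\<And>w. w \<noteq> [] \<Longrightarrow> set w \<subseteq> I \<Longrightarrow> m w = m' w) \<Longrightarrow> g m = g m'"
  unfolding depends_on_def by blast

text \<open>This is homogeneity with scalar 0: since \<open>0 ^ 0 = 1\<close>, the rescaling keeps
  the words without \<open>i\<close> and kills all others, which are zero already.\<close>

lemma homogeneous_at_zero:
  assumes "homogeneous_at i g" "\<And>w. i \<in> set w \<Longrightarrow> m w = 0"
  shows "g m = 0"
proof -
  have "(\<lambda>w. 0 ^ count_list w i * m w) = m"
    using assms(2) by (auto simp: fun_eq_iff power_0_left count_list_0_iff)
  then show ?thesis using assms(1)[unfolded homogeneous_at_def, THEN spec[of _ m], THEN spec[of _ 0]] by simp
qed

lemma distinct_if_count_list_le_1: "(\<And>x. count_list w x \<le> 1) \<Longrightarrow> distinct w"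
proof (induction w)
  case (Cons a w)
  have "count_list w x \<le> 1" for x
    using Cons.prems[of x] by (simp split: if_splits)
  moreover have "a \<notin> set w" using Cons.prems[of a] by (simp add: count_list_0_iff)
  ultimately show ?case using Cons.IH by simp
qed simp

lemma count_list_distinct: "distinct w \<Longrightarrow> x \<in> set w \<Longrightarrow> count_list w x = 1"
  by (induction w) auto

inductive moment_poly :: "'l set \<Rightarrow> (('l list \<Rightarrow> complex) \<Rightarrow> complex) \<Rightarrow> bool" for I where
  const: "moment_poly I (\<lambda>_. c)"
| moment: "w \<noteq> [] \<Longrightarrow> set w \<subseteq> I \<Longrightarrow> moment_poly I (\<lambda>m. m w)"
| add: "moment_poly I f \<Longrightarrow> moment_poly I g \<Longrightarrow> moment_poly I (\<lambda>m. f m + g m)"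
| mult: "moment_poly I f \<Longrightarrow> moment_poly I g \<Longrightarrow> moment_poly I (\<lambda>m. f m * g m)"

lemma moment_poly_mono: "moment_poly I g \<Longrightarrow> I \<subseteq> J \<Longrightarrow> moment_poly J g"
  by (induction rule: moment_poly.induct) (auto intro: moment_poly.intros)

lemma moment_poly_sum: "finite S \<Longrightarrow> (\<And>w. w \<in> S \<Longrightarrow> moment_poly I (f w)) \<Longrightarrow> moment_poly I (\<lambda>m. \<Sum>w\<in>S. f w m)"
  by (induction S rule: finite_induct) (auto intro: moment_poly.intros)

text \<open>\<open>additive_at\<close> puts no condition on words in which the variable is repeated.
  One may therefore erase the moments of these words, one variable after another, without changing
  the value.\<close>

lemma eq_if_eq_on_distinct:
  fixes I :: "'l set"
  assumes "finite I" "depends_on I g" "\<And>i. i \<in> I \<Longrightarrow> additive_at i g" "\<And>i. i \<in> I \<Longrightarrow> homogeneous_at i g"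
    and eq: "\<And>w. w \<noteq> [] \<Longrightarrow> set w \<subseteq> I \<Longrightarrow> distinct w \<Longrightarrow> m w = m' w"
  shows "g m = g m'"
proof -
  define tr where "tr J m = (\<lambda>w. if \<forall>j\<in>J. count_list w j \<le> 1 then m w else (0::complex))"
    for J :: "'l set" and m
  have tr: "g m = g (tr J m)" if "J \<subseteq> I" for J m
    using finite_subset[OF that assms(1)] that
  proof (induction J)
    case empty
    then show ?case by (simp add: tr_def)
  next
    case (insert j J)
    \<comment> \<open>Additivity in \<open>j\<close> with summands the truncation of
      \<open>m\<close> and \<open>m0\<close>: words without \<open>j\<close> agree in all three, and
      \<open>m0\<close> vanishes on words with \<open>j\<close>, so homogeneity removes it.\<close>
    define m0 where "m0 w = (if j \<in> set w then 0 else tr J m w)" for w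
    have "g (tr J m) = g (tr (insert j J) m) + g m0"
      by (rule additive_atD[of j]) (use insert assms in \<open>auto simp: tr_def m0_def count_list_0_iff\<close>)
    moreover have "g m0 = 0"
      by (rule homogeneous_at_zero[of j]) (use insert assms in \<open>auto simp: m0_def\<close>)
    ultimately show ?case using insert by simp
  qed
  have "g (tr I m) = g (tr I m')"
  proof (rule depends_onD[OF assms(2)])
    fix w assume w: "w \<noteq> []" "set w \<subseteq> I"
    have "distinct w" if "\<forall>j\<in>I. count_list w j \<le> 1"
    proof (rule distinct_if_count_list_le_1)
      fix x show "count_list w x \<le> 1" using that w by (cases "x \<in> set w") auto
    qed
    then show "tr I m w = tr I m' w" using eq[OF w] by (auto simp: tr_def)
  qed
  then show ?thesis using tr[of I m] tr[of I m'] by simp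
qed

text \<open>Induction on the number of variables. Fix \<open>i\<close>; only repetition-free words
  matter, and exactly one factor of each term contains \<open>i\<close>. So \<open>g\<close> is a
  sum of moments \<open>m w\<close> over words \<open>w\<close> containing \<open>i\<close>, with
  coefficients \<open>h w\<close> that are multilinear in the variables outside
  \<open>w\<close>.\<close>

lemma moment_poly_of_multilinear:
  fixes I :: "'l set"
  assumes "finite I" "depends_on I g" "\<And>i. i \<in> I \<Longrightarrow> additive_at i g" "\<And>i. i \<in> I \<Longrightarrow> homogeneous_at i g"
  shows "moment_poly I g"
  using assms
proof (induction "card I" arbitrary: I g rule: less_induct)
  case less
  show ?case
  proof (cases "I = {}")
    case True
    have "g m = g (\<lambda>_. 0)" for m
      by (rule depends_onD[OF less.prems(2)]) (use True in auto)
    then have "g = (\<lambda>m. g (\<lambda>_. 0))" by blast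
    then show ?thesis by (metis moment_poly.const)
  next
    case False
    then obtain i where i: "i \<in> I" by auto
    define W where "W = {w. w \<noteq> [] \<and> set w \<subseteq> I \<and> distinct w \<and> i \<in> set w}"
    have finW: "finite W"
      by (rule finite_subset[OF _ finite_subset_distinct[OF less.prems(1)]]) (auto simp: W_def)
    \<comment> \<open>The coefficient of \<open>m w\<close>: the moment of \<open>w\<close> is set
      to 1 and every other word that shares a letter with \<open>w\<close> is erased, so only the
      variables outside \<open>w\<close> remain.\<close>
    define h where "h w m = g (\<lambda>u. if u = w then 1 else if set u \<inter> set w = {} then m u else 0)" for w m
    \<comment> \<open>Once \<open>w\<close> is the only word containing \<open>i\<close> with a
      nonzero moment, words meeting \<open>w\<close> in another letter \<open>j\<close> are
      harmless. Additivity in \<open>j\<close> separates a remainder \<open>m2\<close> without any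
      moment involving \<open>i\<close>, and that remainder contributes 0.\<close>
    have drop: "g (\<lambda>u. if u = w then 1 else if i \<in> set u then 0 else m u) = h w m" if w: "w \<in> W" for w m
    proof -
      have step: "g (\<lambda>u. if u = w then 1 else if i \<in> set u then 0 else m u) =
          g (\<lambda>u. if u = w then 1 else if set u \<inter> insert i J = {} then m u else 0)" if "J \<subseteq> set w" for J
        using finite_subset[OF that finite_set] that
      proof (induction J)
        case empty
        show ?case by (rule arg_cong[of _ _ g]) auto
      next
        case (insert j J)
        define m2 where "m2 u = (if set u \<inter> insert i J = {} then m u else 0)" for u
        show ?case
        proof (cases "j = i")
          case True
          then have eq: "insert i (insert j J) = insert i J" by auto
          show ?thesis unfolding eq by (rule insert.IH) (use insert.prems in blast)
        next
          case False
          have "g (\<lambda>u. if u = w then 1 else if set u \<inter> insert i J = {} then m u else 0) =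
             g (\<lambda>u. if u = w then 1 else if set u \<inter> insert i (insert j J) = {} then m u else 0) + g m2"
            by (rule additive_atD[of j])
               (use insert w less.prems(3) in \<open>auto simp: m2_def W_def count_list_0_iff\<close>)
          moreover have "g m2 = 0"
            by (rule homogeneous_at_zero[of i]) (use less.prems(4) i in \<open>auto simp: m2_def\<close>)
          ultimately show ?thesis using insert by simp
        qed
      qed
      have iw: "insert i (set w) = set w" using w by (auto simp: W_def)
      show ?thesis unfolding h_def by (rule step[of "set w", unfolded iw, OF order_refl])
    qed
    have exp: "g (\<lambda>u. if i \<in> set u \<and> u \<notin> S then 0 else m u) = (\<Sum>w\<in>S. m w * h w m)" if "S \<subseteq> W" for S m
      using finite_subset[OF that finW] that
    proof (induction S)
      case empty
      show ?case by (simp, rule homogeneous_at_zero[of i]) (use less.prems(4) i in auto)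
    next
      case (insert v S)
      have cv: "count_list v i = 1" using insert by (intro count_list_distinct) (auto simp: W_def)
      have "g (\<lambda>u. if i \<in> set u \<and> u \<notin> insert v S then 0 else m u) =
        g (\<lambda>u. if i \<in> set u \<and> u \<notin> S then 0 else m u) + g (\<lambda>u. if u = v then m v else if i \<in> set u then 0 else m u)"
        by (rule additive_atD[of i]) (use insert i less.prems(3) in \<open>auto simp: count_list_0_iff W_def\<close>)
      also have "g (\<lambda>u. if u = v then m v else if i \<in> set u then 0 else m u) =
        g (\<lambda>u. m v ^ count_list u i * (if u = v then 1 else if i \<in> set u then 0 else m u))"
        by (rule arg_cong[of _ _ g]) (auto simp: fun_eq_iff cv)
      also have "\<dots> = m v * h v m"
        using less.prems(4)[OF i] insert drop[of v m] by (auto simp: homogeneous_at_def)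
      finally show ?case using insert by (simp add: add.commute)
    qed
    have "g m = (\<Sum>w\<in>W. m w * h w m)" for m
    proof -
      have "g m = g (\<lambda>u. if i \<in> set u \<and> u \<notin> W then 0 else m u)"
        by (rule eq_if_eq_on_distinct[OF less.prems]) (auto simp: W_def)
      then show ?thesis using exp[of W m] by simp
    qed
    moreover have "moment_poly I (h w)" if w: "w \<in> W" for w
    proof -
      have sub: "set w \<subseteq> I" "i \<in> set w" using w by (auto simp: W_def)
      have "moment_poly (I - set w) (h w)"
      proof (rule less.hyps)
        show "card (I - set w) < card I"
          using less.prems(1) sub by (intro psubset_card_mono) auto
        show "finite (I - set w)" using less.prems(1) by simp
        show "depends_on (I - set w) (h w)"
          unfolding depends_on_def h_def
          by (intro allI impI, rule depends_onD[OF less.prems(2)]) auto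
        fix j assume j: "j \<in> I - set w"
        show "additive_at j (h w)"
          unfolding additive_at_def h_def
        proof (intro allI impI, elim conjE)
          fix m m1 m2 :: "'l list \<Rightarrow> complex"
          assume 1: "\<forall>w. j \<notin> set w \<longrightarrow> m w = m1 w \<and> m w = m2 w" "\<forall>w. count_list w j = 1 \<longrightarrow> m w = m1 w + m2 w"
          show "g (\<lambda>u. if u = w then 1 else if set u \<inter> set w = {} then m u else 0) =
             g (\<lambda>u. if u = w then 1 else if set u \<inter> set w = {} then m1 u else 0) +
             g (\<lambda>u. if u = w then 1 else if set u \<inter> set w = {} then m2 u else 0)"
            by (rule additive_atD[of j]) (use 1 j less.prems(3) in auto)
        qed
        show "homogeneous_at j (h w)"
          unfolding homogeneous_at_def
        proof (intro allI)
          fix m and c :: complex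
          have "h w (\<lambda>w. c ^ count_list w j * m w) =
            g (\<lambda>u. c ^ count_list u j * (if u = w then 1 else if set u \<inter> set w = {} then m u else 0))"
            unfolding h_def using j by (intro arg_cong[of _ _ g]) (auto simp: fun_eq_iff)
          then show "h w (\<lambda>w. c ^ count_list w j * m w) = c * h w m"
            using less.prems(4)[of j] j by (simp add: homogeneous_at_def h_def)
        qed
      qed
      then show ?thesis by (rule moment_poly_mono) auto
    qed
    then have "moment_poly I (\<lambda>m. \<Sum>w\<in>W. m w * h w m)"
      by (intro moment_poly_sum finW moment_poly.mult moment_poly.moment) (auto simp: W_def)
    ultimately show ?thesis by presburger
  qed
qed

lemma is_alg_add_closed: "is_alg A \<Longrightarrow> a \<in> sa_carrier A \<Longrightarrow> b \<in> sa_carrier A \<Longrightarrow> sa_add A a b \<in> sa_carrier A"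
  and is_alg_smul_closed: "is_alg A \<Longrightarrow> a \<in> sa_carrier A \<Longrightarrow> sa_smul A c a \<in> sa_carrier A"
  and is_alg_zero_closed: "is_alg A \<Longrightarrow> sa_zero A \<in> sa_carrier A"
  by (auto simp: is_alg_def)

lemma lin_fun_add: "lin_fun A \<phi> \<Longrightarrow> a \<in> sa_carrier A \<Longrightarrow> b \<in> sa_carrier A \<Longrightarrow> \<phi> (sa_add A a b) = \<phi> a + \<phi> b"
  and lin_fun_smul: "lin_fun A \<phi> \<Longrightarrow> a \<in> sa_carrier A \<Longrightarrow> \<phi> (sa_smul A c a) = c * \<phi> a"
  by (auto simp: lin_fun_def)

lemma lin_fun_zero:
  assumes "is_alg A" "lin_fun A \<phi>" shows "\<phi> (sa_zero A) = 0"
proof -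
  interpret A: calg A by (standard, fact)
  show ?thesis using lin_fun_smul[OF assms(2), of "sa_zero A" 0] by simp
qed

lemma lin_fun_comp: "xhom A C f \<Longrightarrow> lin_fun C \<phi> \<Longrightarrow> lin_fun A (\<lambda>a. \<phi> (f a))"
  by (auto simp: lin_fun_def xhom_def)

section \<open>Natural products of functionals\<close>

text \<open>Linearity and naturality are all that polynomiality uses. Naturality is stated for any
  homomorphism \<open>T\<close> with the prescribed values, instead of the chosen
  \<open>fp_map\<close>, and it absorbs the congruence property.\<close>

definition natural_product :: "'v uprod \<Rightarrow> bool" where
  "natural_product odot \<longleftrightarrow>
    (\<forall>A1 A2 P \<phi>1 \<phi>2. is_free_product A1 A2 P \<and> lin_fun A1 \<phi>1 \<and> lin_fun A2 \<phi>2 \<longrightarrow>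
        lin_fun (fst P) (odot A1 A2 P \<phi>1 \<phi>2)) \<and>
    (\<forall>A1 A2 A1' A2' P P' j1 j2 T \<phi>1 \<phi>2 \<chi>1 \<chi>2.
       is_free_product A1 A2 P \<and> is_free_product A1' A2' P' \<and> xhom A1 A1' j1 \<and> xhom A2 A2' j2 \<and>
       xhom (fst P) (fst P') T \<and>
       (\<forall>a\<in>sa_carrier A1. T (fst (snd P) a) = fst (snd P') (j1 a)) \<and>
       (\<forall>a\<in>sa_carrier A2. T (snd (snd P) a) = snd (snd P') (j2 a)) \<and>
       lin_fun A1' \<phi>1 \<and> lin_fun A2' \<phi>2 \<and>
       (\<forall>a\<in>sa_carrier A1. \<chi>1 a = \<phi>1 (j1 a)) \<and> (\<forall>a\<in>sa_carrier A2. \<chi>2 a = \<phi>2 (j2 a)) \<longrightarrow>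
       (\<forall>x\<in>sa_carrier (fst P). odot A1 A2 P \<chi>1 \<chi>2 x = odot A1' A2' P' \<phi>1 \<phi>2 (T x)))"

lemma natural_product_lin: "natural_product odot \<Longrightarrow> is_free_product A1 A2 P \<Longrightarrow> lin_fun A1 \<phi>1 \<Longrightarrow> lin_fun A2 \<phi>2 \<Longrightarrow>
    lin_fun (fst P) (odot A1 A2 P \<phi>1 \<phi>2)"
  unfolding natural_product_def by (elim conjE) blast

lemma natural_product_nat:
  assumes "natural_product odot" "is_free_product A1 A2 P" "is_free_product A1' A2' P'"
    "xhom A1 A1' j1" "xhom A2 A2' j2" "xhom (fst P) (fst P') T"
    "\<And>a. a \<in> sa_carrier A1 \<Longrightarrow> T (fst (snd P) a) = fst (snd P') (j1 a)"
    "\<And>a. a \<in> sa_carrier A2 \<Longrightarrow> T (snd (snd P) a) = snd (snd P') (j2 a)"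
    "lin_fun A1' \<phi>1" "lin_fun A2' \<phi>2"
    "\<And>a. a \<in> sa_carrier A1 \<Longrightarrow> \<chi>1 a = \<phi>1 (j1 a)" "\<And>a. a \<in> sa_carrier A2 \<Longrightarrow> \<chi>2 a = \<phi>2 (j2 a)"
    "x \<in> sa_carrier (fst P)"
  shows "odot A1 A2 P \<chi>1 \<chi>2 x = odot A1' A2' P' \<phi>1 \<phi>2 (T x)"
  by (rule assms(1)[unfolded natural_product_def, THEN conjunct2, THEN spec, THEN spec, THEN spec, THEN spec,
      THEN spec, THEN spec, THEN spec, THEN spec, THEN spec, THEN spec, THEN spec, THEN spec, THEN spec, THEN mp, THEN bspec])
    (use assms in auto)

lemma natural_product_cong:
  assumes "natural_product odot" "is_free_product A1 A2 P" "lin_fun A1 \<phi>1" "lin_fun A2 \<phi>2"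
    "\<And>a. a \<in> sa_carrier A1 \<Longrightarrow> \<chi>1 a = \<phi>1 a" "\<And>a. a \<in> sa_carrier A2 \<Longrightarrow> \<chi>2 a = \<phi>2 a"
    "x \<in> sa_carrier (fst P)"
  shows "odot A1 A2 P \<chi>1 \<chi>2 x = odot A1 A2 P \<phi>1 \<phi>2 x"
  using natural_product_nat[OF assms(1,2,2) xhom_id xhom_id xhom_id, of \<phi>1 \<phi>2 \<chi>1 \<chi>2 x] assms by simp

lemma fp_hom_eq_fp_map:
  assumes "is_free_product A1 A2 P" "is_free_product A1' A2' P'" "xhom A1 A1' j1" "xhom A2 A2' j2"
    "xhom (fst P) (fst P') T"
    "\<And>a. a \<in> sa_carrier A1 \<Longrightarrow> T (fst (snd P) a) = fst (snd P') (j1 a)"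
    "\<And>a. a \<in> sa_carrier A2 \<Longrightarrow> T (snd (snd P) a) = snd (snd P') (j2 a)"
    "x \<in> sa_carrier (fst P)"
  shows "T x = fp_map A1 A2 P P' j1 j2 x"
  by (rule fp_unique[OF assms(1) is_free_product_algs(3)[OF assms(2)] assms(5) xhom_fp_map[OF assms(1-4)]])
     (use assms fp_map_1[OF assms(1-4)] fp_map_2[OF assms(1-4)] in auto)

lemma natural_product_if_independence:
  fixes odot :: "'v uprod"
  assumes "is_independence odot"
  shows "natural_product odot"
proof -
  note ind = assms[unfolded is_independence_def]
  note lin = ind[THEN conjunct1]
  note cong = ind[THEN conjunct2, THEN conjunct1]
  note nat = ind[THEN conjunct2, THEN conjunct2, THEN conjunct2, THEN conjunct2]
  show ?thesis unfolding natural_product_def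
  proof (intro conjI lin allI impI ballI, elim conjE)
    fix A1 A2 A1' A2' :: "'v salg" and P P' j1 j2 T \<phi>1 \<phi>2 \<chi>1 \<chi>2 x
    assume a: "is_free_product A1 A2 P" "is_free_product A1' A2' P'" "xhom A1 A1' j1" "xhom A2 A2' j2"
      "xhom (fst P) (fst P') T" "\<forall>a\<in>sa_carrier A1. T (fst (snd P) a) = fst (snd P') (j1 a)"
      "\<forall>a\<in>sa_carrier A2. T (snd (snd P) a) = snd (snd P') (j2 a)"
      "lin_fun A1' \<phi>1" "lin_fun A2' \<phi>2" and x: "x \<in> sa_carrier (fst P)"
      and c: "\<forall>a\<in>sa_carrier A1. \<chi>1 a = \<phi>1 (j1 a)" "\<forall>a\<in>sa_carrier A2. \<chi>2 a = \<phi>2 (j2 a)"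
    have "odot A1 A2 P \<chi>1 \<chi>2 x = odot A1 A2 P (\<phi>1 \<circ> j1) (\<phi>2 \<circ> j2) x"
      by (rule cong[THEN spec, THEN spec, THEN spec, THEN spec, THEN spec, THEN spec, THEN spec, THEN mp, THEN bspec])
        (use a x c in auto)
    also have "\<dots> = odot A1' A2' P' \<phi>1 \<phi>2 (fp_map A1 A2 P P' j1 j2 x)"
      by (rule nat[THEN spec, THEN spec, THEN spec, THEN spec, THEN spec, THEN spec, THEN spec, THEN spec, THEN spec, THEN spec, THEN mp, THEN bspec])
        (use a x in \<open>auto simp: alg_hom_iff_xhom\<close>)
    also have "fp_map A1 A2 P P' j1 j2 x = T x"
      by (rule fp_hom_eq_fp_map[symmetric]) (use a x in auto)
    finally show "odot A1 A2 P \<chi>1 \<chi>2 x = odot A1' A2' P' \<phi>1 \<phi>2 (T x)" .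
  qed
qed

definition fp_swap :: "'v fprod \<Rightarrow> 'v fprod" where
  "fp_swap P = (fst P, snd (snd P), fst (snd P))"

lemma fp_swap_simps [simp]: "fst (fp_swap P) = fst P" "fst (snd (fp_swap P)) = snd (snd P)"
    "snd (snd (fp_swap P)) = fst (snd P)" "fp_swap (fp_swap P) = P"
  by (simp_all add: fp_swap_def)

lemma is_free_product_swap: "is_free_product A1 A2 P \<Longrightarrow> is_free_product A2 A1 (fp_swap P)"
proof -
  assume P: "is_free_product A1 A2 P"
  note a = is_free_product_algs[OF P]
  show ?thesis unfolding is_free_product_def fp_swap_def prod.case alg_hom_iff_xhom
  proof (intro conjI allI impI a, goal_cases)
    case (1 C f1 f2)
    then obtain f where "xhom (fst P) C f" "\<And>a. a \<in> sa_carrier A1 \<Longrightarrow> f (fst (snd P) a) = f2 a"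
      "\<And>a. a \<in> sa_carrier A2 \<Longrightarrow> f (snd (snd P) a) = f1 a"
      using fp_extend[OF P, of C f2 f1] by blast
    then show ?case by blast
  next
    case (2 C f1 f2 f g)
    show ?case by (rule ballI, rule fp_unique[OF P, of C]) (use 2 in auto)
  qed
qed

text \<open>Exchanging the factors lets statements proved for variables in the left factor be reused
  for the right one.\<close>

definition swap_prod :: "'v uprod \<Rightarrow> 'v uprod" where
  "swap_prod odot A1 A2 P \<phi>1 \<phi>2 = odot A2 A1 (fp_swap P) \<phi>2 \<phi>1"

lemma natural_product_swap:
  fixes odot :: "'v uprod"
  assumes "natural_product odot" shows "natural_product (swap_prod odot)"
  unfolding natural_product_def
proof (intro conjI allI impI ballI; elim conjE)
  fix A1 A2 P \<phi>1 \<phi>2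
  assume "is_free_product A1 A2 P" "lin_fun A1 \<phi>1" "lin_fun A2 (\<phi>2 :: 'v \<Rightarrow> complex)"
  then show "lin_fun (fst P) (swap_prod odot A1 A2 P \<phi>1 \<phi>2)"
    using natural_product_lin[OF assms is_free_product_swap, of A1 A2 P \<phi>2 \<phi>1] by (simp add: swap_prod_def)
next
  fix A1 A2 A1' A2' :: "'v salg" and P P' j1 j2 T \<phi>1 \<phi>2 \<chi>1 \<chi>2 x
  assume a: "is_free_product A1 A2 P" "is_free_product A1' A2' P'" "xhom A1 A1' j1" "xhom A2 A2' j2"
      "xhom (fst P) (fst P') T" "\<forall>a\<in>sa_carrier A1. T (fst (snd P) a) = fst (snd P') (j1 a)"
      "\<forall>a\<in>sa_carrier A2. T (snd (snd P) a) = snd (snd P') (j2 a)"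
      "lin_fun A1' \<phi>1" "lin_fun A2' \<phi>2" and x: "x \<in> sa_carrier (fst P)"
      and c: "\<forall>a\<in>sa_carrier A1. \<chi>1 a = \<phi>1 (j1 a)" "\<forall>a\<in>sa_carrier A2. \<chi>2 a = \<phi>2 (j2 a)"
  show "swap_prod odot A1 A2 P \<chi>1 \<chi>2 x = swap_prod odot A1' A2' P' \<phi>1 \<phi>2 (T x)"
    unfolding swap_prod_def
    by (rule natural_product_nat[OF assms is_free_product_swap[OF a(1)] is_free_product_swap[OF a(2)] a(4,3)])
       (use a x c in auto)
qed

section \<open>Substitutions and moment functionals\<close>

definition sub :: "('l \<Rightarrow> 'k fa) \<Rightarrow> 'l fa \<Rightarrow> 'k fa" where
  "sub s = lin (\<lambda>w. prod_list (map s (letters w)))"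

lemma sub_zero [simp]: "sub s 0 = 0"
  and sub_add: "sub s (p + q) = sub s p + sub s q"
  and sub_cst: "sub s (cst c * p) = cst c * sub s p"
  and sub_mon: "sub s (mon w) = prod_list (map s w)"
  and sub_single: "sub s (Poly_Mapping.single u c) = cst c * prod_list (map s (letters u))"
  by (simp_all add: sub_def lin_add lin_cst lin_single)

lemma sub_one [simp]: "sub s 1 = 1"
  using sub_mon[of s "[]"] by simp

lemma sub_cst_one [simp]: "sub s (cst c) = cst c"
  using sub_cst[of s c 1] by simp

lemma sub_mult:
  fixes s :: "'l \<Rightarrow> 'k fa"
  shows "sub s (p * q) = sub s p * sub s q"
proof (induction p rule: pm_induct)
  case (single u c)
  show ?case
  proof (induction q rule: pm_induct)
    case (single v d)
    have "cst (c * d) * (x * y) = (cst c * x) * (cst d * y)" for x y :: "'k fa"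
      by (simp only: cst_mult mult.assoc cst_left_commute[of x d y])
    then show ?case by (simp add: mult_single sub_single)
  qed (simp_all add: sub_add distrib_left)
qed (simp_all add: sub_add distrib_right)

lemma FA_prod_list: "w \<noteq> [] \<Longrightarrow> (\<And>l. l \<in> set w \<Longrightarrow> s l \<in> sa_carrier (FA Y)) \<Longrightarrow> prod_list (map s w) \<in> sa_carrier (FA Y)"
proof (induction w)
  case (Cons a w)
  then show ?case by (cases "w = []") (auto intro: FA_mult)
qed simp

lemma xhom_sub:
  assumes s: "\<And>l. l \<in> Y \<Longrightarrow> s l \<in> sa_carrier (FA Z)"
  shows "xhom (FA Y) (FA Z) (sub s)"
proof (rule xhomI)
  show "sub s a \<in> sa_carrier (FA Z)" if "a \<in> sa_carrier (FA Y)" for a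
    using that
  proof (induction a rule: FA_induct)
    case (single w c)
    then show ?case unfolding sub_single using s by (intro FA_cst FA_prod_list) auto
  qed (auto simp: sub_add FA_add FA_zero)
qed (auto simp: sub_add sub_mult sub_cst)

definition mom :: "('l list \<Rightarrow> complex) \<Rightarrow> 'l fa \<Rightarrow> complex" where
  "mom m = pmsum (\<lambda>w c. c * m (letters w))"

lemma mom_zero [simp]: "mom m 0 = 0"
  and mom_single: "mom m (Poly_Mapping.single w c) = c * m (letters w)"
  and mom_add: "mom m (p + q) = mom m p + mom m q"
  unfolding mom_def by (auto simp: pmsum_single pmsum_add algebra_simps)

lemma mom_mon [simp]: "mom m (mon w) = m w"
  by (simp add: mon_def mom_single)

lemma mom_cst: "mom m (cst c * p) = c * mom m p"
  by (induction p rule: pm_induct) (auto simp: cst_mult_single mom_single mom_add algebra_simps)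

lemma mom_sum_mon: "finite S \<Longrightarrow> mom m (\<Sum>w\<in>S. mon w) = (\<Sum>w\<in>S. m w)"
  by (induction S rule: finite_induct) (auto simp: mom_add)

lemma mom_sub: "mom m (sub s p) = mom (\<lambda>w. mom m (prod_list (map s w))) p"
  by (induction p rule: pm_induct) (auto simp: sub_single mom_single sub_add mom_add mom_cst)

lemma mom_cong: "p \<in> sa_carrier (FA Y) \<Longrightarrow> (\<And>w. w \<noteq> [] \<Longrightarrow> set w \<subseteq> Y \<Longrightarrow> m w = m' w) \<Longrightarrow> mom m p = mom m' p"
  by (induction p rule: FA_induct) (auto simp: mom_single mom_add)

section \<open>Products as linear functions of one entry\<close>

context calg begin

lemma lprod_fun_upd_add:
  assumes "distinct xs" "i \<in> set xs" "\<And>p. f p \<in> sa_carrier A" "a \<in> sa_carrier A" "b \<in> sa_carrier A"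
  shows "lprod (map (f(i := sa_add A a b)) xs) = sa_add A (lprod (map (f(i := a)) xs)) (lprod (map (f(i := b)) xs))"
  using assms(1,2)
proof (induction xs)
  case (Cons x xs)
  have cl: "lprod (map (f(i := c)) xs) \<in> sa_carrier A" if "c \<in> sa_carrier A" for c
    by (rule lprod_closed) (use assms that in auto)
  show ?case
  proof (cases "x = i")
    case True
    have eq: "map (f(i := c)) xs = map f xs" for c using Cons.prems True by auto
    have fx: "lprod (map f xs) \<in> sa_carrier A" by (rule lprod_closed) (use assms in auto)
    show ?thesis unfolding list.map eq using True assms(4,5) fx
      by (cases "xs = []") (auto simp: lprod_Cons distrib_right)
  next
    case False
    then have "xs \<noteq> []" "i \<in> set xs" using Cons.prems by auto
    then show ?thesis using Cons False assms(3-5) cl[unfolded fun_upd_def] by (simp add: lprod_Cons distrib_left)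
  qed
qed simp

lemma lprod_fun_upd_smul:
  assumes "distinct xs" "i \<in> set xs" "\<And>p. f p \<in> sa_carrier A" "a \<in> sa_carrier A"
  shows "lprod (map (f(i := sa_smul A c a)) xs) = sa_smul A c (lprod (map (f(i := a)) xs))"
  using assms(1,2)
proof (induction xs)
  case (Cons x xs)
  have cl: "lprod (map (f(i := c)) xs) \<in> sa_carrier A" if "c \<in> sa_carrier A" for c
    by (rule lprod_closed) (use assms that in auto)
  show ?case
  proof (cases "x = i")
    case True
    have eq: "map (f(i := c)) xs = map f xs" for c using Cons.prems True by auto
    have fx: "lprod (map f xs) \<in> sa_carrier A" by (rule lprod_closed) (use assms in auto)
    show ?thesis unfolding list.map eq using True assms(4) fx
      by (cases "xs = []") (auto simp: lprod_Cons smul_mul_left)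
  next
    case False
    then have "xs \<noteq> []" "i \<in> set xs" using Cons.prems by auto
    then show ?thesis using Cons False assms(3-4) cl[unfolded fun_upd_def] by (simp add: lprod_Cons smul_mul_right)
  qed
qed simp

end

lemma xhom_lprod:
  assumes "is_alg A" "is_alg C" "xhom A C T" "set l \<subseteq> sa_carrier A"
  shows "T (calg.lprod A l) = calg.lprod C (map T l)"
proof -
  interpret A: calg A by (standard, fact)
  interpret C: calg C by (standard, fact)
  show ?thesis using assms(4)
  proof (induction l)
    case Nil then show ?case by (simp add: xhom_zero[OF assms(1-3)])
  next
    case (Cons a l)
    then show ?case
      by (cases "l = []") (simp_all add: A.lprod_Cons C.lprod_Cons A.lprod_closed xhom_mul[OF assms(3)])
  qed
qed

section \<open>Splitting a variable into two\<close>

text \<open>Multiplying out: each occurrence of \<open>i\<close> becomes \<open>i\<close> or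
  \<open>z\<close> independently, so the terms are the words that turn back into \<open>u\<close>
  when \<open>z\<close> is read as \<open>i\<close>.\<close>

lemma labellings:
  assumes "i \<noteq> z" "z \<notin> set u"
  shows "finite {w. map (\<lambda>l. if l = z then i else l) w = u} \<and>
    prod_list (map (\<lambda>l. if l = i then mon [i] + mon [z] else mon [l]) u) =
      (\<Sum>w\<in>{w. map (\<lambda>l. if l = z then i else l) w = u}. mon w)"
  using assms(2)
proof (induction u)
  case (Cons a u)
  let ?r = "\<lambda>l. if l = z then i else l" and ?S = "{w. map (\<lambda>l. if l = z then i else l) w = u}"
  have fin: "finite ?S" and IH: "prod_list (map (\<lambda>l. if l = i then mon [i] + mon [z] else mon [l]) u) = sum mon ?S"
    using Cons by auto
  have cons: "sum mon (Cons b ` ?S) = mon [b] * sum mon ?S" for b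
  proof -
    have "sum mon (Cons b ` ?S) = (\<Sum>w\<in>?S. mon (b # w))" by (subst sum.reindex) auto
    also have "\<dots> = (\<Sum>w\<in>?S. mon [b] * mon w)" by (rule sum.cong[OF refl mon_Cons])
    finally show ?thesis by (simp add: sum_distrib_left)
  qed
  show ?case
  proof (cases "a = i")
    case True
    have eq: "{w. map ?r w = a # u} = Cons i ` ?S \<union> Cons z ` ?S"
      using Cons.prems True by (auto simp: map_eq_Cons_conv image_iff split: if_splits)
    have "sum mon (Cons i ` ?S \<union> Cons z ` ?S) = sum mon (Cons i ` ?S) + sum mon (Cons z ` ?S)"
      using fin assms(1) by (intro sum.union_disjoint) auto
    then show ?thesis unfolding eq using fin IH True by (simp add: cons distrib_right)
  next
    case False
    have eq: "{w. map ?r w = a # u} = Cons a ` ?S"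
      using Cons.prems False by (auto simp: map_eq_Cons_conv image_iff split: if_splits)
    show ?thesis unfolding eq using fin IH False by (simp add: cons)
  qed
qed simp

text \<open>Prescribing the moments of \<open>y + z\<close>, of \<open>y\<close> and of \<open>z\<close> simultaneously: the mixed words in which
  \<open>z\<close> occurs exactly once, before all occurrences of \<open>y\<close>, carry the necessary correction.\<close>

lemma joint_moments:
  fixes m m1 m2 :: "'l list \<Rightarrow> complex"
  assumes iz: "i \<noteq> z"
    and 0: "\<And>w. i \<notin> set w \<Longrightarrow> m w = m1 w \<and> m w = m2 w"
    and 1: "\<And>w. count_list w i = 1 \<Longrightarrow> m w = m1 w + m2 w"
  obtains \<Phi> where
    "\<And>u. z \<notin> set u \<Longrightarrow> mom \<Phi> (prod_list (map (\<lambda>l. if l = i then mon [i] + mon [z] else mon [l]) u)) = m u"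
    "\<And>u. z \<notin> set u \<Longrightarrow> \<Phi> u = m1 u"
    "\<And>u. z \<notin> set u \<Longrightarrow> \<Phi> (map (\<lambda>l. if l = i then z else l) u) = m2 u"
proof -
  define r where "r l = (if l = z then i else l)" for l
  define mixed where "mixed w \<longleftrightarrow> (\<exists>v t. w = v @ z # t \<and> i \<notin> set v \<and> z \<notin> set v \<and> z \<notin> set t \<and> i \<in> set t)" for w
  define \<Phi> where "\<Phi> w = (if z \<notin> set w then m1 (map r w) else 0) +
     ((if i \<notin> set w \<and> z \<in> set w then m2 (map r w) else 0) +
      (if mixed w then m (map r w) - m1 (map r w) - m2 (map r w) else 0))" for w
  have rz: "r z = i" by (simp add: r_def)
  have rid: "map r w = w" if "z \<notin> set w" for w
    using that by (intro map_idI) (auto simp: r_def)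
  show thesis
  proof
    fix u assume z: "z \<notin> set u"
    have nm: "\<not> mixed u" using z by (auto simp: mixed_def)
    show "\<Phi> u = m1 u" using z nm rid by (simp add: \<Phi>_def)
    define w' where "w' = map (\<lambda>l. if l = i then z else l) u"
    have rw': "map r w' = u" unfolding w'_def map_map using z by (intro map_idI) (auto simp: r_def)
    have iw': "i \<notin> set w'" using iz by (auto simp: w'_def)
    have "\<not> mixed w'" using iw' by (auto simp: mixed_def)
    have zw': "z \<notin> set w' \<Longrightarrow> i \<notin> set u" by (auto simp: w'_def)
    have "\<Phi> w' = (if z \<notin> set w' then m1 u else m2 u)"
      using rw' iw' \<open>\<not> mixed w'\<close> by (simp add: \<Phi>_def)
    then have "\<Phi> w' = m2 u" using 0[of u] zw' by (metis (full_types))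
    then show "\<Phi> (map (\<lambda>l. if l = i then z else l) u) = m2 u" by (simp only: w'_def)
    let ?S = "{w. map (\<lambda>l. if l = z then i else l) w = u}"
    have S: "?S = {w. map r w = u}" by (simp add: r_def[abs_def])
    have fin: "finite ?S" and pl: "prod_list (map (\<lambda>l. if l = i then mon [i] + mon [z] else mon [l]) u) = sum mon ?S"
      using labellings[OF iz z] by auto
    have cnt: "(\<Sum>w\<in>?S. if Q w then f (map r w) else 0) = of_nat (card {w\<in>?S. Q w}) * f u" for Q and f :: "'l list \<Rightarrow> complex"
    proof -
      have "(\<Sum>w\<in>?S. if Q w then f (map r w) else 0) = (\<Sum>w\<in>{w\<in>?S. Q w}. f (map r w))"
        by (rule sum.inter_filter[OF fin, symmetric])
      also have "\<dots> = (\<Sum>w\<in>{w\<in>?S. Q w}. f u)" by (rule sum.cong) (auto simp: S)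
      finally show ?thesis by simp
    qed
    have "mom \<Phi> (sum mon ?S) = (\<Sum>w\<in>?S. \<Phi> w)" using fin by (rule mom_sum_mon)
    also have "\<dots> = of_nat (card {w\<in>?S. z \<notin> set w}) * m1 u + (of_nat (card {w\<in>?S. i \<notin> set w \<and> z \<in> set w}) * m2 u +
        of_nat (card {w\<in>?S. mixed w}) * (m u - m1 u - m2 u))"
      unfolding \<Phi>_def sum.distrib
      by (simp only: cnt[of "\<lambda>w. z \<notin> set w" m1] cnt[of "\<lambda>w. i \<notin> set w \<and> z \<in> set w" m2]
          cnt[of mixed "\<lambda>u. m u - m1 u - m2 u"])
    \<comment> \<open>The three counts depend on the number of occurrences of \<open>i\<close> in
      \<open>u\<close>. With none, only the first term survives. With one, the first two counts are
      1 and the assumed additivity closes the gap. With several, there is exactly one mixed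
      relabelling and its correction cancels the rest.\<close>
    also have "\<dots> = m u"
    proof -
      have A: "{w\<in>?S. z \<notin> set w} = {u}" using z rid by (auto simp: S)
      have iff: "i \<in> set u \<longleftrightarrow> i \<in> set w \<or> z \<in> set w" if "map r w = u" for w
        using that by (auto simp: r_def)
      show ?thesis
      proof (cases "i \<in> set u")
        case False
        then have B: "{w\<in>?S. i \<notin> set w \<and> z \<in> set w} = {}" "{w\<in>?S. mixed w} = {}"
          using iff rz by (auto simp: S mixed_def)
        show ?thesis unfolding A B using 0[OF False] by simp
      next
        case True
        have bk: "map (\<lambda>l. if l = i then z else l) (map r w) = w" if "i \<notin> set w" for w
          unfolding map_map using that by (intro map_idI) (auto simp: r_def)
        have B: "{w\<in>?S. i \<notin> set w \<and> z \<in> set w} = {w'}"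
        proof -
          have "w = w'" if "map r w = u" "i \<notin> set w" for w
            using bk[OF that(2)] that(1) by (simp only: w'_def)
          then show ?thesis unfolding S using rw' iw' zw' True by blast
        qed
        \<comment> \<open>A mixed relabelling has its only \<open>z\<close> before every
          \<open>i\<close>, so it must mark the first occurrence of \<open>i\<close> in
          \<open>u\<close>; this makes it unique.\<close>
        obtain v t where vt: "u = v @ i # t" "i \<notin> set v" using split_list_first[OF True] by blast
        have zvt: "z \<notin> set v" "z \<notin> set t" using z vt by auto
        have uniq: "w = v @ z # t" if w: "map r w = u" "mixed w" for w
        proof -
          obtain v' t' where v': "w = v' @ z # t'" "i \<notin> set v'" "z \<notin> set v'" "z \<notin> set t'" using w by (auto simp: mixed_def)
          then have "v' @ i # t' = v @ i # t" using w vt rid rz by simp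
          moreover have "takeWhile (\<lambda>x. x \<noteq> i) (v' @ i # t') = v'" "takeWhile (\<lambda>x. x \<noteq> i) (v @ i # t) = v"
            using v'(2) vt(2) by (auto simp: takeWhile_append)
          ultimately have "v' = v \<and> t' = t" by (metis same_append_eq list.inject)
          then show ?thesis using v' by simp
        qed
        have mr: "map r (v @ z # t) = u" using vt zvt rid rz by simp
        show ?thesis
        proof (cases "i \<in> set t")
          case True
          have C: "{w\<in>?S. mixed w} = {v @ z # t}"
          proof -
            have "mixed (v @ z # t)" using vt zvt True unfolding mixed_def by blast
            then show ?thesis unfolding S using uniq mr by blast
          qed
          show ?thesis unfolding A B C by simp
        next
          case False
          have C: "{w\<in>?S. mixed w} = {}"
          proof -
            have "\<not> mixed (v @ z # t)"
              using False vt(2) zvt iz unfolding mixed_def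
              by (metis Un_iff list.set_intros(2) set_append set_ConsD)
            then show ?thesis unfolding S using uniq by blast
          qed
          have "count_list u i = 1" using vt False by simp
          then show ?thesis unfolding A B C using 1[of u] by simp
        qed
      qed
    qed
    finally show "mom \<Phi> (prod_list (map (\<lambda>l. if l = i then mon [i] + mon [z] else mon [l]) u)) = m u"
      unfolding pl .
  qed
qed

section \<open>Moments of words in a free product of free algebras\<close>

lemma prod_list_mon_letters: "prod_list (map (\<lambda>l. mon [l]) w) = mon w"
proof (induction w)
  case (Cons a w)
  then show ?case using mon_append[of "[a]" w] by simp
qed simp

lemma prod_list_kill:
  "prod_list (map (\<lambda>l. if l \<in> L then mon [l] else 0) w) = (if set w \<subseteq> L then mon w else 0)"
proof (induction w)
  case (Cons a w)
  then show ?case using mon_append[of "[a]" w] by simp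
qed simp

lemma prod_list_scale:
  "prod_list (map (\<lambda>l. if l = i then cst c * mon [l] else mon [l]) w) = cst (c ^ count_list w i) * mon w"
proof (induction w)
  case (Cons a w)
  have "mon [b] * (cst d * mon w) = cst d * mon (b # w)" for b d
    by (simp only: cst_left_commute[of "mon [b]"] mon_append[of "[b]" w, symmetric] append_Cons append_Nil)
  then show ?case using Cons by (simp add: mult.assoc cst_mult)
qed simp

context coding begin

definition FAC :: "'v salg" where "FAC = transport enc (FA UNIV)"

definition dcd :: "'v \<Rightarrow> ('v \<times> nat) fa" where "dcd = inv_into (sa_carrier (FA UNIV)) enc"

lemma inj_on_enc: "inj_on enc S"
  using inj_enc by (rule inj_on_subset) simp

lemma is_alg_FAC: "is_alg FAC"
  unfolding FAC_def by (rule is_alg_transport[OF is_alg_FA inj_on_enc])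

lemma xhom_enc: "xhom (FA UNIV) FAC enc"
  unfolding FAC_def by (rule xhom_code[OF is_alg_FA inj_on_enc])

lemma xhom_dcd: "xhom FAC (FA UNIV) dcd"
  unfolding FAC_def dcd_def by (rule xhom_dec[OF is_alg_FA inj_on_enc])

lemma dcd_enc: "p \<in> sa_carrier (FA UNIV) \<Longrightarrow> dcd (enc p) = p"
  unfolding dcd_def by (rule inv_into_f_f[OF inj_on_enc])

lemma enc_mem: "p \<in> sa_carrier (FA UNIV) \<Longrightarrow> enc p \<in> sa_carrier FAC"
  by (rule xhom_closed[OF xhom_enc])

lemma dcd_mem: "x \<in> sa_carrier FAC \<Longrightarrow> dcd x \<in> sa_carrier (FA UNIV)"
  by (rule xhom_closed[OF xhom_dcd])

definition mfun :: "(('v \<times> nat) list \<Rightarrow> complex) \<Rightarrow> 'v \<Rightarrow> complex" where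
  "mfun m x = mom m (dcd x)"

lemma lin_mfun: "lin_fun FAC (mfun m)"
  unfolding mfun_def by (rule lin_fun_comp[OF xhom_dcd]) (auto simp: lin_fun_def mom_add mom_cst)

lemma mfun_cong:
  assumes "\<And>w. w \<noteq> [] \<Longrightarrow> m w = m' w" "x \<in> sa_carrier FAC"
  shows "mfun m x = mfun m' x"
  unfolding mfun_def by (rule mom_cong[OF dcd_mem[OF assms(2)]]) (use assms in auto)

text \<open>A letter that carries nothing but the position at which it occurs in a generic
  word.\<close>

abbreviation lt :: "nat \<Rightarrow> 'v \<times> nat" where "lt p \<equiv> (undefined, p)"
abbreviation gen :: "nat \<Rightarrow> 'v" where "gen p \<equiv> enc (mon [lt p])"

lemma FA_letter: "mon [l] \<in> sa_carrier (FA UNIV)"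
  by (rule FA_mon) auto

lemma gen_mem: "enc (mon [l]) \<in> sa_carrier FAC"
  by (rule enc_mem[OF FA_letter])

definition subst :: "('v \<times> nat \<Rightarrow> ('v \<times> nat) fa) \<Rightarrow> 'v \<Rightarrow> 'v" where
  "subst s x = enc (sub s (dcd x))"

lemma subst:
  assumes s: "\<And>l. s l \<in> sa_carrier (FA UNIV)"
  shows xhom_subst: "xhom FAC FAC (subst s)"
    and mfun_subst: "\<And>x. x \<in> sa_carrier FAC \<Longrightarrow> mfun m (subst s x) = mfun (\<lambda>w. mom m (prod_list (map s w))) x"
    and subst_gen: "subst s (enc (mon [l])) = enc (s l)"
proof -
  have sh: "xhom (FA UNIV) (FA UNIV) (sub s)" by (rule xhom_sub) (rule s)
  show "xhom FAC FAC (subst s)"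
    using xhom_comp[OF xhom_comp[OF xhom_dcd sh] xhom_enc] by (simp add: subst_def[abs_def] comp_def)
  show "mfun m (subst s x) = mfun (\<lambda>w. mom m (prod_list (map s w))) x" if "x \<in> sa_carrier FAC" for x
    using xhom_closed[OF sh dcd_mem[OF that]] by (simp add: subst_def mfun_def dcd_enc mom_sub)
  show "subst s (enc (mon [l])) = enc (s l)"
    by (simp add: subst_def dcd_enc FA_letter sub_mon)
qed

end

text \<open>The generic word of length \<open>n\<close>: position \<open>p\<close> holds its own
  letter, embedded into the factor named by \<open>side\<close>. The product functional at this one
  word, as a function of the moments, is the universal formula from which all other words are
  obtained by naturality.\<close>

locale word_moments = coding enc for enc :: "('v \<times> nat) fa \<Rightarrow> 'v" +
  fixes odot :: "'v uprod" and Q :: "'v fprod" and n :: nat and side :: "nat \<Rightarrow> bool"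
  assumes np: "natural_product odot" and Q: "is_free_product FAC FAC Q"
begin

abbreviation emb :: "nat \<Rightarrow> 'v \<Rightarrow> 'v" where
  "emb p \<equiv> (if side p then fst (snd Q) else snd (snd Q))"

lemma emb_mem: "a \<in> sa_carrier FAC \<Longrightarrow> emb p a \<in> sa_carrier (fst Q)"
  using is_free_product_algs[OF Q] by (auto simp: xhom_closed)

definition wordv :: "(nat \<Rightarrow> 'v) \<Rightarrow> 'v" where
  "wordv y = calg.lprod (fst Q) (map (\<lambda>p. emb p (y p)) [0..<n])"

definition G :: "(('v \<times> nat) list \<Rightarrow> complex) \<Rightarrow> (('v \<times> nat) list \<Rightarrow> complex) \<Rightarrow> (nat \<Rightarrow> 'v) \<Rightarrow> complex" where
  "G m1 m2 y = odot FAC FAC Q (mfun m1) (mfun m2) (wordv y)"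

lemma calg_Q: "calg (fst Q)"
  using is_free_product_algs[OF Q] by (simp add: calg_def)

lemma wordv_mem:
  assumes "\<And>p. y p \<in> sa_carrier FAC" shows "wordv y \<in> sa_carrier (fst Q)"
  unfolding wordv_def by (rule calg.lprod_closed[OF calg_Q]) (use emb_mem assms in auto)

lemma wordv_cong:
  assumes "\<And>p. p < n \<Longrightarrow> y p = y' p" shows "wordv y = wordv y'"
  unfolding wordv_def by (rule arg_cong[of _ _ "calg.lprod (fst Q)"], rule map_cong) (use assms in auto)

lemma G_word_cong: "(\<And>p. p < n \<Longrightarrow> y p = y' p) \<Longrightarrow> G m1 m2 y = G m1 m2 y'"
  unfolding G_def by (subst wordv_cong[of y y']) auto

lemma G_cong0:
  assumes "\<And>w. w \<noteq> [] \<Longrightarrow> m1 w = m1' w" "\<And>w. w \<noteq> [] \<Longrightarrow> m2 w = m2' w" "\<And>p. y p \<in> sa_carrier FAC"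
  shows "G m1 m2 y = G m1' m2' y"
  unfolding G_def
  by (rule natural_product_cong[OF np Q lin_mfun lin_mfun _ _ wordv_mem[OF assms(3)]])
     (auto intro!: mfun_cong assms(1,2))

text \<open>Naturality along two substitutions: pulling back the moments on each side amounts to
  replacing the letters of the generic word.\<close>

lemma G_subst:
  assumes s1: "\<And>l. s1 l \<in> sa_carrier (FA UNIV)" and s2: "\<And>l. s2 l \<in> sa_carrier (FA UNIV)"
  shows "G (\<lambda>w. mom m1 (prod_list (map s1 w))) (\<lambda>w. mom m2 (prod_list (map s2 w))) gen =
    G m1 m2 (\<lambda>p. if side p then enc (s1 (lt p)) else enc (s2 (lt p)))"
proof -
  let ?T = "fp_map FAC FAC Q Q (subst s1) (subst s2)"
  note h1 = xhom_subst[where s = s1, OF s1] and h2 = xhom_subst[where s = s2, OF s2]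
  note T = fp_map[OF Q Q h1 h2]
  have eq: "?T (emb p (gen p)) = emb p (if side p then enc (s1 (lt p)) else enc (s2 (lt p)))" for p
    using T(2,3)[OF gen_mem[of "lt p"]] subst_gen[where s = s1, OF s1] subst_gen[where s = s2, OF s2] by simp
  have "?T (wordv gen) = calg.lprod (fst Q) (map ?T (map (\<lambda>p. emb p (gen p)) [0..<n]))"
    unfolding wordv_def
    by (rule xhom_lprod[OF _ _ T(1)]) (use calg_Q emb_mem[OF gen_mem] in \<open>auto simp: calg_def\<close>)
  also have "map ?T (map (\<lambda>p. emb p (gen p)) [0..<n]) =
      map (\<lambda>p. emb p (if side p then enc (s1 (lt p)) else enc (s2 (lt p)))) [0..<n]"
    unfolding map_map by (rule map_cong[OF refl]) (simp only: comp_def eq)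
  finally have Tw: "?T (wordv gen) = wordv (\<lambda>p. if side p then enc (s1 (lt p)) else enc (s2 (lt p)))"
    by (simp only: wordv_def)
  have "odot FAC FAC Q (mfun (\<lambda>w. mom m1 (prod_list (map s1 w)))) (mfun (\<lambda>w. mom m2 (prod_list (map s2 w)))) (wordv gen) =
     odot FAC FAC Q (mfun m1) (mfun m2) (?T (wordv gen))"
  proof (rule natural_product_nat[OF np Q Q h1 h2 T(1) T(2) T(3) lin_mfun lin_mfun _ _ wordv_mem[OF gen_mem]])
    show "mfun (\<lambda>w. mom m1 (prod_list (map s1 w))) a = mfun m1 (subst s1 a)" if "a \<in> sa_carrier FAC" for a
      by (rule mfun_subst[symmetric]) (use s1 that in auto)
    show "mfun (\<lambda>w. mom m2 (prod_list (map s2 w))) a = mfun m2 (subst s2 a)" if "a \<in> sa_carrier FAC" for a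
      by (rule mfun_subst[symmetric]) (use s2 that in auto)
  qed
  then show ?thesis unfolding G_def Tw .
qed

lemma G_subst_left:
  assumes s1: "\<And>l. s1 l \<in> sa_carrier (FA UNIV)"
  shows "G (\<lambda>w. mom m1 (prod_list (map s1 w))) m2 gen = G m1 m2 (\<lambda>p. if side p then enc (s1 (lt p)) else gen p)"
  using G_subst[where ?s1.0 = s1 and ?s2.0 = "\<lambda>l. mon [l]", OF s1 FA_letter] by (simp add: prod_list_mon_letters)

definition "LeftL = lt ` {p. p < n \<and> side p}"
definition "RightL = lt ` {p. p < n \<and> \<not> side p}"

text \<open>Substituting 0 for the letters that never occur on a given side does not touch the
  generic word, but erases all moments involving such letters.\<close>

lemma G_kill: "G (\<lambda>w. if set w \<subseteq> LeftL then m1 w else 0) (\<lambda>w. if set w \<subseteq> RightL then m2 w else 0) gen = G m1 m2 gen"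
proof -
  have m: "mom m (if b then mon w else 0) = (if b then m w else 0)" for m b and w :: "('v \<times> nat) list"
    by simp
  have "G (\<lambda>w. mom m1 (prod_list (map (\<lambda>l. if l \<in> LeftL then mon [l] else 0) w)))
       (\<lambda>w. mom m2 (prod_list (map (\<lambda>l. if l \<in> RightL then mon [l] else 0) w))) gen =
     G m1 m2 (\<lambda>p. if side p then enc (if lt p \<in> LeftL then mon [lt p] else 0) else enc (if lt p \<in> RightL then mon [lt p] else 0))"
    by (rule G_subst) (simp_all add: FA_letter FA_zero)
  also have "\<dots> = G m1 m2 gen"
    by (rule G_word_cong) (auto simp: LeftL_def RightL_def)
  finally show ?thesis unfolding prod_list_kill m .
qed

lemma G_cong:
  assumes "\<And>w. w \<noteq> [] \<Longrightarrow> set w \<subseteq> LeftL \<Longrightarrow> m1 w = m1' w" "\<And>w. w \<noteq> [] \<Longrightarrow> set w \<subseteq> RightL \<Longrightarrow> m2 w = m2' w"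
  shows "G m1 m2 gen = G m1' m2' gen"
proof -
  have "G (\<lambda>w. if set w \<subseteq> LeftL then m1 w else 0) (\<lambda>w. if set w \<subseteq> RightL then m2 w else 0) gen =
    G (\<lambda>w. if set w \<subseteq> LeftL then m1' w else 0) (\<lambda>w. if set w \<subseteq> RightL then m2' w else 0) gen"
    by (rule G_cong0) (use assms gen_mem in auto)
  then show ?thesis unfolding G_kill .
qed

lemma emb_xhom: "xhom FAC (fst Q) (emb p)"
  using is_free_product_algs[OF Q] by simp

lemma lin_G: "lin_fun (fst Q) (odot FAC FAC Q (mfun m1) (mfun m2))"
  by (rule natural_product_lin[OF np Q lin_mfun lin_mfun])

lemma wordv_upd: "wordv (y(p := a)) = calg.lprod (fst Q) (map ((\<lambda>p. emb p (y p))(p := emb p a)) [0..<n])"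
  unfolding wordv_def by (rule arg_cong[of _ _ "calg.lprod (fst Q)"], rule map_cong) auto

lemma G_slot_add:
  assumes p: "p < n" and y: "\<And>p. y p \<in> sa_carrier FAC" and a: "a \<in> sa_carrier FAC" "b \<in> sa_carrier FAC"
  shows "G m1 m2 (y(p := sa_add FAC a b)) = G m1 m2 (y(p := a)) + G m1 m2 (y(p := b))"
proof -
  have "wordv (y(p := sa_add FAC a b)) = sa_add (fst Q) (wordv (y(p := a))) (wordv (y(p := b)))"
    unfolding wordv_upd xhom_add[OF emb_xhom a]
    by (rule calg.lprod_fun_upd_add[OF calg_Q]) (use p emb_mem[OF y] emb_mem[OF a(1)] emb_mem[OF a(2)] in auto)
  moreover have "wordv (y(p := a)) \<in> sa_carrier (fst Q)" "wordv (y(p := b)) \<in> sa_carrier (fst Q)"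
    by (rule wordv_mem; use y a in simp)+
  ultimately show ?thesis unfolding G_def using lin_fun_add[OF lin_G] by simp
qed

lemma G_slot_smul:
  assumes p: "p < n" and y: "\<And>p. y p \<in> sa_carrier FAC" and a: "a \<in> sa_carrier FAC"
  shows "G m1 m2 (y(p := sa_smul FAC c a)) = c * G m1 m2 (y(p := a))"
proof -
  have "wordv (y(p := sa_smul FAC c a)) = sa_smul (fst Q) c (wordv (y(p := a)))"
    unfolding wordv_upd xhom_smul[OF emb_xhom a]
    by (rule calg.lprod_fun_upd_smul[OF calg_Q]) (use p emb_mem[OF y] emb_mem[OF a] in auto)
  moreover have "wordv (y(p := a)) \<in> sa_carrier (fst Q)"
    by (rule wordv_mem) (use y a in simp)
  ultimately show ?thesis unfolding G_def using lin_fun_smul[OF lin_G] by simp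
qed

text \<open>Read the variable at position \<open>p\<close> as a sum of two. By
  \<open>joint_moments\<close> a single functional assigns the moments \<open>m\<close> to the sum
  and \<open>m1\<close>, \<open>m2\<close> to the summands, and the generic word is linear in its
  entry at \<open>p\<close>.\<close>

lemma left_additive:
  assumes p: "p < n" "side p"
    and 0: "\<And>w. lt p \<notin> set w \<Longrightarrow> m w = m1 w \<and> m w = m2 w"
    and 1: "\<And>w. count_list w (lt p) = 1 \<Longrightarrow> m w = m1 w + m2 w"
  shows "G m k gen = G m1 k gen + G m2 k gen"
proof -
  \<comment> \<open>Positions of the word stay below \<open>n\<close>, so \<open>lt n\<close> is a
    fresh letter for the second summand.\<close>
  let ?i = "lt p" and ?z = "lt n"
  have iz: "?i \<noteq> ?z" using p by simp
  have zL: "?z \<notin> set w" if "set w \<subseteq> LeftL" for w using that by (auto simp: LeftL_def)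
  obtain \<Phi> where \<Phi>:
    "\<And>u. ?z \<notin> set u \<Longrightarrow> mom \<Phi> (prod_list (map (\<lambda>l. if l = ?i then mon [?i] + mon [?z] else mon [l]) u)) = m u"
    "\<And>u. ?z \<notin> set u \<Longrightarrow> \<Phi> u = m1 u"
    "\<And>u. ?z \<notin> set u \<Longrightarrow> \<Phi> (map (\<lambda>l. if l = ?i then ?z else l) u) = m2 u"
    by (rule joint_moments[where i = ?i and z = ?z and m = m and ?m1.0 = m1 and ?m2.0 = m2, OF iz 0 1])
      (assumption | (rule that; assumption))+
  let ?s = "\<lambda>l. if l = ?i then mon [?i] + mon [?z] else mon [l]"
  let ?t = "\<lambda>l. if l = ?i then mon [?z] else mon [l]"
  have add: "enc (mon [?i] + mon [?z]) = sa_add FAC (gen p) (gen n)"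
    using xhom_add[OF xhom_enc FA_letter FA_letter, of ?i ?z] by simp
  have "G m k gen = G (\<lambda>w. mom \<Phi> (prod_list (map ?s w))) k gen"
  proof (rule G_cong)
    show "m w = mom \<Phi> (prod_list (map ?s w))" if "set w \<subseteq> LeftL" for w
      by (rule \<Phi>(1)[OF zL[OF that], symmetric])
  qed simp
  also have "\<dots> = G \<Phi> k (\<lambda>q. if side q then enc (?s (lt q)) else gen q)"
    by (rule G_subst_left) (simp add: FA_letter FA_add)
  also have "\<dots> = G \<Phi> k (gen(p := sa_add FAC (gen p) (gen n)))"
    by (rule G_word_cong) (use p add in auto)
  also have "\<dots> = G \<Phi> k (gen(p := gen p)) + G \<Phi> k (gen(p := gen n))"
    by (rule G_slot_add[OF p(1) gen_mem gen_mem gen_mem])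
  also have "gen(p := gen p) = gen" by (rule fun_upd_triv)
  also have "G \<Phi> k gen = G m1 k gen"
  proof (rule G_cong)
    show "\<Phi> w = m1 w" if "set w \<subseteq> LeftL" for w
      by (rule \<Phi>(2)[OF zL[OF that]])
  qed simp
  also have "G \<Phi> k (gen(p := gen n)) = G \<Phi> k (\<lambda>q. if side q then enc (?t (lt q)) else gen q)"
    by (rule G_word_cong) (use p in auto)
  also have "\<dots> = G (\<lambda>w. mom \<Phi> (prod_list (map ?t w))) k gen"
    by (rule G_subst_left[symmetric]) (simp add: FA_letter)
  also have "\<dots> = G m2 k gen"
  proof (rule G_cong)
    fix w assume "set w \<subseteq> LeftL"
    have "map ?t w = map (\<lambda>l. mon [l]) (map (\<lambda>l. if l = ?i then ?z else l) w)" by simp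
    then have "prod_list (map ?t w) = mon (map (\<lambda>l. if l = ?i then ?z else l) w)"
      by (simp only: prod_list_mon_letters)
    then show "mom \<Phi> (prod_list (map ?t w)) = m2 w" using \<Phi>(3)[OF zL[OF \<open>set w \<subseteq> LeftL\<close>]] by (simp only: mom_mon)
  qed simp
  finally show ?thesis .
qed

lemma left_homogeneous:
  assumes p: "p < n" "side p"
  shows "G (\<lambda>w. c ^ count_list w (lt p) * m w) k gen = c * G m k gen"
proof -
  let ?i = "lt p"
  let ?s = "\<lambda>l. if l = ?i then cst c * mon [l] else mon [l]"
  have "G (\<lambda>w. c ^ count_list w ?i * m w) k gen = G (\<lambda>w. mom m (prod_list (map ?s w))) k gen"
    unfolding prod_list_scale mom_cst mom_mon ..
  also have "\<dots> = G m k (\<lambda>q. if side q then enc (?s (lt q)) else gen q)"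
    by (rule G_subst_left) (simp add: FA_letter FA_cst)
  also have "\<dots> = G m k (gen(p := sa_smul FAC c (gen p)))"
    using p xhom_smul[OF xhom_enc FA_letter, of c ?i] by (intro G_word_cong) auto
  also have "\<dots> = c * G m k (gen(p := gen p))"
    by (rule G_slot_smul[OF p(1) gen_mem gen_mem])
  also have "gen(p := gen p) = gen" by (rule fun_upd_triv)
  finally show ?thesis .
qed

text \<open>One family of moments can feed both factors: by \<open>G_cong\<close> the left one sees
  only words in \<open>LeftL\<close>, the right one only words in \<open>RightL\<close>, and these
  alphabets are disjoint. Each variable thus matters on its own side only, and the swapped product
  settles those on the right.\<close>

lemma moment_poly_G: "moment_poly (lt ` {..<n}) (\<lambda>m. G m m gen)"
proof (rule moment_poly_of_multilinear)
  interpret S: word_moments enc "swap_prod odot" "fp_swap Q" n "\<lambda>p. \<not> side p"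
    by unfold_locales (simp_all add: natural_product_swap[OF np] is_free_product_swap[OF Q])
  have SG: "S.G m2 m1 y = G m1 m2 y" for m1 m2 y
    unfolding S.G_def G_def S.wordv_def wordv_def swap_prod_def fp_swap_simps
    by (rule arg_cong[of _ _ "odot FAC FAC Q (mfun m1) (mfun m2)"], rule arg_cong[of _ _ "calg.lprod (fst Q)"], rule map_cong) auto
  have disj: "set w \<subseteq> RightL \<Longrightarrow> side p \<Longrightarrow> lt p \<notin> set w" "set w \<subseteq> LeftL \<Longrightarrow> \<not> side p \<Longrightarrow> lt p \<notin> set w" for w p
    by (auto simp: RightL_def LeftL_def)
  show "finite (lt ` {..<n})" by simp
  show "depends_on (lt ` {..<n}) (\<lambda>m. G m m gen)"
    unfolding depends_on_def
  proof (intro allI impI)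
    fix m m' :: "('v \<times> nat) list \<Rightarrow> complex"
    assume "\<forall>w. w \<noteq> [] \<longrightarrow> set w \<subseteq> lt ` {..<n} \<longrightarrow> m w = m' w"
    moreover have "LeftL \<subseteq> lt ` {..<n}" "RightL \<subseteq> lt ` {..<n}" by (auto simp: LeftL_def RightL_def)
    ultimately show "G m m gen = G m' m' gen" by (intro G_cong) (meson subset_trans)+
  qed
  fix i assume "i \<in> lt ` {..<n}"
  then obtain p where p: "p < n" "i = lt p" by auto
  show "additive_at i (\<lambda>m. G m m gen)"
    unfolding additive_at_def p(2)
  proof (intro allI impI, elim conjE)
    fix m m1 m2 :: "('v \<times> nat) list \<Rightarrow> complex"
    assume a: "\<forall>w. lt p \<notin> set w \<longrightarrow> m w = m1 w \<and> m w = m2 w" "\<forall>w. count_list w (lt p) = 1 \<longrightarrow> m w = m1 w + m2 w"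
    have e1: "m w = m1 w" and e2: "m w = m2 w" if "lt p \<notin> set w" for w using a(1) that by blast+
    show "G m m gen = G m1 m1 gen + G m2 m2 gen"
    proof (cases "side p")
      case True
      have "G m m gen = G m1 m gen + G m2 m gen"
        by (rule left_additive[OF p(1) True]) (use a in auto)
      also have "G m1 m gen = G m1 m1 gen" by (rule G_cong) (use e1[OF disj(1)[OF _ True]] in simp_all)
      also have "G m2 m gen = G m2 m2 gen" by (rule G_cong) (use e2[OF disj(1)[OF _ True]] in simp_all)
      finally show ?thesis .
    next
      case False
      have "S.G m m gen = S.G m1 m gen + S.G m2 m gen"
        by (rule S.left_additive[OF p(1) False]) (use a in auto)
      then have "G m m gen = G m m1 gen + G m m2 gen" unfolding SG .
      also have "G m m1 gen = G m1 m1 gen" by (rule G_cong) (use e1[OF disj(2)[OF _ False]] in simp_all)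
      also have "G m m2 gen = G m2 m2 gen" by (rule G_cong) (use e2[OF disj(2)[OF _ False]] in simp_all)
      finally show ?thesis .
    qed
  qed
  show "homogeneous_at i (\<lambda>m. G m m gen)"
    unfolding homogeneous_at_def p(2)
  proof (intro allI)
    fix m :: "('v \<times> nat) list \<Rightarrow> complex" and c
    let ?m = "\<lambda>w. c ^ count_list w (lt p) * m w"
    show "G ?m ?m gen = c * G m m gen"
    proof (cases "side p")
      case True
      have "G ?m ?m gen = c * G m ?m gen" by (rule left_homogeneous[OF p(1) True])
      also have "G m ?m gen = G m m gen" by (rule G_cong) (use disj(1)[OF _ True] in auto)
      finally show ?thesis .
    next
      case False
      have "G ?m ?m gen = c * G ?m m gen" using S.left_homogeneous[OF p(1) False, of c m ?m] unfolding SG .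
      also have "G ?m m gen = G m m gen" by (rule G_cong) (use disj(2)[OF _ False] in auto)
      finally show ?thesis .
    qed
  qed
qed

end

section \<open>Polynomial functions of a functional\<close>

inductive Pol :: "'v salg \<Rightarrow> (('v \<Rightarrow> complex) \<Rightarrow> complex) \<Rightarrow> bool" for A where
  const: "Pol A (\<lambda>_. c)"
| ev: "a \<in> sa_carrier A \<Longrightarrow> Pol A (\<lambda>\<phi>. \<phi> a)"
| add: "Pol A p \<Longrightarrow> Pol A q \<Longrightarrow> Pol A (\<lambda>\<phi>. p \<phi> + q \<phi>)"
| mult: "Pol A p \<Longrightarrow> Pol A q \<Longrightarrow> Pol A (\<lambda>\<phi>. p \<phi> * q \<phi>)"

text \<open>The tensor product of the two algebras of polynomial functions. Its explicit form as
  sums of products is what later separates the variables.\<close>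

inductive Pol2 :: "'v salg \<Rightarrow> 'v salg \<Rightarrow> (('v \<Rightarrow> complex) \<Rightarrow> ('v \<Rightarrow> complex) \<Rightarrow> complex) \<Rightarrow> bool" for A1 A2 where
  prod: "Pol A1 p \<Longrightarrow> Pol A2 q \<Longrightarrow> Pol2 A1 A2 (\<lambda>\<phi> \<theta>. p \<phi> * q \<theta>)"
| add: "Pol2 A1 A2 f \<Longrightarrow> Pol2 A1 A2 g \<Longrightarrow> Pol2 A1 A2 (\<lambda>\<phi> \<theta>. f \<phi> \<theta> + g \<phi> \<theta>)"

lemma Pol2_left: "Pol A1 p \<Longrightarrow> Pol2 A1 A2 (\<lambda>\<phi> \<theta>. p \<phi>)"
  using Pol2.prod[OF _ Pol.const[of A2 1], of A1 p] by simp

lemma Pol2_right: "Pol A2 q \<Longrightarrow> Pol2 A1 A2 (\<lambda>\<phi> \<theta>. q \<theta>)"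
  using Pol2.prod[OF Pol.const[of A1 1], of A2 q] by simp

lemma Pol2_mult:
  assumes "Pol2 A1 A2 f" "Pol2 A1 A2 g" shows "Pol2 A1 A2 (\<lambda>\<phi> \<theta>. f \<phi> \<theta> * g \<phi> \<theta>)"
  using assms(1)
proof induction
  case (prod p q)
  from assms(2) show ?case
  proof induction
    case (prod p' q')
    show ?case using Pol2.prod[OF Pol.mult[OF \<open>Pol A1 p\<close> \<open>Pol A1 p'\<close>] Pol.mult[OF \<open>Pol A2 q\<close> \<open>Pol A2 q'\<close>]]
      by (simp only: mult_ac)
  next
    case (add f g)
    then show ?case using Pol2.add by (simp only: distrib_left)
  qed
next
  case (add f g)
  then show ?case using Pol2.add by (simp only: distrib_right)
qed

lemma Pol2_sum:
  assumes "Pol2 A1 A2 f"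
  obtains N :: nat and p q where "\<And>i. i < N \<Longrightarrow> Pol A1 (p i)" "\<And>i. i < N \<Longrightarrow> Pol A2 (q i)"
    "\<And>\<phi> \<theta>. f \<phi> \<theta> = (\<Sum>i<N. p i \<phi> * q i \<theta>)"
proof -
  have "\<exists>l. (\<forall>(p, q)\<in>set l. Pol A1 p \<and> Pol A2 q) \<and> (\<forall>\<phi> \<theta>. f \<phi> \<theta> = (\<Sum>(p, q)\<leftarrow>l. p \<phi> * q \<theta>))"
    using assms
  proof induction
    case (prod p q)
    show ?case by (rule exI[of _ "[(p, q)]"]) (use prod in auto)
  next
    case (add f g)
    then obtain l l' where "\<forall>(p, q)\<in>set l. Pol A1 p \<and> Pol A2 q" "\<forall>\<phi> \<theta>. f \<phi> \<theta> = (\<Sum>(p, q)\<leftarrow>l. p \<phi> * q \<theta>)"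
      "\<forall>(p, q)\<in>set l'. Pol A1 p \<and> Pol A2 q" "\<forall>\<phi> \<theta>. g \<phi> \<theta> = (\<Sum>(p, q)\<leftarrow>l'. p \<phi> * q \<theta>)" by blast
    then show ?case by (intro exI[of _ "l @ l'"]) auto
  qed
  then obtain l where l: "\<forall>(p, q)\<in>set l. Pol A1 p \<and> Pol A2 q" "\<And>\<phi> \<theta>. f \<phi> \<theta> = (\<Sum>(p, q)\<leftarrow>l. p \<phi> * q \<theta>)" by blast
  show ?thesis
  proof (rule that[of "length l" "\<lambda>i. fst (l ! i)" "\<lambda>i. snd (l ! i)"])
    show "Pol A1 (fst (l ! i))" "Pol A2 (snd (l ! i))" if "i < length l" for i
      using bspec[OF l(1) nth_mem[OF that]] by (simp_all add: case_prod_beta)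
    show "f \<phi> \<theta> = (\<Sum>i<length l. fst (l ! i) \<phi> * snd (l ! i) \<theta>)" for \<phi> \<theta>
      unfolding l(2) sum_list_sum_nth by (simp add: case_prod_beta atLeast0LessThan)
  qed
qed

lemma Pol2_of_moment_poly:
  assumes "moment_poly I g" "\<And>w. w \<noteq> [] \<Longrightarrow> set w \<subseteq> I \<Longrightarrow> Pol2 A1 A2 (\<lambda>\<phi> \<theta>. M \<phi> \<theta> w)"
  shows "Pol2 A1 A2 (\<lambda>\<phi> \<theta>. g (M \<phi> \<theta>))"
  using assms(1)
proof induction
  case (const c) then show ?case by (rule Pol2_left[OF Pol.const])
qed (auto intro: assms(2) Pol2.add Pol2_mult)

section \<open>Polynomiality of the product functional\<close>

context coding begin

lemma mom_eq_fext:
  assumes A: "is_alg A" and s: "\<And>l. s l \<in> sa_carrier A" and \<phi>: "lin_fun A \<phi>" and p: "p \<in> sa_carrier (FA UNIV)"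
  shows "mom (\<lambda>w. \<phi> (calg.lprod A (map s w))) p = \<phi> (calg.fext A s p)"
proof -
  interpret A: calg A by (standard, fact)
  note [simp] = A.fext_single[where g = s, OF s] A.fext_add[where g = s, OF s] A.fext_zero[where g = s, OF s]
    A.fext_closed[where g = s, OF s] A.lprod_map_closed[where g = s, OF s]
  from p show ?thesis
    by (induction p rule: FA_induct)
       (auto simp: mom_single mom_add lin_fun_add[OF \<phi>] lin_fun_smul[OF \<phi>] lin_fun_zero[OF A \<phi>])
qed

text \<open>The word is the image of the generic word under homomorphisms sending each positional
  letter to the entry at its place. Pulling \<open>\<phi>\<close> and \<open>\<theta>\<close> back,
  the moments become values of \<open>\<phi>\<close> and \<open>\<theta>\<close> at products of
  entries.\<close>

lemma odot_word_polynomial: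
  fixes odot :: "'v uprod"
  assumes np: "natural_product odot" and P: "is_free_product A1 A2 P"
    and w: "set w \<subseteq> fp_letters A1 A2"
  obtains f where "Pol2 A1 A2 f"
    "\<And>\<phi> \<theta>. lin_fun A1 \<phi> \<Longrightarrow> lin_fun A2 \<theta> \<Longrightarrow>
      odot A1 A2 P \<phi> \<theta> (calg.lprod (fst P) (map (fp_emb (fst (snd P)) (snd (snd P))) w)) = f \<phi> \<theta>"
proof -
  note a = is_free_product_algs[OF P]
  interpret A1: calg A1 by (standard, rule a)
  interpret A2: calg A2 by (standard, rule a)
  obtain Q where Q: "is_free_product FAC FAC Q" using free_product_exists[OF is_alg_FAC is_alg_FAC] .
  define n where "n = length w"
  define side where "side p = (snd (w ! p) = 0)" for p
  interpret M: word_moments enc odot Q n side by unfold_locales (rule np, rule Q)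
  define s1 where "s1 l = (if l \<in> M.LeftL then fst (w ! snd l) else sa_zero A1)" for l
  define s2 where "s2 l = (if l \<in> M.RightL then fst (w ! snd l) else sa_zero A2)" for l
  have wp: "w ! p \<in> fp_letters A1 A2" if "p < n" for p using w that by (auto simp: n_def)
  have wp1: "fst (w ! p) \<in> sa_carrier A1" if "p < n" "side p" for p
    using wp[OF that(1)] that(2) by (cases "w ! p") (auto simp: side_def fp_letters_def)
  have wp2: "fst (w ! p) \<in> sa_carrier A2" if "p < n" "\<not> side p" for p
    using wp[OF that(1)] that(2) by (cases "w ! p") (auto simp: side_def fp_letters_def)
  have s1: "s1 l \<in> sa_carrier A1" for l
    using wp1 by (auto simp: s1_def M.LeftL_def)
  have s2: "s2 l \<in> sa_carrier A2" for l
    using wp2 by (auto simp: s2_def M.RightL_def)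
  define j1 where "j1 = A1.fext s1 \<circ> dcd"
  define j2 where "j2 = A2.fext s2 \<circ> dcd"
  have j1: "xhom FAC A1 j1" unfolding j1_def by (rule xhom_comp[OF xhom_dcd A1.xhom_fext[where g = s1, OF s1]])
  have j2: "xhom FAC A2 j2" unfolding j2_def by (rule xhom_comp[OF xhom_dcd A2.xhom_fext[where g = s2, OF s2]])
  note T = fp_map[OF Q P j1 j2]
  let ?T = "fp_map FAC FAC Q P j1 j2"
  let ?e = "fp_emb (fst (snd P)) (snd (snd P))"
  have Te: "?T (M.emb p (gen p)) = ?e (w ! p)" if "p < n" for p
  proof (cases "side p")
    case True
    then have "j1 (gen p) = fst (w ! p)"
      using that by (simp add: j1_def dcd_enc FA_letter A1.fext_mon[where g = s1, OF s1] s1_def M.LeftL_def image_iff)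
    then show ?thesis using True T(2)[OF gen_mem[of "lt p"]] by (simp add: fp_emb_def side_def)
  next
    case False
    then have "j2 (gen p) = fst (w ! p)"
      using that by (simp add: j2_def dcd_enc FA_letter A2.fext_mon[where g = s2, OF s2] s2_def M.RightL_def image_iff)
    then show ?thesis using False T(3)[OF gen_mem[of "lt p"]] by (simp add: fp_emb_def side_def)
  qed
  have "?T (M.wordv gen) = calg.lprod (fst P) (map ?T (map (\<lambda>p. M.emb p (gen p)) [0..<n]))"
    unfolding M.wordv_def
    by (rule xhom_lprod[OF is_free_product_algs(3)[OF Q] a(3) T(1)]) (use M.emb_mem[OF gen_mem] in auto)
  also have "map ?T (map (\<lambda>p. M.emb p (gen p)) [0..<n]) = map ?e w"
    by (rule nth_equalityI) (use Te in \<open>auto simp: n_def simp del: split_paired_All\<close>)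
  finally have Tw: "?T (M.wordv gen) = calg.lprod (fst P) (map ?e w)" .
  \<comment> \<open>The moments of both functionals are merged into one family, which is possible
    because the two sides use disjoint letters; a word mixing the sides gets the default 0.\<close>
  define mm where "mm \<phi> \<theta> u = (if set u \<subseteq> M.LeftL then \<phi> (A1.lprod (map s1 u))
      else if set u \<subseteq> M.RightL then \<theta> (A2.lprod (map s2 u)) else 0)" for \<phi> \<theta> :: "'v \<Rightarrow> complex" and u
  show ?thesis
  proof (rule that[of "\<lambda>\<phi> \<theta>. M.G (mm \<phi> \<theta>) (mm \<phi> \<theta>) gen"])
    have "Pol2 A1 A2 (\<lambda>\<phi> \<theta>. mm \<phi> \<theta> u)" for u
      by (cases "set u \<subseteq> M.LeftL"; cases "set u \<subseteq> M.RightL")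
        (auto simp: mm_def intro!: Pol2_left[OF Pol.ev] Pol2_right[OF Pol.ev] Pol2_left[OF Pol.const]
        A1.lprod_map_closed[where g = s1, OF s1] A2.lprod_map_closed[where g = s2, OF s2])
    then show "Pol2 A1 A2 (\<lambda>\<phi> \<theta>. M.G (mm \<phi> \<theta>) (mm \<phi> \<theta>) gen)"
      by (rule Pol2_of_moment_poly[OF M.moment_poly_G])
  next
    fix \<phi> \<theta> assume \<phi>: "lin_fun A1 \<phi>" and \<theta>: "lin_fun A2 \<theta>"
    have 1: "mfun (\<lambda>u. \<phi> (A1.lprod (map s1 u))) x = \<phi> (j1 x)" if "x \<in> sa_carrier FAC" for x
      unfolding mfun_def j1_def comp_def by (rule mom_eq_fext[OF a(1) s1 \<phi> dcd_mem[OF that]])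
    have 2: "mfun (\<lambda>u. \<theta> (A2.lprod (map s2 u))) x = \<theta> (j2 x)" if "x \<in> sa_carrier FAC" for x
      unfolding mfun_def j2_def comp_def by (rule mom_eq_fext[OF a(2) s2 \<theta> dcd_mem[OF that]])
    have "M.G (\<lambda>u. \<phi> (A1.lprod (map s1 u))) (\<lambda>u. \<theta> (A2.lprod (map s2 u))) gen =
        odot A1 A2 P \<phi> \<theta> (?T (M.wordv gen))"
      unfolding M.G_def
      by (rule natural_product_nat[OF np Q P j1 j2 T(1) T(2) T(3) \<phi> \<theta> 1 2 M.wordv_mem[OF gen_mem]])
    moreover have "M.G (mm \<phi> \<theta>) (mm \<phi> \<theta>) gen = M.G (\<lambda>u. \<phi> (A1.lprod (map s1 u))) (\<lambda>u. \<theta> (A2.lprod (map s2 u))) gen"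
    proof (rule M.G_cong)
      fix u :: "('v \<times> nat) list" assume u: "u \<noteq> []" "set u \<subseteq> M.RightL"
      then have "\<not> set u \<subseteq> M.LeftL" by (cases u) (auto simp: M.LeftL_def M.RightL_def)
      then show "mm \<phi> \<theta> u = \<theta> (A2.lprod (map s2 u))" using u by (simp add: mm_def)
    qed (simp add: mm_def)
    ultimately show "odot A1 A2 P \<phi> \<theta> (calg.lprod (fst P) (map ?e w)) = M.G (mm \<phi> \<theta>) (mm \<phi> \<theta>) gen"
      by (simp only: Tw)
  qed
qed

lemma odot_polynomial:
  fixes odot :: "'v uprod"
  assumes np: "natural_product odot" and P: "is_free_product A1 A2 P" and x: "x \<in> sa_carrier (fst P)"
  shows "\<exists>f. Pol2 A1 A2 f \<and> (\<forall>\<phi> \<theta>. lin_fun A1 \<phi> \<longrightarrow> lin_fun A2 \<theta> \<longrightarrow> odot A1 A2 P \<phi> \<theta> x = f \<phi> \<theta>)"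
  using P x
proof (induction x rule: fp_word_induct)
  case (word w)
  from odot_word_polynomial[OF np P word(2)] show ?case by metis
next
  case (add x y)
  then obtain f g where "Pol2 A1 A2 f" "\<forall>\<phi> \<theta>. lin_fun A1 \<phi> \<longrightarrow> lin_fun A2 \<theta> \<longrightarrow> odot A1 A2 P \<phi> \<theta> x = f \<phi> \<theta>"
    "Pol2 A1 A2 g" "\<forall>\<phi> \<theta>. lin_fun A1 \<phi> \<longrightarrow> lin_fun A2 \<theta> \<longrightarrow> odot A1 A2 P \<phi> \<theta> y = g \<phi> \<theta>" by blast
  then show ?case
    by (intro exI[of _ "\<lambda>\<phi> \<theta>. f \<phi> \<theta> + g \<phi> \<theta>"])
       (use add in \<open>auto intro: Pol2.add simp: lin_fun_add[OF natural_product_lin[OF np P]]\<close>)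
next
  case (smul c x)
  then obtain f where f: "Pol2 A1 A2 f" "\<forall>\<phi> \<theta>. lin_fun A1 \<phi> \<longrightarrow> lin_fun A2 \<theta> \<longrightarrow> odot A1 A2 P \<phi> \<theta> x = f \<phi> \<theta>" by blast
  show ?case
    by (intro exI[of _ "\<lambda>\<phi> \<theta>. c * f \<phi> \<theta>"])
       (use smul f Pol2_mult[OF Pol2_left[OF Pol.const] f(1)] in \<open>auto simp: lin_fun_smul[OF natural_product_lin[OF np P]]\<close>)
qed

end

section \<open>Perturbations of the identity in finite dimension\<close>

fun mat_iter :: "nat set \<Rightarrow> (nat \<Rightarrow> nat \<Rightarrow> complex) \<Rightarrow> nat \<Rightarrow> (nat \<Rightarrow> complex) \<Rightarrow> nat \<Rightarrow> complex" where
  "mat_iter J A 0 x l = x l"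
| "mat_iter J A (Suc k) x l = (\<Sum>j\<in>J. A l j * mat_iter J A k x j)"

lemma sum_choose_Suc:
  fixes g :: "nat \<Rightarrow> complex"
  shows "(\<Sum>k\<le>Suc n. of_nat (Suc n choose k) * g k) =
    (\<Sum>k\<le>n. of_nat (n choose k) * g k) + (\<Sum>k\<le>n. of_nat (n choose k) * g (Suc k))"
proof -
  have "(\<Sum>k\<le>n. of_nat (n choose k) * g k) = (\<Sum>k\<le>Suc n. of_nat (n choose k) * g k)" by simp
  also have "\<dots> = g 0 + (\<Sum>k\<le>n. of_nat (n choose Suc k) * g (Suc k))"
    by (subst sum.atMost_Suc_shift) simp
  finally have 1: "(\<Sum>k\<le>n. of_nat (n choose k) * g k) = g 0 + (\<Sum>k\<le>n. of_nat (n choose Suc k) * g (Suc k))" .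
  have "(\<Sum>k\<le>Suc n. of_nat (Suc n choose k) * g k) =
      g 0 + (\<Sum>k\<le>n. of_nat (n choose k) * g (Suc k) + of_nat (n choose Suc k) * g (Suc k))"
    by (subst sum.atMost_Suc_shift) (simp add: distrib_right)
  then show ?thesis unfolding sum.distrib 1 by (simp only: add_ac)
qed

text \<open>The recursion applies \<open>1 + c A\<close> at each step, and the right-hand side is
  the binomial expansion of the \<open>n\<close>-th power of this operator.\<close>

lemma linear_recursion:
  assumes "finite J" "\<And>k l. l \<in> J \<Longrightarrow> x (Suc k) l = x k l + c * (\<Sum>j\<in>J. A l j * x k j)" "l \<in> J"
  shows "x n l = (\<Sum>k\<le>n. of_nat (n choose k) * (c ^ k * mat_iter J A k (x 0) l))"
  using assms(3)
proof (induction n arbitrary: l)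
  case (Suc n)
  have "c * (\<Sum>j\<in>J. A l j * x n j) =
      c * (\<Sum>j\<in>J. \<Sum>k\<le>n. A l j * (of_nat (n choose k) * (c ^ k * mat_iter J A k (x 0) j)))"
    by (simp add: Suc.IH sum_distrib_left)
  also have "\<dots> = c * (\<Sum>k\<le>n. \<Sum>j\<in>J. A l j * (of_nat (n choose k) * (c ^ k * mat_iter J A k (x 0) j)))"
    by (subst sum.swap) simp
  also have "\<dots> = (\<Sum>k\<le>n. of_nat (n choose k) * (c ^ Suc k * mat_iter J A (Suc k) (x 0) l))"
    by (simp add: sum_distrib_left mult_ac)
  finally have "c * (\<Sum>j\<in>J. A l j * x n j) =
     (\<Sum>k\<le>n. of_nat (n choose k) * (c ^ Suc k * mat_iter J A (Suc k) (x 0) l))" .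
  then show ?case
    unfolding assms(2)[OF Suc.prems] Suc.IH[OF Suc.prems] sum_choose_Suc by (simp only:)
qed simp

lemma mat_iter_bound:
  assumes "finite J" "\<And>l. l \<in> J \<Longrightarrow> norm (x l) \<le> X" "(\<Sum>l\<in>J. \<Sum>j\<in>J. norm (A l j)) \<le> K" "0 \<le> X" "l \<in> J"
  shows "norm (mat_iter J A k x l) \<le> K ^ k * X"
  using assms(5)
proof (induction k arbitrary: l)
  case (Suc k)
  have K: "0 \<le> K" using assms(3) by (meson order_trans sum_nonneg norm_ge_zero)
  have "norm (mat_iter J A (Suc k) x l) \<le> (\<Sum>j\<in>J. norm (A l j) * norm (mat_iter J A k x j))"
    by (simp add: norm_mult order_trans[OF norm_sum])
  also have "\<dots> \<le> (\<Sum>j\<in>J. norm (A l j) * (K ^ k * X))"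
    by (intro sum_mono mult_left_mono Suc.IH) auto
  also have "\<dots> = (\<Sum>j\<in>J. norm (A l j)) * (K ^ k * X)" by (simp add: sum_distrib_right)
  also have "\<dots> \<le> K * (K ^ k * X)"
  proof (rule mult_right_mono)
    have "(\<Sum>j\<in>J. norm (A l j)) \<le> (\<Sum>l\<in>J. \<Sum>j\<in>J. norm (A l j))"
      by (rule member_le_sum[OF Suc.prems]) (auto intro: sum_nonneg simp: assms)
    then show "(\<Sum>j\<in>J. norm (A l j)) \<le> K" using assms(3) by simp
  qed (use K assms(4) in simp)
  finally show ?case by (simp add: mult.assoc)
qed (use assms in simp)

lemma tendsto_mat_iter:
  assumes "\<And>l j. l \<in> J \<Longrightarrow> j \<in> J \<Longrightarrow> ((\<lambda>n. A n l j) \<longlongrightarrow> A' l j) F" "l \<in> J"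
  shows "((\<lambda>n. mat_iter J (A n) k x l) \<longlongrightarrow> mat_iter J A' k x l) F"
  using assms(2)
  by (induction k arbitrary: l) (auto intro!: tendsto_intros assms(1))

lemma mat_iter_scale: "mat_iter J (\<lambda>l j. c * A l j) k x l = c ^ k * mat_iter J A k x l"
  by (induction k arbitrary: l) (simp_all add: sum_distrib_left mult_ac)

lemma tendsto_choose_over_pow:
  "(\<lambda>N. of_nat (N choose k) / of_nat N ^ k :: complex) \<longlonglongrightarrow> 1 / fact k"
proof -
  have 1: "(\<lambda>N. 1 - of_nat i / of_nat N :: complex) \<longlonglongrightarrow> 1 - 0" for i
    by (intro tendsto_intros lim_const_over_n)
  have "(\<lambda>N. (\<Prod>i<k. 1 - of_nat i / of_nat N :: complex) / fact k) \<longlonglongrightarrow> (\<Prod>i<k. 1 - 0) / fact k"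
    by (intro tendsto_intros 1) auto
  moreover have "(\<Prod>i<k. 1 - of_nat i / of_nat N :: complex) / fact k = of_nat (N choose k) / of_nat N ^ k" if "N > 0" for N
  proof -
    have "(\<Prod>i<k. 1 - of_nat i / of_nat N :: complex) = (\<Prod>i<k. (of_nat N - of_nat i) / of_nat N)"
      using that by (intro prod.cong) (auto simp: field_simps)
    also have "\<dots> = (\<Prod>i<k. of_nat N - of_nat i :: complex) / of_nat N ^ k"
      by (simp add: prod_dividef)
    also have "(\<Prod>i<k. of_nat N - of_nat i :: complex) = fact k * of_nat (N choose k)"
      by (simp add: binomial_gbinomial gbinomial_prod_rev atLeast0LessThan)
    finally show ?thesis by simp
  qed
  ultimately show ?thesis
    by (simp add: Lim_transform_eventually eventually_sequentiallyI[of 1])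
qed

text \<open>The matrix form of the compound interest limit: \<open>(1 + A n / N n) ^ N n\<close>
  tends to the exponential of \<open>A'\<close>. Termwise limits are summed by dominated convergence
  with majorant \<open>K ^ k * X / k!\<close>.\<close>

lemma compound_limit:
  fixes N :: "nat \<Rightarrow> nat"
  assumes J: "finite J" and N: "filterlim N at_top sequentially"
    and A: "\<And>l j. l \<in> J \<Longrightarrow> j \<in> J \<Longrightarrow> (\<lambda>n. A n l j) \<longlonglongrightarrow> A' l j" and l: "l \<in> J"
  shows "summable (\<lambda>k. norm (mat_iter J A' k x l / fact k)) \<and>
    (\<lambda>n. \<Sum>k\<le>N n. of_nat (N n choose k) * ((1 / of_nat (N n)) ^ k * mat_iter J (A n) k x l)) \<longlonglongrightarrow>
      suminf (\<lambda>k. mat_iter J A' k x l / fact k)"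
proof -
  define a where "a k n = of_nat (N n choose k) * ((1 / of_nat (N n)) ^ k * mat_iter J (A n) k x l)" for k n
  \<comment> \<open>The added 1 leaves room for the matrices \<open>A n\<close>, whose entries only
    converge, to satisfy the bound eventually.\<close>
  define K where "K = (\<Sum>l\<in>J. \<Sum>j\<in>J. norm (A' l j)) + 1"
  define X where "X = (\<Sum>l\<in>J. norm (x l))"
  have X: "norm (x j) \<le> X" if "j \<in> J" for j unfolding X_def by (rule member_le_sum[OF that]) (auto simp: J)
  have X0: "0 \<le> X" by (simp add: X_def sum_nonneg)
  have K0: "0 \<le> K" by (simp add: K_def sum_nonneg add_nonneg_nonneg)
  have lim: "(\<lambda>n. a k n) \<longlonglongrightarrow> mat_iter J A' k x l / fact k" for k
  proof -
    have "(\<lambda>n. of_nat (N n choose k) / of_nat (N n) ^ k * mat_iter J (A n) k x l) \<longlonglongrightarrow> 1 / fact k * mat_iter J A' k x l"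
      by (intro tendsto_mult tendsto_mat_iter A l filterlim_compose[OF tendsto_choose_over_pow N])
    then show ?thesis by (simp add: a_def power_inverse divide_inverse mult_ac)
  qed
  have "(\<lambda>n. \<Sum>l\<in>J. \<Sum>j\<in>J. norm (A n l j)) \<longlonglongrightarrow> (\<Sum>l\<in>J. \<Sum>j\<in>J. norm (A' l j))"
    by (intro tendsto_intros A)
  then have "eventually (\<lambda>n. (\<Sum>l\<in>J. \<Sum>j\<in>J. norm (A n l j)) < K) sequentially"
    by (rule order_tendstoD) (simp add: K_def)
  moreover have "eventually (\<lambda>n. N n > 0) sequentially"
    by (rule eventually_compose_filterlim[OF eventually_gt_at_top N])
  ultimately have ev: "eventually (\<lambda>n. \<forall>k. norm (a k n) \<le> K ^ k * X / fact k) sequentially"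
  proof eventually_elim
    case (elim n)
    show ?case
    proof
      fix k
      have "real (N n choose k) * fact k \<le> real (N n) ^ k"
        using binomial_fact_pow[of "N n" k] by (metis of_nat_mono of_nat_mult of_nat_fact of_nat_power)
      then have 1: "real (N n choose k) * (1 / real (N n)) ^ k \<le> 1 / fact k"
        using elim by (simp add: field_simps power_one_over)
      have 2: "norm (mat_iter J (A n) k x l) \<le> K ^ k * X"
        by (rule mat_iter_bound[OF J X _ X0 l]) (use elim in auto)
      have "norm (a k n) = (real (N n choose k) * (1 / real (N n)) ^ k) * norm (mat_iter J (A n) k x l)"
        by (simp add: a_def norm_mult norm_power norm_divide)
      also have "\<dots> \<le> (1 / fact k) * (K ^ k * X)"
        by (intro mult_mono 1 2) auto
      finally show "norm (a k n) \<le> K ^ k * X / fact k" by simp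
    qed
  qed
  have "eventually (\<lambda>(k, n). norm (a k n) \<le> K ^ k * X / fact k) (at_top \<times>\<^sub>F sequentially)"
  proof -
    have "eventually (\<lambda>(i, n). \<forall>k. norm (a k n) \<le> K ^ k * X / fact k) (at_top \<times>\<^sub>F sequentially :: (nat \<times> nat) filter)"
      using ev by (subst eventually_prod2) auto
    then show ?thesis by (rule eventually_mono) auto
  qed
  moreover have "summable (\<lambda>k. K ^ k * X / fact k)"
    using summable_mult2[OF summable_exp[of K], of X] by (simp add: field_simps)
  ultimately have T: "summable (\<lambda>k. norm (mat_iter J A' k x l / fact k)) \<and>
      (\<lambda>n. suminf (\<lambda>k. a k n)) \<longlonglongrightarrow> suminf (\<lambda>k. mat_iter J A' k x l / fact k)"
    using tannerys_theorem[of a "\<lambda>k. mat_iter J A' k x l / fact k" sequentially, OF lim] by auto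
  have "suminf (\<lambda>k. a k n) = (\<Sum>k\<le>N n. a k n)" for n
    by (rule suminf_finite) (auto simp: a_def binomial_eq_0)
  then show ?thesis using T by (simp add: a_def)
qed

section \<open>Functionals separating finitely many functions\<close>

text \<open>Functionals on functions of \<open>s\<close>, restricted to finite combinations of point
  evaluations: fixing one variable of a polynomial expression leaves a polynomial in the
  other.\<close>

inductive evalcomb :: "'s set \<Rightarrow> (('s \<Rightarrow> complex) \<Rightarrow> complex) \<Rightarrow> bool" for S where
  ev: "s \<in> S \<Longrightarrow> evalcomb S (\<lambda>f. f s)"
| add: "evalcomb S D \<Longrightarrow> evalcomb S E \<Longrightarrow> evalcomb S (\<lambda>f. D f + E f)"
| scale: "evalcomb S D \<Longrightarrow> evalcomb S (\<lambda>f. c * D f)"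

lemma evalcomb_add: "evalcomb S D \<Longrightarrow> D (\<lambda>s. f s + g s) = D f + D g"
  by (induction rule: evalcomb.induct) (auto simp: algebra_simps)

lemma evalcomb_scale: "evalcomb S D \<Longrightarrow> D (\<lambda>s. f s * c) = D f * c"
  by (induction rule: evalcomb.induct) (auto simp: algebra_simps)

lemma evalcomb_zero: "evalcomb S D \<Longrightarrow> D (\<lambda>s. 0) = 0"
  using evalcomb_scale[of S D "\<lambda>_. 0" 0] by simp

lemma evalcomb_cong: "evalcomb S D \<Longrightarrow> (\<And>s. s \<in> S \<Longrightarrow> f s = g s) \<Longrightarrow> D f = D g"
  by (induction rule: evalcomb.induct) auto

lemma evalcomb_sum:
  assumes "finite J" and D: "evalcomb S D"
  shows "D (\<lambda>s. \<Sum>j\<in>J. f j s) = (\<Sum>j\<in>J. D (f j))"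
  using assms(1)
proof (induction J rule: finite_induct)
  case (insert j J)
  then show ?case using evalcomb_add[OF D, of "f j" "\<lambda>s. \<Sum>j\<in>J. f j s"] by simp
qed (simp add: evalcomb_zero[OF D])

lemma evalcomb_sum_left:
  assumes "finite J" "\<And>j. j \<in> J \<Longrightarrow> evalcomb S (D j)" "S \<noteq> {}"
  shows "evalcomb S (\<lambda>f. \<Sum>j\<in>J. c j * D j f)"
  using assms(1,2)
proof (induction J rule: finite_induct)
  case empty
  obtain s where "s \<in> S" using assms(3) by auto
  then show ?case using evalcomb.scale[OF evalcomb.ev, of s S 0] by simp
next
  case (insert j J)
  then show ?case using evalcomb.add[OF evalcomb.scale[of S "D j" "c j"]] by simp
qed

text \<open>Gaussian elimination: a maximal linearly independent subfamily of the functions on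
  \<open>S\<close> is built one function at a time, together with a dual system of combinations of
  evaluations.\<close>

lemma dual_functionals:
  fixes p :: "nat \<Rightarrow> 's \<Rightarrow> complex"
  assumes S: "S \<noteq> {}"
  shows "\<exists>J D a. J \<subseteq> {..<N} \<and> (\<forall>j\<in>J. evalcomb S (D j)) \<and> (\<forall>j\<in>J. \<forall>k\<in>J. D j (p k) = (if j = k then 1 else 0)) \<and>
    (\<forall>i<N. \<forall>s\<in>S. p i s = (\<Sum>j\<in>J. a i j * p j s))"
proof (induction N)
  case 0
  show ?case by (intro exI[of _ "{}"]) auto
next
  case (Suc N)
  then obtain J :: "nat set" and D a where J: "J \<subseteq> {..<N}" and D: "\<forall>j\<in>J. evalcomb S (D j)"
    and dual: "\<forall>j\<in>J. \<forall>k\<in>J. D j (p k) = (if j = k then 1 else 0)"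
    and rep: "\<forall>i<N. \<forall>s\<in>S. p i s = (\<Sum>j\<in>J. a i j * p j s)" by blast
  have fin: "finite J" using J finite_subset by blast
  have N: "N \<notin> J" using J by auto
  define r where "r s = p N s - (\<Sum>j\<in>J. D j (p N) * p j s)" for s
  show ?case
  proof (cases "\<forall>s\<in>S. r s = 0")
    case True
    have "\<forall>i<Suc N. \<forall>s\<in>S. p i s = (\<Sum>j\<in>J. (if i = N then D j (p N) else a i j) * p j s)"
      using rep True by (auto simp: r_def less_Suc_eq)
    then show ?thesis using J D dual
      by (intro exI[of _ J] exI[of _ D] exI[of _ "\<lambda>i j. if i = N then D j (p N) else a i j"]) auto
  next
    case False
    then obtain s0 where s0: "s0 \<in> S" "r s0 \<noteq> 0" by auto
    \<comment> \<open>\<open>r\<close> is what remains of \<open>p N\<close> after subtracting its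
      component in the earlier functions. \<open>E\<close> evaluates the same kind of remainder at a
      point where \<open>r\<close> is nonzero, normalised so that \<open>p N\<close> goes to 1 and
      the earlier functions go to 0.\<close>
    define E where "E f = (1 / r s0) * (f s0 + (-1) * (\<Sum>j\<in>J. p j s0 * D j f))" for f
    have E: "evalcomb S E" unfolding E_def[abs_def]
      by (intro evalcomb.scale evalcomb.add evalcomb.ev s0(1) evalcomb_sum_left fin S) (use D in auto)
    have Ep: "E (p k) = 0" if "k \<in> J" for k
    proof -
      have "(\<Sum>j\<in>J. p j s0 * D j (p k)) = (\<Sum>j\<in>J. if j = k then p j s0 else 0)"
        using that dual by (intro sum.cong) auto
      then show ?thesis using that fin by (simp add: E_def)
    qed
    have EN: "E (p N) = 1" using s0 by (simp add: E_def r_def mult.commute)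
    \<comment> \<open>The old functionals are corrected by a multiple of \<open>E\<close> so that
      they vanish on the new function.\<close>
    define D' where "D' j f = (if j = N then E f else D j f + (- D j (p N)) * E f)" for j f
    have D': "evalcomb S (D' j)" if "j \<in> insert N J" for j
    proof (cases "j = N")
      case True then show ?thesis using E by (simp add: D'_def[abs_def])
    next
      case False
      then have "evalcomb S (D j)" using that D by auto
      then have "evalcomb S (\<lambda>f. D j f + (- D j (p N)) * E f)" by (intro evalcomb.add evalcomb.scale E)
      then show ?thesis using False by (simp add: D'_def[abs_def])
    qed
    have "\<forall>j\<in>insert N J. \<forall>k\<in>insert N J. D' j (p k) = (if j = k then 1 else 0)"
      using dual Ep EN N by (auto simp: D'_def)
    moreover have "\<forall>i<Suc N. \<forall>s\<in>S. p i s = (\<Sum>j\<in>insert N J. (if i = N then (if j = N then 1 else 0) else if j = N then 0 else a i j) * p j s)"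
    proof (intro allI impI ballI)
      fix i s assume i: "i < Suc N" and s: "s \<in> S"
      show "p i s = (\<Sum>j\<in>insert N J. (if i = N then (if j = N then 1 else 0) else if j = N then 0 else a i j) * p j s)"
      proof (cases "i = N")
        case True
        have "(\<Sum>j\<in>J. (if j = N then 1 else 0) * p j s) = 0" using N by (intro sum.neutral) auto
        then show ?thesis using True N fin by simp
      next
        case False
        have "(\<Sum>j\<in>J. (if j = N then 0 else a i j) * p j s) = (\<Sum>j\<in>J. a i j * p j s)"
          using N by (intro sum.cong) auto
        then show ?thesis using False N fin rep i s by simp
      qed
    qed
    ultimately show ?thesis
      using J D' by (intro exI[of _ "insert N J"] exI[of _ D']
        exI[of _ "\<lambda>i j. if i = N then (if j = N then 1 else 0) else if j = N then 0 else a i j"]) auto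
  qed
qed

section \<open>Polynomial functions along sequences of functionals\<close>

lemma Pol_sum: "finite I \<Longrightarrow> (\<And>i. i \<in> I \<Longrightarrow> Pol A (f i)) \<Longrightarrow> Pol A (\<lambda>\<phi>. \<Sum>i\<in>I. f i \<phi>)"
  by (induction I rule: finite_induct) (auto intro: Pol.intros)

lemma Pol_cong: "Pol A p \<Longrightarrow> (\<And>a. a \<in> sa_carrier A \<Longrightarrow> \<phi> a = \<phi>' a) \<Longrightarrow> p \<phi> = p \<phi>'"
  by (induction rule: Pol.induct) auto

lemma Pol_tendsto: "Pol A p \<Longrightarrow> (\<And>a. a \<in> sa_carrier A \<Longrightarrow> ((\<lambda>n. \<phi> n a) \<longlongrightarrow> \<phi>' a) F) \<Longrightarrow> ((\<lambda>n. p (\<phi> n)) \<longlongrightarrow> p \<phi>') F"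
  by (induction rule: Pol.induct) (auto intro: tendsto_intros)

lemma Pol2_tendsto: "Pol2 A1 A2 f \<Longrightarrow> (\<And>a. a \<in> sa_carrier A1 \<Longrightarrow> ((\<lambda>n. \<phi> n a) \<longlongrightarrow> \<phi>' a) F) \<Longrightarrow>
    (\<And>a. a \<in> sa_carrier A2 \<Longrightarrow> ((\<lambda>n. \<theta> n a) \<longlongrightarrow> \<theta>' a) F) \<Longrightarrow> ((\<lambda>n. f (\<phi> n) (\<theta> n)) \<longlongrightarrow> f \<phi>' \<theta>') F"
  by (induction rule: Pol2.induct) (auto intro!: tendsto_intros intro: Pol_tendsto)

lemma Pol2_fix_left: "Pol2 A1 A2 f \<Longrightarrow> Pol A2 (\<lambda>\<theta>. f \<phi> \<theta>)"
  by (induction rule: Pol2.induct) (auto intro: Pol.intros)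

text \<open>\<open>d \<psi>\<close> is the derivative of \<open>p\<close> at the zero functional in
  direction \<open>\<psi>\<close>. It is taken along arbitrary sequences with
  \<open>N n * \<phi> n\<close> tending to \<open>\<psi>\<close>, because the approximating states
  are not multiples of \<open>\<psi>\<close>.\<close>

lemma Pol_derivative:
  fixes A :: "'v salg"
  assumes "Pol A p"
  shows "\<exists>d. (\<forall>c \<psi>. d (\<lambda>x. c * \<psi> x) = c * d \<psi>) \<and>
    (\<forall>\<phi> N \<psi>. filterlim N at_top sequentially \<longrightarrow>
      (\<forall>a\<in>sa_carrier A. (\<lambda>n. of_nat (N n) * \<phi> n a) \<longlonglongrightarrow> \<psi> a) \<longrightarrow>
      (\<lambda>n. of_nat (N n) * (p (\<phi> n) - p (\<lambda>_. 0))) \<longlonglongrightarrow> d \<psi>)"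
  using assms
proof induction
  case (const c)
  show ?case by (intro exI[of _ "\<lambda>_. 0"]) auto
next
  case (ev a)
  then show ?case by (intro exI[of _ "\<lambda>\<psi>. \<psi> a"]) auto
next
  case (add p q)
  then obtain d e where de: "\<forall>c \<psi>. d (\<lambda>x. c * \<psi> x) = c * d \<psi>" "\<forall>c \<psi>. e (\<lambda>x. c * \<psi> x) = c * e \<psi>"
    "\<forall>\<phi> N \<psi>. filterlim N at_top sequentially \<longrightarrow>
      (\<forall>a\<in>sa_carrier A. (\<lambda>n. of_nat (N n) * \<phi> n a) \<longlonglongrightarrow> \<psi> a) \<longrightarrow>
      (\<lambda>n. of_nat (N n) * (p (\<phi> n) - p (\<lambda>_. 0))) \<longlonglongrightarrow> d \<psi>"
    "\<forall>\<phi> N \<psi>. filterlim N at_top sequentially \<longrightarrow>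
      (\<forall>a\<in>sa_carrier A. (\<lambda>n. of_nat (N n) * \<phi> n a) \<longlonglongrightarrow> \<psi> a) \<longrightarrow>
      (\<lambda>n. of_nat (N n) * (q (\<phi> n) - q (\<lambda>_. 0))) \<longlonglongrightarrow> e \<psi>" by blast
  show ?case
  proof (intro exI[of _ "\<lambda>\<psi>. d \<psi> + e \<psi>"] conjI allI impI)
    fix \<phi> :: "nat \<Rightarrow> 'v \<Rightarrow> complex" and N \<psi>
    assume h: "filterlim N at_top sequentially" "\<forall>a\<in>sa_carrier A. (\<lambda>n. of_nat (N n) * \<phi> n a) \<longlonglongrightarrow> \<psi> a"
    have "(\<lambda>n. of_nat (N n) * (p (\<phi> n) - p (\<lambda>_. 0)) + of_nat (N n) * (q (\<phi> n) - q (\<lambda>_. 0))) \<longlonglongrightarrow> d \<psi> + e \<psi>"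
      using de(3,4) h by (intro tendsto_add) blast+
    then show "(\<lambda>n. of_nat (N n) * (p (\<phi> n) + q (\<phi> n) - (p (\<lambda>_. 0) + q (\<lambda>_. 0)))) \<longlonglongrightarrow> d \<psi> + e \<psi>"
      by (simp add: algebra_simps)
  qed (use de in \<open>simp add: distrib_left\<close>)
next
  case (mult p q)
  then obtain d e where de: "\<forall>c \<psi>. d (\<lambda>x. c * \<psi> x) = c * d \<psi>" "\<forall>c \<psi>. e (\<lambda>x. c * \<psi> x) = c * e \<psi>"
    "\<forall>\<phi> N \<psi>. filterlim N at_top sequentially \<longrightarrow>
      (\<forall>a\<in>sa_carrier A. (\<lambda>n. of_nat (N n) * \<phi> n a) \<longlonglongrightarrow> \<psi> a) \<longrightarrow>
      (\<lambda>n. of_nat (N n) * (p (\<phi> n) - p (\<lambda>_. 0))) \<longlonglongrightarrow> d \<psi>"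
    "\<forall>\<phi> N \<psi>. filterlim N at_top sequentially \<longrightarrow>
      (\<forall>a\<in>sa_carrier A. (\<lambda>n. of_nat (N n) * \<phi> n a) \<longlonglongrightarrow> \<psi> a) \<longrightarrow>
      (\<lambda>n. of_nat (N n) * (q (\<phi> n) - q (\<lambda>_. 0))) \<longlonglongrightarrow> e \<psi>" by blast
  show ?case
  proof (intro exI[of _ "\<lambda>\<psi>. d \<psi> * q (\<lambda>_. 0) + p (\<lambda>_. 0) * e \<psi>"] conjI allI impI)
    fix \<phi> :: "nat \<Rightarrow> 'v \<Rightarrow> complex" and N \<psi>
    assume h: "filterlim N at_top sequentially" "\<forall>a\<in>sa_carrier A. (\<lambda>n. of_nat (N n) * \<phi> n a) \<longlonglongrightarrow> \<psi> a"
    have z: "(\<lambda>n. \<phi> n a) \<longlonglongrightarrow> 0" if "a \<in> sa_carrier A" for a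
    proof -
      have "(\<lambda>n. inverse (of_nat (N n)) * (of_nat (N n) * \<phi> n a)) \<longlonglongrightarrow> 0 * \<psi> a"
        using h that by (intro tendsto_mult filterlim_compose[OF lim_inverse_n h(1)]) auto
      moreover have "eventually (\<lambda>n. N n > 0) sequentially" by (rule eventually_compose_filterlim[OF eventually_gt_at_top h(1)])
      then have "eventually (\<lambda>n. inverse (of_nat (N n)) * (of_nat (N n) * \<phi> n a) = \<phi> n a) sequentially"
        by eventually_elim simp
      ultimately show ?thesis using Lim_transform_eventually by force
    qed
    have q: "(\<lambda>n. q (\<phi> n)) \<longlonglongrightarrow> q (\<lambda>_. 0)" by (rule Pol_tendsto[OF \<open>Pol A q\<close>]) (rule z)
    have "(\<lambda>n. of_nat (N n) * (p (\<phi> n) - p (\<lambda>_. 0)) * q (\<phi> n) + p (\<lambda>_. 0) * (of_nat (N n) * (q (\<phi> n) - q (\<lambda>_. 0)))) \<longlonglongrightarrow>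
        d \<psi> * q (\<lambda>_. 0) + p (\<lambda>_. 0) * e \<psi>"
      using de(3,4) h by (intro tendsto_intros q) blast+
    then show "(\<lambda>n. of_nat (N n) * (p (\<phi> n) * q (\<phi> n) - p (\<lambda>_. 0) * q (\<lambda>_. 0))) \<longlonglongrightarrow> d \<psi> * q (\<lambda>_. 0) + p (\<lambda>_. 0) * e \<psi>"
      by (simp add: algebra_simps)
  qed (use de in \<open>simp add: algebra_simps\<close>)
qed

section \<open>Convolution semigroups\<close>

text \<open>This isolates the algebraic facts behind the analysis of exponentials, which is applied
  both to \<open>B\<close> and to the free algebra lying over it.\<close>

locale convolution_structure =
  fixes B :: "'v salg" and conv :: "('v \<Rightarrow> complex) \<Rightarrow> ('v \<Rightarrow> complex) \<Rightarrow> 'v \<Rightarrow> complex"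
  assumes alg: "is_alg B"
    and conv_lin: "lin_fun B \<phi> \<Longrightarrow> lin_fun B \<theta> \<Longrightarrow> lin_fun B (conv \<phi> \<theta>)"
    and conv_cong: "lin_fun B \<phi> \<Longrightarrow> lin_fun B \<theta> \<Longrightarrow> (\<And>a. a \<in> sa_carrier B \<Longrightarrow> \<phi>' a = \<phi> a) \<Longrightarrow>
      (\<And>a. a \<in> sa_carrier B \<Longrightarrow> \<theta>' a = \<theta> a) \<Longrightarrow> b \<in> sa_carrier B \<Longrightarrow> conv \<phi>' \<theta>' b = conv \<phi> \<theta> b"
    and conv_assoc: "lin_fun B \<phi> \<Longrightarrow> lin_fun B \<theta> \<Longrightarrow> lin_fun B \<omega> \<Longrightarrow> b \<in> sa_carrier B \<Longrightarrow>
      conv (conv \<phi> \<theta>) \<omega> b = conv \<phi> (conv \<theta> \<omega>) b"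
    and conv_zero_left: "lin_fun B \<phi> \<Longrightarrow> b \<in> sa_carrier B \<Longrightarrow> conv (\<lambda>_. 0) \<phi> b = \<phi> b"
    and conv_zero_right: "lin_fun B \<phi> \<Longrightarrow> b \<in> sa_carrier B \<Longrightarrow> conv \<phi> (\<lambda>_. 0) b = \<phi> b"
    and conv_poly: "b \<in> sa_carrier B \<Longrightarrow>
      \<exists>f. Pol2 B B f \<and> (\<forall>\<phi> \<theta>. lin_fun B \<phi> \<longrightarrow> lin_fun B \<theta> \<longrightarrow> conv \<phi> \<theta> b = f \<phi> \<theta>)"
begin

lemma lin_zero: "lin_fun B (\<lambda>_. 0)"
  by (simp add: lin_fun_def)

lemma lin_scale: "lin_fun B \<psi> \<Longrightarrow> lin_fun B (\<lambda>x. c * \<psi> x)"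
  by (auto simp: lin_fun_def algebra_simps)

lemma lin_cong: "lin_fun B \<phi> \<Longrightarrow> (\<And>a. a \<in> sa_carrier B \<Longrightarrow> \<phi>' a = \<phi> a) \<Longrightarrow> lin_fun B \<phi>'"
  using is_alg_add_closed[OF alg] is_alg_smul_closed[OF alg] by (simp add: lin_fun_def)

fun cpow :: "('v \<Rightarrow> complex) \<Rightarrow> nat \<Rightarrow> 'v \<Rightarrow> complex" where
  "cpow \<psi> 0 = (\<lambda>_. 0)"
| "cpow \<psi> (Suc n) = conv \<psi> (cpow \<psi> n)"

lemma lin_cpow: "lin_fun B \<psi> \<Longrightarrow> lin_fun B (cpow \<psi> n)"
  by (induction n) (auto intro: lin_zero conv_lin)

lemma cpow_add:
  assumes "lin_fun B \<psi>" "b \<in> sa_carrier B"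
  shows "cpow \<psi> (j + k) b = conv (cpow \<psi> j) (cpow \<psi> k) b"
  using assms(2)
proof (induction j arbitrary: b)
  case 0
  then show ?case by (simp add: conv_zero_left lin_cpow assms)
next
  case (Suc j)
  have "cpow \<psi> (Suc j + k) b = conv \<psi> (conv (cpow \<psi> j) (cpow \<psi> k)) b"
    unfolding cpow.simps(2) add_Suc
    by (rule conv_cong) (use Suc assms in \<open>auto intro: conv_lin lin_cpow\<close>)
  then show ?case using Suc.prems by (simp add: conv_assoc lin_cpow assms)
qed

lemma Pol_right_translate:
  assumes "Pol B p" and \<phi>: "lin_fun B \<phi>"
  shows "\<exists>p'. Pol B p' \<and> (\<forall>\<theta>. lin_fun B \<theta> \<longrightarrow> p (conv \<phi> \<theta>) = p' \<theta>)"
  using assms(1)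
proof induction
  case (const c)
  show ?case by (intro exI[of _ "\<lambda>_. c"]) (auto intro: Pol.const)
next
  case (ev a)
  obtain f where f: "Pol2 B B f" "\<forall>\<phi> \<theta>. lin_fun B \<phi> \<longrightarrow> lin_fun B \<theta> \<longrightarrow> conv \<phi> \<theta> a = f \<phi> \<theta>"
    using conv_poly[OF ev] by blast
  show ?case by (intro exI[of _ "\<lambda>\<theta>. f \<phi> \<theta>"]) (use f \<phi> in \<open>auto intro: Pol2_fix_left\<close>)
next
  case (add p q)
  then obtain p' q' where "Pol B p'" "Pol B q'" "\<forall>\<theta>. lin_fun B \<theta> \<longrightarrow> p (conv \<phi> \<theta>) = p' \<theta>"
    "\<forall>\<theta>. lin_fun B \<theta> \<longrightarrow> q (conv \<phi> \<theta>) = q' \<theta>" by blast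
  then show ?case by (intro exI[of _ "\<lambda>\<theta>. p' \<theta> + q' \<theta>"]) (auto intro: Pol.add)
next
  case (mult p q)
  then obtain p' q' where "Pol B p'" "Pol B q'" "\<forall>\<theta>. lin_fun B \<theta> \<longrightarrow> p (conv \<phi> \<theta>) = p' \<theta>"
    "\<forall>\<theta>. lin_fun B \<theta> \<longrightarrow> q (conv \<phi> \<theta>) = q' \<theta>" by blast
  then show ?case by (intro exI[of _ "\<lambda>\<theta>. p' \<theta> * q' \<theta>"]) (auto intro: Pol.mult)
qed

text \<open>A point evaluation fixes the left argument of the convolution, and the result is
  polynomial in the right one; combinations preserve this.\<close>

lemma evalcomb_translate:
  assumes "evalcomb {\<phi>. lin_fun B \<phi>} D" and p: "Pol B p"
  shows "\<exists>p'. Pol B p' \<and> (\<forall>\<theta>. lin_fun B \<theta> \<longrightarrow> D (\<lambda>\<phi>. p (conv \<phi> \<theta>)) = p' \<theta>)"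
  using assms(1)
proof induction
  case (ev s)
  then show ?case using Pol_right_translate[OF p] by simp
next
  case (add D E)
  then obtain p' q' where "Pol B p'" "Pol B q'" "\<forall>\<theta>. lin_fun B \<theta> \<longrightarrow> D (\<lambda>\<phi>. p (conv \<phi> \<theta>)) = p' \<theta>"
    "\<forall>\<theta>. lin_fun B \<theta> \<longrightarrow> E (\<lambda>\<phi>. p (conv \<phi> \<theta>)) = q' \<theta>" by blast
  then show ?case by (intro exI[of _ "\<lambda>\<theta>. p' \<theta> + q' \<theta>"]) (auto intro: Pol.add)
next
  case (scale D c)
  then obtain p' where "Pol B p'" "\<forall>\<theta>. lin_fun B \<theta> \<longrightarrow> D (\<lambda>\<phi>. p (conv \<phi> \<theta>)) = p' \<theta>" by blast
  then show ?case by (intro exI[of _ "\<lambda>\<theta>. c * p' \<theta>"]) (auto intro: Pol.mult Pol.const)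
qed

text \<open>The functions \<open>\<theta> \<mapsto> (\<phi> \<star> \<theta>) b\<close> span a finite-dimensional space on which convolution from the
  left acts by matrices with polynomial entries; this replaces the fundamental theorem on coalgebras.\<close>

lemma matrix_representation:
  assumes b: "b \<in> sa_carrier B"
  obtains J :: "nat set" and a :: "nat \<Rightarrow> complex" and q m where "finite J"
    "\<And>l. l \<in> J \<Longrightarrow> Pol B (q l)" "\<And>l j. l \<in> J \<Longrightarrow> j \<in> J \<Longrightarrow> Pol B (m l j)"
    "\<And>\<phi> \<theta> l. lin_fun B \<phi> \<Longrightarrow> lin_fun B \<theta> \<Longrightarrow> l \<in> J \<Longrightarrow> q l (conv \<phi> \<theta>) = (\<Sum>j\<in>J. m l j \<phi> * q j \<theta>)"
    "\<And>\<theta>. lin_fun B \<theta> \<Longrightarrow> \<theta> b = (\<Sum>l\<in>J. a l * q l \<theta>)"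
proof -
  let ?S = "{\<phi>. lin_fun B \<phi>}"
  obtain f where f: "Pol2 B B f" and fc: "\<And>\<phi> \<theta>. lin_fun B \<phi> \<Longrightarrow> lin_fun B \<theta> \<Longrightarrow> conv \<phi> \<theta> b = f \<phi> \<theta>"
    using conv_poly[OF b] by blast
  obtain N :: nat and p q where p: "\<And>i. i < N \<Longrightarrow> Pol B (p i)" and q: "\<And>i. i < N \<Longrightarrow> Pol B (q i)"
    and fs: "\<And>\<phi> \<theta>. f \<phi> \<theta> = (\<Sum>i<N. p i \<phi> * q i \<theta>)" by (rule Pol2_sum[OF f]) (rule that; assumption)
  have "?S \<noteq> {}" using lin_zero by blast
  from dual_functionals[OF this, of N p] obtain J D a where
    JD: "J \<subseteq> {..<N} \<and> (\<forall>j\<in>J. evalcomb ?S (D j)) \<and> (\<forall>j\<in>J. \<forall>k\<in>J. D j (p k) = (if j = k then 1 else 0)) \<and>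
      (\<forall>i<N. \<forall>s\<in>?S. p i s = (\<Sum>j\<in>J. a i j * p j s))" by (elim exE)
  note J = JD[THEN conjunct1]
  have D: "evalcomb ?S (D j)" if "j \<in> J" for j
    by (rule bspec[OF JD[THEN conjunct2, THEN conjunct1] that])
  have dual: "D j (p k) = (if j = k then 1 else 0)" if "j \<in> J" "k \<in> J" for j k
    by (rule bspec[OF bspec[OF JD[THEN conjunct2, THEN conjunct2, THEN conjunct1] that(1)] that(2)])
  have rep: "p i s = (\<Sum>j\<in>J. a i j * p j s)" if "i < N" "s \<in> ?S" for i s
    using JD[THEN conjunct2, THEN conjunct2, THEN conjunct2] that by (simp only:)
  have fin: "finite J" using J finite_subset by blast
  \<comment> \<open>Rewriting all \<open>p i\<close> in terms of the independent ones collects the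
    right factors into \<open>q'\<close>; these span the finite-dimensional space.\<close>
  define q' where "q' j \<theta> = (\<Sum>i<N. a i j * q i \<theta>)" for j \<theta>
  have fe: "f \<phi> \<theta> = (\<Sum>j\<in>J. p j \<phi> * q' j \<theta>)" if "lin_fun B \<phi>" for \<phi> \<theta>
  proof -
    have "f \<phi> \<theta> = (\<Sum>i<N. (\<Sum>j\<in>J. a i j * p j \<phi>) * q i \<theta>)"
      unfolding fs using rep that by (intro sum.cong) auto
    also have "\<dots> = (\<Sum>j\<in>J. \<Sum>i<N. a i j * p j \<phi> * q i \<theta>)"
      unfolding sum_distrib_right by (rule sum.swap)
    also have "\<dots> = (\<Sum>j\<in>J. p j \<phi> * q' j \<theta>)"
      unfolding q'_def sum_distrib_left by (intro sum.cong refl) (simp add: mult_ac)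
    finally show ?thesis .
  qed
  have ex: "\<exists>p'. Pol B p' \<and> (\<forall>\<theta>. lin_fun B \<theta> \<longrightarrow> D l (\<lambda>\<phi>. p j (conv \<phi> \<theta>)) = p' \<theta>)" if "l \<in> J" "j \<in> J" for l j
    by (rule evalcomb_translate[OF D[OF that(1)] p]) (use that J in auto)
  define m where "m l j = (SOME p'. Pol B p' \<and> (\<forall>\<theta>. lin_fun B \<theta> \<longrightarrow> D l (\<lambda>\<phi>. p j (conv \<phi> \<theta>)) = p' \<theta>))" for l j
  have m': "Pol B (m l j) \<and> (\<forall>\<theta>. lin_fun B \<theta> \<longrightarrow> D l (\<lambda>\<phi>. p j (conv \<phi> \<theta>)) = m l j \<theta>)" if "l \<in> J" "j \<in> J" for l j
    unfolding m_def by (rule someI_ex[OF ex[OF that]])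
  note m = m'[THEN conjunct1]
  have mD: "D l (\<lambda>\<phi>. p j (conv \<phi> \<theta>)) = m l j \<theta>" if "l \<in> J" "j \<in> J" "lin_fun B \<theta>" for l j \<theta>
    using m'[OF that(1,2)] that(3) by blast
  show thesis
  proof (rule that[of J q' m "\<lambda>j. p j (\<lambda>_. 0)"])
    show "finite J" by (rule fin)
    show "Pol B (q' l)" for l
      unfolding q'_def by (intro Pol_sum Pol.mult Pol.const q) auto
    show "\<And>l j. l \<in> J \<Longrightarrow> j \<in> J \<Longrightarrow> Pol B (m l j)" by (rule m)
    fix \<theta> assume \<theta>: "lin_fun B \<theta>"
    \<comment> \<open>The zero functional is the unit of the convolution, so evaluating the left
      variable there recovers \<open>\<theta> b\<close>.\<close>
    have "\<theta> b = f (\<lambda>_. 0) \<theta>" using fc[OF lin_zero \<theta>] conv_zero_left[OF \<theta> b] by simp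
    then show "\<theta> b = (\<Sum>l\<in>J. p l (\<lambda>_. 0) * q' l \<theta>)" using fe[OF lin_zero] by simp
    fix \<omega> l assume \<omega>: "lin_fun B \<omega>" and l: "l \<in> J"
    \<comment> \<open>The dual functional \<open>D l\<close> is applied in \<open>\<phi>\<close> to
      both bracketings of the triple convolution: one yields the coordinate \<open>q' l\<close>, the
      other the matrix \<open>m\<close> acting on the \<open>q' j\<close>.\<close>
    have "D l (\<lambda>\<phi>. f \<phi> (conv \<theta> \<omega>)) = D l (\<lambda>\<phi>. \<Sum>j\<in>J. p j \<phi> * q' j (conv \<theta> \<omega>))"
      by (rule evalcomb_cong[OF D[OF l]]) (use fe in auto)
    also have "\<dots> = (\<Sum>j\<in>J. D l (p j) * q' j (conv \<theta> \<omega>))"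
      unfolding evalcomb_sum[OF fin D[OF l]] evalcomb_scale[OF D[OF l]] ..
    also have "\<dots> = (\<Sum>j\<in>J. if l = j then q' j (conv \<theta> \<omega>) else 0)"
      using dual l by (intro sum.cong) auto
    also have "\<dots> = q' l (conv \<theta> \<omega>)" using fin l by simp
    finally have 1: "D l (\<lambda>\<phi>. f \<phi> (conv \<theta> \<omega>)) = q' l (conv \<theta> \<omega>)" .
    have "D l (\<lambda>\<phi>. f \<phi> (conv \<theta> \<omega>)) = D l (\<lambda>\<phi>. \<Sum>j\<in>J. p j (conv \<phi> \<theta>) * q' j \<omega>)"
    proof (rule evalcomb_cong[OF D[OF l]])
      fix \<phi> assume "\<phi> \<in> ?S"
      then have \<phi>: "lin_fun B \<phi>" by simp
      have "f \<phi> (conv \<theta> \<omega>) = conv (conv \<phi> \<theta>) \<omega> b"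
        using fc[OF \<phi> conv_lin[OF \<theta> \<omega>]] conv_assoc[OF \<phi> \<theta> \<omega> b] by simp
      also have "\<dots> = f (conv \<phi> \<theta>) \<omega>" by (rule fc[OF conv_lin[OF \<phi> \<theta>] \<omega>])
      finally show "f \<phi> (conv \<theta> \<omega>) = (\<Sum>j\<in>J. p j (conv \<phi> \<theta>) * q' j \<omega>)"
        using fe[OF conv_lin[OF \<phi> \<theta>]] by simp
    qed
    also have "\<dots> = (\<Sum>j\<in>J. D l (\<lambda>\<phi>. p j (conv \<phi> \<theta>)) * q' j \<omega>)"
      unfolding evalcomb_sum[OF fin D[OF l]] evalcomb_scale[OF D[OF l]] ..
    also have "\<dots> = (\<Sum>j\<in>J. m l j \<theta> * q' j \<omega>)" using mD l \<theta> by (intro sum.cong) auto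
    finally show "q' l (conv \<theta> \<omega>) = (\<Sum>j\<in>J. m l j \<theta> * q' j \<omega>)" unfolding 1 .
  qed
qed

text \<open>\<open>E k \<psi>\<close> plays the role of the \<open>k\<close>-th convolution power of
  \<open>D(\<psi>)\<close> at \<open>b\<close>, so the limit is the exponential series.
  \<open>E\<close> is fixed before \<open>\<psi>\<close>; its homogeneity of degree \<open>k\<close>
  later gives a power series in the time parameter.\<close>

lemma exp_limit:
  assumes b: "b \<in> sa_carrier B"
  obtains E :: "nat \<Rightarrow> ('v \<Rightarrow> complex) \<Rightarrow> complex" where
    "\<And>c \<psi> k. E k (\<lambda>x. c * \<psi> x) = c ^ k * E k \<psi>"
    "\<And>\<psi> \<phi> N. (\<And>n. lin_fun B (\<phi> n)) \<Longrightarrow> filterlim N at_top sequentially \<Longrightarrow>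
      (\<And>a. a \<in> sa_carrier B \<Longrightarrow> (\<lambda>n. of_nat (N n) * \<phi> n a) \<longlonglongrightarrow> \<psi> a) \<Longrightarrow>
      summable (\<lambda>k. norm (E k \<psi> / fact k)) \<and> (\<lambda>n. cpow (\<phi> n) (N n) b) \<longlonglongrightarrow> suminf (\<lambda>k. E k \<psi> / fact k)"
proof -
  obtain J :: "nat set" and a q m where J: "finite J"
    and q: "\<And>l. l \<in> J \<Longrightarrow> Pol B (q l)" and m: "\<And>l j. l \<in> J \<Longrightarrow> j \<in> J \<Longrightarrow> Pol B (m l j)"
    and qm: "\<And>\<phi> \<theta> l. lin_fun B \<phi> \<Longrightarrow> lin_fun B \<theta> \<Longrightarrow> l \<in> J \<Longrightarrow> q l (conv \<phi> \<theta>) = (\<Sum>j\<in>J. m l j \<phi> * q j \<theta>)"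
    and bq: "\<And>\<theta>. lin_fun B \<theta> \<Longrightarrow> \<theta> b = (\<Sum>l\<in>J. a l * q l \<theta>)"
    by (rule matrix_representation[OF b]) (rule that; assumption)
  let ?P = "\<lambda>l j d. (\<forall>c \<psi>. d (\<lambda>x. c * \<psi> x) = c * d \<psi>) \<and>
    (\<forall>\<phi> N \<psi>. filterlim N at_top sequentially \<longrightarrow>
      (\<forall>a\<in>sa_carrier B. (\<lambda>n. of_nat (N n) * \<phi> n a) \<longlonglongrightarrow> \<psi> a) \<longrightarrow>
      (\<lambda>n. of_nat (N n) * (m l j (\<phi> n) - m l j (\<lambda>_. 0))) \<longlonglongrightarrow> d \<psi>)"
  have ex: "\<exists>d. ?P l j d" if "l \<in> J" "j \<in> J" for l j by (rule Pol_derivative[OF m[OF that]])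
  define d where "d l j = (if l \<in> J \<and> j \<in> J then SOME d. ?P l j d else (\<lambda>_. 0))" for l j
  have d: "?P l j (d l j)" if "l \<in> J" "j \<in> J" for l j
    unfolding d_def using someI_ex[OF ex[OF that]] that by simp
  have dc: "d l j (\<lambda>x. c * \<psi> x) = c * d l j \<psi>" for l j c \<psi>
    using d[of l j] by (cases "l \<in> J \<and> j \<in> J") (auto simp: d_def)
  let ?x0 = "\<lambda>l. q l (\<lambda>_. 0)"
  define E where "E k \<psi> = (\<Sum>l\<in>J. a l * mat_iter J (\<lambda>l j. d l j \<psi>) k ?x0 l)" for k \<psi>
  show thesis
  proof (rule that[of E])
    show "E k (\<lambda>x. c * \<psi> x) = c ^ k * E k \<psi>" for c \<psi> k
      unfolding E_def dc mat_iter_scale sum_distrib_left by (intro sum.cong refl) (simp add: mult_ac)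
    fix \<psi> \<phi> N assume \<phi>: "\<And>n. lin_fun B (\<phi> n)" and N: "filterlim N at_top sequentially"
      and lim: "\<And>a. a \<in> sa_carrier B \<Longrightarrow> (\<lambda>n. of_nat (N n) * \<phi> n a) \<longlonglongrightarrow> \<psi> a"
    \<comment> \<open>The matrix of a single step, minus the matrix of the unit, blown up by the
      number of steps; it converges to the derivative in direction \<open>\<psi>\<close>.\<close>
    define A where "A n l j = of_nat (N n) * (m l j (\<phi> n) - m l j (\<lambda>_. 0))" for n l j
    have A: "(\<lambda>n. A n l j) \<longlonglongrightarrow> d l j \<psi>" if "l \<in> J" "j \<in> J" for l j
      unfolding A_def using d[OF that] N lim by blast
    note C = compound_limit[OF J N, of A "\<lambda>l j. d l j \<psi>" _ ?x0, OF A]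
    have Esum: "E k \<psi> / fact k = (\<Sum>l\<in>J. a l * (mat_iter J (\<lambda>l j. d l j \<psi>) k ?x0 l / fact k))" for k
      unfolding E_def sum_divide_distrib by simp
    have summ: "summable (\<lambda>k. mat_iter J (\<lambda>l j. d l j \<psi>) k ?x0 l / fact k)" if "l \<in> J" for l
      using C[OF _ _ that] by (blast intro: summable_norm_cancel)
    have s1: "summable (\<lambda>k. norm (E k \<psi> / fact k))"
    proof (rule summable_comparison_test')
      show "summable (\<lambda>k. \<Sum>l\<in>J. norm (a l) * norm (mat_iter J (\<lambda>l j. d l j \<psi>) k ?x0 l / fact k))"
        using C by (intro summable_sum summable_mult) blast
      show "norm (norm (E k \<psi> / fact k)) \<le> (\<Sum>l\<in>J. norm (a l) * norm (mat_iter J (\<lambda>l j. d l j \<psi>) k ?x0 l / fact k))" if "k \<ge> 0" for k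
        unfolding Esum norm_mult[symmetric] by (simp add: norm_sum)
    qed
    have s2: "suminf (\<lambda>k. E k \<psi> / fact k) = (\<Sum>l\<in>J. a l * suminf (\<lambda>k. mat_iter J (\<lambda>l j. d l j \<psi>) k ?x0 l / fact k))"
      unfolding Esum by (rule sums_unique[symmetric], intro sums_sum sums_mult summable_sums summ)
    have it: "q l (cpow (\<phi> n) (N n)) = (\<Sum>k\<le>N n. of_nat (N n choose k) * ((1 / of_nat (N n)) ^ k * mat_iter J (A n) k ?x0 l))"
      if l: "l \<in> J" and Nn: "N n > 0" for l n
    proof -
      have "q l (cpow (\<phi> n) (Suc k)) = q l (cpow (\<phi> n) k) + (1 / of_nat (N n)) * (\<Sum>j\<in>J. A n l j * q j (cpow (\<phi> n) k))"
        if "l \<in> J" for k l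
      proof -
        \<comment> \<open>The matrix at the zero functional need not be the identity matrix, but it
          fixes every vector of the form \<open>q \<theta>\<close>, and this is enough for the
          recursion.\<close>
        have "q l (cpow (\<phi> n) k) = q l (conv (\<lambda>_. 0) (cpow (\<phi> n) k))"
          by (rule Pol_cong[OF q[OF that]]) (simp add: conv_zero_left lin_cpow \<phi>)
        also have "\<dots> = (\<Sum>j\<in>J. m l j (\<lambda>_. 0) * q j (cpow (\<phi> n) k))"
          by (rule qm[OF lin_zero lin_cpow[OF \<phi>] that])
        finally have 1: "q l (cpow (\<phi> n) k) = (\<Sum>j\<in>J. m l j (\<lambda>_. 0) * q j (cpow (\<phi> n) k))" .
        have "(1 / of_nat (N n)) * (\<Sum>j\<in>J. A n l j * q j (cpow (\<phi> n) k)) =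
          (\<Sum>j\<in>J. (m l j (\<phi> n) - m l j (\<lambda>_. 0)) * q j (cpow (\<phi> n) k))"
          unfolding sum_distrib_left A_def using Nn by (intro sum.cong) auto
        also have "\<dots> = (\<Sum>j\<in>J. m l j (\<phi> n) * q j (cpow (\<phi> n) k)) - (\<Sum>j\<in>J. m l j (\<lambda>_. 0) * q j (cpow (\<phi> n) k))"
          by (simp add: left_diff_distrib sum_subtractf)
        finally show ?thesis using 1 qm[OF \<phi> lin_cpow[OF \<phi>] that, of n n k] by simp
      qed
      from linear_recursion[of J "\<lambda>k l. q l (cpow (\<phi> n) k)" "1 / of_nat (N n)" "A n", OF J this l, of "N n"]
      show ?thesis by simp
    qed
    have "(\<lambda>n. \<Sum>l\<in>J. a l * (\<Sum>k\<le>N n. of_nat (N n choose k) * ((1 / of_nat (N n)) ^ k * mat_iter J (A n) k ?x0 l))) \<longlonglongrightarrow>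
        suminf (\<lambda>k. E k \<psi> / fact k)"
      unfolding s2 using C by (intro tendsto_intros) blast
    moreover have "eventually (\<lambda>n. N n > 0) sequentially"
      by (rule eventually_compose_filterlim[OF eventually_gt_at_top N])
    then have "eventually (\<lambda>n. (\<Sum>l\<in>J. a l * (\<Sum>k\<le>N n. of_nat (N n choose k) * ((1 / of_nat (N n)) ^ k * mat_iter J (A n) k ?x0 l))) =
        cpow (\<phi> n) (N n) b) sequentially"
    proof eventually_elim
      case (elim n)
      show ?case unfolding bq[OF lin_cpow[OF \<phi>]] using it elim by (intro sum.cong) auto
    qed
    ultimately have "(\<lambda>n. cpow (\<phi> n) (N n) b) \<longlonglongrightarrow> suminf (\<lambda>k. E k \<psi> / fact k)"
      by (rule Lim_transform_eventually)
    with s1 show "summable (\<lambda>k. norm (E k \<psi> / fact k)) \<and> (\<lambda>n. cpow (\<phi> n) (N n) b) \<longlonglongrightarrow> suminf (\<lambda>k. E k \<psi> / fact k)"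
      by simp
  qed
qed

definition cexp :: "('v \<Rightarrow> complex) \<Rightarrow> 'v \<Rightarrow> complex" where
  "cexp \<psi> b = lim (\<lambda>n. cpow (\<lambda>x. \<psi> x / of_nat n) n b)"

lemma lin_div: "lin_fun B \<psi> \<Longrightarrow> lin_fun B (\<lambda>x. \<psi> x / c)"
  using lin_scale[of \<psi> "1 / c"] by simp

lemma tendsto_div_mult: "(\<lambda>n. of_nat n * (z / of_nat n)) \<longlonglongrightarrow> (z :: complex)"
proof (rule Lim_transform_eventually[OF tendsto_const])
  show "eventually (\<lambda>n. z = of_nat n * (z / of_nat n)) sequentially"
    using eventually_gt_at_top[of 0] by eventually_elim simp
qed

lemma cexp_series:
  assumes b: "b \<in> sa_carrier B"
  obtains E :: "nat \<Rightarrow> ('v \<Rightarrow> complex) \<Rightarrow> complex" where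
    "\<And>c \<psi> k. E k (\<lambda>x. c * \<psi> x) = c ^ k * E k \<psi>"
    "\<And>\<psi>. lin_fun B \<psi> \<Longrightarrow> summable (\<lambda>k. norm (E k \<psi> / fact k))"
    "\<And>\<psi>. lin_fun B \<psi> \<Longrightarrow> cexp \<psi> b = suminf (\<lambda>k. E k \<psi> / fact k)"
    "\<And>\<psi> \<phi> N. lin_fun B \<psi> \<Longrightarrow> (\<And>n. lin_fun B (\<phi> n)) \<Longrightarrow> filterlim N at_top sequentially \<Longrightarrow>
      (\<And>a. a \<in> sa_carrier B \<Longrightarrow> (\<lambda>n. of_nat (N n) * \<phi> n a) \<longlonglongrightarrow> \<psi> a) \<Longrightarrow>
      (\<lambda>n. cpow (\<phi> n) (N n) b) \<longlonglongrightarrow> cexp \<psi> b"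
proof (rule exp_limit[OF b])
  fix E :: "nat \<Rightarrow> ('v \<Rightarrow> complex) \<Rightarrow> complex"
  assume hom: "\<And>c \<psi> k. E k (\<lambda>x. c * \<psi> x) = c ^ k * E k \<psi>"
    and lim: "\<And>\<psi> \<phi> N. (\<And>n. lin_fun B (\<phi> n)) \<Longrightarrow> filterlim N at_top sequentially \<Longrightarrow>
      (\<And>a. a \<in> sa_carrier B \<Longrightarrow> (\<lambda>n. of_nat (N n) * \<phi> n a) \<longlonglongrightarrow> \<psi> a) \<Longrightarrow>
      summable (\<lambda>k. norm (E k \<psi> / fact k)) \<and> (\<lambda>n. cpow (\<phi> n) (N n) b) \<longlonglongrightarrow> suminf (\<lambda>k. E k \<psi> / fact k)"
  have L: "summable (\<lambda>k. norm (E k \<psi> / fact k)) \<and>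
      (\<lambda>n. cpow (\<lambda>x. \<psi> x / of_nat n) n b) \<longlonglongrightarrow> suminf (\<lambda>k. E k \<psi> / fact k)" if "lin_fun B \<psi>" for \<psi>
    by (rule lim[OF lin_div[OF that] filterlim_ident tendsto_div_mult])
  then have e: "cexp \<psi> b = suminf (\<lambda>k. E k \<psi> / fact k)" if "lin_fun B \<psi>" for \<psi>
    unfolding cexp_def using that limI by blast
  show thesis
  proof (rule that[of E])
    show "\<And>c \<psi> k. E k (\<lambda>x. c * \<psi> x) = c ^ k * E k \<psi>" by (rule hom)
    show "\<And>\<psi>. lin_fun B \<psi> \<Longrightarrow> summable (\<lambda>k. norm (E k \<psi> / fact k))" using L by blast
    show "\<And>\<psi>. lin_fun B \<psi> \<Longrightarrow> cexp \<psi> b = suminf (\<lambda>k. E k \<psi> / fact k)" by (rule e)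
    show "(\<lambda>n. cpow (\<phi> n) (N n) b) \<longlonglongrightarrow> cexp \<psi> b"
      if "lin_fun B \<psi>" "\<And>n. lin_fun B (\<phi> n)" "filterlim N at_top sequentially"
        "\<And>a. a \<in> sa_carrier B \<Longrightarrow> (\<lambda>n. of_nat (N n) * \<phi> n a) \<longlonglongrightarrow> \<psi> a" for \<psi> \<phi> N
      unfolding e[OF that(1)] using lim[OF that(2-4)] by (rule conjunct2)
  qed
qed

lemma cpow_tendsto_cexp:
  assumes "lin_fun B \<psi>" "\<And>n. lin_fun B (\<phi> n)" "filterlim N at_top sequentially"
    "\<And>a. a \<in> sa_carrier B \<Longrightarrow> (\<lambda>n. of_nat (N n) * \<phi> n a) \<longlonglongrightarrow> \<psi> a" "b \<in> sa_carrier B"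
  shows "(\<lambda>n. cpow (\<phi> n) (N n) b) \<longlonglongrightarrow> cexp \<psi> b"
proof (rule cexp_series[OF assms(5)])
  fix E :: "nat \<Rightarrow> ('v \<Rightarrow> complex) \<Rightarrow> complex"
  assume lim: "\<And>\<psi> \<phi> N. lin_fun B \<psi> \<Longrightarrow> (\<And>n. lin_fun B (\<phi> n)) \<Longrightarrow> filterlim N at_top sequentially \<Longrightarrow>
      (\<And>a. a \<in> sa_carrier B \<Longrightarrow> (\<lambda>n. of_nat (N n) * \<phi> n a) \<longlonglongrightarrow> \<psi> a) \<Longrightarrow>
      (\<lambda>n. cpow (\<phi> n) (N n) b) \<longlonglongrightarrow> cexp \<psi> b"
  show ?thesis by (rule lim[OF assms(1-4)])
qed

lemma cpow_div_tendsto_cexp: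
  assumes "lin_fun B \<psi>" "b \<in> sa_carrier B"
  shows "(\<lambda>n. cpow (\<lambda>x. \<psi> x / of_nat n) n b) \<longlonglongrightarrow> cexp \<psi> b"
  by (rule cpow_tendsto_cexp[OF assms(1) lin_div[OF assms(1)] filterlim_ident tendsto_div_mult assms(2)])

lemma lin_cexp:
  assumes \<psi>: "lin_fun B \<psi>" shows "lin_fun B (cexp \<psi>)"
  unfolding lin_fun_def
proof (intro conjI ballI allI)
  note c = cpow_div_tendsto_cexp[OF \<psi>]
  have l: "lin_fun B (cpow (\<lambda>x. \<psi> x / of_nat n) n)" for n by (rule lin_cpow[OF lin_div[OF \<psi>]])
  show "cexp \<psi> (sa_add B a b) = cexp \<psi> a + cexp \<psi> b" if "a \<in> sa_carrier B" "b \<in> sa_carrier B" for a b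
    using tendsto_add[OF c[OF that(1)] c[OF that(2)]] c[OF is_alg_add_closed[OF alg that]]
    by (auto simp: lin_fun_add[OF l that] intro: LIMSEQ_unique)
  show "cexp \<psi> (sa_smul B k a) = k * cexp \<psi> a" if "a \<in> sa_carrier B" for k a
    using tendsto_mult[OF tendsto_const[of k] c[OF that]] c[OF is_alg_smul_closed[OF alg that, of k]]
    by (auto simp: lin_fun_smul[OF l that] intro: LIMSEQ_unique)
qed

lemma conv_tendsto:
  assumes "\<And>n. lin_fun B (\<phi> n)" "\<And>n. lin_fun B (\<theta> n)" "lin_fun B \<phi>'" "lin_fun B \<theta>'"
    "\<And>a. a \<in> sa_carrier B \<Longrightarrow> (\<lambda>n. \<phi> n a) \<longlonglongrightarrow> \<phi>' a" "\<And>a. a \<in> sa_carrier B \<Longrightarrow> (\<lambda>n. \<theta> n a) \<longlonglongrightarrow> \<theta>' a"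
    and b: "b \<in> sa_carrier B"
  shows "(\<lambda>n. conv (\<phi> n) (\<theta> n) b) \<longlonglongrightarrow> conv \<phi>' \<theta>' b"
proof -
  obtain f where f: "Pol2 B B f" and fc: "\<And>\<phi> \<theta>. lin_fun B \<phi> \<Longrightarrow> lin_fun B \<theta> \<Longrightarrow> conv \<phi> \<theta> b = f \<phi> \<theta>"
    using conv_poly[OF b] by blast
  have "(\<lambda>n. f (\<phi> n) (\<theta> n)) \<longlonglongrightarrow> f \<phi>' \<theta>'"
    by (rule Pol2_tendsto[OF f]) (use assms in auto)
  then show ?thesis using fc assms by simp
qed

lemma cexp_zero: "b \<in> sa_carrier B \<Longrightarrow> cexp (\<lambda>_. 0) b = 0"
proof -
  assume b: "b \<in> sa_carrier B"
  have "cpow (\<lambda>_. 0) n a = 0" if "a \<in> sa_carrier B" for n a using that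
    by (induction n arbitrary: a) (simp_all add: conv_zero_left lin_cpow lin_zero)
  then show ?thesis using b by (simp add: cexp_def)
qed

lemma floor_limits:
  fixes s :: real and z :: complex
  assumes "s > 0"
  shows "filterlim (\<lambda>n. nat \<lfloor>s * real n\<rfloor>) at_top sequentially"
    and "(\<lambda>n. of_nat (nat \<lfloor>s * real n\<rfloor>) * (z / of_nat n)) \<longlonglongrightarrow> of_real s * z"
proof -
  have 1: "(\<lambda>n. real (nat \<lfloor>s * real n\<rfloor>) / real n) \<longlonglongrightarrow> s"
  proof (rule tendsto_sandwich)
    show "eventually (\<lambda>n. s - 1 / real n \<le> real (nat \<lfloor>s * real n\<rfloor>) / real n) sequentially"
      using eventually_gt_at_top[of 0]
    proof eventually_elim
      case (elim n)
      have "(s * real n - 1) / real n \<le> real (nat \<lfloor>s * real n\<rfloor>) / real n"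
        by (rule divide_right_mono) linarith+
      then show ?case using elim by (simp add: diff_divide_distrib)
    qed
    show "eventually (\<lambda>n. real (nat \<lfloor>s * real n\<rfloor>) / real n \<le> s) sequentially"
      using eventually_gt_at_top[of 0]
    proof eventually_elim
      case (elim n)
      have "real (nat \<lfloor>s * real n\<rfloor>) / real n \<le> s * real n / real n"
        using assms by (intro divide_right_mono) simp_all
      then show ?case using elim by simp
    qed
    show "(\<lambda>n. s - 1 / real n) \<longlonglongrightarrow> s" using tendsto_diff[OF tendsto_const lim_1_over_n, of s] by simp
  qed simp
  have "(\<lambda>n. of_real (real (nat \<lfloor>s * real n\<rfloor>) / real n) * z) \<longlonglongrightarrow> of_real s * z"
    by (intro tendsto_mult tendsto_of_real 1 tendsto_const)
  then show "(\<lambda>n. of_nat (nat \<lfloor>s * real n\<rfloor>) * (z / of_nat n)) \<longlonglongrightarrow> of_real s * z" by simp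
  have "filterlim (\<lambda>n. s * real n) at_top sequentially"
    by (rule filterlim_tendsto_pos_mult_at_top[OF tendsto_const assms filterlim_real_sequentially])
  then have "filterlim (\<lambda>n. \<lfloor>s * real n\<rfloor>) at_top sequentially"
    by (rule filterlim_compose[OF filterlim_floor_sequentially])
  then show "filterlim (\<lambda>n. nat \<lfloor>s * real n\<rfloor>) at_top sequentially"
    by (rule filterlim_compose[OF filterlim_nat_sequentially])
qed

text \<open>Both exponentials are limits of powers of the same functionals
  \<open>\<psi> / n\<close>, with exponents the integer parts of \<open>s n\<close> and
  \<open>t n\<close>. The power law \<open>cpow_add\<close> passes to the limit, and no series have
  to be multiplied. Zero times are separate because the exponents must tend to infinity.\<close>

lemma cexp_semigroup:
  fixes s t :: real
  assumes \<psi>: "lin_fun B \<psi>" and st: "s \<ge> 0" "t \<ge> 0" and b: "b \<in> sa_carrier B"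
  shows "cexp (\<lambda>x. of_real (s + t) * \<psi> x) b = conv (cexp (\<lambda>x. of_real s * \<psi> x)) (cexp (\<lambda>x. of_real t * \<psi> x)) b"
proof -
  have l: "lin_fun B (\<lambda>x. c * \<psi> x)" for c by (rule lin_scale[OF \<psi>])
  note le = lin_cexp[OF l]
  consider "s = 0" | "t = 0" | "s > 0" "t > 0" using st by linarith
  then show ?thesis
  proof cases
    case 1
    have "conv (cexp (\<lambda>x. of_real s * \<psi> x)) (cexp (\<lambda>x. of_real t * \<psi> x)) b = conv (\<lambda>_. 0) (cexp (\<lambda>x. of_real t * \<psi> x)) b"
      by (rule conv_cong[OF lin_zero le]) (use 1 b cexp_zero in auto)
    then show ?thesis using 1 conv_zero_left[OF le b] by simp
  next
    case 2
    have "conv (cexp (\<lambda>x. of_real s * \<psi> x)) (cexp (\<lambda>x. of_real t * \<psi> x)) b = conv (cexp (\<lambda>x. of_real s * \<psi> x)) (\<lambda>_. 0) b"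
      by (rule conv_cong[OF le lin_zero]) (use 2 b cexp_zero in auto)
    then show ?thesis using 2 conv_zero_right[OF le b] by simp
  next
    case 3
    let ?\<phi> = "\<lambda>n x. \<psi> x / of_nat n"
    let ?N = "\<lambda>s n. nat \<lfloor>s * real n\<rfloor>"
    have lim: "(\<lambda>n. cpow (?\<phi> n) (?N s n) a) \<longlonglongrightarrow> cexp (\<lambda>x. of_real s * \<psi> x) a"
      if "s > 0" "a \<in> sa_carrier B" for a s
      by (rule cpow_tendsto_cexp[OF l lin_div[OF \<psi>] floor_limits(1)[OF that(1)] floor_limits(2)[OF that(1)] that(2)])
    have "(\<lambda>n. cpow (?\<phi> n) (?N s n + ?N t n) b) \<longlonglongrightarrow> cexp (\<lambda>x. of_real (s + t) * \<psi> x) b"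
    proof (rule cpow_tendsto_cexp[OF l lin_div[OF \<psi>] _ _ b])
      show "filterlim (\<lambda>n. ?N s n + ?N t n) at_top sequentially"
        by (rule filterlim_at_top_mono[OF floor_limits(1)[OF 3(1)]]) auto
      show "(\<lambda>n. of_nat (?N s n + ?N t n) * (\<psi> a / of_nat n)) \<longlonglongrightarrow> of_real (s + t) * \<psi> a" for a
        using tendsto_add[OF floor_limits(2)[OF 3(1), of "\<psi> a"] floor_limits(2)[OF 3(2), of "\<psi> a"]]
        by (simp add: distrib_right add_divide_distrib)
    qed
    moreover have "(\<lambda>n. conv (cpow (?\<phi> n) (?N s n)) (cpow (?\<phi> n) (?N t n)) b) \<longlonglongrightarrow>
        conv (cexp (\<lambda>x. of_real s * \<psi> x)) (cexp (\<lambda>x. of_real t * \<psi> x)) b"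
      by (rule conv_tendsto[OF _ _ le le lim[OF 3(1)] lim[OF 3(2)] b]) (rule lin_cpow[OF lin_div[OF \<psi>]])+
    ultimately show ?thesis
      by (simp add: cpow_add[OF lin_div[OF \<psi>] b] LIMSEQ_unique)
  qed
qed

text \<open>Homogeneity of the coefficients makes the exponential of \<open>t \<psi>\<close> at
  \<open>b\<close> a power series in \<open>t\<close>, convergent at 1 and hence continuous at
  0.\<close>

lemma cexp_continuous_at_zero:
  assumes \<psi>: "lin_fun B \<psi>" and b: "b \<in> sa_carrier B"
  shows "((\<lambda>t. cexp (\<lambda>x. complex_of_real t * \<psi> x) b) \<longlongrightarrow> 0) (at_right 0)"
proof (rule cexp_series[OF b])
  fix E :: "nat \<Rightarrow> ('v \<Rightarrow> complex) \<Rightarrow> complex"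
  assume hom: "\<And>c \<psi> k. E k (\<lambda>x. c * \<psi> x) = c ^ k * E k \<psi>"
    and s: "\<And>\<psi>. lin_fun B \<psi> \<Longrightarrow> summable (\<lambda>k. norm (E k \<psi> / fact k))"
    and e: "\<And>\<psi>. lin_fun B \<psi> \<Longrightarrow> cexp \<psi> b = suminf (\<lambda>k. E k \<psi> / fact k)"
  have eq: "cexp (\<lambda>x. complex_of_real t * \<psi> x) b = suminf (\<lambda>k. (E k \<psi> / fact k) * of_real t ^ k)" for t
    unfolding e[OF lin_scale[OF \<psi>]] hom by (simp add: mult.commute)
  have "isCont (\<lambda>z. suminf (\<lambda>k. (E k \<psi> / fact k) * z ^ k)) 0"
    by (rule isCont_powser[of _ 1]) (use summable_norm_cancel[OF s[OF \<psi>]] in simp_all)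
  moreover have "((\<lambda>t. complex_of_real t) \<longlongrightarrow> 0) (at_right 0)"
    using tendsto_of_real[OF tendsto_ident_at[of 0 "{0<..}"]] by simp
  ultimately have "((\<lambda>t. suminf (\<lambda>k. (E k \<psi> / fact k) * of_real t ^ k)) \<longlongrightarrow> suminf (\<lambda>k. (E k \<psi> / fact k) * 0 ^ k)) (at_right 0)"
    by (rule isCont_tendsto_compose)
  moreover have "suminf (\<lambda>k. (E k \<psi> / fact k) * 0 ^ k) = 0"
    using eq[of 0] cexp_zero[OF b] by simp
  ultimately show ?thesis by (simp add: eq)
qed

end

section \<open>Generators of continuous convolution semigroups\<close>

lemma average_tendsto:
  fixes f :: "real \<Rightarrow> complex"
  assumes cont: "continuous_on {a..} f"
  shows "((\<lambda>t. integral {a..a + t} f / of_real t) \<longlongrightarrow> f a) (at_right 0)"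
proof (rule tendstoI)
  fix e :: real assume e: "e > 0"
  have "continuous (at a within {a..}) f"
    using cont by (simp add: continuous_on_eq_continuous_within)
  then obtain d where d: "d > 0" "\<And>x. x \<ge> a \<Longrightarrow> dist x a < d \<Longrightarrow> dist (f x) (f a) < e / 2"
    using e unfolding continuous_within_eps_delta by (metis atLeast_iff half_gt_zero)
  have "dist (integral {a..a + t} f / of_real t) (f a) < e" if t: "0 < t" "t < d" for t
  proof -
    have c: "continuous_on {a..a + t} f" by (rule continuous_on_subset[OF cont]) auto
    have "integral {a..a + t} (\<lambda>x. f x - f a) = integral {a..a + t} f - integral {a..a + t} (\<lambda>x. f a)"
      by (intro integral_diff integrable_continuous_real c continuous_intros)
    also have "integral {a..a + t} (\<lambda>x. f a) = of_real t * f a" using t by (simp add: scaleR_conv_of_real)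
    finally have 1: "integral {a..a + t} f - of_real t * f a = integral {a..a + t} (\<lambda>x. f x - f a)" by simp
    have "norm (integral {a..a + t} (\<lambda>x. f x - f a)) \<le> e / 2 * (a + t - a)"
    proof (rule integral_bound)
      show "continuous_on {a..a + t} (\<lambda>x. f x - f a)" by (intro continuous_intros c)
      show "norm (f x - f a) \<le> e / 2" if "x \<in> {a..a + t}" for x
        using d(2)[of x] that t by (simp add: dist_norm less_imp_le)
    qed (use t in simp)
    then have 2: "norm (integral {a..a + t} f - of_real t * f a) \<le> e / 2 * t" unfolding 1 by simp
    have "integral {a..a + t} f / of_real t - f a = (integral {a..a + t} f - of_real t * f a) / of_real t"
      using t by (simp add: field_simps)
    then have "dist (integral {a..a + t} f / of_real t) (f a) = norm (integral {a..a + t} f - of_real t * f a) / t"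
      using t by (simp add: dist_norm norm_divide)
    also have "\<dots> \<le> e / 2 * t / t" using 2 t by (intro divide_right_mono) auto
    also have "\<dots> < e" using t e by simp
    finally show ?thesis .
  qed
  then show "eventually (\<lambda>t. dist (integral {a..a + t} f / of_real t) (f a) < e) (at_right 0)"
    using d(1) by (auto simp: eventually_at_right_field)
qed

text \<open>Convergence of \<open>R\<close> makes \<open>Q\<close> a Cauchy family through the
  estimate; a limit is found along one sequence of times and then reached by all small
  times.\<close>

lemma limit_from_estimate:
  fixes Q R :: "real \<Rightarrow> nat \<Rightarrow> complex"
  assumes J: "finite J"
    and est: "\<And>s t. 0 < s \<Longrightarrow> 0 < t \<Longrightarrow> (\<Sum>l\<in>J. norm (Q t l - Q s l)) \<le> C * (\<Sum>l\<in>J. norm (R t l - R s l))"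
    and C: "0 \<le> C"
    and R: "\<And>l. l \<in> J \<Longrightarrow> ((\<lambda>t. R t l) \<longlongrightarrow> R' l) (at_right 0)"
    and l: "l \<in> J"
  shows "\<exists>L. ((\<lambda>t. Q t l) \<longlongrightarrow> L) (at_right 0)"
proof -
  define \<rho> where "\<rho> t = (\<Sum>l\<in>J. norm (R t l - R' l))" for t
  have "((\<lambda>t. \<Sum>l\<in>J. norm (R t l - R' l)) \<longlongrightarrow> (\<Sum>l\<in>J. norm (R' l - R' l))) (at_right 0)"
    by (intro tendsto_intros R)
  then have \<rho>: "(\<rho> \<longlongrightarrow> 0) (at_right 0)" by (simp add: \<rho>_def[abs_def])
  have est': "norm (Q t l - Q s l) \<le> C * (\<rho> t + \<rho> s)" if "0 < s" "0 < t" for s t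
  proof -
    have "norm (Q t l - Q s l) \<le> (\<Sum>l\<in>J. norm (Q t l - Q s l))"
      by (rule member_le_sum[OF l]) (use J in auto)
    also have "\<dots> \<le> C * (\<Sum>l\<in>J. norm (R t l - R s l))" by (rule est[OF that])
    also have "\<dots> \<le> C * (\<Sum>l\<in>J. norm (R t l - R' l) + norm (R s l - R' l))"
    proof (intro mult_left_mono sum_mono C)
      fix l
      have "R t l - R s l = (R t l - R' l) - (R s l - R' l)" by simp
      then show "norm (R t l - R s l) \<le> norm (R t l - R' l) + norm (R s l - R' l)"
        by (metis norm_triangle_ineq4)
    qed
    finally show ?thesis by (simp add: \<rho>_def sum.distrib)
  qed
  define \<tau> where "\<tau> n = inverse (real (Suc n))" for n
  have \<tau>: "\<tau> n > 0" for n by (simp add: \<tau>_def)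
  have "filterlim \<tau> (at_right 0) sequentially"
    unfolding \<tau>_def[abs_def] filterlim_at using LIMSEQ_inverse_real_of_nat by auto
  then have \<rho>\<tau>: "(\<lambda>n. \<rho> (\<tau> n)) \<longlonglongrightarrow> 0" by (rule filterlim_compose[OF \<rho>])
  have "Cauchy (\<lambda>n. Q (\<tau> n) l)"
  proof (rule metric_CauchyI)
    fix e :: real assume e: "e > 0"
    have "(\<lambda>n. C * \<rho> (\<tau> n)) \<longlonglongrightarrow> C * 0" by (intro tendsto_mult tendsto_const \<rho>\<tau>)
    then have "eventually (\<lambda>n. C * \<rho> (\<tau> n) < e / 2) sequentially" using e by (intro order_tendstoD(2)[where a = "e/2"]) auto
    then obtain M where M: "\<And>n. n \<ge> M \<Longrightarrow> C * \<rho> (\<tau> n) < e / 2" by (auto simp: eventually_sequentially)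
    have "dist (Q (\<tau> m) l) (Q (\<tau> n) l) < e" if "m \<ge> M" "n \<ge> M" for m n
      using est'[OF \<tau>[of n] \<tau>[of m]] M[OF that(1)] M[OF that(2)] by (simp add: dist_norm distrib_left)
    then show "\<exists>M. \<forall>m\<ge>M. \<forall>n\<ge>M. dist (Q (\<tau> m) l) (Q (\<tau> n) l) < e" by blast
  qed
  then obtain L where L: "(\<lambda>n. Q (\<tau> n) l) \<longlonglongrightarrow> L" using Cauchy_convergent convergent_def by blast
  have bd: "norm (Q t l - L) \<le> C * \<rho> t" if t: "t > 0" for t
  proof (rule LIMSEQ_le)
    show "(\<lambda>n. norm (Q t l - Q (\<tau> n) l)) \<longlonglongrightarrow> norm (Q t l - L)" by (intro tendsto_intros L)
    show "(\<lambda>n. C * (\<rho> t + \<rho> (\<tau> n))) \<longlonglongrightarrow> C * \<rho> t"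
      using tendsto_mult[OF tendsto_const[of C] tendsto_add[OF tendsto_const[of "\<rho> t"] \<rho>\<tau>]] by simp
    show "\<exists>N. \<forall>n\<ge>N. norm (Q t l - Q (\<tau> n) l) \<le> C * (\<rho> t + \<rho> (\<tau> n))" using est'[OF \<tau> t] by blast
  qed
  have "((\<lambda>t. C * \<rho> t) \<longlongrightarrow> C * 0) (at_right 0)" by (intro tendsto_mult tendsto_const \<rho>)
  then have z: "((\<lambda>t. C * \<rho> t) \<longlongrightarrow> 0) (at_right 0)" by simp
  have "eventually (\<lambda>t. norm (Q t l - L) \<le> C * \<rho> t) (at_right 0)"
    by (rule eventually_mono[OF eventually_at_right_less bd])
  from Lim_null_comparison[OF this z] have "((\<lambda>t. Q t l - L) \<longlongrightarrow> 0) (at_right 0)" .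
  then show ?thesis using Lim_null by blast
qed

text \<open>The classical smoothing argument. In a matrix representation the coordinates
  \<open>u\<close> of the semigroup are continuous. Their integral over an interval of length
  \<open>h\<close> is differentiable and equals \<open>h u + W u\<close>, where \<open>W\<close> is
  small compared with \<open>h\<close>; solving for \<open>u\<close> shows that the difference
  quotients of \<open>u\<close> at 0 converge.\<close>

lemma (in convolution_structure) generator_exists:
  fixes \<phi> :: "real \<Rightarrow> 'v \<Rightarrow> complex"
  assumes lin: "\<And>t. t \<ge> 0 \<Longrightarrow> lin_fun B (\<phi> t)"
    and semi: "\<And>s t b. s \<ge> 0 \<Longrightarrow> t \<ge> 0 \<Longrightarrow> b \<in> sa_carrier B \<Longrightarrow> \<phi> (s + t) b = conv (\<phi> s) (\<phi> t) b"
    and zero: "\<And>b. b \<in> sa_carrier B \<Longrightarrow> \<phi> 0 b = 0"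
    and lim: "\<And>b. b \<in> sa_carrier B \<Longrightarrow> ((\<lambda>t. \<phi> t b) \<longlongrightarrow> 0) (at_right 0)"
    and b: "b \<in> sa_carrier B"
  shows "\<exists>L. ((\<lambda>t. \<phi> t b / of_real t) \<longlongrightarrow> L) (at_right 0)"
proof -
  have pol0: "p (\<phi> 0) = p (\<lambda>_. 0)" if "Pol B p" for p
    by (rule Pol_cong[OF that]) (rule zero)
  have increment: "q l (\<phi> (s + t)) - q l (\<phi> t) = (\<Sum>j\<in>J. (m l j (\<phi> s) - m l j (\<lambda>_. 0)) * q j (\<phi> t))"
    if q: "\<And>l. l \<in> J \<Longrightarrow> Pol B (q l)"
      and qm: "\<And>\<phi> \<theta> l. lin_fun B \<phi> \<Longrightarrow> lin_fun B \<theta> \<Longrightarrow> l \<in> J \<Longrightarrow> q l (conv \<phi> \<theta>) = (\<Sum>j\<in>J. m l j \<phi> * q j \<theta>)"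
      and l: "l \<in> J" and st: "s \<ge> 0" "t \<ge> 0" for J :: "nat set" and q m l s t
  proof -
    have "q l (\<phi> (s + t)) = q l (conv (\<phi> s) (\<phi> t))"
      by (rule Pol_cong[OF q[OF l]]) (rule semi[OF st])
    also have "\<dots> = (\<Sum>j\<in>J. m l j (\<phi> s) * q j (\<phi> t))" by (rule qm[OF lin[OF st(1)] lin[OF st(2)] l])
    finally have 1: "q l (\<phi> (s + t)) = (\<Sum>j\<in>J. m l j (\<phi> s) * q j (\<phi> t))" .
    have "q l (\<phi> t) = q l (conv (\<lambda>_. 0) (\<phi> t))"
      by (rule Pol_cong[OF q[OF l]]) (simp add: conv_zero_left lin st)
    also have "\<dots> = (\<Sum>j\<in>J. m l j (\<lambda>_. 0) * q j (\<phi> t))" by (rule qm[OF lin_zero lin[OF st(2)] l])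
    finally show ?thesis using 1 by (simp add: left_diff_distrib sum_subtractf)
  qed
  have Dlim: "((\<lambda>s. p (\<phi> s) - p (\<lambda>_. 0)) \<longlongrightarrow> 0) (at_right 0)" if "Pol B p" for p
    using tendsto_diff[OF Pol_tendsto[OF that lim] tendsto_const[of "p (\<lambda>_. 0)"]] by simp
  have sumD: "(\<Sum>l\<in>J. norm (\<Sum>j\<in>J. D l j * x j)) \<le> (\<Sum>l\<in>J. \<Sum>j\<in>J. norm (D l j)) * (\<Sum>j\<in>J. norm (x j))"
    if J: "finite J" for J :: "nat set" and D :: "nat \<Rightarrow> nat \<Rightarrow> complex" and x :: "nat \<Rightarrow> complex"
  proof -
    have "norm (\<Sum>j\<in>J. D l j * x j) \<le> (\<Sum>j\<in>J. norm (D l j)) * (\<Sum>j\<in>J. norm (x j))" for l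
    proof -
      have "norm (\<Sum>j\<in>J. D l j * x j) \<le> (\<Sum>j\<in>J. norm (D l j) * norm (x j))"
        by (rule order_trans[OF norm_sum]) (simp add: norm_mult)
      also have "\<dots> \<le> (\<Sum>j\<in>J. norm (D l j) * (\<Sum>j\<in>J. norm (x j)))"
        by (intro sum_mono mult_left_mono member_le_sum) (use J in auto)
      finally show ?thesis by (simp add: sum_distrib_right)
    qed
    then show ?thesis unfolding sum_distrib_right by (intro sum_mono)
  qed
  have cont: "continuous_on {0..} (\<lambda>t. \<phi> t c)" if c: "c \<in> sa_carrier B" for c
  proof (rule matrix_representation[OF c])
    fix J :: "nat set" and a q m assume J: "finite J"
      and q: "\<And>l. l \<in> J \<Longrightarrow> Pol B (q l)" and m: "\<And>l j. l \<in> J \<Longrightarrow> j \<in> J \<Longrightarrow> Pol B (m l j)"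
      and qm: "\<And>\<phi> \<theta> l. lin_fun B \<phi> \<Longrightarrow> lin_fun B \<theta> \<Longrightarrow> l \<in> J \<Longrightarrow> q l (conv \<phi> \<theta>) = (\<Sum>j\<in>J. m l j \<phi> * q j \<theta>)"
      and bq: "\<And>\<theta>. lin_fun B \<theta> \<Longrightarrow> \<theta> c = (\<Sum>l\<in>J. a l * q l \<theta>)"
    define u where "u t l = q l (\<phi> t)" for t l
    define \<delta> where "\<delta> s = (\<Sum>l\<in>J. \<Sum>j\<in>J. norm (m l j (\<phi> s) - m l j (\<lambda>_. 0)))" for s
    define U where "U t = (\<Sum>l\<in>J. norm (u t l))" for t
    have U0: "0 \<le> U t" for t by (simp add: U_def sum_nonneg)
    have \<delta>0: "0 \<le> \<delta> t" for t by (simp add: \<delta>_def sum_nonneg)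
    have "(\<delta> \<longlongrightarrow> (\<Sum>l\<in>J. \<Sum>j\<in>J. norm (0::complex))) (at_right 0)"
      unfolding \<delta>_def[abs_def] by (intro tendsto_intros Dlim m)
    then have \<delta>: "(\<delta> \<longlongrightarrow> 0) (at_right 0)" by simp
    have inc: "(\<Sum>l\<in>J. norm (u (s + t) l - u t l)) \<le> \<delta> s * U t" if "s \<ge> 0" "t \<ge> 0" for s t
    proof -
      have "(\<Sum>l\<in>J. norm (u (s + t) l - u t l)) = (\<Sum>l\<in>J. norm (\<Sum>j\<in>J. (m l j (\<phi> s) - m l j (\<lambda>_. 0)) * u t j))"
        unfolding u_def by (intro sum.cong refl arg_cong[where f = norm] increment[OF q qm]) (use that in auto)
      also have "\<dots> \<le> \<delta> s * U t" unfolding \<delta>_def U_def by (rule sumD[OF J])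
      finally show ?thesis .
    qed
    have "eventually (\<lambda>s. \<delta> s < 1 / 2) (at_right 0)" using \<delta> by (rule order_tendstoD) simp
    then obtain \<eta> where \<eta>: "\<eta> > 0" "\<And>s. 0 < s \<Longrightarrow> s < \<eta> \<Longrightarrow> \<delta> s < 1 / 2"
      by (auto simp: eventually_at_right_field)
    have bound: "norm (u t l - u t0 l) \<le> 2 * \<delta> \<bar>t - t0\<bar> * U t0"
      if t: "t \<ge> 0" "t0 \<ge> 0" "t \<noteq> t0" "\<bar>t - t0\<bar> < \<eta>" and l: "l \<in> J" for t t0 l
    proof (cases "t > t0")
      case True
      have "norm (u t l - u t0 l) \<le> (\<Sum>l\<in>J. norm (u ((t - t0) + t0) l - u t0 l))"
        using member_le_sum[OF l, of "\<lambda>l. norm (u t l - u t0 l)"] J by simp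
      also have "\<dots> \<le> \<delta> (t - t0) * U t0" by (rule inc) (use True t in auto)
      also have "\<dots> \<le> 2 * \<delta> \<bar>t - t0\<bar> * U t0" using True \<delta>0[of "t - t0"] U0[of t0] by (simp add: mult_nonneg_nonneg)
      finally show ?thesis .
    next
      case False
      \<comment> \<open>To the left of \<open>t0\<close> the increment is controlled by
        \<open>U t\<close> at the moving point. Since \<open>\<delta>\<close> is below 1/2 there,
        \<open>U t\<close> is at most twice \<open>U t0\<close>, which explains the factor 2 in the
        bound.\<close>
      then have s: "t0 - t > 0" "t0 - t < \<eta>" using t by auto
      have i: "(\<Sum>l\<in>J. norm (u t0 l - u t l)) \<le> \<delta> (t0 - t) * U t" using inc[of "t0 - t" t] s t by simp
      have "U t \<le> U t0 + (\<Sum>l\<in>J. norm (u t0 l - u t l))"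
        unfolding U_def sum.distrib[symmetric]
        by (intro sum_mono) (metis add.commute norm_minus_commute norm_triangle_sub)
      also have "\<dots> \<le> U t0 + 1 / 2 * U t"
        using i mult_right_mono[OF less_imp_le[OF \<eta>(2)[OF s]] U0[of t]] by simp
      finally have "U t \<le> 2 * U t0" by simp
      then have "\<delta> (t0 - t) * U t \<le> \<delta> (t0 - t) * (2 * U t0)" using \<delta>0 by (rule mult_left_mono)
      moreover have "norm (u t l - u t0 l) \<le> (\<Sum>l\<in>J. norm (u t0 l - u t l))"
        using member_le_sum[OF l, of "\<lambda>l. norm (u t0 l - u t l)"] J by (simp add: norm_minus_commute)
      ultimately show ?thesis using i s(1) by (simp add: abs_if mult_ac)
    qed
    have cu: "continuous_on {0..} (\<lambda>t. u t l)" if l: "l \<in> J" for l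
      unfolding continuous_on_def
    proof
      fix t0 :: real assume t0: "t0 \<in> {0..}"
      have "filterlim (\<lambda>t. \<bar>t - t0\<bar>) (at_right 0) (at t0 within {0..})"
        unfolding filterlim_at
      proof
        show "eventually (\<lambda>t. \<bar>t - t0\<bar> \<in> {0<..} \<and> \<bar>t - t0\<bar> \<noteq> 0) (at t0 within {0..})"
          by (auto simp: eventually_at_filter)
        show "((\<lambda>t. \<bar>t - t0\<bar>) \<longlongrightarrow> 0) (at t0 within {0..})"
          using tendsto_rabs[OF tendsto_diff[OF tendsto_ident_at tendsto_const[of t0]], of t0 "{0..}"] by simp
      qed
      then have "((\<lambda>t. \<delta> \<bar>t - t0\<bar>) \<longlongrightarrow> 0) (at t0 within {0..})" by (rule filterlim_compose[OF \<delta>])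
      then have "((\<lambda>t. 2 * \<delta> \<bar>t - t0\<bar> * U t0) \<longlongrightarrow> 2 * 0 * U t0) (at t0 within {0..})"
        by (intro tendsto_intros)
      then have z: "((\<lambda>t. 2 * \<delta> \<bar>t - t0\<bar> * U t0) \<longlongrightarrow> 0) (at t0 within {0..})" by simp
      have "eventually (\<lambda>t. norm (u t l - u t0 l) \<le> 2 * \<delta> \<bar>t - t0\<bar> * U t0) (at t0 within {0..})"
        unfolding eventually_at
      proof (intro exI[of _ \<eta>] conjI ballI impI \<eta>(1))
        fix t assume "t \<in> {0..}" "t \<noteq> t0 \<and> dist t t0 < \<eta>"
        then show "norm (u t l - u t0 l) \<le> 2 * \<delta> \<bar>t - t0\<bar> * U t0"
          using t0 l by (intro bound) (auto simp: dist_real_def)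
      qed
      from Lim_null_comparison[OF this z] show "((\<lambda>t. u t l) \<longlongrightarrow> u t0 l) (at t0 within {0..})"
        using Lim_null by blast
    qed
    have "continuous_on {0..} (\<lambda>t. \<Sum>l\<in>J. a l * u t l)" by (intro continuous_intros cu)
    then show ?thesis
      by (rule continuous_on_eq) (use bq[OF lin] in \<open>simp add: u_def\<close>)
  qed
  have contP: "continuous_on {0..} (\<lambda>t. p (\<phi> t))" if "Pol B p" for p
    unfolding continuous_on_def
    by (intro ballI Pol_tendsto[OF that]) (use cont in \<open>auto simp: continuous_on_def\<close>)
  show ?thesis
  proof (rule matrix_representation[OF b])
    fix J :: "nat set" and a q m assume J: "finite J"
      and q: "\<And>l. l \<in> J \<Longrightarrow> Pol B (q l)" and m: "\<And>l j. l \<in> J \<Longrightarrow> j \<in> J \<Longrightarrow> Pol B (m l j)"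
      and qm: "\<And>\<phi> \<theta> l. lin_fun B \<phi> \<Longrightarrow> lin_fun B \<theta> \<Longrightarrow> l \<in> J \<Longrightarrow> q l (conv \<phi> \<theta>) = (\<Sum>j\<in>J. m l j \<phi> * q j \<theta>)"
      and bq: "\<And>\<theta>. lin_fun B \<theta> \<Longrightarrow> \<theta> b = (\<Sum>l\<in>J. a l * q l \<theta>)"
    define u where "u t l = q l (\<phi> t)" for t l
    define D where "D s l j = m l j (\<phi> s) - m l j (\<lambda>_. 0)" for s l j
    \<comment> \<open>Chosen so that the perturbation \<open>Wm\<close>, summed over
      \<open>J\<close>, costs at most half of \<open>h * X\<close> in the estimate below; the added
      1 keeps the constant positive for empty \<open>J\<close>.\<close>
    define \<kappa> where "\<kappa> = 1 / (2 * (real (card J) + 1))"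
    have \<kappa>: "\<kappa> > 0" "real (card J) * \<kappa> \<le> 1 / 2" by (simp_all add: \<kappa>_def field_simps)
    have "eventually (\<lambda>s. \<forall>l\<in>J. \<forall>j\<in>J. norm (D s l j) < \<kappa>) (at_right 0)"
    proof (intro eventually_ball_finite ballI J)
      fix l j assume "l \<in> J" "j \<in> J"
      then have "((\<lambda>s. norm (D s l j)) \<longlongrightarrow> norm (0::complex)) (at_right 0)" unfolding D_def by (intro tendsto_norm Dlim m)
      then show "eventually (\<lambda>s. norm (D s l j) < \<kappa>) (at_right 0)" by (rule order_tendstoD) (use \<kappa> in simp)
    qed
    then obtain \<eta> where \<eta>: "\<eta> > 0" "\<And>s l j. 0 < s \<Longrightarrow> s < \<eta> \<Longrightarrow> l \<in> J \<Longrightarrow> j \<in> J \<Longrightarrow> norm (D s l j) < \<kappa>"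
      unfolding eventually_at_right_field by blast
    define h where "h = \<eta> / 2"
    have h: "h > 0" using \<eta> by (simp add: h_def)
    have Db: "norm (D s l j) \<le> \<kappa>" if "s \<in> {0..h}" "l \<in> J" "j \<in> J" for s l j
    proof (cases "s = 0")
      case True then show ?thesis using pol0[OF m[OF that(2,3)]] \<kappa> by (simp add: D_def)
    next
      case False then show ?thesis using \<eta>(2)[of s l j] \<eta>(1) that by (auto simp: h_def intro: less_imp_le)
    qed
    have cu: "continuous_on {0..} (\<lambda>t. u t l)" if "l \<in> J" for l unfolding u_def by (rule contP[OF q[OF that]])
    have cD: "continuous_on {0..h} (\<lambda>s. D s l j)" if "l \<in> J" "j \<in> J" for l j
      unfolding D_def by (intro continuous_intros continuous_on_subset[OF contP[OF m[OF that]]]) auto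
    define Wm where "Wm l j = integral {0..h} (\<lambda>s. D s l j)" for l j
    have Wb: "norm (Wm l j) \<le> \<kappa> * h" if "l \<in> J" "j \<in> J" for l j
      using integral_bound[of 0 h "\<lambda>s. D s l j" \<kappa>] cD[OF that] Db that h by (simp add: Wm_def)
    \<comment> \<open>The smoothed coordinates. Their derivative is an increment of \<open>u\<close>
      by continuity, whereas differentiability of \<open>u\<close> is what has to be shown.\<close>
    define F where "F t l = integral {t..t + h} (\<lambda>x. u x l)" for t l
    have F: "F t l = of_real h * u t l + (\<Sum>j\<in>J. Wm l j * u t j)" if t: "t \<ge> 0" and l: "l \<in> J" for t l
    proof -
      have "F t l = integral {0..h} ((\<lambda>x. u x l) \<circ> ((+) t))"
        unfolding F_def by (subst integral_shift_Icc_real) (simp add: add.commute)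
      also have "\<dots> = integral {0..h} (\<lambda>s. u t l + (\<Sum>j\<in>J. D s l j * u t j))"
      proof (rule Henstock_Kurzweil_Integration.integral_cong)
        fix s assume "s \<in> {0..h}"
        then have "u (s + t) l - u t l = (\<Sum>j\<in>J. D s l j * u t j)"
          unfolding u_def D_def by (intro increment[where J = J and q = q and m = m, OF q qm l] t) auto
        then have "u (t + s) l = u t l + (\<Sum>j\<in>J. D s l j * u t j)"
          by (simp only: add.commute[of t s] diff_eq_eq add.commute[of "u t l"])
        then show "((\<lambda>x. u x l) \<circ> ((+) t)) s = u t l + (\<Sum>j\<in>J. D s l j * u t j)"
          by (simp only: comp_def)
      qed
      also have "\<dots> = of_real h * u t l + (\<Sum>j\<in>J. Wm l j * u t j)"
      proof (rule integral_unique, intro has_integral_add has_integral_sum J)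
        show "((\<lambda>s. u t l) has_integral of_real h * u t l) {0..h}"
          using has_integral_const_real[of "u t l" 0 h] h by (simp add: scaleR_conv_of_real)
        show "((\<lambda>s. D s l j * u t j) has_integral Wm l j * u t j) {0..h}" if "j \<in> J" for j
          unfolding Wm_def
          by (intro has_integral_mult_left integrable_integral integrable_continuous_real cD l that)
      qed
      finally show ?thesis .
    qed
    define Q where "Q t l = (u t l - u 0 l) / of_real t" for t l
    define R where "R t l = (F t l - F 0 l) / of_real t" for t l
    have R: "R t l = of_real h * Q t l + (\<Sum>j\<in>J. Wm l j * Q t j)" if "t > 0" "l \<in> J" for t l
    proof -
      have "F t l - F 0 l = of_real h * (u t l - u 0 l) + (\<Sum>j\<in>J. Wm l j * (u t j - u 0 j))"
        using F[of t l] F[of 0 l] that by (simp add: algebra_simps sum_subtractf)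
      then show ?thesis by (simp add: R_def Q_def add_divide_distrib sum_divide_distrib)
    qed
    have Rlim: "((\<lambda>t. R t l) \<longlongrightarrow> u h l - u 0 l) (at_right 0)" if l: "l \<in> J" for l
    proof -
      have ih: "continuous_on {h..} (\<lambda>x. u x l)" by (rule continuous_on_subset[OF cu[OF l]]) (use h in auto)
      have "((\<lambda>t. integral {h..h + t} (\<lambda>x. u x l) / of_real t - integral {0..0 + t} (\<lambda>x. u x l) / of_real t) \<longlongrightarrow> u h l - u 0 l) (at_right 0)"
        by (intro tendsto_diff average_tendsto ih cu l)
      moreover have "integral {h..h + t} (\<lambda>x. u x l) / of_real t - integral {0..0 + t} (\<lambda>x. u x l) / of_real t = R t l"
        if t: "0 < t" for t
      proof -
        have int: "(\<lambda>x. u x l) integrable_on {0..h + t}"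
          by (rule integrable_continuous_real, rule continuous_on_subset[OF cu[OF l]]) auto
        have "integral {0..h} (\<lambda>x. u x l) + integral {h..h + t} (\<lambda>x. u x l) = integral {0..h + t} (\<lambda>x. u x l)"
          by (rule Henstock_Kurzweil_Integration.integral_combine) (use h t int in auto)
        moreover have "integral {0..t} (\<lambda>x. u x l) + integral {t..h + t} (\<lambda>x. u x l) = integral {0..h + t} (\<lambda>x. u x l)"
          by (rule Henstock_Kurzweil_Integration.integral_combine) (use h t int in auto)
        ultimately have "F t l - F 0 l = integral {h..h + t} (\<lambda>x. u x l) - integral {0..t} (\<lambda>x. u x l)"
          by (simp add: F_def add.commute algebra_simps)
        then show ?thesis by (simp add: R_def diff_divide_distrib)
      qed
      then have "eventually (\<lambda>t. integral {h..h + t} (\<lambda>x. u x l) / of_real t - integral {0..0 + t} (\<lambda>x. u x l) / of_real t = R t l) (at_right 0)"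
        by (rule eventually_mono[OF eventually_at_right_less])
      ultimately show ?thesis by (rule Lim_transform_eventually)
    qed
    \<comment> \<open>Solving \<open>h Q + Wm Q = R\<close> for \<open>Q\<close> without inverting a
      matrix: the term with \<open>Wm\<close> is at most half of \<open>h * X\<close> and is
      absorbed on the left.\<close>
    have est: "(\<Sum>l\<in>J. norm (Q t l - Q s l)) \<le> 2 / h * (\<Sum>l\<in>J. norm (R t l - R s l))" if st: "0 < s" "0 < t" for s t
    proof -
      define X where "X = (\<Sum>l\<in>J. norm (Q t l - Q s l))"
      define Y where "Y = (\<Sum>l\<in>J. norm (R t l - R s l))"
      have X0: "0 \<le> X" by (simp add: X_def sum_nonneg)
      have "h * norm (Q t l - Q s l) \<le> norm (R t l - R s l) + \<kappa> * h * X" if l: "l \<in> J" for l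
      proof -
        have eq: "of_real h * (Q t l - Q s l) = (R t l - R s l) - (\<Sum>j\<in>J. Wm l j * (Q t j - Q s j))"
          using R[OF st(2) l] R[OF st(1) l] by (simp add: algebra_simps sum_subtractf)
        have "h * norm (Q t l - Q s l) = norm (of_real h * (Q t l - Q s l))" using h by (simp add: norm_mult)
        also have "\<dots> \<le> norm (R t l - R s l) + norm (\<Sum>j\<in>J. Wm l j * (Q t j - Q s j))"
          unfolding eq by (rule norm_triangle_ineq4)
        also have "norm (\<Sum>j\<in>J. Wm l j * (Q t j - Q s j)) \<le> (\<Sum>j\<in>J. \<kappa> * h * norm (Q t j - Q s j))"
          by (rule order_trans[OF norm_sum], rule sum_mono) (use Wb l in \<open>auto simp: norm_mult intro: mult_right_mono\<close>)
        also have "\<dots> = \<kappa> * h * X" by (simp add: X_def sum_distrib_left)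
        finally show ?thesis by simp
      qed
      then have "(\<Sum>l\<in>J. h * norm (Q t l - Q s l)) \<le> (\<Sum>l\<in>J. norm (R t l - R s l) + \<kappa> * h * X)"
        by (rule sum_mono)
      then have "h * X \<le> Y + real (card J) * \<kappa> * (h * X)"
        by (simp add: X_def Y_def sum_distrib_left sum.distrib mult_ac)
      also have "\<dots> \<le> Y + 1 / 2 * (h * X)"
        using mult_right_mono[OF \<kappa>(2), of "h * X"] h X0 by simp
      finally show ?thesis using h by (simp add: X_def[symmetric] Y_def[symmetric] field_simps)
    qed
    have "\<exists>L. ((\<lambda>t. Q t l) \<longlongrightarrow> L) (at_right 0)" if "l \<in> J" for l
      by (rule limit_from_estimate[OF J est _ Rlim that]) (use h in auto)
    then obtain L where L: "\<And>l. l \<in> J \<Longrightarrow> ((\<lambda>t. Q t l) \<longlongrightarrow> L l) (at_right 0)" by metis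
    have "((\<lambda>t. \<Sum>l\<in>J. a l * Q t l) \<longlongrightarrow> (\<Sum>l\<in>J. a l * L l)) (at_right 0)" by (intro tendsto_intros L)
    moreover have "(\<Sum>l\<in>J. a l * Q t l) = \<phi> t b / of_real t" if "t > 0" for t
    proof -
      have "(\<Sum>l\<in>J. a l * Q t l) = ((\<Sum>l\<in>J. a l * u t l) - (\<Sum>l\<in>J. a l * u 0 l)) / of_real t"
        by (simp add: Q_def sum_subtractf[symmetric] sum_divide_distrib right_diff_distrib)
      also have "\<dots> = (\<phi> t b - \<phi> 0 b) / of_real t"
        using bq[OF lin, of t] bq[OF lin, of 0] that by (simp add: u_def)
      finally show ?thesis using zero[OF b] by simp
    qed
    then have "eventually (\<lambda>t. (\<Sum>l\<in>J. a l * Q t l) = \<phi> t b / of_real t) (at_right 0)"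
      by (rule eventually_mono[OF eventually_at_right_less])
    ultimately have "((\<lambda>t. \<phi> t b / of_real t) \<longlongrightarrow> (\<Sum>l\<in>J. a l * L l)) (at_right 0)"
      by (rule Lim_transform_eventually)
    then show ?thesis by (rule exI)
  qed
qed

text \<open>\<open>\<phi> t\<close> is the \<open>n\<close>-th convolution power of
  \<open>\<phi> (t/n)\<close>, and \<open>n * \<phi> (t/n)\<close> tends to \<open>t \<psi>\<close>
  by the definition of the generator; so the general limit theorem for powers identifies
  \<open>\<phi> t\<close>.\<close>

lemma (in convolution_structure) semigroup_eq_cexp:
  fixes \<phi> :: "real \<Rightarrow> 'v \<Rightarrow> complex"
  assumes lin: "\<And>t. t \<ge> 0 \<Longrightarrow> lin_fun B (\<phi> t)"
    and semi: "\<And>s t b. s \<ge> 0 \<Longrightarrow> t \<ge> 0 \<Longrightarrow> b \<in> sa_carrier B \<Longrightarrow> \<phi> (s + t) b = conv (\<phi> s) (\<phi> t) b"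
    and zero: "\<And>b. b \<in> sa_carrier B \<Longrightarrow> \<phi> 0 b = 0"
    and lim: "\<And>b. b \<in> sa_carrier B \<Longrightarrow> ((\<lambda>t. \<phi> t b) \<longlongrightarrow> 0) (at_right 0)"
  obtains \<psi> where "lin_fun B \<psi>" "\<And>b. b \<in> sa_carrier B \<Longrightarrow> ((\<lambda>t. \<phi> t b / of_real t) \<longlongrightarrow> \<psi> b) (at_right 0)"
    "\<And>t b. t \<ge> 0 \<Longrightarrow> b \<in> sa_carrier B \<Longrightarrow> \<phi> t b = cexp (\<lambda>x. of_real t * \<psi> x) b"
proof -
  have "\<exists>L. ((\<lambda>t. \<phi> t b / of_real t) \<longlongrightarrow> L) (at_right 0)" if "b \<in> sa_carrier B" for b
    by (rule generator_exists[OF lin semi zero lim that])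
  then have "\<forall>b. \<exists>L. b \<in> sa_carrier B \<longrightarrow> ((\<lambda>t. \<phi> t b / of_real t) \<longlongrightarrow> L) (at_right 0)" by blast
  from choice[OF this] obtain \<psi> where \<psi>: "\<And>b. b \<in> sa_carrier B \<Longrightarrow> ((\<lambda>t. \<phi> t b / of_real t) \<longlongrightarrow> \<psi> b) (at_right 0)" by blast
  have pos: "eventually (\<lambda>t::real. t > 0) (at_right 0)" by (rule eventually_at_right_less)
  have l: "lin_fun B \<psi>"
    unfolding lin_fun_def
  proof (intro conjI ballI allI)
    fix a b assume ab: "a \<in> sa_carrier B" "b \<in> sa_carrier B"
    have "((\<lambda>t. \<phi> t (sa_add B a b) / of_real t) \<longlongrightarrow> \<psi> a + \<psi> b) (at_right 0)"
    proof (rule Lim_transform_eventually[OF tendsto_add[OF \<psi>[OF ab(1)] \<psi>[OF ab(2)]]])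
      show "eventually (\<lambda>t. \<phi> t a / of_real t + \<phi> t b / of_real t = \<phi> t (sa_add B a b) / of_real t) (at_right 0)"
        using pos by eventually_elim (simp add: lin_fun_add[OF lin ab] add_divide_distrib)
    qed
    then show "\<psi> (sa_add B a b) = \<psi> a + \<psi> b"
      by (rule tendsto_unique[OF trivial_limit_at_right_real \<psi>[OF is_alg_add_closed[OF alg ab]]])
  next
    fix c a assume a: "a \<in> sa_carrier B"
    have "((\<lambda>t. \<phi> t (sa_smul B c a) / of_real t) \<longlongrightarrow> c * \<psi> a) (at_right 0)"
    proof (rule Lim_transform_eventually[OF tendsto_mult[OF tendsto_const[of c] \<psi>[OF a]]])
      show "eventually (\<lambda>t. c * (\<phi> t a / of_real t) = \<phi> t (sa_smul B c a) / of_real t) (at_right 0)"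
        using pos by eventually_elim (simp add: lin_fun_smul[OF lin a])
    qed
    then show "\<psi> (sa_smul B c a) = c * \<psi> a"
      by (rule tendsto_unique[OF trivial_limit_at_right_real \<psi>[OF is_alg_smul_closed[OF alg a]]])
  qed
  have eq: "\<phi> t b = cexp (\<lambda>x. of_real t * \<psi> x) b" if t: "t \<ge> 0" and b: "b \<in> sa_carrier B" for t b
  proof (cases "t = 0")
    case True
    then show ?thesis using zero[OF b] cexp_zero[OF b] by simp
  next
    case False
    with t have t: "t > 0" by simp
    have pw: "cpow (\<phi> s) n a = \<phi> (real n * s) a" if "s \<ge> 0" "a \<in> sa_carrier B" for s n a
      using that(2)
    proof (induction n arbitrary: a)
      case (Suc n)
      have "cpow (\<phi> s) (Suc n) a = conv (\<phi> s) (\<phi> (real n * s)) a"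
        unfolding cpow.simps by (rule conv_cong) (use Suc that lin in auto)
      also have "\<dots> = \<phi> (s + real n * s) a" by (rule semi[symmetric]) (use Suc that in auto)
      finally show ?case by (simp add: algebra_simps)
    qed (simp add: zero)
    have f: "filterlim (\<lambda>n. t / real (Suc n)) (at_right 0) sequentially"
      unfolding filterlim_at
    proof
      show "(\<lambda>n. t / real (Suc n)) \<longlonglongrightarrow> 0"
        using tendsto_mult[OF tendsto_const[of t] LIMSEQ_inverse_real_of_nat] by (simp add: divide_inverse)
    qed (use t in auto)
    have "(\<lambda>n. cpow (\<phi> (t / real (Suc n))) (Suc n) b) \<longlonglongrightarrow> cexp (\<lambda>x. of_real t * \<psi> x) b"
    proof (rule cpow_tendsto_cexp[OF lin_scale[OF l] _ filterlim_Suc _ b])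
      show "lin_fun B (\<phi> (t / real (Suc n)))" for n by (rule lin) (use t in simp)
      show "(\<lambda>n. of_nat (Suc n) * \<phi> (t / real (Suc n)) a) \<longlonglongrightarrow> of_real t * \<psi> a" if a: "a \<in> sa_carrier B" for a
      proof -
        have "(\<lambda>n. of_real t * (\<phi> (t / real (Suc n)) a / of_real (t / real (Suc n)))) \<longlonglongrightarrow> of_real t * \<psi> a"
          by (intro tendsto_mult tendsto_const filterlim_compose[OF \<psi>[OF a] f])
        moreover have "of_real t * (\<phi> (t / real (Suc n)) a / of_real (t / real (Suc n))) = of_nat (Suc n) * \<phi> (t / real (Suc n)) a" for n
          using t by (simp add: field_simps del: of_nat_Suc)
        ultimately show ?thesis by simp
      qed
    qed
    moreover have "cpow (\<phi> (t / real (Suc n))) (Suc n) b = \<phi> t b" for n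
      using pw[of "t / real (Suc n)" b "Suc n"] t b by (simp del: of_nat_Suc cpow.simps)
    ultimately show ?thesis by (simp add: LIMSEQ_const_iff)
  qed
  show thesis by (rule that[OF l \<psi> eq])
qed

section \<open>Convolution of functionals on a dual semigroup\<close>

text \<open>For the dual semigroups constructed below, coassociativity is only established for one pair of
  iterated free products; this is all that associativity of the convolution requires.\<close>

definition weak_dual :: "'v salg \<Rightarrow> 'v fprod \<Rightarrow> ('v \<Rightarrow> 'v) \<Rightarrow> bool" where
  "weak_dual B P \<Delta> \<longleftrightarrow> is_free_product B B P \<and> xhom B (fst P) \<Delta> \<and>
     (\<exists>G H. is_free_product (fst P) B G \<and> is_free_product B (fst P) H \<and>
        (\<forall>b\<in>sa_carrier B. fp_assoc B B B P G P H (fp_map B B P G \<Delta> id (\<Delta> b)) = fp_map B B P H id \<Delta> (\<Delta> b))) \<and>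
     (\<forall>b\<in>sa_carrier B. fp_lift B B P B (\<lambda>_. sa_zero B) id (\<Delta> b) = b) \<and>
     (\<forall>b\<in>sa_carrier B. fp_lift B B P B id (\<lambda>_. sa_zero B) (\<Delta> b) = b)"

lemma (in coding) weak_dual_if_dual_semigroup:
  fixes B :: "'v salg"
  assumes "dual_semigroup B P \<Delta>" shows "weak_dual B P \<Delta>"
proof -
  note d = assms[unfolded dual_semigroup_def]
  have P: "is_free_product B B P" using d by (simp add: is_star_free_product_def)
  note a = is_free_product_algs[OF P]
  obtain G where G: "is_free_product (fst P) B G" using free_product_exists[OF a(3,1)] .
  obtain H where H: "is_free_product B (fst P) H" using free_product_exists[OF a(1,3)] .
  have co: "\<forall>b\<in>sa_carrier B. fp_assoc B B B P G P H (fp_map B B P G \<Delta> id (\<Delta> b)) = fp_map B B P H id \<Delta> (\<Delta> b)"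
    using d[THEN conjunct2, THEN conjunct2, THEN conjunct2, THEN conjunct1] G H by blast
  have "xhom B (fst P) \<Delta>" using d by (simp add: star_hom_def alg_hom_iff_xhom)
  then show ?thesis unfolding weak_dual_def using P G H co d by blast
qed

text \<open>Associativity combines naturality along \<open>\<Delta>\<close>, associativity of the
  product and coassociativity. For the unit, the zero functional factors through the zero
  homomorphism, so naturality reduces the claim to the counit equation and the marginal
  property.\<close>

lemma (in coding) convolution_structure_if_weak_dual:
  fixes B :: "'v salg"
  assumes ind: "is_independence odot" and wd: "weak_dual B P \<Delta>"
  shows "convolution_structure B (convolution odot B P \<Delta>)"
proof -
  note np = natural_product_if_independence[OF ind]
  note w = wd[unfolded weak_dual_def]
  have P: "is_free_product B B P" and \<Delta>: "xhom B (fst P) \<Delta>" using w by blast+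
  from w obtain G H where G: "is_free_product (fst P) B G" and H: "is_free_product B (fst P) H"
    and co: "\<And>b. b \<in> sa_carrier B \<Longrightarrow> fp_assoc B B B P G P H (fp_map B B P G \<Delta> id (\<Delta> b)) = fp_map B B P H id \<Delta> (\<Delta> b)"
    by blast
  have cu: "fp_lift B B P B (\<lambda>_. sa_zero B) id (\<Delta> b) = b" "fp_lift B B P B id (\<lambda>_. sa_zero B) (\<Delta> b) = b"
    if "b \<in> sa_carrier B" for b using w that by blast+
  note a = is_free_product_algs[OF P]
  interpret B: calg B by (standard, rule a)
  have \<Delta>c: "\<Delta> b \<in> sa_carrier (fst P)" if "b \<in> sa_carrier B" for b by (rule xhom_closed[OF \<Delta> that])
  note i = ind[unfolded is_independence_def]
  have A1: "odot B B P \<phi> \<theta> (fst (snd P) b) = \<phi> b" "odot B B P \<phi> \<theta> (snd (snd P) b) = \<theta> b"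
    if "lin_fun B \<phi>" "lin_fun B \<theta>" "b \<in> sa_carrier B" for \<phi> \<theta> b
    using i[THEN conjunct2, THEN conjunct2, THEN conjunct1, THEN spec, THEN spec, THEN spec, THEN spec, THEN spec,
      THEN mp, OF conjI[OF P conjI[OF that(1,2)]]] that(3) by blast+
  have lin: "lin_fun (fst P) (odot B B P \<phi> \<theta>)" if "lin_fun B \<phi>" "lin_fun B \<theta>" for \<phi> \<theta>
    by (rule natural_product_lin[OF np P that])
  note Z = xhom_const_zero[OF a(1)]
  have zero: "\<chi>1 (sa_zero B) = 0" if "lin_fun B \<chi>1" for \<chi>1 by (rule lin_fun_zero[OF a(1) that])
  have iz: "fst (snd P) (sa_zero B) = sa_zero (fst P)" "snd (snd P) (sa_zero B) = sa_zero (fst P)"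
    by (rule xhom_zero[OF a(1,3,4)], rule xhom_zero[OF a(1,3,5)])
  have l0: "lin_fun B (\<lambda>_. 0)" by (simp add: lin_fun_def)
  show ?thesis
  proof
    show "is_alg B" by (rule a)
    show "lin_fun B (convolution odot B P \<Delta> \<phi> \<theta>)" if "lin_fun B \<phi>" "lin_fun B \<theta>" for \<phi> \<theta>
      unfolding convolution_def by (rule lin_fun_comp[OF \<Delta> lin[OF that]])
    show "convolution odot B P \<Delta> \<phi>' \<theta>' b = convolution odot B P \<Delta> \<phi> \<theta> b"
      if "lin_fun B \<phi>" "lin_fun B \<theta>" "\<And>a. a \<in> sa_carrier B \<Longrightarrow> \<phi>' a = \<phi> a" "\<And>a. a \<in> sa_carrier B \<Longrightarrow> \<theta>' a = \<theta> a"
        "b \<in> sa_carrier B" for \<phi> \<theta> \<phi>' \<theta>' b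
      unfolding convolution_def by (rule natural_product_cong[OF np P that(1-4) \<Delta>c[OF that(5)]])
    show "\<exists>f. Pol2 B B f \<and> (\<forall>\<phi> \<theta>. lin_fun B \<phi> \<longrightarrow> lin_fun B \<theta> \<longrightarrow> convolution odot B P \<Delta> \<phi> \<theta> b = f \<phi> \<theta>)"
      if "b \<in> sa_carrier B" for b
      unfolding convolution_def by (rule odot_polynomial[OF np P \<Delta>c[OF that]])
  next
    fix \<phi> \<theta> \<omega> b assume l: "lin_fun B \<phi>" "lin_fun B \<theta>" "lin_fun B \<omega>" and b: "b \<in> sa_carrier B"
    note M1 = fp_map[OF P G \<Delta> xhom_id] and M2 = fp_map[OF P H xhom_id \<Delta>]
    \<comment> \<open>The inner convolution is a product functional composed with
      \<open>\<Delta>\<close>; naturality moves this \<open>\<Delta>\<close> from the functional to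
      the argument, where coassociativity applies.\<close>
    have "odot B B P (\<lambda>b. odot B B P \<phi> \<theta> (\<Delta> b)) \<omega> (\<Delta> b) =
        odot (fst P) B G (odot B B P \<phi> \<theta>) \<omega> (fp_map B B P G \<Delta> id (\<Delta> b))"
      by (rule natural_product_nat[OF np P G \<Delta> xhom_id M1 lin[OF l(1,2)] l(3) _ _ \<Delta>c[OF b]]) auto
    also have "\<dots> = odot B (fst P) H \<phi> (odot B B P \<theta> \<omega>) (fp_assoc B B B P G P H (fp_map B B P G \<Delta> id (\<Delta> b)))"
      by (rule i[THEN conjunct2, THEN conjunct2, THEN conjunct2, THEN conjunct1, THEN spec, THEN spec, THEN spec,
          THEN spec, THEN spec, THEN spec, THEN spec, THEN spec, THEN spec, THEN spec, THEN mp, THEN bspec])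
        (use P G H l xhom_closed[OF M1(1) \<Delta>c[OF b]] in auto)
    also have "\<dots> = odot B (fst P) H \<phi> (odot B B P \<theta> \<omega>) (fp_map B B P H id \<Delta> (\<Delta> b))"
      by (simp only: co[OF b])
    also have "\<dots> = odot B B P \<phi> (\<lambda>b. odot B B P \<theta> \<omega> (\<Delta> b)) (\<Delta> b)"
      by (rule natural_product_nat[OF np P H xhom_id \<Delta> M2 l(1) lin[OF l(2,3)] _ _ \<Delta>c[OF b], symmetric]) auto
    finally show "convolution odot B P \<Delta> (convolution odot B P \<Delta> \<phi> \<theta>) \<omega> b =
        convolution odot B P \<Delta> \<phi> (convolution odot B P \<Delta> \<theta> \<omega>) b"
      unfolding convolution_def .
  next
    fix \<phi> b assume l: "lin_fun B \<phi>" and b: "b \<in> sa_carrier B"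
    note L = fp_lift[OF P a(1) Z xhom_id]
    have "odot B B P (\<lambda>_. 0) \<phi> (\<Delta> b) = odot B B P (\<lambda>_. 0) \<phi> ((snd (snd P) \<circ> fp_lift B B P B (\<lambda>_. sa_zero B) id) (\<Delta> b))"
      by (rule natural_product_nat[OF np P P Z xhom_id xhom_comp[OF L(1) a(5)] _ _ l0 l _ _ \<Delta>c[OF b]])
         (use L iz in auto)
    then show "convolution odot B P \<Delta> (\<lambda>_. 0) \<phi> b = \<phi> b"
      unfolding convolution_def using A1(2)[OF l0 l b] cu[OF b] by simp
    note L = fp_lift[OF P a(1) xhom_id Z]
    have "odot B B P \<phi> (\<lambda>_. 0) (\<Delta> b) = odot B B P \<phi> (\<lambda>_. 0) ((fst (snd P) \<circ> fp_lift B B P B id (\<lambda>_. sa_zero B)) (\<Delta> b))"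
      by (rule natural_product_nat[OF np P P xhom_id Z xhom_comp[OF L(1) a(4)] _ _ l l0 _ _ \<Delta>c[OF b]])
         (use L iz in auto)
    then show "convolution odot B P \<Delta> \<phi> (\<lambda>_. 0) b = \<phi> b"
      unfolding convolution_def using A1(1)[OF l l0 b] cu[OF b] by simp
  qed
qed

section \<open>Hermitian bases\<close>

definition pscale :: "complex \<Rightarrow> ('k \<Rightarrow>\<^sub>0 complex) \<Rightarrow> 'k \<Rightarrow>\<^sub>0 complex" where
  "pscale c p = Poly_Mapping.map ((*) c) p"

lemma lookup_pscale [simp]: "coef (pscale c p) k = c * coef p k"
  by (simp add: pscale_def Poly_Mapping.map.rep_eq when_def)

lemma pscale_single: "pscale c (Poly_Mapping.single k d) = Poly_Mapping.single k (c * d)"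
  by (rule poly_mapping_eqI) (simp add: lookup_single when_def)

lemma pscale_add: "pscale c (p + q) = pscale c p + pscale c q"
  by (rule poly_mapping_eqI) (simp add: lookup_add distrib_left)

lemma pscale_zero [simp]: "pscale c 0 = 0"
  by (rule poly_mapping_eqI) simp

interpretation PS: vector_space "pscale :: complex \<Rightarrow> ('k \<Rightarrow>\<^sub>0 complex) \<Rightarrow> 'k \<Rightarrow>\<^sub>0 complex"
  by standard (auto intro!: poly_mapping_eqI simp: lookup_add algebra_simps)

interpretation PSP: vector_space_pair "pscale :: complex \<Rightarrow> ('k \<Rightarrow>\<^sub>0 complex) \<Rightarrow> 'k \<Rightarrow>\<^sub>0 complex"
    "pscale :: complex \<Rightarrow> ('k \<Rightarrow>\<^sub>0 complex) \<Rightarrow> 'k \<Rightarrow>\<^sub>0 complex"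
  by standard

lemma lin_pscale: "lin h (pscale c p) = cst c * lin h p"
  by (induction p rule: pm_induct) (auto simp: pscale_single pscale_add lin_single lin_add cst_mult mult.assoc distrib_left)

text \<open>\<open>\<kappa>\<close> yields coordinates with respect to a linear basis
  \<open>X\<close> of Hermitian elements. The guard in \<open>\<kappa>_eval\<close> makes the
  evaluated family lie in the carrier for every element of the type.\<close>

locale hermitian_basis =
  fixes B :: "'v salg" and X :: "'v set" and \<kappa> :: "'v \<Rightarrow> 'v \<Rightarrow>\<^sub>0 complex"
  assumes star_alg: "is_star_alg B"
    and X: "X \<subseteq> sa_carrier B" and hermitian: "\<And>x. x \<in> X \<Longrightarrow> sa_star B x = x"
    and \<kappa>_add: "\<And>a b. a \<in> sa_carrier B \<Longrightarrow> b \<in> sa_carrier B \<Longrightarrow> \<kappa> (sa_add B a b) = \<kappa> a + \<kappa> b"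
    and \<kappa>_smul: "\<And>c a. a \<in> sa_carrier B \<Longrightarrow> \<kappa> (sa_smul B c a) = pscale c (\<kappa> a)"
    and \<kappa>_keys: "\<And>a. Poly_Mapping.keys (\<kappa> a) \<subseteq> X"
    and \<kappa>_basis: "\<And>x. x \<in> X \<Longrightarrow> \<kappa> x = Poly_Mapping.single x 1"
    and \<kappa>_eval: "\<And>a. a \<in> sa_carrier B \<Longrightarrow> calg.lext B (\<lambda>k. if k \<in> sa_carrier B then k else sa_zero B) (\<kappa> a) = a"

lemma (in calg) lext_pscale:
  assumes g: "\<And>k. g k \<in> sa_carrier A"
  shows "lext g (pscale c p) = sa_smul A c (lext g p)"
  by (induction p rule: pm_induct)
     (auto simp: pscale_single pscale_add lext_single[where g = g, OF g] lext_add[where g = g, OF g]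
       smul_smul smul_add_right g lext_closed[where g = g, OF g])

text \<open>\<open>B\<close> is the quotient of all formal combinations over \<open>'v\<close> by
  the kernel \<open>K\<close> of evaluation. A basis of \<open>K\<close> is completed by Hermitian
  elements to a basis of the formal combinations; the completing elements are a basis of
  \<open>B\<close>.\<close>

lemma hermitian_basis_exists:
  fixes B :: "'v salg"
  assumes sB: "is_star_alg B"
  obtains X \<kappa> where "hermitian_basis B X \<kappa>"
proof -
  have aB: "is_alg B" using sB by (simp add: is_star_alg_def)
  interpret B: calg B by (standard, fact)
  have star: "\<And>a. a \<in> sa_carrier B \<Longrightarrow> sa_star B a \<in> sa_carrier B" "\<And>a. a \<in> sa_carrier B \<Longrightarrow> sa_star B (sa_star B a) = a"
    "\<And>a b. a \<in> sa_carrier B \<Longrightarrow> b \<in> sa_carrier B \<Longrightarrow> sa_star B (sa_add B a b) = sa_add B (sa_star B a) (sa_star B b)"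
    "\<And>c a. a \<in> sa_carrier B \<Longrightarrow> sa_star B (sa_smul B c a) = sa_smul B (cnj c) (sa_star B a)"
    using sB unfolding is_star_alg_def by blast+
  define g where "g k = (if k \<in> sa_carrier B then k else sa_zero B)" for k
  have g: "g k \<in> sa_carrier B" for k by (simp add: g_def)
  define e where "e = B.lext g"
  have e: "e 0 = sa_zero B" "e (p + q) = sa_add B (e p) (e q)" "e (pscale c p) = sa_smul B c (e p)"
    "e (Poly_Mapping.single k d) = sa_smul B d (g k)" "e p \<in> sa_carrier B" for p q c k d
    unfolding e_def by (simp_all add: B.lext_add[where g = g, OF g] B.lext_pscale[where g = g, OF g]
      B.lext_single[where g = g, OF g] B.lext_closed[where g = g, OF g])
  define K where "K = {p. e p = sa_zero B}"
  have K: "PS.subspace K" unfolding PS.subspace_def K_def by (simp add: e)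
  obtain bK where bK: "bK \<subseteq> K" "PS.independent bK" "K \<subseteq> PS.span bK" by (rule PS.basis_exists[of K])
  define V where "V = bK \<union> {Poly_Mapping.single x 1 |x. x \<in> sa_carrier B \<and> sa_star B x = x}"
  obtain bB where bB: "bK \<subseteq> bB" "bB \<subseteq> V" "PS.independent bB" "V \<subseteq> PS.span bB"
    by (rule PS.maximal_independent_subset_extend[of bK V]) (use bK(2) in \<open>auto simp: V_def\<close>)
  have spK: "K \<subseteq> PS.span bB" using bK(3) PS.span_mono[OF bB(1)] by blast
  have sp1: "Poly_Mapping.single x 1 \<in> PS.span bB" for x
  proof (cases "x \<in> sa_carrier B")
    case False
    then have "Poly_Mapping.single x 1 \<in> K" by (simp add: K_def e g_def)
    then show ?thesis using spK by blast
  next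
    case x: True
    \<comment> \<open>\<open>h\<close> and \<open>k\<close> are the Hermitian real and imaginary
      parts of \<open>x\<close>, so Hermitian elements together with \<open>K\<close> span
      everything.\<close>
    define h where "h = sa_smul B (1/2) (sa_add B x (sa_star B x))"
    define k where "k = sa_smul B (- \<i> / 2) (sa_add B x (sa_smul B (-1) (sa_star B x)))"
    have hk: "h \<in> sa_carrier B" "k \<in> sa_carrier B" using x star by (simp_all add: h_def k_def)
    have hh: "sa_star B h = h" using x star by (simp add: h_def B.add_comm)
    have hk': "sa_star B k = k"
      using x star by (simp add: k_def B.smul_add_right B.smul_smul B.add_comm)
    have x_eq: "sa_add B h (sa_smul B \<i> k) = x"
    proof -
      have "sa_add B h (sa_smul B \<i> k) = sa_add B (sa_add B (sa_smul B (1/2) x) (sa_smul B (1/2) (sa_star B x)))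
          (sa_add B (sa_smul B (1/2) x) (sa_smul B (-1/2) (sa_star B x)))"
        using x star by (simp add: h_def k_def B.smul_add_right B.smul_smul)
      also have "\<dots> = sa_add B (sa_add B (sa_smul B (1/2) x) (sa_smul B (1/2) x))
          (sa_add B (sa_smul B (1/2) (sa_star B x)) (sa_smul B (-1/2) (sa_star B x)))"
        using x star by (simp add: B.add_ac)
      also have "\<dots> = sa_add B (sa_smul B (1/2 + 1/2) x) (sa_smul B (1/2 + -1/2) (sa_star B x))"
        using x star by (simp only: B.smul_add_left)
      finally show ?thesis using x star by simp
    qed
    let ?d = "Poly_Mapping.single x 1 + pscale (-1) (Poly_Mapping.single h 1 + pscale \<i> (Poly_Mapping.single k 1))"
    have gx: "g x = x" "g h = h" "g k = k" using x hk by (simp_all add: g_def)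
    have "e ?d = sa_add B x (sa_smul B (-1) x)"
      by (simp only: e gx B.smul_one[OF x] B.smul_one[OF hk(1)] B.smul_one[OF hk(2)] x_eq)
    also have "\<dots> = sa_smul B (1 + -1) x" using x by (simp only: B.smul_add_left B.smul_one)
    finally have "?d \<in> K" using x by (simp add: K_def)
    then have 1: "?d \<in> PS.span bB" using spK by blast
    have "Poly_Mapping.single h 1 \<in> V" "Poly_Mapping.single k 1 \<in> V" using hk hh hk' by (auto simp: V_def)
    then have "Poly_Mapping.single h 1 \<in> PS.span bB" "Poly_Mapping.single k 1 \<in> PS.span bB" using bB(4) by blast+
    then have 2: "Poly_Mapping.single h 1 + pscale \<i> (Poly_Mapping.single k 1) \<in> PS.span bB"
      by (intro PS.span_add PS.span_scale)
    have "Poly_Mapping.single x 1 = ?d + (Poly_Mapping.single h 1 + pscale \<i> (Poly_Mapping.single k 1))"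
      by (rule poly_mapping_eqI) (simp add: lookup_add algebra_simps)
    then show ?thesis using PS.span_add[OF 1 2] by simp
  qed
  have span: "p \<in> PS.span bB" for p
  proof (induction p rule: pm_induct)
    case (single x c)
    then show ?case using PS.span_scale[OF sp1[of x], of c] by (simp add: pscale_single)
  qed (auto intro: PS.span_add PS.span_zero)
  \<comment> \<open>The projection along \<open>K\<close> onto the span of the completing Hermitian
    elements; on the formal symbol of an element it returns its coordinates.\<close>
  define pr where "pr = PSP.construct bB (\<lambda>b. if b \<in> bK then 0 else b)"
  have prb: "pr b = (if b \<in> bK then 0 else b)" if "b \<in> bB" for b
    unfolding pr_def by (rule PSP.construct_basis[OF bB(3) that])
  have "Vector_Spaces.linear pscale pscale pr" unfolding pr_def by (rule PSP.linear_construct[OF bB(3)])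
  note lin = this[unfolded Vector_Spaces.linear_iff]
  have pr_add: "pr (p + q) = pr p + pr q" for p q
    using lin[THEN conjunct2, THEN conjunct2, THEN conjunct1] by blast
  have pr_scale: "pr (pscale c p) = pscale c (pr p)" for c p
    using lin[THEN conjunct2, THEN conjunct2, THEN conjunct2] by blast
  have pr0: "pr 0 = 0" using pr_scale[of 0 0] by simp
  define X where "X = {x \<in> sa_carrier B. sa_star B x = x \<and> Poly_Mapping.single x 1 \<in> bB - bK}"
  have pr_e: "e (pr p) = e p" for p
    using span[of p]
  proof (induction rule: PS.span_induct_alt)
    case base then show ?case by (simp add: pr0)
  next
    case (step c x y)
    have "e (pr x) = e x"
      using prb[OF step(1)] bK(1) by (auto simp: e K_def)
    then show ?case using step by (simp add: pr_add pr_scale e)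
  qed
  have pr_keys: "Poly_Mapping.keys (pr p) \<subseteq> X" for p
    using span[of p]
  proof (induction rule: PS.span_induct_alt)
    case base then show ?case by (simp add: pr0)
  next
    case (step c x y)
    have "Poly_Mapping.keys (pr x) \<subseteq> X"
    proof (cases "x \<in> bK")
      case True then show ?thesis using prb[OF step(1)] by simp
    next
      case False
      then obtain v where "v \<in> sa_carrier B" "sa_star B v = v" "x = Poly_Mapping.single v 1"
        using step(1) bB(2) by (auto simp: V_def)
      then show ?thesis using prb[OF step(1)] False step(1) by (auto simp: X_def)
    qed
    moreover have "Poly_Mapping.keys (pscale c (pr x)) \<subseteq> Poly_Mapping.keys (pr x)" by (auto simp: in_keys_iff)
    ultimately show ?case using step Poly_Mapping.keys_add[of "pscale c (pr x)" "pr y"] by (simp add: pr_add pr_scale) blast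
  qed
  have prK: "pr p = 0" if "p \<in> K" for p
  proof -
    have "p \<in> PS.span bK" using that bK(3) by blast
    then show ?thesis
    proof (induction rule: PS.span_induct_alt)
      case base then show ?case by (simp add: pr0)
    next
      case (step c x y)
      then show ?case using prb[of x] bB(1) by (auto simp: pr_add pr_scale)
    qed
  qed
  define \<kappa> where "\<kappa> b = pr (Poly_Mapping.single b 1)" for b
  have eqK: "pr p = pr q" if "e p = e q" for p q
  proof -
    have "e (p + pscale (-1) q) = sa_smul B (1 + -1) (e q)"
      unfolding e that B.smul_add_left[OF e(5)] using e(5) by simp
    then have "pr (p + pscale (-1) q) = 0" using e(5) by (intro prK) (simp add: K_def)
    moreover have "p = (p + pscale (-1) q) + q" by (rule poly_mapping_eqI) (simp add: lookup_add)
    ultimately show ?thesis by (metis pr_add add_0)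
  qed
  have "hermitian_basis B X \<kappa>"
  proof
    show "is_star_alg B" by (rule sB)
    show "\<kappa> (sa_add B a b) = \<kappa> a + \<kappa> b" if "a \<in> sa_carrier B" "b \<in> sa_carrier B" for a b
      unfolding \<kappa>_def pr_add[symmetric] by (rule eqK) (use that in \<open>simp add: e g_def\<close>)
    show "\<kappa> (sa_smul B c a) = pscale c (\<kappa> a)" if "a \<in> sa_carrier B" for c a
      unfolding \<kappa>_def pr_scale[symmetric] by (rule eqK) (use that in \<open>simp add: e g_def\<close>)
    show "Poly_Mapping.keys (\<kappa> a) \<subseteq> X" for a unfolding \<kappa>_def by (rule pr_keys)
    show "\<kappa> x = Poly_Mapping.single x 1" if "x \<in> X" for x
      using that prb by (auto simp: \<kappa>_def X_def)
    show "calg.lext B (\<lambda>k. if k \<in> sa_carrier B then k else sa_zero B) (\<kappa> a) = a" if "a \<in> sa_carrier B" for a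
    proof -
      have "e (\<kappa> a) = a" unfolding \<kappa>_def pr_e using that by (simp add: e g_def)
      then show ?thesis by (simp add: e_def g_def[abs_def])
    qed
  qed (auto simp: X_def)
  then show ?thesis by (rule that)
qed

section \<open>Operators acting on the first letter\<close>

definition starts :: "nat set \<Rightarrow> ('v \<times> nat) fa set" where
  "starts K = {p. Poly_Mapping.keys p \<subseteq> {w. \<exists>x j v. letters w = (x, j) # v \<and> j \<in> K}}"

lemma starts_zero [simp]: "0 \<in> starts K"
  by (simp add: starts_def)

lemma starts_add: "p \<in> starts K \<Longrightarrow> q \<in> starts K \<Longrightarrow> p + q \<in> starts K"
  using Poly_Mapping.keys_add[of p q] unfolding starts_def by blast

lemma starts_single: "j \<in> K \<Longrightarrow> letters w = (x, j) # v \<Longrightarrow> Poly_Mapping.single w c \<in> starts K"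
  by (auto simp: starts_def)

lemma starts_mult:
  assumes "p \<in> starts K" shows "p * q \<in> starts K"
proof -
  have "\<exists>x j v. letters w = (x, j) # v \<and> j \<in> K" if "w \<in> Poly_Mapping.keys (p * q)" for w
  proof -
    have "w \<in> {u + v |u v. u \<in> Poly_Mapping.keys p \<and> v \<in> Poly_Mapping.keys q}"
      using that Poly_Mapping.keys_mult by (rule rev_subsetD)
    then obtain u v where uv: "u \<in> Poly_Mapping.keys p" "w = u + v" by blast
    then obtain x j u' where "letters u = (x, j) # u'" "j \<in> K"
      using assms unfolding starts_def by blast
    then show ?thesis using uv(2) by (intro exI[of _ x] exI[of _ j] exI[of _ "u' @ letters v"]) simp
  qed
  then show ?thesis unfolding starts_def by blast
qed

lemma starts_cst: "p \<in> starts K \<Longrightarrow> cst c * p \<in> starts K"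
  unfolding cst_commute by (rule starts_mult)

lemma starts_mono: "K \<subseteq> L \<Longrightarrow> p \<in> starts K \<Longrightarrow> p \<in> starts L"
  unfolding starts_def by blast

lemma starts_mon: "j \<in> K \<Longrightarrow> mon ((x, j) # v) \<in> starts K"
  unfolding mon_def by (rule starts_single[of j K _ x v]) auto

lemma starts_induct [consumes 1, case_names zero single add]:
  fixes p :: "('v \<times> nat) fa"
  assumes "p \<in> starts K" "Q 0" "\<And>x j v c. j \<in> K \<Longrightarrow> Q (cst c * mon ((x, j) # v))"
    "\<And>p q. Q p \<Longrightarrow> Q q \<Longrightarrow> Q (p + q)"
  shows "Q p"
proof (rule pm_induct_on[OF assms(1)[unfolded starts_def mem_Collect_eq]])
  fix w :: "('v \<times> nat) word" and c
  assume "w \<in> {w. \<exists>x j v. letters w = (x, j) # v \<and> j \<in> K}"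
  then show "Q (Poly_Mapping.single w c)" using assms(3) by (auto simp: single_eq_cst_mon)
qed (use assms in auto)

lemma fa_induct [case_names zero Nil Cons cst add]:
  fixes p :: "('v \<times> nat) fa"
  assumes "Q 0" "Q 1" "\<And>x j v. Q (mon ((x, j) # v))" "\<And>c p. Q p \<Longrightarrow> Q (cst c * p)" "\<And>p q. Q p \<Longrightarrow> Q q \<Longrightarrow> Q (p + q)"
  shows "Q p"
proof (induction p rule: pm_induct)
  case (single w c)
  have "Q (mon (letters w))"
  proof (cases "letters w")
    case Nil then show ?thesis using assms(2) by simp
  next
    case (Cons l v) then show ?thesis using assms(3) by (cases l) simp
  qed
  then show ?case unfolding single_eq_cst_mon by (rule assms(4))
qed (use assms in auto)

text \<open>Operators that see only the first letter. A word that begins outside \<open>K\<close> is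
  treated like the empty word, being multiplied by \<open>T 1\<close> from the left. Such operators
  are closed under composition, and two of them with disjoint tags interact as freely as the copies
  in a free product.\<close>

definition good :: "nat set \<Rightarrow> (('v \<times> nat) fa \<Rightarrow> ('v \<times> nat) fa) \<Rightarrow> bool" where
  "good K T \<longleftrightarrow> (\<forall>p q. T (p + q) = T p + T q) \<and> (\<forall>c p. T (cst c * p) = cst c * T p) \<and>
     T 1 \<in> starts K \<and> (\<forall>n\<in>starts UNIV. T n \<in> starts K) \<and>
     (\<forall>n\<in>starts UNIV. \<forall>m. T (n * m) = T n * m) \<and> (\<forall>n\<in>starts (- K). T n = T 1 * n)"

lemma goodD:
  assumes "good K T"
  shows good_add: "T (p + q) = T p + T q" and good_cst: "T (cst c * p) = cst c * T p"
    and good_one: "T 1 \<in> starts K" and good_starts: "n \<in> starts UNIV \<Longrightarrow> T n \<in> starts K"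
    and good_mult: "n \<in> starts UNIV \<Longrightarrow> T (n * m) = T n * m"
    and good_other: "n \<in> starts (- K) \<Longrightarrow> T n = T 1 * n"
  using assms unfolding good_def by blast+

lemma good_zero: "good K T \<Longrightarrow> T 0 = 0"
  using good_cst[of K T 0 0] by simp

definition endo :: "nat set \<Rightarrow> (('v \<times> nat) fa \<Rightarrow> ('v \<times> nat) fa) salg" where
  "endo K = \<lparr>sa_carrier = {T. good K T}, sa_add = (\<lambda>S T m. S m + T m), sa_mul = (\<lambda>S T m. S (T m)),
     sa_smul = (\<lambda>c T m. cst c * T m), sa_star = (\<lambda>T. T), sa_zero = (\<lambda>_. 0)\<rparr>"

lemma endo_simps [simp]: "T \<in> sa_carrier (endo K) \<longleftrightarrow> good K T" "sa_add (endo K) S T = (\<lambda>m. S m + T m)"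
    "sa_mul (endo K) S T = (\<lambda>m. S (T m))" "sa_smul (endo K) c T = (\<lambda>m. cst c * T m)" "sa_zero (endo K) = (\<lambda>_. 0)"
  by (simp_all add: endo_def)

lemma good_const_zero: "good K (\<lambda>_. 0)"
  by (simp add: good_def)

lemma good_plus: "good K S \<Longrightarrow> good K T \<Longrightarrow> good K (\<lambda>m. S m + T m)"
  unfolding good_def by (simp add: starts_add distrib_left distrib_right)

lemma good_scale:
  assumes "good K T" shows "good K (\<lambda>m. cst c * T m)"
proof -
  note T = goodD[OF assms]
  show ?thesis unfolding good_def
    by (intro conjI allI ballI)
       (auto simp: T starts_cst distrib_left mult.assoc cst_left_commute[of "cst c"] intro: starts_cst T)
qed

lemma good_comp:
  assumes S: "good K S" and T: "good K T" shows "good K (\<lambda>m. S (T m))"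
proof -
  have u: "T n \<in> starts UNIV" if "n \<in> starts UNIV" for n using starts_mono[OF subset_UNIV good_starts[OF T that]] .
  have u1: "T 1 \<in> starts UNIV" using starts_mono[OF subset_UNIV good_one[OF T]] .
  show ?thesis unfolding good_def
  proof (intro conjI allI ballI)
    show "S (T (p + q)) = S (T p) + S (T q)" for p q by (simp only: good_add[OF S] good_add[OF T])
    show "S (T (cst c * p)) = cst c * S (T p)" for c p by (simp only: good_cst[OF S] good_cst[OF T])
    show "S (T 1) \<in> starts K" by (rule good_starts[OF S u1])
    show "S (T n) \<in> starts K" if "n \<in> starts UNIV" for n by (rule good_starts[OF S u[OF that]])
    show "S (T (n * m)) = S (T n) * m" if "n \<in> starts UNIV" for n m
      by (simp only: good_mult[OF T that] good_mult[OF S u[OF that]])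
    show "S (T n) = S (T 1) * n" if "n \<in> starts (- K)" for n
      by (simp only: good_other[OF T that] good_mult[OF S u1])
  qed
qed

lemma is_alg_endo: "is_alg (endo K)"
  unfolding is_alg_def endo_simps
proof (intro conjI ballI allI)
  fix T :: "('a \<times> nat) fa \<Rightarrow> ('a \<times> nat) fa" assume "T \<in> sa_carrier (endo K)"
  then have "good K (\<lambda>m. cst (- 1) * T m)" by (simp add: good_scale)
  moreover have "(\<lambda>m. T m + cst (- 1) * T m) = (\<lambda>_. 0)" by (simp add: cst_def single_uminus fun_eq_iff)
  ultimately show "\<exists>S\<in>sa_carrier (endo K). (\<lambda>m. T m + S m) = (\<lambda>_. 0)"
    by (intro bexI[of _ "\<lambda>m. cst (- 1) * T m"]) auto
qed (auto simp: good_const_zero good_plus good_scale good_comp fun_eq_iff add.assoc add.commute cst_mult mult.assoc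
      cst_add distrib_left distrib_right good_add good_cst)

text \<open>Enlarging the tag set only weakens the conditions, so representations with different
  tags meet in a common algebra of operators.\<close>

lemma good_mono:
  assumes T: "good K T" and KL: "K \<subseteq> L" shows "good L T"
proof -
  have "starts (- L) \<subseteq> starts (- K :: nat set)" using KL starts_mono[of "- L" "- K"] by blast
  then show ?thesis using T starts_mono[OF KL] unfolding good_def by blast
qed

lemma xhom_endo_mono: "xhom A (endo K) f \<Longrightarrow> K \<subseteq> L \<Longrightarrow> xhom A (endo L) f"
  unfolding xhom_def endo_simps using good_mono[of K _ L] by blast

section \<open>Left and right multiplication on words\<close>

context hermitian_basis begin

lemma alg_B: "is_alg B"
  using star_alg by (simp add: is_star_alg_def)

sublocale B: calg B
  by standard (rule alg_B)

lemma star_closed [simp]: "a \<in> sa_carrier B \<Longrightarrow> sa_star B a \<in> sa_carrier B"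
  and star_star [simp]: "a \<in> sa_carrier B \<Longrightarrow> sa_star B (sa_star B a) = a"
  and star_add: "a \<in> sa_carrier B \<Longrightarrow> b \<in> sa_carrier B \<Longrightarrow> sa_star B (sa_add B a b) = sa_add B (sa_star B a) (sa_star B b)"
  and star_smul: "a \<in> sa_carrier B \<Longrightarrow> sa_star B (sa_smul B c a) = sa_smul B (cnj c) (sa_star B a)"
  and star_mul: "a \<in> sa_carrier B \<Longrightarrow> b \<in> sa_carrier B \<Longrightarrow> sa_star B (sa_mul B a b) = sa_mul B (sa_star B b) (sa_star B a)"
  using star_alg unfolding is_star_alg_def by blast+

definition ev :: "('v \<Rightarrow>\<^sub>0 complex) \<Rightarrow> 'v" where
  "ev = B.lext (\<lambda>k. if k \<in> sa_carrier B then k else sa_zero B)"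

lemma ev_\<kappa>: "a \<in> sa_carrier B \<Longrightarrow> ev (\<kappa> a) = a"
  unfolding ev_def by (rule \<kappa>_eval)

lemma ev_closed: "ev u \<in> sa_carrier B"
  and ev_zero: "ev 0 = sa_zero B"
  and ev_add: "ev (u + v) = sa_add B (ev u) (ev v)"
  unfolding ev_def by (simp_all add: B.lext_closed B.lext_add)

lemma ev_single: "x \<in> X \<Longrightarrow> ev (Poly_Mapping.single x c) = sa_smul B c x"
  unfolding ev_def using X by (subst B.lext_single) auto

lemma X_closed: "x \<in> X \<Longrightarrow> x \<in> sa_carrier B"
  using X by blast

lemma basis_induct [consumes 1, case_names basis add smul zero]:
  assumes "b \<in> sa_carrier B" "\<And>x. x \<in> X \<Longrightarrow> Q x" "\<And>a b. a \<in> sa_carrier B \<Longrightarrow> b \<in> sa_carrier B \<Longrightarrow> Q a \<Longrightarrow> Q b \<Longrightarrow> Q (sa_add B a b)"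
    "\<And>c a. a \<in> sa_carrier B \<Longrightarrow> Q a \<Longrightarrow> Q (sa_smul B c a)" "Q (sa_zero B)"
  shows "Q b"
proof -
  have "Q (ev u)" if "Poly_Mapping.keys u \<subseteq> X" for u
    using that
  proof (induction u rule: pm_induct_on)
    case (single x c)
    then show ?case using assms(2,4) X_closed by (simp add: ev_single)
  qed (use assms ev_closed in \<open>auto simp: ev_zero ev_add\<close>)
  from this[OF \<kappa>_keys, of b] show ?thesis using ev_\<kappa>[OF assms(1)] by simp
qed

definition \<iota> :: "nat \<Rightarrow> 'v \<Rightarrow> ('v \<times> nat) fa" where
  "\<iota> k b = lin (\<lambda>x. mon [(x, k)]) (\<kappa> b)"

lemma \<iota>_add: "a \<in> sa_carrier B \<Longrightarrow> b \<in> sa_carrier B \<Longrightarrow> \<iota> k (sa_add B a b) = \<iota> k a + \<iota> k b"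
  and \<iota>_smul: "a \<in> sa_carrier B \<Longrightarrow> \<iota> k (sa_smul B c a) = cst c * \<iota> k a"
  and \<iota>_basis: "x \<in> X \<Longrightarrow> \<iota> k x = mon [(x, k)]"
  by (simp_all add: \<iota>_def \<kappa>_add \<kappa>_smul \<kappa>_basis lin_add lin_pscale lin_single)

lemma \<iota>_zero: "\<iota> k (sa_zero B) = 0"
  using \<iota>_smul[of "sa_zero B" k 0] by simp

lemma \<iota>_starts: "b \<in> sa_carrier B \<Longrightarrow> \<iota> k b \<in> starts {k}"
  by (induction b rule: basis_induct) (auto simp: \<iota>_basis \<iota>_add \<iota>_smul \<iota>_zero intro: starts_mon starts_add starts_cst)

lemma \<iota>_starts': "b \<in> sa_carrier B \<Longrightarrow> k \<in> K \<Longrightarrow> \<iota> k b \<in> starts K"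
  by (rule starts_mono[OF _ \<iota>_starts]) auto

lemma \<iota>_FA: "b \<in> sa_carrier B \<Longrightarrow> k \<in> I \<Longrightarrow> \<iota> k b \<in> sa_carrier (FA (X \<times> I))"
  by (induction b rule: basis_induct) (auto simp: \<iota>_basis \<iota>_add \<iota>_smul \<iota>_zero FA_zero intro: FA_mon FA_add FA_cst)

lemma fstar_\<iota>: "b \<in> sa_carrier B \<Longrightarrow> fstar (\<iota> k b) = \<iota> k (sa_star B b)"
proof (induction b rule: basis_induct)
  case (basis x)
  then show ?case by (simp add: \<iota>_basis hermitian fstar_mon)
next
  case (add a b)
  then show ?case by (simp add: \<iota>_add fstar_add star_add)
next
  case (smul c a)
  then show ?case by (simp add: \<iota>_smul fstar_cst_mult star_smul)
next
  case zero
  have "sa_star B (sa_zero B) = sa_zero B" using star_smul[of "sa_zero B" 0] by simp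
  then show ?case by (simp add: \<iota>_zero)
qed

text \<open>Left multiplication by an element of copy \<open>k\<close> on reduced words: it is
  merged into the first letter if that letter belongs to the same copy, and prepended otherwise.
  This is the standard action of a free product on alternating words; letters outside the basis are
  sent to 0.\<close>

definition Lw :: "nat \<Rightarrow> 'v \<Rightarrow> ('v \<times> nat) list \<Rightarrow> ('v \<times> nat) fa" where
  "Lw k b w = (case w of [] \<Rightarrow> \<iota> k b | l # v \<Rightarrow>
     if snd l = k then (if fst l \<in> X then \<iota> k (sa_mul B b (fst l)) * mon v else 0) else \<iota> k b * mon w)"

definition Lop :: "nat \<Rightarrow> 'v \<Rightarrow> ('v \<times> nat) fa \<Rightarrow> ('v \<times> nat) fa" where
  "Lop k b = lin (\<lambda>w. Lw k b (letters w))"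

lemma Lop_add: "Lop k b (p + q) = Lop k b p + Lop k b q"
  and Lop_cst: "Lop k b (cst c * p) = cst c * Lop k b p"
  and Lop_zero [simp]: "Lop k b 0 = 0"
  and Lop_mon: "Lop k b (mon w) = Lw k b w"
  by (simp_all add: Lop_def lin_add lin_cst)

lemma Lop_one: "Lop k b 1 = \<iota> k b"
  using Lop_mon[of k b "[]"] by (simp add: Lw_def)

lemma Lop_Cons: "Lop k b (mon ((x, j) # v)) =
    (if j = k then (if x \<in> X then \<iota> k (sa_mul B b x) * mon v else 0) else \<iota> k b * mon ((x, j) # v))"
  by (simp add: Lop_mon Lw_def)

lemma Lop_mult: "n \<in> starts UNIV \<Longrightarrow> Lop k b (n * m) = Lop k b n * m"
proof (induction n rule: starts_induct)
  case (single x j v c)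
  have "Lop k b (mon ((x, j) # v) * m) = Lop k b (mon ((x, j) # v)) * m"
  proof (induction m rule: pm_induct)
    case (single w e)
    have "mon ((x, j) # v) * Poly_Mapping.single w e = cst e * mon ((x, j) # v @ letters w)"
      unfolding single_eq_cst_mon cst_left_commute mon_append[symmetric] by simp
    moreover have "Lop k b (mon ((x, j) # v @ letters w)) = Lop k b (mon ((x, j) # v)) * mon (letters w)"
    proof -
      have 1: "mon ((x, j) # v @ letters w) = mon ((x, j) # v) * mon (letters w)"
        by (simp only: mon_append[symmetric] append_Cons)
      show ?thesis unfolding Lop_Cons by (auto simp: mult.assoc mon_append 1)
    qed
    ultimately show ?case by (simp add: Lop_cst single_eq_cst_mon cst_left_commute)
  qed (simp_all add: Lop_add distrib_left)
  then show ?case by (simp add: Lop_cst mult.assoc)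
qed (simp_all add: Lop_add distrib_right)

lemma Lop_\<iota>:
  assumes b: "b \<in> sa_carrier B" and d: "d \<in> sa_carrier B"
  shows "Lop k b (\<iota> k d * m) = \<iota> k (sa_mul B b d) * m"
  using d
proof (induction d rule: basis_induct)
  case (basis x)
  have "mon [(x, k)] \<in> starts UNIV" by (rule starts_mon) simp
  then show ?case using basis by (simp add: \<iota>_basis Lop_mult Lop_Cons)
qed (use b in \<open>simp_all add: \<iota>_add \<iota>_smul \<iota>_zero distrib_right Lop_add mult.assoc Lop_cst B.distrib_left B.smul_mul_right\<close>)

lemma Lop_starts: "b \<in> sa_carrier B \<Longrightarrow> Lop k b m \<in> starts {k}"
proof (induction m rule: fa_induct)
  case (Cons x j v)
  then show ?case using X_closed by (auto simp: Lop_Cons intro!: starts_mult \<iota>_starts)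
qed (auto simp: Lop_one Lop_cst Lop_add intro: \<iota>_starts starts_cst starts_add)

lemma good_Lop:
  assumes b: "b \<in> sa_carrier B" and k: "k \<in> K"
  shows "good K (Lop k b)"
proof -
  have "good {k} (Lop k b)"
    unfolding good_def
  proof (intro conjI allI ballI)
    show "Lop k b n = Lop k b 1 * n" if "n \<in> starts (- {k})" for n
      using that
      by (induction n rule: starts_induct) (auto simp: Lop_one Lop_cst Lop_Cons cst_left_commute Lop_add distrib_left)
  qed (auto simp: Lop_add Lop_cst Lop_mult intro: Lop_starts[OF b])
  then show ?thesis by (rule good_mono) (use k in auto)
qed

lemma xhom_Lop:
  assumes k: "k \<in> K" shows "xhom B (endo K) (Lop k)"
proof (rule xhomI)
  show "Lop k a \<in> sa_carrier (endo K)" if "a \<in> sa_carrier B" for a using good_Lop[OF that k] by simp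
  show "Lop k (sa_add B a b) = sa_add (endo K) (Lop k a) (Lop k b)" if a: "a \<in> sa_carrier B" "b \<in> sa_carrier B" for a b
    unfolding endo_simps
  proof
    fix m show "Lop k (sa_add B a b) m = Lop k a m + Lop k b m"
      using a X_closed by (induction m rule: fa_induct)
        (auto simp: Lop_one \<iota>_add Lop_Cons B.distrib_right distrib_right Lop_cst Lop_add distrib_left)
  qed
  show "Lop k (sa_smul B c a) = sa_smul (endo K) c (Lop k a)" if a: "a \<in> sa_carrier B" for c a
    unfolding endo_simps
  proof
    fix m show "Lop k (sa_smul B c a) m = cst c * Lop k a m"
      using a X_closed by (induction m rule: fa_induct)
        (auto simp: Lop_one \<iota>_smul Lop_Cons B.smul_mul_left mult.assoc Lop_cst cst_left_commute[of "cst _"] Lop_add distrib_left)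
  qed
  show "Lop k (sa_mul B a b) = sa_mul (endo K) (Lop k a) (Lop k b)" if a: "a \<in> sa_carrier B" "b \<in> sa_carrier B" for a b
    unfolding endo_simps
  proof
    fix m show "Lop k (sa_mul B a b) m = Lop k a (Lop k b m)"
    proof (induction m rule: fa_induct)
      case Nil
      show ?case using Lop_\<iota>[OF a, of k 1] by (simp add: Lop_one)
    next
      case (Cons x j v)
      then show ?case using Lop_\<iota>[OF a, of k] Lop_\<iota>[of a "sa_mul B b x" k "mon v"] a X_closed
        by (auto simp: Lop_Cons B.mul_assoc)
    qed (simp_all add: Lop_cst Lop_add)
  qed
qed

text \<open>The substitution that intertwines the standard representations \<open>Lop 0\<close>, \<open>Lop 1\<close> with
  given ones by operators on the first letter.\<close>

definition rsub :: "('v \<Rightarrow> ('v \<times> nat) fa \<Rightarrow> ('v \<times> nat) fa) \<Rightarrow> ('v \<Rightarrow> ('v \<times> nat) fa \<Rightarrow> ('v \<times> nat) fa) \<Rightarrow>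
    ('v \<times> nat) fa \<Rightarrow> ('v \<times> nat) fa" where
  "rsub \<Theta>0 \<Theta>1 = sub (\<lambda>l. if fst l \<in> X \<and> snd l = 0 then \<Theta>0 (fst l) 1
      else if fst l \<in> X \<and> snd l = 1 then \<Theta>1 (fst l) 1 else 0)"

text \<open>The tags \<open>i\<close> and \<open>j\<close> are left open so that one argument covers
  both copies. Merging letters corresponds to multiplicativity of the representation, prepending to
  its behaviour on words that begin outside \<open>K\<close>.\<close>

lemma rsub_Lop_aux:
  fixes i :: nat
  assumes \<Theta>: "xhom B (endo K) \<Theta>" and \<Theta>': "xhom B (endo K') \<Theta>'" and disj: "K \<inter> K' = {}"
    and D: "\<And>p q. D (p + q) = D p + D q" "\<And>c p. D (cst c * p) = cst c * D p" "\<And>p q. D (p * q) = D p * D q" "D 1 = 1" "D 0 = 0"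
    and Di: "\<And>x. x \<in> X \<Longrightarrow> D (mon [(x, i)]) = \<Theta> x 1" and Dj: "\<And>x. x \<in> X \<Longrightarrow> D (mon [(x, j)]) = \<Theta>' x 1"
    and Do: "\<And>x k. x \<notin> X \<or> k \<noteq> i \<and> k \<noteq> j \<Longrightarrow> D (mon [(x, k)]) = 0"
    and ij: "i \<noteq> j" and b: "b \<in> sa_carrier B"
  shows "D (Lop i b m) = \<Theta> b (D m)"
proof -
  have g: "good K (\<Theta> b)" if "b \<in> sa_carrier B" for b using xhom_closed[OF \<Theta> that] by simp
  have g': "good K' (\<Theta>' b)" if "b \<in> sa_carrier B" for b using xhom_closed[OF \<Theta>' that] by simp
  have Dc: "D (mon (l # v)) = D (mon [l]) * D (mon v)" for l v
    by (subst mon_Cons) (rule D(3))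
  have Dk: "D (cst c) = cst c" for c
    using D(2)[of c 1] D(4) by simp
  have D\<iota>: "D (\<iota> i b) = \<Theta> b 1" if "b \<in> sa_carrier B" for b
    using that
  proof (induction b rule: basis_induct)
    case zero
    have "\<Theta> (sa_zero B) = (\<lambda>_. 0)" using xhom_zero[OF alg_B is_alg_endo \<Theta>] by simp
    then show ?case by (simp add: \<iota>_zero D)
  qed (simp_all add: \<iota>_basis Di \<iota>_add \<iota>_smul D Dk xhom_add[OF \<Theta>] xhom_smul[OF \<Theta>])
  show ?thesis
  proof (induction m rule: fa_induct)
    case zero show ?case using good_zero[OF g[OF b]] D by simp
  next
    case Nil show ?case using D\<iota>[OF b] D by (simp add: Lop_one)
  next
    case (Cons x k v)
    have u: "\<Theta> y 1 \<in> starts UNIV" if "y \<in> sa_carrier B" for y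
      using starts_mono[OF subset_UNIV good_one[OF g[OF that]]] .
    consider "x \<notin> X \<or> k \<noteq> i \<and> k \<noteq> j" | "x \<in> X" "k = i" | "x \<in> X" "k = j" by blast
    then show ?case
    proof cases
      case 1
      then have z: "D (mon ((x, k) # v)) = 0" using Do Dc[of "(x, k)" v] by simp
      show ?thesis using 1 good_zero[OF g[OF b]] by (auto simp: Lop_Cons D z)
    next
      case 2
      have x: "x \<in> sa_carrier B" using 2 X_closed by simp
      have "D (Lop i b (mon ((x, k) # v))) = \<Theta> (sa_mul B b x) 1 * D (mon v)"
        using 2 b x by (simp add: Lop_Cons D D\<iota>)
      also have "\<dots> = \<Theta> b (\<Theta> x 1) * D (mon v)" using xhom_mul[OF \<Theta> b x] by simp
      also have "\<dots> = \<Theta> b (\<Theta> x 1 * D (mon v))" by (rule good_mult[OF g[OF b] u[OF x], symmetric])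
      also have "\<Theta> x 1 * D (mon v) = D (mon ((x, k) # v))" using 2 Dc[of "(x, k)" v] Di by simp
      finally show ?thesis .
    next
      case 3
      have x: "x \<in> sa_carrier B" using 3 X_closed by simp
      \<comment> \<open>The image of a letter from the other copy begins with a tag in
        \<open>K'\<close>, hence outside \<open>K\<close>; so \<open>\<Theta> b\<close> merely
        multiplies from the left, just as \<open>Lop i b\<close> prepends.\<close>
      have "\<Theta>' x 1 * D (mon v) \<in> starts (- K)"
        using starts_mono[OF _ starts_mult[OF good_one[OF g'[OF x]]], of "- K"] disj by blast
      moreover have "\<Theta>' x 1 * D (mon v) = D (mon ((x, k) # v))" using 3 Dc[of "(x, k)" v] Dj by simp
      ultimately have "\<Theta> b (D (mon ((x, k) # v))) = \<Theta> b 1 * D (mon ((x, k) # v))"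
        using good_other[OF g[OF b]] by simp
      then show ?thesis using 3 ij D\<iota>[OF b] by (simp add: Lop_Cons D)
    qed
  qed (simp_all add: Lop_cst Lop_add D Dk good_add[OF g[OF b]] good_cst[OF g[OF b]])
qed

lemma rsub_Lop:
  assumes \<Theta>0: "xhom B (endo K0) \<Theta>0" and \<Theta>1: "xhom B (endo K1) \<Theta>1" and disj: "K0 \<inter> K1 = {}"
    and b: "b \<in> sa_carrier B"
  shows "rsub \<Theta>0 \<Theta>1 (Lop 0 b m) = \<Theta>0 b (rsub \<Theta>0 \<Theta>1 m)" "rsub \<Theta>0 \<Theta>1 (Lop 1 b m) = \<Theta>1 b (rsub \<Theta>0 \<Theta>1 m)"
proof -
  have m: "rsub \<Theta>0 \<Theta>1 (mon [l]) = (if fst l \<in> X \<and> snd l = 0 then \<Theta>0 (fst l) 1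
      else if fst l \<in> X \<and> snd l = 1 then \<Theta>1 (fst l) 1 else 0)" for l by (simp add: rsub_def sub_mon)
  note D = sub_add sub_cst sub_mult sub_one sub_zero
  show "rsub \<Theta>0 \<Theta>1 (Lop 0 b m) = \<Theta>0 b (rsub \<Theta>0 \<Theta>1 m)"
    by (rule rsub_Lop_aux[where i = 0 and j = 1, OF \<Theta>0 \<Theta>1 disj _ _ _ _ _ _ _ _ _ b])
       (auto simp: m, simp_all add: rsub_def D)
  show "rsub \<Theta>0 \<Theta>1 (Lop 1 b m) = \<Theta>1 b (rsub \<Theta>0 \<Theta>1 m)"
    by (rule rsub_Lop_aux[where i = 1 and j = 0, OF \<Theta>1 \<Theta>0 _ _ _ _ _ _ _ _ _ _ b])
       (use disj in \<open>auto simp: m\<close>, simp_all add: rsub_def D)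
qed

text \<open>Right multiplication on the last letter, obtained by conjugating left multiplication
  with the involution.\<close>

definition Rop :: "nat \<Rightarrow> 'v \<Rightarrow> ('v \<times> nat) fa \<Rightarrow> ('v \<times> nat) fa" where
  "Rop l c m = fstar (Lop l (sa_star B c) (fstar m))"

lemma Rop_add: "Rop l c (p + q) = Rop l c p + Rop l c q"
  and Rop_cst: "Rop l c (cst d * p) = cst d * Rop l c p"
  by (simp_all add: Rop_def fstar_add Lop_add fstar_cst_mult Lop_cst)

lemma Rop_one: "c \<in> sa_carrier B \<Longrightarrow> Rop l c 1 = \<iota> l c"
  by (simp add: Rop_def Lop_one fstar_\<iota>)

lemma fstar_starts_UNIV: "n \<in> starts UNIV \<Longrightarrow> fstar n \<in> starts UNIV"
proof (induction n rule: starts_induct)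
  case (single x j v c)
  obtain y k u where "rev ((x, j) # v) = (y, k) # u" by (cases "rev ((x, j) # v)") auto
  then show ?case unfolding fstar_cst_mult fstar_mon by (auto intro!: starts_cst starts_mon)
qed (auto simp: fstar_add intro: starts_add)

lemma Rop_mult: "n \<in> starts UNIV \<Longrightarrow> Rop l c (m * n) = m * Rop l c n"
  by (simp add: Rop_def fstar_mult Lop_mult fstar_starts_UNIV)

lemma Rop_\<iota>:
  assumes c: "c \<in> sa_carrier B" and d: "d \<in> sa_carrier B"
  shows "Rop l c (\<iota> l d) = \<iota> l (sa_mul B d c)" and "k \<noteq> l \<Longrightarrow> Rop l c (\<iota> k d) = \<iota> k d * \<iota> l c"
proof -
  show "Rop l c (\<iota> l d) = \<iota> l (sa_mul B d c)"
    using Lop_\<iota>[of "sa_star B c" "sa_star B d" l 1] c d by (simp add: Rop_def fstar_\<iota> star_mul)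
  assume "k \<noteq> l"
  then have "\<iota> k (sa_star B d) \<in> starts (- {l})" using d by (intro \<iota>_starts') auto
  then have "Lop l (sa_star B c) (\<iota> k (sa_star B d)) = \<iota> l (sa_star B c) * \<iota> k (sa_star B d)"
    using good_other[OF good_Lop[of "sa_star B c" l "{l}"]] c by (simp add: Lop_one)
  then show "Rop l c (\<iota> k d) = \<iota> k d * \<iota> l c" using c d by (simp add: Rop_def fstar_\<iota> fstar_mult)
qed

lemma Rop_letter_notin: "x \<notin> X \<Longrightarrow> Rop l c (mon [(x, l)]) = 0"
  and Rop_letter_other: "c \<in> sa_carrier B \<Longrightarrow> k \<noteq> l \<Longrightarrow> Rop l c (mon [(x, k)]) = mon [(x, k)] * \<iota> l c"
  by (simp_all add: Rop_def fstar_mon Lop_Cons fstar_mult fstar_\<iota>)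

text \<open>On words with two or more letters the operators touch opposite ends. Only the empty word
  and single letters need a check, and there the claim is associativity in \<open>B\<close>.\<close>

lemma Lop_Rop_commute:
  assumes b: "b \<in> sa_carrier B" and c: "c \<in> sa_carrier B"
  shows "Lop k b (Rop l c m) = Rop l c (Lop k b m)"
proof (induction m rule: fa_induct)
  case zero show ?case by (simp add: Rop_def)
next
  case Nil
  show ?case
  proof (cases "k = l")
    case True
    then show ?thesis using Lop_\<iota>[OF b c, of k 1] Rop_\<iota>(1)[OF c b] c by (simp add: Rop_one Lop_one)
  next
    case False
    then have "\<iota> l c \<in> starts (- {k})" using c by (intro \<iota>_starts') auto
    then have "Lop k b (\<iota> l c) = \<iota> k b * \<iota> l c"
      using good_other[OF good_Lop[OF b, of k "{k}"]] by (simp add: Lop_one)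
    then show ?thesis using Rop_\<iota>(2)[OF c b False] c by (simp add: Rop_one Lop_one)
  qed
next
  case (Cons x j v)
  have st: "mon (a # v) \<in> starts UNIV" for a :: "'v \<times> nat" and v by (cases a) (auto intro: starts_mon)
  show ?case
  proof (cases v)
    case (Cons a u)
    have 1: "mon ((x, j) # v) = mon [(x, j)] * mon v" by (rule mon_Cons)
    show ?thesis unfolding 1 using st[of a u] st[of "(x, j)" "[]"] Cons by (simp add: Rop_mult Lop_mult)
  next
    case Nil
    have \<iota>st: "\<iota> l c \<in> starts UNIV" using \<iota>_starts'[OF c] by simp
    consider "j = k" "j = l" | "j = k" "j \<noteq> l" | "j \<noteq> k" by blast
    then show ?thesis
    proof cases
      case 1
      show ?thesis
      proof (cases "x \<in> X")
        case True
        have x: "x \<in> sa_carrier B" using X_closed[OF True] .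
        have "Lop k b (Rop l c (mon [(x, j)])) = \<iota> l (sa_mul B b (sa_mul B x c))"
          using 1 True Rop_\<iota>(1)[OF c x, of l] Lop_\<iota>[OF b, of "sa_mul B x c" l 1] x c by (simp add: \<iota>_basis)
        moreover have "Rop l c (Lop k b (mon [(x, j)])) = \<iota> l (sa_mul B (sa_mul B b x) c)"
          using 1 True Rop_\<iota>(1)[OF c, of "sa_mul B b x" l] b x by (simp add: Lop_Cons)
        ultimately show ?thesis using Nil b c x by (simp add: B.mul_assoc)
      next
        case False
        then show ?thesis using 1 Nil Rop_letter_notin[of x l c] by (simp add: Lop_Cons Rop_def)
      qed
    next
      case 2
      have "Lop k b (Rop l c (mon [(x, j)])) = Lop k b (mon [(x, j)]) * \<iota> l c"
        using 2 c st[of "(x, j)" "[]"] by (simp add: Rop_letter_other Lop_mult)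
      moreover have "Rop l c (Lop k b (mon [(x, j)])) = Lop k b (mon [(x, j)]) * \<iota> l c"
        using 2 X_closed b c Rop_\<iota>(2)[OF c, of "sa_mul B b x" k l] by (auto simp: Lop_Cons Rop_def)
      ultimately show ?thesis using Nil by simp
    next
      case 3
      have "Rop l c (mon [(x, j)]) \<in> starts {j}"
      proof (cases "j = l")
        case True
        then show ?thesis using Rop_\<iota>(1)[OF c, of x l] Rop_letter_notin[of x l c] X_closed[of x] c
          by (cases "x \<in> X") (auto simp: \<iota>_basis[symmetric] intro: \<iota>_starts)
      next
        case False
        then show ?thesis using c by (auto simp: Rop_letter_other intro: starts_mult starts_mon)
      qed
      then have "Rop l c (mon [(x, j)]) \<in> starts (- {k})" using 3 by (intro starts_mono[of "{j}" "- {k}"]) auto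
      then have "Lop k b (Rop l c (mon [(x, j)])) = \<iota> k b * Rop l c (mon [(x, j)])"
        using good_other[OF good_Lop[OF b, of k "{k}"]] by (simp add: Lop_one)
      moreover have "Rop l c (Lop k b (mon [(x, j)])) = \<iota> k b * Rop l c (mon [(x, j)])"
        using 3 st[of "(x, j)" "[]"] by (simp add: Lop_Cons Rop_mult)
      ultimately show ?thesis using Nil by simp
    qed
  qed
next
  case (cst d p)
  then show ?case by (simp add: Lop_cst Rop_cst)
next
  case (add p q)
  then show ?case by (simp add: Lop_add Rop_add)
qed

end

text \<open>Uniqueness of extensions holds for targets over any type, because it follows from the
  induction principle of the free product rather than from its universal property at the
  target.\<close>

lemma fp_unique_any:
  assumes P: "is_free_product A1 A2 P" and f: "xhom (fst P) C f" and h: "xhom (fst P) C h"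
    and eq: "\<And>a. a \<in> sa_carrier A1 \<Longrightarrow> f (fst (snd P) a) = h (fst (snd P) a)"
    "\<And>a. a \<in> sa_carrier A2 \<Longrightarrow> f (snd (snd P) a) = h (snd (snd P) a)"
    and x: "x \<in> sa_carrier (fst P)"
  shows "f x = h x"
  using P x
proof (induction x rule: fp_induct)
  case (add x y) then show ?case by (simp only: xhom_add[OF f] xhom_add[OF h])
next
  case (smul c x) then show ?case by (simp only: xhom_smul[OF f] xhom_smul[OF h])
next
  case (mul x y) then show ?case by (simp only: xhom_mul[OF f] xhom_mul[OF h])
qed (simp_all add: eq)

section \<open>Lifting the comultiplication to a free algebra\<close>

locale lifting = hermitian_basis B X \<kappa> + coding enc
  for B :: "'v salg" and X \<kappa> and enc :: "('v \<times> nat) fa \<Rightarrow> 'v" +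
  fixes P :: "'v fprod" and \<Delta> :: "'v \<Rightarrow> 'v"
  assumes dual: "dual_semigroup B P \<Delta>"
begin

abbreviation "F \<equiv> fst P"
abbreviation "i1 \<equiv> fst (snd P)"
abbreviation "i2 \<equiv> snd (snd P)"

lemma P: "is_free_product B B P"
  using dual by (simp add: dual_semigroup_def is_star_free_product_def)

lemma alg_F: "is_alg F" and hom_i1: "xhom B F i1" and hom_i2: "xhom B F i2"
  by (rule is_free_product_algs[OF P])+

sublocale F: calg F by standard (rule alg_F)

lemma star_F: "is_star_alg F" and star_i1: "star_hom B F i1" and star_i2: "star_hom B F i2" and star_\<Delta>: "star_hom B F \<Delta>"
  using dual by (auto simp: dual_semigroup_def is_star_free_product_def split: prod.splits)

lemma hom_\<Delta>: "xhom B F \<Delta>"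
  using star_\<Delta> by (simp add: star_hom_def alg_hom_iff_xhom)

lemma i_star: "b \<in> sa_carrier B \<Longrightarrow> sa_star F (i1 b) = i1 (sa_star B b)" "b \<in> sa_carrier B \<Longrightarrow> sa_star F (i2 b) = i2 (sa_star B b)"
  "b \<in> sa_carrier B \<Longrightarrow> sa_star F (\<Delta> b) = \<Delta> (sa_star B b)"
  using star_i1 star_i2 star_\<Delta> by (simp_all add: star_hom_def)

lemma \<Delta>_closed: "b \<in> sa_carrier B \<Longrightarrow> \<Delta> b \<in> sa_carrier F"
  by (rule xhom_closed[OF hom_\<Delta>])

lemma F_star_closed [simp]: "a \<in> sa_carrier F \<Longrightarrow> sa_star F a \<in> sa_carrier F"
  and F_star_add: "a \<in> sa_carrier F \<Longrightarrow> b \<in> sa_carrier F \<Longrightarrow> sa_star F (sa_add F a b) = sa_add F (sa_star F a) (sa_star F b)"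
  and F_star_smul: "a \<in> sa_carrier F \<Longrightarrow> sa_star F (sa_smul F c a) = sa_smul F (cnj c) (sa_star F a)"
  and F_star_mul: "a \<in> sa_carrier F \<Longrightarrow> b \<in> sa_carrier F \<Longrightarrow> sa_star F (sa_mul F a b) = sa_mul F (sa_star F b) (sa_star F a)"
  and F_star_star: "a \<in> sa_carrier F \<Longrightarrow> sa_star F (sa_star F a) = a"
  using star_F unfolding is_star_alg_def by blast+

definition rep :: "nat set \<Rightarrow> nat \<Rightarrow> nat \<Rightarrow> 'v \<Rightarrow> ('v \<times> nat) fa \<Rightarrow> ('v \<times> nat) fa" where
  "rep K k l = (SOME f. xhom F (endo K) f \<and> (\<forall>a\<in>sa_carrier B. f (i1 a) = Lop k a) \<and> (\<forall>a\<in>sa_carrier B. f (i2 a) = Lop l a))"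

lemma rep:
  assumes "k \<in> K" "l \<in> K"
  shows xhom_rep: "xhom F (endo K) (rep K k l)"
    and rep_1: "\<And>a. a \<in> sa_carrier B \<Longrightarrow> rep K k l (i1 a) = Lop k a"
    and rep_2: "\<And>a. a \<in> sa_carrier B \<Longrightarrow> rep K k l (i2 a) = Lop l a"
proof -
  have "\<exists>f. xhom F (endo K) f \<and> (\<forall>a\<in>sa_carrier B. f (i1 a) = Lop k a) \<and> (\<forall>a\<in>sa_carrier B. f (i2 a) = Lop l a)"
  proof (rule fp_extend_any[OF P is_alg_endo xhom_Lop[OF assms(1)] xhom_Lop[OF assms(2)]])
    fix f assume "xhom F (endo K) f" "\<And>a. a \<in> sa_carrier B \<Longrightarrow> f (i1 a) = Lop k a" "\<And>a. a \<in> sa_carrier B \<Longrightarrow> f (i2 a) = Lop l a"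
    then show ?thesis by blast
  qed
  from someI_ex[OF this]
  show "xhom F (endo K) (rep K k l)" "\<And>a. a \<in> sa_carrier B \<Longrightarrow> rep K k l (i1 a) = Lop k a"
    "\<And>a. a \<in> sa_carrier B \<Longrightarrow> rep K k l (i2 a) = Lop l a"
    unfolding rep_def by blast+
qed

definition "LP = rep {0, 1} 0 1"

lemma LP: "xhom F (endo {0, 1}) LP" "a \<in> sa_carrier B \<Longrightarrow> LP (i1 a) = Lop 0 a" "a \<in> sa_carrier B \<Longrightarrow> LP (i2 a) = Lop 1 a"
  unfolding LP_def by (rule rep; simp)+

text \<open>The normal form of \<open>z\<close> in alternating words of basis letters. It is a
  linear section of the evaluation \<open>\<Psi>\<close>, but no homomorphism.\<close>

definition S :: "'v \<Rightarrow> ('v \<times> nat) fa" where "S z = LP z 1"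

lemma rsub_LP:
  assumes \<Theta>0: "xhom B (endo K0) \<Theta>0" and \<Theta>1: "xhom B (endo K1) \<Theta>1" and disj: "K0 \<inter> K1 = {}"
    and \<Theta>: "xhom F (endo K) \<Theta>" and eq: "\<And>a. a \<in> sa_carrier B \<Longrightarrow> \<Theta> (i1 a) = \<Theta>0 a" "\<And>a. a \<in> sa_carrier B \<Longrightarrow> \<Theta> (i2 a) = \<Theta>1 a"
    and z: "z \<in> sa_carrier F"
  shows "rsub \<Theta>0 \<Theta>1 (LP z m) = \<Theta> z (rsub \<Theta>0 \<Theta>1 m)"
  using P z
proof (induction z arbitrary: m rule: fp_induct)
  case (left a) then show ?case by (simp only: LP eq rsub_Lop[OF \<Theta>0 \<Theta>1 disj])
next
  case (right a) then show ?case by (simp only: LP eq rsub_Lop[OF \<Theta>0 \<Theta>1 disj])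
next
  case (add x y)
  then show ?case by (simp add: xhom_add[OF LP(1)] xhom_add[OF \<Theta>]) (simp add: rsub_def sub_add)
next
  case (smul c x)
  then show ?case by (simp add: xhom_smul[OF LP(1)] xhom_smul[OF \<Theta>]) (simp add: rsub_def sub_cst)
next
  case (mul x y)
  then show ?case by (simp add: xhom_mul[OF LP(1)] xhom_mul[OF \<Theta>])
qed

text \<open>Substituting into a normal form becomes applying a homomorphism of the free product to
  the vacuum 1. Identities between homomorphisms, such as coassociativity, thereby turn into
  identities between normal forms.\<close>

lemma rsub_S:
  assumes "xhom B (endo K0) \<Theta>0" "xhom B (endo K1) \<Theta>1" "K0 \<inter> K1 = {}"
    "xhom F (endo K) \<Theta>" "\<And>a. a \<in> sa_carrier B \<Longrightarrow> \<Theta> (i1 a) = \<Theta>0 a" "\<And>a. a \<in> sa_carrier B \<Longrightarrow> \<Theta> (i2 a) = \<Theta>1 a"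
    and "z \<in> sa_carrier F"
  shows "rsub \<Theta>0 \<Theta>1 (S z) = \<Theta> z 1"
proof -
  have "rsub \<Theta>0 \<Theta>1 1 = 1" by (simp add: rsub_def)
  then show ?thesis using rsub_LP[OF assms, of 1] by (simp add: S_def)
qed

lemma rsub_mon: "rsub \<Theta>0 \<Theta>1 (mon [(x, k)]) = (if x \<in> X \<and> k = 0 then \<Theta>0 x 1 else if x \<in> X \<and> k = 1 then \<Theta>1 x 1 else 0)"
  by (simp add: rsub_def sub_mon)

section \<open>Normal forms and the involution\<close>

definition RP :: "'v \<Rightarrow> ('v \<times> nat) fa \<Rightarrow> ('v \<times> nat) fa" where
  "RP z m = fstar (LP (sa_star F z) (fstar m))"

lemma RP:
  shows RP_1: "a \<in> sa_carrier B \<Longrightarrow> RP (i1 a) m = Rop 0 a m"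
    and RP_2: "a \<in> sa_carrier B \<Longrightarrow> RP (i2 a) m = Rop 1 a m"
    and RP_add: "x \<in> sa_carrier F \<Longrightarrow> y \<in> sa_carrier F \<Longrightarrow> RP (sa_add F x y) m = RP x m + RP y m"
    and RP_smul: "x \<in> sa_carrier F \<Longrightarrow> RP (sa_smul F c x) m = cst c * RP x m"
    and RP_mul: "x \<in> sa_carrier F \<Longrightarrow> y \<in> sa_carrier F \<Longrightarrow> RP (sa_mul F x y) m = RP y (RP x m)"
  by (simp_all add: RP_def Rop_def i_star LP F_star_add F_star_smul F_star_mul xhom_add[OF LP(1)] xhom_smul[OF LP(1)]
      xhom_mul[OF LP(1)] fstar_add fstar_cst_mult)

lemma LP_add: "x \<in> sa_carrier F \<Longrightarrow> y \<in> sa_carrier F \<Longrightarrow> LP (sa_add F x y) m = LP x m + LP y m"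
  and LP_smul: "x \<in> sa_carrier F \<Longrightarrow> LP (sa_smul F c x) m = cst c * LP x m"
  and LP_mul: "x \<in> sa_carrier F \<Longrightarrow> y \<in> sa_carrier F \<Longrightarrow> LP (sa_mul F x y) m = LP x (LP y m)"
  by (simp_all add: xhom_add[OF LP(1)] xhom_smul[OF LP(1)] xhom_mul[OF LP(1)])

lemma LP_linear:
  assumes "z \<in> sa_carrier F" shows "LP z (p + q) = LP z p + LP z q" "LP z (cst c * p) = cst c * LP z p"
  using xhom_closed[OF LP(1) assms] by (simp_all add: good_add good_cst)

lemma LP_Rop_commute:
  assumes z: "z \<in> sa_carrier F" and c: "c \<in> sa_carrier B"
  shows "LP z (Rop k c m) = Rop k c (LP z m)"
  using P z
proof (induction z arbitrary: m rule: fp_induct)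
  case (left a) then show ?case by (simp only: LP Lop_Rop_commute[OF _ c])
next
  case (right a) then show ?case by (simp only: LP Lop_Rop_commute[OF _ c])
next
  case (add x y) then show ?case by (simp only: LP_add Rop_add)
next
  case (smul d x) then show ?case by (simp only: LP_smul Rop_cst)
next
  case (mul x y) then show ?case by (simp only: LP_mul)
qed

lemma LP_RP_commute:
  assumes z: "z \<in> sa_carrier F" and y: "y \<in> sa_carrier F"
  shows "LP z (RP y m) = RP y (LP z m)"
  using P y
proof (induction y arbitrary: m rule: fp_induct)
  case (left a) then show ?case by (simp only: RP LP_Rop_commute[OF z])
next
  case (right a) then show ?case by (simp only: RP LP_Rop_commute[OF z])
next
  case (add x y) then show ?case by (simp only: RP_add LP_linear[OF z])
next
  case (smul d x) then show ?case by (simp only: RP_smul LP_linear[OF z])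
next
  case (mul x y) then show ?case by (simp only: RP_mul)
qed

text \<open>Spelling an element from the left or from the right gives the same normal form. For a
  product \<open>x y\<close>, both are \<open>RP y\<close> applied to the spelling of
  \<open>x\<close>, because the left and right actions commute.\<close>

lemma LP_one_eq_RP_one:
  assumes z: "z \<in> sa_carrier F" shows "LP z 1 = RP z 1"
  using P z
proof (induction z rule: fp_induct)
  case (left a) then show ?case by (simp only: RP LP Lop_one Rop_one)
next
  case (right a) then show ?case by (simp only: RP LP Lop_one Rop_one)
next
  case (add x y) then show ?case by (simp only: RP_add LP_add)
next
  case (smul d x) then show ?case by (simp only: RP_smul LP_smul)
next
  case (mul x y) then show ?case by (simp only: RP_mul LP_mul LP_RP_commute)
qed

lemma fstar_S: "z \<in> sa_carrier F \<Longrightarrow> fstar (S z) = S (sa_star F z)"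
  unfolding S_def using LP_one_eq_RP_one[of "sa_star F z"] by (simp add: RP_def F_star_star)

lemma FA_mult_mon: "p \<in> sa_carrier (FA Y) \<Longrightarrow> set v \<subseteq> Y \<Longrightarrow> p * mon v \<in> sa_carrier (FA Y)"
  by (cases "v = []") (auto intro: FA_mult FA_mon)

lemma Lop_FA:
  assumes b: "b \<in> sa_carrier B" and k: "k \<in> I" and m: "m \<in> sa_carrier (FA (X \<times> I))"
  shows "Lop k b m \<in> sa_carrier (FA (X \<times> I))"
  using m
proof (induction m rule: FA_induct)
  case (single w c)
  then obtain x j v where w: "letters w = (x, j) # v" by (cases "letters w") auto
  have "Lop k b (mon ((x, j) # v)) \<in> sa_carrier (FA (X \<times> I))"
    using single b k X_closed w
    by (auto simp: Lop_Cons intro!: FA_mult_mon \<iota>_FA FA_zero)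
  then show ?case unfolding single_eq_cst_mon w Lop_cst by (rule FA_cst)
qed (simp_all add: FA_zero Lop_add FA_add)

lemma LP_FA:
  assumes z: "z \<in> sa_carrier F"
  shows "LP z 1 \<in> sa_carrier (FA (X \<times> {0, 1})) \<and>
    (\<forall>m\<in>sa_carrier (FA (X \<times> {0, 1})). LP z m \<in> sa_carrier (FA (X \<times> {0, 1})))"
  using P z
proof (induction z rule: fp_induct)
  case (left a) then show ?case by (auto simp: LP Lop_one intro: \<iota>_FA Lop_FA)
next
  case (right a) then show ?case by (auto simp: LP Lop_one intro: \<iota>_FA Lop_FA)
next
  case (add x y) then show ?case by (simp only: LP_add) (blast intro: FA_add)
next
  case (smul d x) then show ?case by (simp only: LP_smul) (blast intro: FA_cst)
next
  case (mul x y) then show ?case by (simp only: LP_mul) blast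
qed

lemma S_FA: "z \<in> sa_carrier F \<Longrightarrow> S z \<in> sa_carrier (FA (X \<times> {0, 1}))"
  unfolding S_def using LP_FA by blast

definition le :: "'v \<times> nat \<Rightarrow> 'v" where
  "le l = (if fst l \<in> X \<and> snd l = 0 then i1 (fst l) else if fst l \<in> X \<and> snd l = 1 then i2 (fst l) else sa_zero F)"

lemma le: "le l \<in> sa_carrier F"
  using X_closed by (auto simp: le_def intro: xhom_closed[OF hom_i1] xhom_closed[OF hom_i2])

abbreviation "\<Psi> \<equiv> F.fext le"

lemma \<Psi>: "xhom (FA Y) F \<Psi>"
  by (rule F.xhom_fext[where g = le, OF le])

lemmas \<Psi>_rules = F.fext_closed[where g = le, OF le] F.fext_zero[where g = le, OF le] F.fext_add[where g = le, OF le]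
  F.fext_smul[where g = le, OF le] F.fext_mon[where g = le, OF le]

lemma \<Psi>_\<iota>: "b \<in> sa_carrier B \<Longrightarrow> \<Psi> (\<iota> 0 b) = i1 b" "b \<in> sa_carrier B \<Longrightarrow> \<Psi> (\<iota> 1 b) = i2 b"
proof (induction b rule: basis_induct)
  case zero
  { case 1 then show ?case by (simp add: \<iota>_zero \<Psi>_rules xhom_zero[OF alg_B alg_F hom_i1])
  next case 2 then show ?case by (simp add: \<iota>_zero \<Psi>_rules xhom_zero[OF alg_B alg_F hom_i2]) }
qed (simp_all add: \<iota>_basis \<iota>_add \<iota>_smul \<Psi>_rules le_def xhom_add[OF hom_i1] xhom_add[OF hom_i2] xhom_smul[OF hom_i1] xhom_smul[OF hom_i2])

lemma \<Psi>_Lop: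
  assumes b: "b \<in> sa_carrier B" and k: "k = 0 \<and> i = i1 \<or> k = 1 \<and> i = i2"
  shows "\<Psi> (Lop k b 1) = i b" and "m \<in> sa_carrier (FA (X \<times> {0, 1})) \<Longrightarrow> \<Psi> (Lop k b m) = sa_mul F (i b) (\<Psi> m)"
proof -
  have i: "xhom B F i" using k hom_i1 hom_i2 by auto
  have \<Psi>i: "\<Psi> (\<iota> k a) = i a" if "a \<in> sa_carrier B" for a using k \<Psi>_\<iota>[OF that] by auto
  have kI: "k \<in> {0, 1}" using k by auto
  note ic = xhom_closed[OF i]
  show "\<Psi> (Lop k b 1) = i b" by (simp add: Lop_one \<Psi>i b)
  assume "m \<in> sa_carrier (FA (X \<times> {0, 1}))"
  then show "\<Psi> (Lop k b m) = sa_mul F (i b) (\<Psi> m)"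
  proof (induction m rule: FA_induct)
    case (single w c)
    then obtain x j v where w: "letters w = (x, j) # v" by (cases "letters w") auto
    have x: "x \<in> X" "j \<in> {0, 1}" and v: "set v \<subseteq> X \<times> {0, 1}" using single w by auto
    have "\<Psi> (Lop k b (mon ((x, j) # v))) = sa_mul F (i b) (\<Psi> (mon ((x, j) # v)))"
    proof (cases "j = k")
      case False
      have "\<Psi> (\<iota> k b * mon ((x, j) # v)) = sa_mul F (\<Psi> (\<iota> k b)) (\<Psi> (mon ((x, j) # v)))"
        by (rule xhom_mul[OF \<Psi>, of _ "X \<times> {0, 1}", simplified])
          (use x v b kI in \<open>auto intro!: \<iota>_FA FA_mon\<close>)
      then show ?thesis using False by (simp add: Lop_Cons \<Psi>i b)
    next
      case True
      have bx: "sa_mul B b x \<in> sa_carrier B" using b x X_closed by simp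
      have lx: "le (x, j) = i x" using k True x by (auto simp: le_def)
      show ?thesis
      proof (cases "v = []")
        case True
        then show ?thesis using \<open>j = k\<close> x bx lx b X_closed
          by (simp add: Lop_Cons \<Psi>i \<Psi>_rules xhom_mul[OF i])
      next
        case False
        have mv: "mon v \<in> sa_carrier (FA (X \<times> {0, 1}))" using False v by (rule FA_mon)
        have "\<Psi> (\<iota> k (sa_mul B b x) * mon v) = sa_mul F (\<Psi> (\<iota> k (sa_mul B b x))) (\<Psi> (mon v))"
          using xhom_mul[OF \<Psi> \<iota>_FA[OF bx kI] mv] by simp
        also have "\<dots> = sa_mul F (i b) (sa_mul F (i x) (\<Psi> (mon v)))"
          using b x X_closed ic by (simp add: \<Psi>i bx xhom_mul[OF i] F.mul_assoc \<Psi>_rules(1))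
        also have "sa_mul F (i x) (\<Psi> (mon v)) = \<Psi> (mon ((x, j) # v))"
          using False lx by (simp add: \<Psi>_rules F.lprod_Cons)
        finally show ?thesis using \<open>j = k\<close> x by (simp add: Lop_Cons)
      qed
    qed
    then show ?case unfolding single_eq_cst_mon w Lop_cst
      using b ic by (simp add: \<Psi>_rules(4) F.smul_mul_right \<Psi>_rules(1))
  next
    case zero then show ?case using b ic by (simp add: \<Psi>_rules)
  next
    case (add p q) then show ?case using b ic by (simp add: \<Psi>_rules(1,3) Lop_add F.distrib_left)
  qed
qed

lemma \<Psi>_LP:
  assumes z: "z \<in> sa_carrier F"
  shows "\<Psi> (LP z 1) = z \<and> (\<forall>m\<in>sa_carrier (FA (X \<times> {0, 1})). \<Psi> (LP z m) = sa_mul F z (\<Psi> m))"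
  using P z
proof (induction z rule: fp_induct)
  case (left a) then show ?case using \<Psi>_Lop[of a 0 i1] by (simp add: LP)
next
  case (right a) then show ?case using \<Psi>_Lop[of a 1 i2] by (simp add: LP)
next
  case (add x y) then show ?case by (simp add: LP_add \<Psi>_rules(1,3) F.distrib_right)
next
  case (smul d x) then show ?case by (simp add: LP_smul \<Psi>_rules(1,4) F.smul_mul_left)
next
  case (mul x y)
  then show ?case using LP_FA[OF mul(2)] by (simp add: LP_mul \<Psi>_rules(1) F.mul_assoc)
qed

lemma \<Psi>_S: "z \<in> sa_carrier F \<Longrightarrow> \<Psi> (S z) = z"
  unfolding S_def using \<Psi>_LP by blast

end

section \<open>Coded free algebras\<close>

lemma FA_mono: "p \<in> sa_carrier (FA Y) \<Longrightarrow> Y \<subseteq> Z \<Longrightarrow> p \<in> sa_carrier (FA Z)"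
  unfolding FA_carrier by blast

lemma sub_mon_id: "sub (\<lambda>l. mon [l]) p = p"
proof (induction p rule: pm_induct)
  case (single w c)
  show ?case unfolding single_eq_cst_mon by (simp add: sub_cst sub_mon prod_list_mon_letters)
qed (simp_all add: sub_add)

lemma sub_fstar:
  assumes "p \<in> sa_carrier (FA Y)" and s: "\<And>l. l \<in> Y \<Longrightarrow> fstar (s l) = s l"
  shows "sub s (fstar p) = fstar (sub s p)"
  using assms(1)
proof (induction p rule: FA_mon_induct)
  case (letter l) then show ?case by (simp add: fstar_mon sub_mon s)
next
  case (smul p c) then show ?case by (simp add: fstar_cst_mult sub_cst)
qed (simp_all add: fstar_add sub_add fstar_mult sub_mult)

context coding begin

definition FC :: "('v \<times> nat) set \<Rightarrow> 'v salg" where "FC Y = transport enc (FA Y)"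

lemma FC_carrier: "sa_carrier (FC Y) = enc ` sa_carrier (FA Y)"
  by (simp add: FC_def carrier_transport)

lemma is_star_alg_FC: "is_star_alg (FC Y)"
  unfolding FC_def by (rule is_star_alg_transport[OF is_star_alg_FA inj_on_enc])

lemma is_alg_FC: "is_alg (FC Y)"
  using is_star_alg_FC by (simp add: is_star_alg_def)

lemma enc_FC: "xhom (FA Y) (FC Y) enc"
  unfolding FC_def by (rule xhom_code[OF is_alg_FA inj_on_enc])

lemma FC_star: "p \<in> sa_carrier (FA Y) \<Longrightarrow> sa_star (FC Y) (enc p) = enc (fstar p)"
  unfolding FC_def using star_code[OF is_alg_FA inj_on_enc, of p Y] by simp

lemma dcd_enc_FA: "p \<in> sa_carrier (FA Y) \<Longrightarrow> dcd (enc p) = p"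
  by (rule dcd_enc) (rule FA_mono; simp)

lemma dcd_FC: "xhom (FC Y) (FA Y) dcd"
proof (rule xhom_cong[OF _ is_alg_FC])
  show "xhom (FC Y) (FA Y) (inv_into (sa_carrier (FA Y)) enc)"
    unfolding FC_def by (rule xhom_dec[OF is_alg_FA inj_on_enc])
  show "inv_into (sa_carrier (FA Y)) enc a = dcd a" if "a \<in> sa_carrier (FC Y)" for a
    using that by (auto simp: FC_carrier dcd_enc_FA inv_into_f_f[OF inj_on_enc])
qed

lemma FC_gen: "l \<in> Y \<Longrightarrow> enc (mon [l]) \<in> sa_carrier (FC Y)"
  unfolding FC_carrier by (intro imageI FA_mon) auto

lemma FC_unique:
  assumes "is_alg C" "xhom (FC Y) C f" "xhom (FC Y) C h" "\<And>l. l \<in> Y \<Longrightarrow> f (enc (mon [l])) = h (enc (mon [l]))"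
    and "a \<in> sa_carrier (FC Y)"
  shows "f a = h a"
proof -
  obtain p where p: "p \<in> sa_carrier (FA Y)" "a = enc p" using assms(5) by (auto simp: FC_carrier)
  have "(f \<circ> enc) p = (h \<circ> enc) p"
    by (rule FA_xhom_unique[OF assms(1) xhom_comp[OF enc_FC assms(2)] xhom_comp[OF enc_FC assms(3)] _ p(1)])
       (simp add: assms(4))
  then show ?thesis using p by simp
qed

lemma subst_enc: "p \<in> sa_carrier (FA Y) \<Longrightarrow> subst s (enc p) = enc (sub s p)"
  by (simp add: subst_def dcd_enc_FA)

lemma subst_letter: "subst s (enc (mon [l])) = enc (s l)"
  by (simp add: subst_enc[OF FA_letter] sub_mon)

lemma xhom_subst_FC:
  assumes "\<And>l. l \<in> Y \<Longrightarrow> s l \<in> sa_carrier (FA Z)"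
  shows "xhom (FC Y) (FC Z) (subst s)"
  using xhom_comp[OF xhom_comp[OF dcd_FC xhom_sub[of Y s Z, OF assms]] enc_FC] by (simp add: subst_def[abs_def] comp_def)

lemma star_subst_FC:
  assumes s: "\<And>l. l \<in> Y \<Longrightarrow> s l \<in> sa_carrier (FA Z)" and st: "\<And>l. l \<in> Y \<Longrightarrow> fstar (s l) = s l"
  shows "star_hom (FC Y) (FC Z) (subst s)"
  unfolding star_hom_def alg_hom_iff_xhom
proof (intro conjI ballI)
  show h: "xhom (FC Y) (FC Z) (subst s)" by (rule xhom_subst_FC[OF s])
  fix a assume "a \<in> sa_carrier (FC Y)"
  then obtain p where p: "p \<in> sa_carrier (FA Y)" "a = enc p" by (auto simp: FC_carrier)
  have "sub s p \<in> sa_carrier (FA Z)" by (rule xhom_closed[OF xhom_sub[of Y s Z, OF s] p(1)])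
  then show "subst s (sa_star (FC Y) a) = sa_star (FC Z) (subst s a)"
    using p by (simp add: FC_star subst_enc[OF FA_fstar[OF p(1)]] subst_enc[OF p(1)] sub_fstar[OF p(1), of s, OF st])
qed

definition ren :: "('v \<times> nat \<Rightarrow> 'v \<times> nat) \<Rightarrow> 'v \<Rightarrow> 'v" where
  "ren r = subst (\<lambda>l. mon [r l])"

lemma ren_letter [simp]: "ren r (enc (mon [l])) = enc (mon [r l])"
  by (simp add: ren_def subst_letter)

lemma ren_id: "p \<in> sa_carrier (FA Y) \<Longrightarrow> ren id (enc p) = enc p"
  by (simp add: ren_def subst_enc[of p Y] sub_mon_id)

lemma star_ren: "r ` Y \<subseteq> Z \<Longrightarrow> star_hom (FC Y) (FC Z) (ren r)"
  unfolding ren_def by (rule star_subst_FC) (auto simp: fstar_mon intro!: FA_mon)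

lemma xhom_ren: "r ` Y \<subseteq> Z \<Longrightarrow> xhom (FC Y) (FC Z) (ren r)"
  using star_ren[of r Y Z] by (simp add: star_hom_def alg_hom_iff_xhom)

text \<open>Every letter of \<open>Z\<close> comes from exactly one renaming, so homomorphisms on
  the two factors prescribe the values on letters without conflict. Explicit renamings give concrete
  models of the iterated products.\<close>

lemma free_product_FC:
  assumes r1: "inj_on r1 Y1" and r2: "inj_on r2 Y2" and disj: "r1 ` Y1 \<inter> r2 ` Y2 = {}" and Z: "r1 ` Y1 \<union> r2 ` Y2 = Z"
  shows "is_star_free_product (FC Y1) (FC Y2) (FC Z, ren r1, ren r2)"
proof -
  have s: "star_hom (FC Y1) (FC Z) (ren r1)" "star_hom (FC Y2) (FC Z) (ren r2)" by (rule star_ren; use Z in blast)+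
  have h: "xhom (FC Y1) (FC Z) (ren r1)" "xhom (FC Y2) (FC Z) (ren r2)" by (rule xhom_ren; use Z in blast)+
  have ex: "\<exists>f. xhom (FC Z) C f \<and> (\<forall>a\<in>sa_carrier (FC Y1). f (ren r1 a) = f1 a) \<and> (\<forall>a\<in>sa_carrier (FC Y2). f (ren r2 a) = f2 a)"
    if C: "is_alg C" and f1: "xhom (FC Y1) C f1" and f2: "xhom (FC Y2) C f2" for C :: "'v salg" and f1 f2
  proof -
    define g where "g l = (if l \<in> r1 ` Y1 then f1 (enc (mon [inv_into Y1 r1 l])) else f2 (enc (mon [inv_into Y2 r2 l])))" for l
    have gc: "g l \<in> sa_carrier C" if "l \<in> Z" for l
      using that Z by (auto simp: g_def inv_into_f_f[OF r1] inv_into_f_f[OF r2] intro!: xhom_closed[OF f1] xhom_closed[OF f2] FC_gen)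
    have g1: "g (r1 l) = f1 (enc (mon [l]))" if "l \<in> Y1" for l using that by (simp add: g_def inv_into_f_f[OF r1])
    have g2: "g (r2 l) = f2 (enc (mon [l]))" if "l \<in> Y2" for l
    proof -
      have "r2 l \<notin> r1 ` Y1" using that disj by blast
      then show ?thesis using that by (simp add: g_def inv_into_f_f[OF r2])
    qed
    show ?thesis
    proof (rule FA_extend[OF C, of Z g])
      show "g l \<in> sa_carrier C" if "l \<in> Z" for l using gc[OF that] .
      fix f assume f: "xhom (FA Z) C f" and fg: "\<And>l. l \<in> Z \<Longrightarrow> f (mon [l]) = g l"
      have hf: "xhom (FC Z) C (f \<circ> dcd)" by (rule xhom_comp[OF dcd_FC f])
      have fl: "(f \<circ> dcd) (enc (mon [l])) = g l" if "l \<in> Z" for l using fg[OF that] by (simp add: dcd_enc_FA[OF FA_letter])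
      show ?thesis
      proof (intro exI conjI ballI)
        show "xhom (FC Z) C (f \<circ> dcd)" by (rule hf)
        show "(f \<circ> dcd) (ren r1 a) = f1 a" if a: "a \<in> sa_carrier (FC Y1)" for a
        proof -
          have "((f \<circ> dcd) \<circ> ren r1) a = f1 a"
          proof (rule FC_unique[OF C xhom_comp[OF h(1) hf] f1 _ a])
            fix l assume l: "l \<in> Y1"
            have "r1 l \<in> Z" using l Z by blast
            from fl[OF this] show "((f \<circ> dcd) \<circ> ren r1) (enc (mon [l])) = f1 (enc (mon [l]))" using l g1 by simp
          qed
          then show ?thesis by simp
        qed
        show "(f \<circ> dcd) (ren r2 a) = f2 a" if a: "a \<in> sa_carrier (FC Y2)" for a
        proof -
          have "((f \<circ> dcd) \<circ> ren r2) a = f2 a"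
          proof (rule FC_unique[OF C xhom_comp[OF h(2) hf] f2 _ a])
            fix l assume l: "l \<in> Y2"
            have "r2 l \<in> Z" using l Z by blast
            from fl[OF this] show "((f \<circ> dcd) \<circ> ren r2) (enc (mon [l])) = f2 (enc (mon [l]))" using l g2 by simp
          qed
          then show ?thesis by simp
        qed
      qed
    qed
  qed
  have un: "f x = f' x" if C: "is_alg C" and f: "xhom (FC Z) C f" "xhom (FC Z) C f'"
    and eq: "\<forall>a\<in>sa_carrier (FC Y1). f (ren r1 a) = f' (ren r1 a)" "\<forall>a\<in>sa_carrier (FC Y2). f (ren r2 a) = f' (ren r2 a)"
    and x: "x \<in> sa_carrier (FC Z)" for C :: "'v salg" and f f' x
  proof (rule FC_unique[OF C f _ x])
    fix l assume "l \<in> Z"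
    then consider k where "k \<in> Y1" "l = r1 k" | k where "k \<in> Y2" "l = r2 k" using Z by blast
    then show "f (enc (mon [l])) = f' (enc (mon [l]))"
    proof cases
      case 1 then show ?thesis using eq(1)[rule_format, OF FC_gen[OF 1(1)]] by simp
    next
      case 2 then show ?thesis using eq(2)[rule_format, OF FC_gen[OF 2(1)]] by simp
    qed
  qed
  have "is_free_product (FC Y1) (FC Y2) (FC Z, ren r1, ren r2)"
    unfolding is_free_product_def alg_hom_iff_xhom prod.case
  proof (intro conjI allI impI is_alg_FC h, goal_cases)
    case (1 C f1 f2)
    then show ?case using ex[of C f1 f2] by simp
  next
    case (2 C f1 f2 f g)
    show ?case by (rule ballI, rule un[of C]) (use 2 in auto)
  qed
  then show ?thesis using s by (simp add: is_star_free_product_def is_star_alg_FC)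
qed

end

section \<open>The lifted comultiplication\<close>

context lifting begin

definition "T0 = FC (X \<times> {0})"
definition "PT = (FC (X \<times> {0, 1}), ren id, ren (\<lambda>l. (fst l, 1)))"
text \<open>\<open>GP\<close> and \<open>HP\<close> share the free algebra on three tagged copies,
  with embeddings chosen such that the canonical associativity isomorphism is the identity.\<close>

definition "GP = (FC (X \<times> {0, 1, 2}), ren id, ren (\<lambda>l. (fst l, 2)))"
definition "HP = (FC (X \<times> {0, 1, 2}), ren id, ren (\<lambda>l. (fst l, Suc (snd l))))"

lemma star_PT: "is_star_free_product T0 T0 PT"
  unfolding T0_def PT_def by (rule free_product_FC) (auto simp: inj_on_def image_iff)

lemma PT: "is_free_product T0 T0 PT" using star_PT by (simp add: is_star_free_product_def)

lemma GP: "is_free_product (fst PT) T0 GP"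
proof -
  have "is_star_free_product (FC (X \<times> {0, 1})) (FC (X \<times> {0})) (FC (X \<times> {0, 1, 2}), ren id, ren (\<lambda>l. (fst l, 2)))"
    by (rule free_product_FC) (auto simp: inj_on_def image_iff)
  then show ?thesis by (simp add: is_star_free_product_def T0_def PT_def GP_def)
qed

lemma HP: "is_free_product T0 (fst PT) HP"
proof -
  have "is_star_free_product (FC (X \<times> {0})) (FC (X \<times> {0, 1})) (FC (X \<times> {0, 1, 2}), ren id, ren (\<lambda>l. (fst l, Suc (snd l))))"
    by (rule free_product_FC) (auto simp: inj_on_def image_iff)
  then show ?thesis by (simp add: is_star_free_product_def T0_def PT_def HP_def)
qed

lemma fst_PT: "fst PT = FC (X \<times> {0, 1})" by (simp add: PT_def)

text \<open>A homomorphism on a free algebra may be prescribed on letters. Taking the normal form of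
  \<open>\<Delta> x\<close> yields a lift that inherits coassociativity, counit and
  involution.\<close>

definition lft :: "'v \<Rightarrow> 'v" where
  "lft = subst (\<lambda>l. S (\<Delta> (fst l)))"

lemma star_lft: "star_hom T0 (fst PT) lft"
  unfolding T0_def fst_PT lft_def
  by (rule star_subst_FC) (use X_closed hermitian in \<open>auto simp: fstar_S \<Delta>_closed i_star intro!: S_FA[unfolded One_nat_def]\<close>)

lemma xhom_lft: "xhom T0 (fst PT) lft"
  using star_lft by (simp add: star_hom_def alg_hom_iff_xhom)

lemma lft_letter: "lft (enc (mon [(x, k)])) = enc (S (\<Delta> x))"
  by (simp add: lft_def subst_letter)

lemma rsub_hom:
  assumes h: "xhom (fst PT) (FC Z) h"
    and h0: "\<And>x. x \<in> X \<Longrightarrow> h (enc (mon [(x, 0)])) = enc (\<Theta>0 x 1)" and h1: "\<And>x. x \<in> X \<Longrightarrow> h (enc (mon [(x, 1)])) = enc (\<Theta>1 x 1)"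
    and c0: "\<And>x. x \<in> X \<Longrightarrow> \<Theta>0 x 1 \<in> sa_carrier (FA Z)" and c1: "\<And>x. x \<in> X \<Longrightarrow> \<Theta>1 x 1 \<in> sa_carrier (FA Z)"
    and p: "p \<in> sa_carrier (FA (X \<times> {0, 1}))"
  shows "h (enc p) = enc (rsub \<Theta>0 \<Theta>1 p)"
proof -
  have r: "xhom (FA (X \<times> {0, 1})) (FA Z) (rsub \<Theta>0 \<Theta>1)"
    unfolding rsub_def by (rule xhom_sub) (use c0 c1 in auto)
  have "(h \<circ> enc) p = (enc \<circ> rsub \<Theta>0 \<Theta>1) p"
  proof (rule FA_xhom_unique[OF is_alg_FC xhom_comp[OF enc_FC h[unfolded fst_PT]] xhom_comp[OF r enc_FC] _ p])
    fix l :: "'v \<times> nat" assume "l \<in> X \<times> {0, 1}"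
    then show "(h \<circ> enc) (mon [l]) = (enc \<circ> rsub \<Theta>0 \<Theta>1) (mon [l])"
      using h0 h1 by (auto simp: rsub_mon)
  qed
  then show ?thesis by simp
qed

lemma xhom_LP_\<Delta>: "xhom B (endo {0, 1}) (\<lambda>b. LP (\<Delta> b))"
  using xhom_comp[OF hom_\<Delta> LP(1)] by (simp add: comp_def)

lemma xhom_rep_\<Delta>: "xhom B (endo {1, 2}) (\<lambda>b. rep {1, 2} 1 2 (\<Delta> b))"
  using xhom_comp[OF hom_\<Delta> xhom_rep[of 1 "{1, 2}" 2]] by (simp add: comp_def)

text \<open>Either side is a representation of a threefold free product of \<open>B\<close>, applied
  to an iterated coproduct and then to 1. The representations of the two bracketings agree under the
  canonical isomorphism, so coassociativity of \<open>\<Delta>\<close> finishes.\<close>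

lemma coassoc_rep:
  assumes b: "b \<in> sa_carrier B"
  shows "rsub (\<lambda>b. LP (\<Delta> b)) (Lop 2) (S (\<Delta> b)) = rsub (Lop 0) (\<lambda>b. rep {1, 2} 1 2 (\<Delta> b)) (S (\<Delta> b))"
proof -
  let ?R = "rep {1, 2} 1 2" and ?E = "endo {0, 1, 2} :: (('v \<times> nat) fa \<Rightarrow> ('v \<times> nat) fa) salg"
  have R: "xhom F (endo {1, 2}) ?R" and R1: "\<And>a. a \<in> sa_carrier B \<Longrightarrow> ?R (i1 a) = Lop 1 a"
    and R2: "\<And>a. a \<in> sa_carrier B \<Longrightarrow> ?R (i2 a) = Lop 2 a" by (rule rep; simp)+
  have RE: "xhom F ?E ?R" and LE: "xhom F ?E LP" by (rule xhom_endo_mono[OF R] xhom_endo_mono[OF LP(1)]; simp)+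
  have L2: "xhom B ?E (Lop 2)" and L0: "xhom B ?E (Lop 0)" by (rule xhom_Lop; simp)+
  \<comment> \<open>Abstract threefold products serve here; only the resulting operators on words
    are compared with the coded models.\<close>
  obtain G where G: "is_free_product F B G" by (rule free_product_exists[OF alg_F alg_B])
  obtain H where H: "is_free_product B F H" by (rule free_product_exists[OF alg_B alg_F])
  note aH = is_free_product_algs[OF H]
  obtain LG where LG: "xhom (fst G) ?E LG" "\<And>a. a \<in> sa_carrier F \<Longrightarrow> LG (fst (snd G) a) = LP a"
      "\<And>a. a \<in> sa_carrier B \<Longrightarrow> LG (snd (snd G) a) = Lop 2 a"
    by (rule fp_extend_any[OF G is_alg_endo LE L2]) (rule that; assumption)
  obtain LH where LH: "xhom (fst H) ?E LH" "\<And>a. a \<in> sa_carrier B \<Longrightarrow> LH (fst (snd H) a) = Lop 0 a"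
      "\<And>a. a \<in> sa_carrier F \<Longrightarrow> LH (snd (snd H) a) = ?R a"
    by (rule fp_extend_any[OF H is_alg_endo L0 RE]) (rule that; assumption)
  define l1 where "l1 = fp_lift B B P (fst H) (fst (snd H)) (snd (snd H) \<circ> i1)"
  note l1 = fp_lift[OF P aH(3,4) xhom_comp[OF hom_i1 aH(5)], folded l1_def]
  define as where "as = fp_assoc B B B P G P H"
  have as_eq: "as = fp_lift F B G (fst H) l1 (snd (snd H) \<circ> i2)" by (simp add: as_def fp_assoc_def l1_def)
  note as = fp_lift[OF G aH(3) l1(1) xhom_comp[OF hom_i2 aH(5)], folded as_eq]
  have 1: "LP z = (LH \<circ> l1) z" if "z \<in> sa_carrier F" for z
  proof (rule fp_unique_any[OF P LE xhom_comp[OF l1(1) LH(1)] _ _ that])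
    show "LP (i1 a) = (LH \<circ> l1) (i1 a)" if "a \<in> sa_carrier B" for a using that by (simp add: LP l1 LH)
    show "LP (i2 a) = (LH \<circ> l1) (i2 a)" if "a \<in> sa_carrier B" for a
      using that R1[OF that] LH(3)[OF xhom_closed[OF hom_i1 that]] by (simp add: LP l1)
  qed
  have 2: "LG y = (LH \<circ> as) y" if "y \<in> sa_carrier (fst G)" for y
  proof (rule fp_unique_any[OF G LG(1) xhom_comp[OF as(1) LH(1)] _ _ that])
    show "LG (fst (snd G) a) = (LH \<circ> as) (fst (snd G) a)" if "a \<in> sa_carrier F" for a
      using that 1[OF that] by (simp add: LG as)
    show "LG (snd (snd G) a) = (LH \<circ> as) (snd (snd G) a)" if "a \<in> sa_carrier B" for a
      using that R2[OF that] LH(3)[OF xhom_closed[OF hom_i2 that]] by (simp add: LG as)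
  qed
  note mG = fp_map[OF P G hom_\<Delta> xhom_id] and mH = fp_map[OF P H xhom_id hom_\<Delta>]
  have "rsub (\<lambda>b. LP (\<Delta> b)) (Lop 2) (S (\<Delta> b)) = (LG \<circ> fp_map B B P G \<Delta> id) (\<Delta> b) 1"
    by (rule rsub_S[OF xhom_LP_\<Delta> xhom_Lop[of 2 "{2}"] _ xhom_comp[OF mG(1) LG(1)]])
       (use b \<Delta>_closed in \<open>simp_all add: mG LG\<close>)
  moreover have "rsub (Lop 0) (\<lambda>b. ?R (\<Delta> b)) (S (\<Delta> b)) = (LH \<circ> fp_map B B P H id \<Delta>) (\<Delta> b) 1"
    by (rule rsub_S[OF xhom_Lop[of 0 "{0}"] xhom_rep_\<Delta> _ xhom_comp[OF mH(1) LH(1)]])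
       (use b \<Delta>_closed in \<open>simp_all add: mH LH\<close>)
  moreover have "as (fp_map B B P G \<Delta> id (\<Delta> b)) = fp_map B B P H id \<Delta> (\<Delta> b)"
    unfolding as_def
    using dual[unfolded dual_semigroup_def, THEN conjunct2, THEN conjunct2, THEN conjunct2, THEN conjunct1,
      THEN spec, THEN spec, THEN mp, OF conjI[OF G H], THEN bspec, OF b] .
  ultimately show ?thesis using 2[OF xhom_closed[OF mG(1) \<Delta>_closed[OF b]]] by simp
qed

text \<open>Deleting the letters of one copy corresponds to representing that copy by zero, and this
  representation factors through the homomorphism of the counit axiom.\<close>

lemma counit_rep:
  assumes b: "b \<in> sa_carrier B"
  shows "rsub (\<lambda>_ _. 0) (Lop 0) (S (\<Delta> b)) = \<iota> 0 b" "rsub (Lop 0) (\<lambda>_ _. 0) (S (\<Delta> b)) = \<iota> 0 b"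
proof -
  have Z: "xhom B (endo {}) (\<lambda>_ _. 0)" using xhom_const_zero[OF is_alg_endo, of B "{}"] by simp
  note Z0 = xhom_const_zero[OF alg_B]
  have L0: "xhom B (endo {0}) (Lop 0)" by (rule xhom_Lop) simp
  have Lz: "Lop 0 (sa_zero B) = (\<lambda>_. 0)" using xhom_zero[OF alg_B is_alg_endo L0] by simp
  note c = dual[unfolded dual_semigroup_def, THEN conjunct2, THEN conjunct2, THEN conjunct2, THEN conjunct2]
  note l = fp_lift[OF P alg_B Z0 xhom_id]
  have "rsub (\<lambda>_ _. 0) (Lop 0) (S (\<Delta> b)) = (Lop 0 \<circ> fp_lift B B P B (\<lambda>_. sa_zero B) id) (\<Delta> b) 1"
    by (rule rsub_S[OF Z L0 _ xhom_comp[OF l(1) L0]]) (use b \<Delta>_closed in \<open>simp_all add: l Lz\<close>)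
  then show "rsub (\<lambda>_ _. 0) (Lop 0) (S (\<Delta> b)) = \<iota> 0 b" using c[THEN conjunct1] b by (simp add: Lop_one)
  note l = fp_lift[OF P alg_B xhom_id Z0]
  have "rsub (Lop 0) (\<lambda>_ _. 0) (S (\<Delta> b)) = (Lop 0 \<circ> fp_lift B B P B id (\<lambda>_. sa_zero B)) (\<Delta> b) 1"
    by (rule rsub_S[OF L0 Z _ xhom_comp[OF l(1) L0]]) (use b \<Delta>_closed in \<open>simp_all add: l Lz\<close>)
  then show "rsub (Lop 0) (\<lambda>_ _. 0) (S (\<Delta> b)) = \<iota> 0 b" using c[THEN conjunct2] b by (simp add: Lop_one)
qed

lemma rsub_shift:
  assumes p: "p \<in> sa_carrier (FA (X \<times> {0, 1}))"
  shows "sub (\<lambda>l. mon [(fst l, Suc (snd l))]) p = rsub (Lop 1) (Lop 2) p"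
  using p
proof (induction p rule: FA_mon_induct)
  case (letter l) then show ?case by (auto simp: rsub_mon sub_mon Lop_one \<iota>_basis eval_nat_numeral)
qed (simp_all add: rsub_def sub_add sub_cst sub_mult)

lemma PT_emb: "fst (snd PT) = ren id" "snd (snd PT) = ren (\<lambda>l. (fst l, 1))"
  and GP_simps: "fst GP = FC (X \<times> {0, 1, 2})" "fst (snd GP) = ren id" "snd (snd GP) = ren (\<lambda>l. (fst l, 2))"
  and HP_simps: "fst HP = FC (X \<times> {0, 1, 2})" "fst (snd HP) = ren id" "snd (snd HP) = ren (\<lambda>l. (fst l, Suc (snd l)))"
  by (simp_all add: PT_def GP_def HP_def)

lemma T0_gen: "x \<in> X \<Longrightarrow> enc (mon [(x, 0)]) \<in> sa_carrier T0"
  unfolding T0_def by (rule FC_gen) simp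

lemma S\<Delta>_FA: "x \<in> X \<Longrightarrow> S (\<Delta> x) \<in> sa_carrier (FA (X \<times> {0, 1}))"
  by (rule S_FA[OF \<Delta>_closed[OF X_closed]])

lemma fp_map_GP:
  assumes x: "x \<in> X"
  shows "fp_map T0 T0 PT GP lft id (enc (S (\<Delta> x))) = enc (rsub (\<lambda>b. LP (\<Delta> b)) (Lop 2) (S (\<Delta> x)))"
proof (rule rsub_hom[of "X \<times> {0, 1, 2}", OF _ _ _ _ _ S\<Delta>_FA[OF x]])
  note m = fp_map[OF PT GP xhom_lft xhom_id]
  show "xhom (fst PT) (FC (X \<times> {0, 1, 2})) (fp_map T0 T0 PT GP lft id)" using m(1) by (simp only: GP_simps)
  fix y assume y: "y \<in> X"
  show "fp_map T0 T0 PT GP lft id (enc (mon [(y, 0)])) = enc (LP (\<Delta> y) 1)"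
    using m(2)[OF T0_gen[OF y]] ren_id[OF S\<Delta>_FA[OF y]] by (simp add: PT_emb GP_simps lft_letter) (simp add: S_def)
  show "fp_map T0 T0 PT GP lft id (enc (mon [(y, 1)])) = enc (Lop 2 y 1)"
    using m(3)[OF T0_gen[OF y]] y by (simp add: PT_emb GP_simps Lop_one \<iota>_basis)
  show "LP (\<Delta> y) 1 \<in> sa_carrier (FA (X \<times> {0, 1, 2}))" by (rule FA_mono[OF S\<Delta>_FA[OF y, unfolded S_def]]) auto
  show "Lop 2 y 1 \<in> sa_carrier (FA (X \<times> {0, 1, 2}))" using y by (auto simp: Lop_one \<iota>_basis intro!: FA_mon)
qed

lemma fp_map_HP:
  assumes x: "x \<in> X"
  shows "fp_map T0 T0 PT HP id lft (enc (S (\<Delta> x))) = enc (rsub (Lop 0) (\<lambda>b. rep {1, 2} 1 2 (\<Delta> b)) (S (\<Delta> x)))"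
proof (rule rsub_hom[of "X \<times> {0, 1, 2}", OF _ _ _ _ _ S\<Delta>_FA[OF x]])
  note m = fp_map[OF PT HP xhom_id xhom_lft]
  have sh: "rep {1, 2} 1 2 (\<Delta> y) 1 = sub (\<lambda>l. mon [(fst l, Suc (snd l))]) (S (\<Delta> y))" if y: "y \<in> X" for y
    unfolding rsub_shift[OF S\<Delta>_FA[OF y]]
    by (rule rsub_S[OF xhom_Lop[of 1 "{1}"] xhom_Lop[of 2 "{2}"] _ xhom_rep, symmetric])
       (use y X_closed \<Delta>_closed rep_1[of 1 "{1, 2}" 2] rep_2[of 1 "{1, 2}" 2] in auto)
  show "xhom (fst PT) (FC (X \<times> {0, 1, 2})) (fp_map T0 T0 PT HP id lft)" using m(1) by (simp only: HP_simps)
  fix y assume y: "y \<in> X"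
  show "fp_map T0 T0 PT HP id lft (enc (mon [(y, 0)])) = enc (Lop 0 y 1)"
    using m(2)[OF T0_gen[OF y]] y by (simp add: PT_emb HP_simps Lop_one \<iota>_basis)
  show "fp_map T0 T0 PT HP id lft (enc (mon [(y, 1)])) = enc (rep {1, 2} 1 2 (\<Delta> y) 1)"
    unfolding sh[OF y] using m(3)[OF T0_gen[OF y]] S\<Delta>_FA[OF y] by (simp add: PT_emb HP_simps lft_letter ren_def subst_enc subst_letter)
  show "Lop 0 y 1 \<in> sa_carrier (FA (X \<times> {0, 1, 2}))" using y by (auto simp: Lop_one \<iota>_basis intro!: FA_mon)
  have "xhom (FA (X \<times> {0, 1})) (FA (X \<times> {0, 1, 2})) (sub (\<lambda>l. mon [(fst l, Suc (snd l))]))"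
    by (rule xhom_sub) (auto intro!: FA_mon)
  from xhom_closed[OF this S\<Delta>_FA[OF y]]
  show "rep {1, 2} 1 2 (\<Delta> y) 1 \<in> sa_carrier (FA (X \<times> {0, 1, 2}))" unfolding sh[OF y] .
qed

lemma fp_assoc_coded:
  assumes y: "y \<in> sa_carrier (fst GP)"
  shows "fp_assoc T0 T0 T0 PT GP PT HP y = y"
proof -
  note aH = is_free_product_algs[OF HP] and aP = is_free_product_algs[OF PT]
  define l1 where "l1 = fp_lift T0 T0 PT (fst HP) (fst (snd HP)) (snd (snd HP) \<circ> fst (snd PT))"
  note l1 = fp_lift[OF PT aH(3,4) xhom_comp[OF aP(4) aH(5)], folded l1_def]
  define as where "as = fp_assoc T0 T0 T0 PT GP PT HP"
  have as_eq: "as = fp_lift (fst PT) T0 GP (fst HP) l1 (snd (snd HP) \<circ> snd (snd PT))" by (simp add: as_def fp_assoc_def l1_def)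
  note as = fp_lift[OF GP aH(3) l1(1) xhom_comp[OF aP(5) aH(5)], folded as_eq]
  have "as y = id y"
  proof (rule FC_unique[where Y = "X \<times> {0, 1, 2}" and C = "FC (X \<times> {0, 1, 2})" and f = as and h = id and a = y, OF is_alg_FC])
    show "xhom (FC (X \<times> {0, 1, 2})) (FC (X \<times> {0, 1, 2})) as" using as(1) by (simp only: GP_simps HP_simps)
    show "y \<in> sa_carrier (FC (X \<times> {0, 1, 2}))" using y by (simp only: GP_simps)
    fix l :: "'v \<times> nat" assume "l \<in> X \<times> {0, 1, 2}"
    then obtain x where x: "x \<in> X" and l: "l = (x, 0) \<or> l = (x, 1) \<or> l = (x, 2)" by auto
    note g = T0_gen[OF x]
    have g': "enc (mon [(x, k)]) \<in> sa_carrier (fst PT)" if "k < 2" for k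
      unfolding fst_PT by (rule FC_gen) (use that x in auto)
    have "as (enc (mon [(x, 0)])) = enc (mon [(x, 0)])" using as(2)[OF g'[of 0]] l1(2)[OF g] by (simp add: PT_emb GP_simps HP_simps)
    moreover have "as (enc (mon [(x, 1)])) = enc (mon [(x, 1)])" using as(2)[OF g'[of 1]] l1(3)[OF g] by (simp add: PT_emb GP_simps HP_simps)
    moreover have "as (enc (mon [(x, 2)])) = enc (mon [(x, 2)])" using as(3)[OF g] by (simp add: PT_emb GP_simps HP_simps eval_nat_numeral)
    ultimately show "as (enc (mon [l])) = id (enc (mon [l]))" using l by auto
  qed (rule xhom_id)
  then show ?thesis by (simp add: as_def)
qed

lemma weak_dual_lft: "weak_dual T0 PT lft"
  unfolding weak_dual_def
proof (intro conjI ballI exI)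
  show "is_free_product T0 T0 PT" "xhom T0 (fst PT) lft" "is_free_product (fst PT) T0 GP" "is_free_product T0 (fst PT) HP"
    by (rule PT xhom_lft GP HP)+
  have algT: "is_alg T0" unfolding T0_def by (rule is_alg_FC)
  have gen: "\<exists>x\<in>X. l = (x, 0)" if "l \<in> X \<times> {0}" for l :: "'v \<times> nat" using that by auto
  fix b assume b: "b \<in> sa_carrier T0"
  note mG = fp_map[OF PT GP xhom_lft xhom_id] and mH = fp_map[OF PT HP xhom_id xhom_lft]
  have "(fp_map T0 T0 PT GP lft id \<circ> lft) b = (fp_map T0 T0 PT HP id lft \<circ> lft) b"
  proof (rule FC_unique[where Y = "X \<times> {0}" and C = "FC (X \<times> {0, 1, 2})" and f = "fp_map T0 T0 PT GP lft id \<circ> lft"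
      and h = "fp_map T0 T0 PT HP id lft \<circ> lft" and a = b, OF is_alg_FC])
    show "xhom (FC (X \<times> {0})) (FC (X \<times> {0, 1, 2})) (fp_map T0 T0 PT GP lft id \<circ> lft)"
      using xhom_comp[OF xhom_lft mG(1)] by (simp only: GP_simps T0_def)
    show "xhom (FC (X \<times> {0})) (FC (X \<times> {0, 1, 2})) (fp_map T0 T0 PT HP id lft \<circ> lft)"
      using xhom_comp[OF xhom_lft mH(1)] by (simp only: HP_simps T0_def)
    show "b \<in> sa_carrier (FC (X \<times> {0}))" using b by (simp only: T0_def)
    fix l :: "'v \<times> nat" assume "l \<in> X \<times> {0}"
    then obtain x where x: "x \<in> X" "l = (x, 0)" using gen by blast
    show "(fp_map T0 T0 PT GP lft id \<circ> lft) (enc (mon [l])) = (fp_map T0 T0 PT HP id lft \<circ> lft) (enc (mon [l]))"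
      unfolding x comp_def lft_letter fp_map_GP[OF x(1)] fp_map_HP[OF x(1)] coassoc_rep[OF X_closed[OF x(1)]] ..
  qed
  then show "fp_assoc T0 T0 T0 PT GP PT HP (fp_map T0 T0 PT GP lft id (lft b)) = fp_map T0 T0 PT HP id lft (lft b)"
    using fp_assoc_coded[OF xhom_closed[OF mG(1) xhom_closed[OF xhom_lft b]]] by simp
next
  have algT: "is_alg T0" unfolding T0_def by (rule is_alg_FC)
  have zero: "sa_zero T0 = enc 0" unfolding T0_def using xhom_zero[OF is_alg_FA is_alg_FC enc_FC] by simp
  fix b assume b: "b \<in> sa_carrier T0"
  note Z = xhom_const_zero[OF algT]
  note l = fp_lift[OF PT algT Z xhom_id]
  let ?l = "fp_lift T0 T0 PT T0 (\<lambda>_. sa_zero T0) id"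
  have "(?l \<circ> lft) b = id b"
  proof (rule FC_unique[where Y = "X \<times> {0}" and C = T0 and f = "?l \<circ> lft" and h = id and a = b, OF algT])
    show "xhom (FC (X \<times> {0})) T0 (?l \<circ> lft)" using xhom_comp[OF xhom_lft l(1)] by (simp only: T0_def)
    show "xhom (FC (X \<times> {0})) T0 id" unfolding T0_def by (rule xhom_id)
    show "b \<in> sa_carrier (FC (X \<times> {0}))" using b by (simp only: T0_def)
    fix k :: "'v \<times> nat" assume "k \<in> X \<times> {0}"
    then obtain x where x: "x \<in> X" "k = (x, 0)" by auto
    have "?l (enc (S (\<Delta> x))) = enc (rsub (\<lambda>_ _. 0) (Lop 0) (S (\<Delta> x)))"
    proof (rule rsub_hom[of "X \<times> {0}", OF _ _ _ _ _ S\<Delta>_FA[OF x(1)]])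
      show "xhom (fst PT) (FC (X \<times> {0})) ?l" using l(1) by (simp only: T0_def)
      fix y assume y: "y \<in> X"
      show "?l (enc (mon [(y, 0)])) = enc 0" using l(2)[OF T0_gen[OF y]] by (simp add: PT_emb zero)
      show "?l (enc (mon [(y, 1)])) = enc (Lop 0 y 1)" using l(3)[OF T0_gen[OF y]] y by (simp add: PT_emb Lop_one \<iota>_basis)
      show "Lop 0 y 1 \<in> sa_carrier (FA (X \<times> {0}))" using y by (auto simp: Lop_one \<iota>_basis intro!: FA_mon)
    qed (rule FA_zero)
    then show "(?l \<circ> lft) (enc (mon [k])) = id (enc (mon [k]))"
      using x counit_rep(1)[OF X_closed[OF x(1)]] by (simp add: lft_letter \<iota>_basis)
  qed
  then show "?l (lft b) = b" by simp
next
  have algT: "is_alg T0" unfolding T0_def by (rule is_alg_FC)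
  have zero: "sa_zero T0 = enc 0" unfolding T0_def using xhom_zero[OF is_alg_FA is_alg_FC enc_FC] by simp
  fix b assume b: "b \<in> sa_carrier T0"
  note Z = xhom_const_zero[OF algT]
  note l = fp_lift[OF PT algT xhom_id Z]
  let ?l = "fp_lift T0 T0 PT T0 id (\<lambda>_. sa_zero T0)"
  have "(?l \<circ> lft) b = id b"
  proof (rule FC_unique[where Y = "X \<times> {0}" and C = T0 and f = "?l \<circ> lft" and h = id and a = b, OF algT])
    show "xhom (FC (X \<times> {0})) T0 (?l \<circ> lft)" using xhom_comp[OF xhom_lft l(1)] by (simp only: T0_def)
    show "xhom (FC (X \<times> {0})) T0 id" unfolding T0_def by (rule xhom_id)
    show "b \<in> sa_carrier (FC (X \<times> {0}))" using b by (simp only: T0_def)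
    fix k :: "'v \<times> nat" assume "k \<in> X \<times> {0}"
    then obtain x where x: "x \<in> X" "k = (x, 0)" by auto
    have "?l (enc (S (\<Delta> x))) = enc (rsub (Lop 0) (\<lambda>_ _. 0) (S (\<Delta> x)))"
    proof (rule rsub_hom[of "X \<times> {0}", OF _ _ _ _ _ S\<Delta>_FA[OF x(1)]])
      show "xhom (fst PT) (FC (X \<times> {0})) ?l" using l(1) by (simp only: T0_def)
      fix y assume y: "y \<in> X"
      show "?l (enc (mon [(y, 1)])) = enc 0" using l(3)[OF T0_gen[OF y]] by (simp add: PT_emb zero)
      show "?l (enc (mon [(y, 0)])) = enc (Lop 0 y 1)" using l(2)[OF T0_gen[OF y]] y by (simp add: PT_emb Lop_one \<iota>_basis)
      show "Lop 0 y 1 \<in> sa_carrier (FA (X \<times> {0}))" using y by (auto simp: Lop_one \<iota>_basis intro!: FA_mon)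
    qed (rule FA_zero)
    then show "(?l \<circ> lft) (enc (mon [k])) = id (enc (mon [k]))"
      using x counit_rep(2)[OF X_closed[OF x(1)]] by (simp add: lft_letter \<iota>_basis)
  qed
  then show "?l (lft b) = b" by simp
qed

section \<open>Projection of the free algebra onto B\<close>

definition lb :: "'v \<times> nat \<Rightarrow> 'v" where
  "lb l = (if fst l \<in> X then fst l else sa_zero B)"

lemma lb: "lb l \<in> sa_carrier B"
  using X_closed by (auto simp: lb_def)

lemma lb_X: "x \<in> X \<Longrightarrow> lb (x, k) = x"
  by (simp add: lb_def)

definition prj :: "'v \<Rightarrow> 'v" where "prj t = B.fext lb (dcd t)"

lemmas fext_lb = B.fext_closed[where g = lb, OF lb] B.fext_zero[where g = lb, OF lb] B.fext_add[where g = lb, OF lb]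
  B.fext_smul[where g = lb, OF lb] B.fext_mon[where g = lb, OF lb] B.fext_single[where g = lb, OF lb]

lemma xhom_prj: "xhom T0 B prj"
  using xhom_comp[OF dcd_FC B.xhom_fext[where g = lb, OF lb]] by (simp add: T0_def prj_def[abs_def] comp_def)

lemma prj_letter: "x \<in> X \<Longrightarrow> prj (enc (mon [(x, k)])) = x"
  by (simp add: prj_def dcd_enc_FA[OF FA_letter] fext_lb lb_X)

lemma prj_surj:
  assumes b: "b \<in> sa_carrier B" obtains t where "t \<in> sa_carrier T0" "prj t = b"
proof
  have m: "\<iota> 0 b \<in> sa_carrier (FA (X \<times> {0}))" using b by (rule \<iota>_FA) simp
  show "enc (\<iota> 0 b) \<in> sa_carrier T0" unfolding T0_def FC_carrier using m by blast
  have "B.fext lb (\<iota> 0 b) = b"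
    using b by (induction b rule: basis_induct) (simp_all add: \<iota>_basis \<iota>_add \<iota>_smul \<iota>_zero fext_lb lb_X)
  then show "prj (enc (\<iota> 0 b)) = b" by (simp add: prj_def dcd_enc_FA[OF m])
qed

lemma star_prj: "star_hom T0 B prj"
  unfolding star_hom_def alg_hom_iff_xhom
proof (intro conjI ballI)
  show "xhom T0 B prj" by (rule xhom_prj)
  fix t assume "t \<in> sa_carrier T0"
  then obtain p where p: "p \<in> sa_carrier (FA (X \<times> {0}))" "t = enc p" by (auto simp: T0_def FC_carrier)
  from p(1) have "B.fext lb (fstar p) = sa_star B (B.fext lb p)"
  proof (induction p rule: FA_mon_induct)
    case (letter l) then show ?case by (auto simp: fstar_mon fext_lb lb_X hermitian)
  next
    case zero
    have "sa_star B (sa_zero B) = sa_zero B" using star_smul[of "sa_zero B" 0] by simp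
    then show ?case by (simp add: fext_lb)
  next
    case (mult p q)
    then show ?case
      using B.fext_mult[where g = lb, OF lb FA_fstar[OF mult(2)] FA_fstar[OF mult(1)]] B.fext_mult[where g = lb, OF lb mult(1,2)]
      by (simp add: fstar_mult star_mul fext_lb(1))
  qed (simp_all add: fstar_add fext_lb(1,3,4) star_add fstar_cst_mult star_smul)
  then show "prj (sa_star T0 t) = sa_star B (prj t)"
    using p FA_fstar[OF p(1)] by (simp add: prj_def T0_def FC_star dcd_enc_FA)
qed

text \<open>\<open>prj\<close> respects the comultiplications: evaluating the normal form of
  \<open>\<Delta> x\<close> returns \<open>\<Delta> x\<close>, so evaluation after
  \<open>lft\<close> equals \<open>\<Delta>\<close> after \<open>prj\<close> on letters, hence
  everywhere. Naturality of the product does the rest.\<close>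

lemma convolution_prj:
  assumes np: "natural_product odot" and \<phi>: "lin_fun B \<phi>" and \<theta>: "lin_fun B \<theta>" and t: "t \<in> sa_carrier T0"
  shows "convolution odot T0 PT lft (\<phi> \<circ> prj) (\<theta> \<circ> prj) t = convolution odot B P \<Delta> \<phi> \<theta> (prj t)"
proof -
  let ?Q = "\<lambda>y. \<Psi> (dcd y)"
  have Q: "xhom (fst PT) F ?Q" using xhom_comp[OF dcd_FC \<Psi>] by (simp add: fst_PT comp_def)
  have Ql: "?Q (enc (mon [l])) = le l" for l by (simp add: dcd_enc_FA[OF FA_letter] \<Psi>_rules)
  note a = is_free_product_algs[OF PT]
  have gen: "\<exists>x\<in>X. l = (x, 0)" if "l \<in> X \<times> {0}" for l :: "'v \<times> nat" using that by auto
  have Q1: "(?Q \<circ> fst (snd PT)) s = (i1 \<circ> prj) s" "(?Q \<circ> snd (snd PT)) s = (i2 \<circ> prj) s" "(?Q \<circ> lft) s = (\<Delta> \<circ> prj) s"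
    if s: "s \<in> sa_carrier T0" for s
    using s unfolding T0_def
    by (rule FC_unique[OF alg_F xhom_comp[OF a(4) Q, unfolded T0_def] xhom_comp[OF xhom_prj hom_i1, unfolded T0_def], rotated 1]
      FC_unique[OF alg_F xhom_comp[OF a(5) Q, unfolded T0_def] xhom_comp[OF xhom_prj hom_i2, unfolded T0_def], rotated 1]
      FC_unique[OF alg_F xhom_comp[OF xhom_lft Q, unfolded T0_def] xhom_comp[OF xhom_prj hom_\<Delta>, unfolded T0_def], rotated 1];
      use gen in \<open>fastforce simp: PT_emb Ql le_def prj_letter lft_letter dcd_enc_FA[OF S\<Delta>_FA] \<Psi>_S \<Delta>_closed X_closed\<close>)+
  have "odot T0 T0 PT (\<phi> \<circ> prj) (\<theta> \<circ> prj) (lft t) = odot B B P \<phi> \<theta> (?Q (lft t))"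
    by (rule natural_product_nat[OF np PT P xhom_prj xhom_prj Q _ _ \<phi> \<theta> _ _ xhom_closed[OF xhom_lft t]]) (use Q1 in auto)
  then show ?thesis using Q1(3)[OF t] by (simp add: convolution_def)
qed

end

section \<open>States\<close>

lemma nonneg_complex_iff: "nonneg_complex z \<longleftrightarrow> 0 \<le> Re z \<and> Im z = 0"
  unfolding nonneg_complex_def by (auto simp: complex_eq_iff)

lemma nonneg_complex_add: "nonneg_complex z \<Longrightarrow> nonneg_complex w \<Longrightarrow> nonneg_complex (z + w)"
  and nonneg_complex_cnj_mult: "nonneg_complex (cnj z * z)"
  by (auto simp: nonneg_complex_iff algebra_simps)

lemma nonneg_complex_limit:
  assumes "\<And>n. nonneg_complex (f n)" "(f \<longlongrightarrow> z) G" "G \<noteq> bot"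
  shows "nonneg_complex z"
proof -
  have "0 \<le> Re z"
    by (rule tendsto_lowerbound[OF tendsto_Re[OF assms(2)] _ assms(3)]) (use assms(1) in \<open>simp add: nonneg_complex_iff\<close>)
  moreover have "((\<lambda>n. Im (f n)) \<longlongrightarrow> 0) G" using assms(1) by (simp add: nonneg_complex_iff)
  then have "Im z = 0" using tendsto_unique[OF assms(3) tendsto_Im[OF assms(2)]] by simp
  ultimately show ?thesis by (simp add: nonneg_complex_iff)
qed

lemma is_stateD: "is_state A \<phi> \<Longrightarrow> a \<in> sa_carrier A \<Longrightarrow> nonneg_complex
    (c * cnj c + cnj c * \<phi> a + c * \<phi> (sa_star A a) + \<phi> (sa_mul A (sa_star A a) a))"
  by (simp add: is_state_def)

lemma is_state_square: "is_state A \<phi> \<Longrightarrow> a \<in> sa_carrier A \<Longrightarrow> nonneg_complex (\<phi> (sa_mul A (sa_star A a) a))"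
  using is_stateD[of A \<phi> a 0] by simp

text \<open>Positivity at \<open>c = 0\<close>, \<open>c = 1\<close> and \<open>c = \<i>\<close>:
  vanishing imaginary parts compare first the imaginary and then the real parts of the values at
  \<open>a\<close> and its adjoint.\<close>

lemma is_state_star:
  assumes "is_state A \<phi>" "a \<in> sa_carrier A" shows "\<phi> (sa_star A a) = cnj (\<phi> a)"
  using is_state_square[OF assms] is_stateD[OF assms, of 1] is_stateD[OF assms, of \<i>]
  by (auto simp: nonneg_complex_iff complex_eq_iff)

lemma is_state_limit:
  assumes A: "is_star_alg A" and s: "\<And>n. is_state A (\<phi> n)" and lim: "\<And>a. a \<in> sa_carrier A \<Longrightarrow> (\<lambda>n. \<phi> n a) \<longlonglongrightarrow> \<psi> a"
  shows "is_state A \<psi>"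
proof -
  interpret A: calg A using A by (simp add: calg_def is_star_alg_def)
  have st: "sa_star A a \<in> sa_carrier A" if "a \<in> sa_carrier A" for a using A that by (simp add: is_star_alg_def)
  have lin: "lin_fun A (\<phi> n)" for n using s by (simp add: is_state_def)
  show ?thesis unfolding is_state_def lin_fun_def
  proof (intro conjI ballI allI)
    show "\<psi> (sa_add A a b) = \<psi> a + \<psi> b" if "a \<in> sa_carrier A" "b \<in> sa_carrier A" for a b
      using tendsto_add[OF lim[OF that(1)] lim[OF that(2)]] lim[OF A.add_closed[OF that]]
      by (simp add: lin_fun_add[OF lin] that LIMSEQ_unique)
    show "\<psi> (sa_smul A c a) = c * \<psi> a" if "a \<in> sa_carrier A" for c a
      by (rule LIMSEQ_unique[OF lim[OF A.smul_closed[OF that]]])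
         (use tendsto_mult[OF tendsto_const lim[OF that]] in \<open>simp add: lin_fun_smul[OF lin] that\<close>)
    show "nonneg_complex (c * cnj c + cnj c * \<psi> a + c * \<psi> (sa_star A a) + \<psi> (sa_mul A (sa_star A a) a))"
      if "a \<in> sa_carrier A" for c a
      by (rule nonneg_complex_limit[OF is_stateD[OF s that]]) (use that st in \<open>auto intro!: tendsto_intros lim\<close>)
  qed
qed

lemma is_state_cong:
  assumes "is_star_alg A" "is_state A \<phi>" "\<And>a. a \<in> sa_carrier A \<Longrightarrow> \<psi> a = \<phi> a"
  shows "is_state A \<psi>"
  by (rule is_state_limit[of A "\<lambda>_. \<phi>"]) (use assms in simp_all)

lemma is_state_zero: "is_state A (\<lambda>_. 0)"
  using nonneg_complex_cnj_mult by (simp add: is_state_def lin_fun_def mult.commute)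

lemma is_state_comp:
  assumes f: "star_hom A C f" and A: "is_star_alg A" and \<phi>: "is_state C \<phi>"
  shows "is_state A (\<lambda>a. \<phi> (f a))"
proof -
  have h: "xhom A C f" using f by (simp add: star_hom_def alg_hom_iff_xhom)
  have st: "sa_star A a \<in> sa_carrier A" if "a \<in> sa_carrier A" for a using A that by (simp add: is_star_alg_def)
  have s: "f (sa_star A a) = sa_star C (f a)" if "a \<in> sa_carrier A" for a using f that by (simp add: star_hom_def)
  show ?thesis unfolding is_state_def
  proof (intro conjI allI ballI)
    show "lin_fun A (\<lambda>a. \<phi> (f a))" using lin_fun_comp[OF h] \<phi> by (simp add: is_state_def)
    show "nonneg_complex (c * cnj c + cnj c * \<phi> (f a) + c * \<phi> (f (sa_star A a)) + \<phi> (f (sa_mul A (sa_star A a) a)))"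
      if "a \<in> sa_carrier A" for c a
      using is_stateD[OF \<phi> xhom_closed[OF h that], of c] that by (simp add: s st xhom_mul[OF h])
  qed
qed

section \<open>Vacuum states and their scaling limit\<close>

context lifting begin

text \<open>The vectors \<open>J(x\<^sub>1) \<cdots> J(x\<^sub>k)\<Omega>\<close> in \<open>\<complex>\<Omega> \<oplus> B\<close>, with the positive form
  \<open>\<langle>a\<Omega> + v, b\<Omega> + w\<rangle> = cnj a b + \<psi>(v* w)\<close>, for the symmetric operators
  \<open>J(x) (a\<Omega> + v) = (s\<^sup>2 \<psi>(x) a + s \<psi>(x v))\<Omega> + s a x + x v\<close>. The vacuum expectation is a state, and for
  \<open>s\<^sup>2 = 1/n\<close> it is \<open>\<psi>/n\<close> up to terms of lower order.\<close>

primrec st :: "real \<Rightarrow> ('v \<Rightarrow> complex) \<Rightarrow> ('v \<times> nat) list \<Rightarrow> complex \<times> 'v" where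
  "st s \<psi> [] = (1, sa_zero B)"
| "st s \<psi> (l # w) = (of_real (s\<^sup>2) * \<psi> (lb l) * fst (st s \<psi> w) + of_real s * \<psi> (sa_mul B (lb l) (snd (st s \<psi> w))),
     sa_add B (sa_smul B (of_real s * fst (st s \<psi> w)) (lb l)) (sa_mul B (lb l) (snd (st s \<psi> w))))"

lemma st_closed [simp]: "snd (st s \<psi> w) \<in> sa_carrier B"
  by (induction w) (simp_all add: lb)

lemma star_zero: "sa_star B (sa_zero B) = sa_zero B"
  using star_smul[of "sa_zero B" 0] by simp

lemma star_lb: "sa_star B (lb l) = lb l"
  by (simp add: lb_def hermitian star_zero)

text \<open>Symmetry of the operators \<open>J(x)\<close>: in the vacuum moment of
  \<open>rev u @ w\<close>, the letters of \<open>u\<close> are moved to the left argument of the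
  form one at a time. Hermiticity of \<open>\<psi>\<close> and of the letters enters here.\<close>

lemma st_rev:
  assumes \<psi>: "cond_pos B \<psi>"
  shows "fst (st s \<psi> (rev u @ w)) = cnj (fst (st s \<psi> u)) * fst (st s \<psi> w) +
    \<psi> (sa_mul B (sa_star B (snd (st s \<psi> u))) (snd (st s \<psi> w)))"
proof (induction u arbitrary: w)
  have lin: "lin_fun B \<psi>" using \<psi> by (simp add: cond_pos_def)
  case Nil
  show ?case using lin_fun_zero[OF alg_B lin] by (simp add: star_zero)
next
  have lin: "lin_fun B \<psi>" using \<psi> by (simp add: cond_pos_def)
  have herm: "cnj (\<psi> a) = \<psi> (sa_star B a)" if "a \<in> sa_carrier B" for a using \<psi> that by (simp add: cond_pos_def)
  note L = lin_fun_add[OF lin] lin_fun_smul[OF lin]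
  case (Cons l u)
  have "fst (st s \<psi> (rev (l # u) @ w)) = fst (st s \<psi> (rev u @ (l # w)))" by simp
  also have "\<dots> = cnj (fst (st s \<psi> u)) * fst (st s \<psi> (l # w)) +
    \<psi> (sa_mul B (sa_star B (snd (st s \<psi> u))) (snd (st s \<psi> (l # w))))" by (rule Cons)
  also have "\<dots> = cnj (fst (st s \<psi> (l # u))) * fst (st s \<psi> w) +
    \<psi> (sa_mul B (sa_star B (snd (st s \<psi> (l # u)))) (snd (st s \<psi> w)))"
    by (simp add: lb star_lb herm star_add star_smul star_mul B.distrib_left B.distrib_right B.smul_mul_left B.smul_mul_right
      L B.mul_assoc) (simp add: algebra_simps)
  finally show ?case .
qed

definition vec :: "real \<Rightarrow> ('v \<Rightarrow> complex) \<Rightarrow> ('v \<times> nat) fa \<Rightarrow> 'v" where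
  "vec s \<psi> = B.lext (\<lambda>w. snd (st s \<psi> (letters w)))"

lemma vec [simp]: "vec s \<psi> p \<in> sa_carrier B" and vec_zero: "vec s \<psi> 0 = sa_zero B"
  and vec_add: "vec s \<psi> (p + q) = sa_add B (vec s \<psi> p) (vec s \<psi> q)"
  and vec_single: "vec s \<psi> (Poly_Mapping.single w c) = sa_smul B c (snd (st s \<psi> (letters w)))"
  by (simp_all add: vec_def B.lext_closed B.lext_add B.lext_single)

abbreviation "vac s \<psi> \<equiv> mom (\<lambda>w. fst (st s \<psi> w))"

lemma vac_form:
  assumes \<psi>: "cond_pos B \<psi>"
  shows "vac s \<psi> (fstar p * q) = cnj (vac s \<psi> p) * vac s \<psi> q + \<psi> (sa_mul B (sa_star B (vec s \<psi> p)) (vec s \<psi> q))"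
proof -
  have lin: "lin_fun B \<psi>" using \<psi> by (simp add: cond_pos_def)
  note L = lin_fun_add[OF lin] lin_fun_smul[OF lin] lin_fun_zero[OF alg_B lin]
  show ?thesis
  proof (induction p rule: pm_induct)
    case zero then show ?case by (simp add: vec_zero star_zero L)
  next
    case (add p p')
    then show ?case by (simp add: fstar_add distrib_right mom_add vec_add star_add B.distrib_right L)
  next
    case (single u c)
    show ?case
    proof (induction q rule: pm_induct)
      case zero then show ?case by (simp add: vec_zero L)
    next
      case (add q q')
      then show ?case by (simp add: distrib_left mom_add vec_add B.distrib_left L)
    next
      case (single w d)
      show ?case
        by (simp add: fstar_single mult_single mom_single st_rev[OF \<psi>] vec_single star_smul B.smul_mul_left B.smul_mul_right L)
           (simp add: algebra_simps)
    qed
  qed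
qed

definition gauss :: "real \<Rightarrow> ('v \<Rightarrow> complex) \<Rightarrow> 'v \<Rightarrow> complex" where
  "gauss s \<psi> t = vac s \<psi> (dcd t)"

lemma lin_gauss: "lin_fun T0 (gauss s \<psi>)"
  unfolding gauss_def T0_def
  by (rule lin_fun_comp[OF dcd_FC]) (auto simp: lin_fun_def mom_add mom_cst)

lemma is_state_gauss:
  assumes \<psi>: "cond_pos B \<psi>" shows "is_state T0 (gauss s \<psi>)"
  unfolding is_state_def
proof (intro conjI allI ballI lin_gauss)
  fix c t assume "t \<in> sa_carrier T0"
  then obtain p where p: "p \<in> sa_carrier (FA (X \<times> {0}))" "t = enc p" by (auto simp: T0_def FC_carrier)
  note p' = FA_fstar[OF p(1)]
  \<comment> \<open>With the unit adjoined, the state condition is positivity of the vacuum moment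
    of \<open>fstar q * q\<close>, which the form splits into a squared modulus and a value of
    \<open>\<psi>\<close> at a square.\<close>
  let ?q = "cst c + p"
  have tt: "sa_mul T0 (sa_star T0 t) t = enc (fstar p * p)"
    using xhom_mul[OF enc_FC p' p(1)] p by (simp add: T0_def FC_star)
  have v1: "vac s \<psi> 1 = 1" using mom_mon[of "\<lambda>w. fst (st s \<psi> w)" "[]"] by simp
  have "c * cnj c + cnj c * gauss s \<psi> t + c * gauss s \<psi> (sa_star T0 t) + gauss s \<psi> (sa_mul T0 (sa_star T0 t) t) =
      vac s \<psi> (cst (cnj c * c)) + vac s \<psi> (cst (cnj c) * p) + vac s \<psi> (cst c * fstar p) + vac s \<psi> (fstar p * p)"
    unfolding tt using p dcd_enc_FA[OF p'] dcd_enc_FA[OF p(1)] dcd_enc_FA[OF FA_mult[OF p' p(1)]] mom_cst[of "\<lambda>w. fst (st s \<psi> w)" "cnj c * c" 1]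
    by (simp add: gauss_def T0_def FC_star mom_cst v1)
  also have "\<dots> = vac s \<psi> (cst (cnj c) * cst c + cst (cnj c) * p + fstar p * cst c + fstar p * p)"
    by (simp only: mom_add cst_mult cst_commute[of c "fstar p"])
  also have "cst (cnj c) * cst c + cst (cnj c) * p + fstar p * cst c + fstar p * p = fstar ?q * ?q"
    by (simp only: fstar_add fstar_cst distrib_left distrib_right add.assoc add.left_commute)
  also have "nonneg_complex (vac s \<psi> (fstar ?q * ?q))"
    unfolding vac_form[OF \<psi>] using \<psi>
    by (intro nonneg_complex_add nonneg_complex_cnj_mult) (simp add: cond_pos_def)
  finally show "nonneg_complex (c * cnj c + cnj c * gauss s \<psi> t + c * gauss s \<psi> (sa_star T0 t) + gauss s \<psi> (sa_mul T0 (sa_star T0 t) t))" .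
qed

text \<open>For scale \<open>s\<close> equal to one over the root of \<open>n\<close>, a nonempty
  word leaves a component of order \<open>s\<close> in \<open>B\<close> and one of order
  \<open>1/n\<close> along the vacuum. The \<open>B\<close> component is tested against linear
  functionals, as \<open>B\<close> has no topology. One-letter moments come from the diagonal term
  of \<open>J\<close>, longer ones from the last field operator acting on the \<open>B\<close>
  component.\<close>

lemma st_limit:
  assumes \<psi>: "lin_fun B \<psi>"
  shows "(\<lambda>n. fst (st (1 / sqrt (real n)) \<psi> w)) \<longlonglongrightarrow> (if w = [] then 1 else 0)"
    and "lin_fun B \<theta> \<Longrightarrow> (\<lambda>n. of_real (sqrt (real n)) * \<theta> (snd (st (1 / sqrt (real n)) \<psi> w))) \<longlonglongrightarrow> (if w = [] then 0 else \<theta> (B.lprod (map lb w)))"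
    and "w \<noteq> [] \<Longrightarrow> (\<lambda>n. of_nat n * fst (st (1 / sqrt (real n)) \<psi> w)) \<longlonglongrightarrow> \<psi> (B.lprod (map lb w))"
proof -
  define r where "r n = 1 / sqrt (real n)" for n
  have r0: "(\<lambda>n. complex_of_real ((r n)\<^sup>2)) \<longlonglongrightarrow> 0"
  proof -
    have "(\<lambda>n. (r n)\<^sup>2) \<longlonglongrightarrow> 0" unfolding r_def by real_asymp
    then show ?thesis using tendsto_of_real[of "\<lambda>n. (r n)\<^sup>2" 0 sequentially, where 'a = complex] by simp
  qed
  have ev: "eventually (\<lambda>n. real n > 0) sequentially" using eventually_gt_at_top[of 0] by eventually_elim simp
  have sr: "(\<lambda>n. complex_of_real (sqrt (real n) * r n)) \<longlonglongrightarrow> 1" "(\<lambda>n. complex_of_real (real n * (r n)\<^sup>2)) \<longlonglongrightarrow> 1"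
    by (rule tendsto_eventually, rule eventually_mono[OF ev], simp add: r_def power_divide)+
  \<comment> \<open>Trading one factor \<open>r\<close> for two lets the root of \<open>n\<close> be
    absorbed by the induction hypothesis; the identity also holds at \<open>n = 0\<close>, where
    both sides vanish.\<close>
  have r1: "complex_of_real (r n) * z = complex_of_real ((r n)\<^sup>2) * (complex_of_real (sqrt (real n)) * z)" for n z
  proof -
    have "r n = (r n)\<^sup>2 * sqrt (real n)" by (cases "n = 0") (simp_all add: r_def power2_eq_square real_div_sqrt field_simps)
    then have "complex_of_real (r n) = complex_of_real ((r n)\<^sup>2) * complex_of_real (sqrt (real n))" by (metis of_real_mult)
    then show ?thesis by simp
  qed
  have nr: "of_nat n * complex_of_real (r n) = complex_of_real (sqrt (real n))" for n
  proof -
    have "real n * r n = sqrt (real n)" by (simp add: r_def real_div_sqrt)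
    then show ?thesis by (metis of_real_mult of_real_of_nat_eq)
  qed
  have lprod: "B.lprod (map lb w) \<in> sa_carrier B" for w by (rule B.lprod_map_closed[where g = lb, OF lb])
  have linl: "lin_fun B (\<lambda>a. \<theta> (sa_mul B (lb l) a))" if "lin_fun B \<theta>" for \<theta> l
    using that by (simp add: lin_fun_def lb B.distrib_left B.smul_mul_right)
  have "(\<lambda>n. fst (st (r n) \<psi> w)) \<longlonglongrightarrow> (if w = [] then 1 else 0) \<and>
     (\<forall>\<theta>. lin_fun B \<theta> \<longrightarrow> (\<lambda>n. of_real (sqrt (real n)) * \<theta> (snd (st (r n) \<psi> w))) \<longlonglongrightarrow> (if w = [] then 0 else \<theta> (B.lprod (map lb w))))" for w
  proof (induction w)
    case Nil
    show ?case by (auto simp: lin_fun_zero[OF alg_B])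
  next
    case (Cons l w)
    note a = Cons[THEN conjunct1]
    have v: "(\<lambda>n. of_real (sqrt (real n)) * \<theta> (sa_mul B (lb l) (snd (st (r n) \<psi> w)))) \<longlonglongrightarrow>
        (if w = [] then 0 else \<theta> (sa_mul B (lb l) (B.lprod (map lb w))))" if "lin_fun B \<theta>" for \<theta>
      by (rule Cons[THEN conjunct2, THEN spec, THEN mp, OF linl[OF that]])
    show ?case
    proof (intro conjI allI impI)
      have "(\<lambda>n. of_real ((r n)\<^sup>2) * \<psi> (lb l) * fst (st (r n) \<psi> w) +
          of_real ((r n)\<^sup>2) * (of_real (sqrt (real n)) * \<psi> (sa_mul B (lb l) (snd (st (r n) \<psi> w))))) \<longlonglongrightarrow>
          0 * \<psi> (lb l) * (if w = [] then 1 else 0) + 0 * (if w = [] then 0 else \<psi> (sa_mul B (lb l) (B.lprod (map lb w))))"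
        by (intro tendsto_intros r0 a v \<psi>)
      then show "(\<lambda>n. fst (st (r n) \<psi> (l # w))) \<longlonglongrightarrow> (if l # w = [] then 1 else 0)" by (simp add: r1)
      fix \<theta> assume \<theta>: "lin_fun B \<theta>"
      have "(\<lambda>n. of_real (sqrt (real n) * r n) * (fst (st (r n) \<psi> w) * \<theta> (lb l)) +
          of_real (sqrt (real n)) * \<theta> (sa_mul B (lb l) (snd (st (r n) \<psi> w)))) \<longlonglongrightarrow>
          1 * ((if w = [] then 1 else 0) * \<theta> (lb l)) + (if w = [] then 0 else \<theta> (sa_mul B (lb l) (B.lprod (map lb w))))"
        by (intro tendsto_intros sr a v \<theta>)
      moreover have "1 * ((if w = [] then 1 else 0) * \<theta> (lb l)) + (if w = [] then 0 else \<theta> (sa_mul B (lb l) (B.lprod (map lb w)))) =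
          \<theta> (B.lprod (map lb (l # w)))" by (simp add: B.lprod_Cons)
      ultimately show "(\<lambda>n. of_real (sqrt (real n)) * \<theta> (snd (st (r n) \<psi> (l # w)))) \<longlonglongrightarrow> (if l # w = [] then 0 else \<theta> (B.lprod (map lb (l # w))))"
        by (simp add: lin_fun_add[OF \<theta>] lin_fun_smul[OF \<theta>] lb algebra_simps)
    qed
  qed
  note lim = this
  from lim[of w] show "(\<lambda>n. fst (st (1 / sqrt (real n)) \<psi> w)) \<longlonglongrightarrow> (if w = [] then 1 else 0)" by (simp add: r_def)
  from lim[of w] show "(\<lambda>n. of_real (sqrt (real n)) * \<theta> (snd (st (1 / sqrt (real n)) \<psi> w))) \<longlonglongrightarrow> (if w = [] then 0 else \<theta> (B.lprod (map lb w)))"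
    if "lin_fun B \<theta>" using that by (simp add: r_def)
  assume "w \<noteq> []"
  then obtain l u where w: "w = l # u" by (cases w) auto
  have "(\<lambda>n. of_real (real n * (r n)\<^sup>2) * (\<psi> (lb l) * fst (st (r n) \<psi> u)) +
      of_real (sqrt (real n)) * \<psi> (sa_mul B (lb l) (snd (st (r n) \<psi> u)))) \<longlonglongrightarrow>
      1 * (\<psi> (lb l) * (if u = [] then 1 else 0)) + (if u = [] then 0 else \<psi> (sa_mul B (lb l) (B.lprod (map lb u))))"
    by (intro tendsto_intros sr lim[of u, THEN conjunct1] lim[of u, THEN conjunct2, THEN spec, THEN mp, OF linl[OF \<psi>]])
  moreover have "1 * (\<psi> (lb l) * (if u = [] then 1 else 0)) + (if u = [] then 0 else \<psi> (sa_mul B (lb l) (B.lprod (map lb u)))) =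
      \<psi> (B.lprod (map lb w))" by (simp add: w B.lprod_Cons)
  moreover have "of_real (real n * (r n)\<^sup>2) * (\<psi> (lb l) * fst (st (r n) \<psi> u)) +
      of_real (sqrt (real n)) * \<psi> (sa_mul B (lb l) (snd (st (r n) \<psi> u))) = of_nat n * fst (st (r n) \<psi> w)" for n
    unfolding nr[symmetric] w by (simp add: algebra_simps)
  ultimately show "(\<lambda>n. of_nat n * fst (st (1 / sqrt (real n)) \<psi> w)) \<longlonglongrightarrow> \<psi> (B.lprod (map lb w))" by (simp add: r_def)
qed

lemma gauss_limit:
  assumes \<psi>: "lin_fun B \<psi>" and t: "t \<in> sa_carrier T0"
  shows "(\<lambda>n. of_nat n * gauss (1 / sqrt (real n)) \<psi> t) \<longlonglongrightarrow> \<psi> (prj t)"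
proof -
  obtain p where p: "p \<in> sa_carrier (FA (X \<times> {0}))" "t = enc p" using t by (auto simp: T0_def FC_carrier)
  from p(1) have "(\<lambda>n. of_nat n * vac (1 / sqrt (real n)) \<psi> p) \<longlonglongrightarrow> \<psi> (B.fext lb p)"
  proof (induction p rule: FA_induct)
    case zero then show ?case using lin_fun_zero[OF alg_B \<psi>] by (simp add: fext_lb)
  next
    case (single w c)
    have "(\<lambda>n. c * (of_nat n * fst (st (1 / sqrt (real n)) \<psi> (letters w)))) \<longlonglongrightarrow> c * \<psi> (B.lprod (map lb (letters w)))"
      by (intro tendsto_intros st_limit(3) \<psi>) (use single in simp)
    then show ?case
      by (simp add: mom_single fext_lb(6) lin_fun_smul[OF \<psi>] B.lprod_map_closed[where g = lb, OF lb] mult.left_commute)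
  next
    case (add p q)
    from tendsto_add[OF this(1,2)] show ?case by (simp add: mom_add fext_lb(1,3) lin_fun_add[OF \<psi>] distrib_left)
  qed
  then show ?thesis using p by (simp add: gauss_def prj_def dcd_enc_FA)
qed

text \<open>Convolution powers of the vacuum states are states, and they converge to the exponential
  of \<open>\<psi> \<circ> prj\<close> on the free algebra. This is the exponential of
  \<open>\<psi>\<close> composed with \<open>prj\<close>, a surjective star-homomorphism, so
  positivity descends to \<open>B\<close>.\<close>

lemma is_state_cexp:
  assumes pos: "positive_independence odot" and \<psi>: "cond_pos B \<psi>"
  shows "is_state B (convolution_structure.cexp (convolution odot B P \<Delta>) \<psi>)"
proof -
  have ind: "is_independence odot" using pos by (simp add: positive_independence_def)
  note np = natural_product_if_independence[OF ind]
  have lin: "lin_fun B \<psi>" using \<psi> by (simp add: cond_pos_def)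
  interpret CB: convolution_structure B "convolution odot B P \<Delta>"
    by (rule convolution_structure_if_weak_dual[OF ind weak_dual_if_dual_semigroup[OF dual]])
  interpret CT: convolution_structure T0 "convolution odot T0 PT lft"
    by (rule convolution_structure_if_weak_dual[OF ind weak_dual_lft])
  have starT: "is_star_alg T0" unfolding T0_def by (rule is_star_alg_FC)
  have conv: "is_state T0 (convolution odot T0 PT lft \<phi> \<theta>)" if "is_state T0 \<phi>" "is_state T0 \<theta>" for \<phi> \<theta>
  proof -
    have "is_state (fst PT) (odot T0 T0 PT \<phi> \<theta>)"
      using pos[unfolded positive_independence_def, THEN conjunct2] star_PT that by blast
    from is_state_comp[OF star_lft starT this] show ?thesis by (simp add: convolution_def)
  qed
  have pow: "is_state T0 (CT.cpow \<phi> n)" if "is_state T0 \<phi>" for \<phi> n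
    by (induction n) (simp_all add: is_state_zero conv that)
  have "lin_fun T0 (\<psi> \<circ> prj)" using lin_fun_comp[OF xhom_prj lin] by (simp add: comp_def)
  then have "(\<lambda>n. CT.cpow (gauss (1 / sqrt (real n)) \<psi>) n t) \<longlonglongrightarrow> CT.cexp (\<psi> \<circ> prj) t" if "t \<in> sa_carrier T0" for t
    by (rule CT.cpow_tendsto_cexp[OF _ lin_gauss filterlim_ident _ that]) (use gauss_limit[OF lin] in simp)
  then have sT: "is_state T0 (CT.cexp (\<psi> \<circ> prj))"
    by (rule is_state_limit[OF starT pow[OF is_state_gauss[OF \<psi>]]])
  have cp: "CT.cpow (\<phi> \<circ> prj) n t = CB.cpow \<phi> n (prj t)" if \<phi>: "lin_fun B \<phi>" and t: "t \<in> sa_carrier T0" for \<phi> n t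
    using t
  proof (induction n arbitrary: t)
    case (Suc n)
    have l: "lin_fun T0 (\<phi> \<circ> prj)" "lin_fun T0 (CB.cpow \<phi> n \<circ> prj)"
      using lin_fun_comp[OF xhom_prj \<phi>] lin_fun_comp[OF xhom_prj CB.lin_cpow[OF \<phi>]] by (simp_all add: comp_def)
    have "CT.cpow (\<phi> \<circ> prj) (Suc n) t = convolution odot T0 PT lft (\<phi> \<circ> prj) (CB.cpow \<phi> n \<circ> prj) t"
      using CT.conv_cong[OF l _ _ Suc(2), of "\<phi> \<circ> prj" "CT.cpow (\<phi> \<circ> prj) n"] Suc(1) by simp
    also have "\<dots> = CB.cpow \<phi> (Suc n) (prj t)"
      using convolution_prj[OF np \<phi> CB.lin_cpow[OF \<phi>] Suc(2)] by simp
    finally show ?case .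
  qed simp
  have ce: "CT.cexp (\<psi> \<circ> prj) t = CB.cexp \<psi> (prj t)" if "t \<in> sa_carrier T0" for t
    unfolding CT.cexp_def CB.cexp_def using cp[OF CB.lin_div[OF lin] that] by (simp add: comp_def)
  show ?thesis unfolding is_state_def
  proof (intro conjI allI ballI)
    show "lin_fun B (CB.cexp \<psi>)" by (rule CB.lin_cexp[OF lin])
    fix c b assume "b \<in> sa_carrier B"
    then obtain t where t: "t \<in> sa_carrier T0" "prj t = b" by (rule prj_surj)
    have st: "sa_star T0 t \<in> sa_carrier T0" using starT t by (simp add: is_star_alg_def)
    have p: "prj (sa_star T0 t) = sa_star B b" using star_prj t by (simp add: star_hom_def)
    have tt: "sa_mul T0 (sa_star T0 t) t \<in> sa_carrier T0"
      using starT st t(1) by (simp add: is_star_alg_def calg.mul_closed calg_def)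
    have "prj (sa_mul T0 (sa_star T0 t) t) = sa_mul B (sa_star B b) b"
      using xhom_mul[OF xhom_prj st t(1)] p t by simp
    then show "nonneg_complex (c * cnj c + cnj c * CB.cexp \<psi> b + c * CB.cexp \<psi> (sa_star B b) +
        CB.cexp \<psi> (sa_mul B (sa_star B b) b))"
      using is_stateD[OF sT t(1), of c] t p by (simp add: ce st tt)
  qed
qed

end

section \<open>The Schoenberg correspondence\<close>

lemma conv_pow_eq_cpow: "conv_pow odot B P \<Delta> \<psi> n = convolution_structure.cpow (convolution odot B P \<Delta>) \<psi> n"
  if "convolution_structure B (convolution odot B P \<Delta>)"
proof -
  interpret convolution_structure B "convolution odot B P \<Delta>" by (rule that)
  show ?thesis by (induction n) simp_all
qed

text \<open>Both directions of the correspondence need only a convolution structure and positivity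
  of exponentials. Assuming these keeps the codes out, so that the zero algebra is covered as
  well.\<close>

lemma schoenberg_if_exp_state:
  fixes B :: "'v salg" and P :: "'v fprod" and \<Delta> :: "'v \<Rightarrow> 'v" and odot :: "'v uprod"
  assumes cs: "convolution_structure B (convolution odot B P \<Delta>)" and star: "is_star_alg B"
    and state: "\<And>\<psi>. cond_pos B \<psi> \<Longrightarrow> is_state B (convolution_structure.cexp (convolution odot B P \<Delta>) \<psi>)"
  shows "(\<forall>\<psi>. cond_pos B \<psi> \<longrightarrow>
            conv_exp_exists odot B P \<Delta> \<psi> \<and> is_state B (conv_exp odot B P \<Delta> \<psi>)) \<and>
         (\<forall>\<phi> :: real \<Rightarrow> 'v \<Rightarrow> complex.
            (cont_conv_semigroup odot B P \<Delta> \<phi> \<and> (\<forall>t\<ge>0. is_state B (\<phi> t))) \<longleftrightarrow>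
            (\<exists>\<psi>. cond_pos B \<psi> \<and>
               (\<forall>t\<ge>0. \<forall>b\<in>sa_carrier B.
                  \<phi> t b = conv_exp odot B P \<Delta> (\<lambda>x. complex_of_real t * \<psi> x) b)))"
proof -
  let ?c = "convolution odot B P \<Delta>"
  interpret convolution_structure B ?c by (rule cs)
  have ex: "conv_exp odot B P \<Delta> \<psi> = cexp \<psi>" for \<psi>
    by (simp add: conv_exp_def cexp_def[abs_def] conv_pow_eq_cpow[OF cs])
  have lin: "lin_fun B \<psi>" if "cond_pos B \<psi>" for \<psi> using that by (simp add: cond_pos_def)
  have exists: "conv_exp_exists odot B P \<Delta> \<psi>" if "cond_pos B \<psi>" for \<psi>
    unfolding conv_exp_exists_def conv_pow_eq_cpow[OF cs] using cpow_div_tendsto_cexp[OF lin[OF that]] by (auto intro: convergentI)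
  have fwd: "\<exists>\<psi>. cond_pos B \<psi> \<and> (\<forall>t\<ge>0. \<forall>b\<in>sa_carrier B. \<phi> t b = cexp (\<lambda>x. complex_of_real t * \<psi> x) b)"
    if sg: "cont_conv_semigroup odot B P \<Delta> \<phi>" and s: "\<forall>t\<ge>0. is_state B (\<phi> t)" for \<phi> :: "real \<Rightarrow> 'v \<Rightarrow> complex"
  proof (rule semigroup_eq_cexp[of \<phi>])
    note sg = sg[unfolded cont_conv_semigroup_def]
    show "lin_fun B (\<phi> t)" if "t \<ge> 0" for t using sg that by blast
    show "\<phi> (s + t) b = ?c (\<phi> s) (\<phi> t) b" if "s \<ge> 0" "t \<ge> 0" "b \<in> sa_carrier B" for s t b using sg that by blast
    show "\<phi> 0 b = 0" if "b \<in> sa_carrier B" for b using sg that by blast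
    show "((\<lambda>t. \<phi> t b) \<longlongrightarrow> 0) (at_right 0)" if "b \<in> sa_carrier B" for b using sg that by blast
    fix \<psi> assume \<psi>: "lin_fun B \<psi>" and lim: "\<And>b. b \<in> sa_carrier B \<Longrightarrow> ((\<lambda>t. \<phi> t b / of_real t) \<longlongrightarrow> \<psi> b) (at_right 0)"
      and eq: "\<And>t b. t \<ge> 0 \<Longrightarrow> b \<in> sa_carrier B \<Longrightarrow> \<phi> t b = cexp (\<lambda>x. of_real t * \<psi> x) b"
    have ev: "eventually (\<lambda>t. t > (0::real)) (at_right 0)" by (rule eventually_at_right_less)
    have star_closed: "sa_star B a \<in> sa_carrier B" if "a \<in> sa_carrier B" for a using star that by (simp add: is_star_alg_def)
    have mul_closed: "sa_mul B a b \<in> sa_carrier B" if "a \<in> sa_carrier B" "b \<in> sa_carrier B" for a b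
      using alg that by (simp add: calg.mul_closed calg_def)
    have "cond_pos B \<psi>" unfolding cond_pos_def
    proof (intro conjI ballI \<psi>)
      fix a assume a: "a \<in> sa_carrier B"
      have "((\<lambda>t. \<phi> t (sa_star B a) / of_real t) \<longlongrightarrow> cnj (\<psi> a)) (at_right 0)"
      proof (rule Lim_transform_eventually[OF tendsto_cnj[OF lim[OF a]]])
        show "eventually (\<lambda>t. cnj (\<phi> t a / of_real t) = \<phi> t (sa_star B a) / of_real t) (at_right 0)"
          using ev by eventually_elim (use s a in \<open>simp add: is_state_star\<close>)
      qed
      then show "\<psi> (sa_star B a) = cnj (\<psi> a)"
        using tendsto_unique[OF _ lim[OF star_closed[OF a]]] trivial_limit_at_right_real by blast
      let ?d = "sa_mul B (sa_star B a) a"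
      have d: "?d \<in> sa_carrier B" using a star_closed mul_closed by blast
      \<comment> \<open>The closedness lemma asks for nonnegativity at every \<open>t\<close>, so
        the quotient is replaced by 0 at times where \<open>\<phi> t\<close> need not be a
        state.\<close>
      have "((\<lambda>t. if t > 0 then \<phi> t ?d / of_real t else 0) \<longlongrightarrow> \<psi> ?d) (at_right 0)"
        by (rule Lim_transform_eventually[OF lim[OF d]]) (use ev in \<open>eventually_elim, simp\<close>)
      then show "nonneg_complex (\<psi> ?d)"
      proof (rule nonneg_complex_limit[rotated])
        fix t :: real
        show "nonneg_complex (if t > 0 then \<phi> t ?d / of_real t else 0)"
          using s is_state_square[of B "\<phi> t" a] a
          by (auto simp: nonneg_complex_iff Re_divide_of_real Im_divide_of_real)
      qed (rule trivial_limit_at_right_real)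
    qed
    then show ?thesis using eq by blast
  qed
  have bwd: "cont_conv_semigroup odot B P \<Delta> \<phi> \<and> (\<forall>t\<ge>0. is_state B (\<phi> t))"
    if \<psi>: "cond_pos B \<psi>" and eq: "\<forall>t\<ge>0. \<forall>b\<in>sa_carrier B. \<phi> t b = cexp (\<lambda>x. complex_of_real t * \<psi> x) b"
    for \<phi> :: "real \<Rightarrow> 'v \<Rightarrow> complex" and \<psi>
  proof -
    note l = lin[OF \<psi>]
    have le: "lin_fun B (cexp (\<lambda>x. complex_of_real t * \<psi> x))" for t by (rule lin_cexp[OF lin_scale[OF l]])
    have "cont_conv_semigroup odot B P \<Delta> \<phi>"
      unfolding cont_conv_semigroup_def
    proof (intro conjI allI impI ballI)
      show "lin_fun B (\<phi> t)" if "t \<ge> 0" for t by (rule lin_cong[OF le]) (use eq that in blast)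
      show "\<phi> (s + t) b = ?c (\<phi> s) (\<phi> t) b" if "s \<ge> 0" "t \<ge> 0" "b \<in> sa_carrier B" for s t b
        using cexp_semigroup[OF l that] conv_cong[OF le[of s] le[of t], of "\<phi> s" "\<phi> t" b] eq that by simp
      fix b assume b: "b \<in> sa_carrier B"
      show "\<phi> 0 b = 0" using eq b cexp_zero[OF b] by simp
      show "((\<lambda>t. \<phi> t b) \<longlongrightarrow> 0) (at_right 0)"
        by (rule Lim_transform_eventually[OF cexp_continuous_at_zero[OF l b]])
           (use eventually_at_right_less[of "0::real"] in \<open>eventually_elim, use eq b in simp\<close>)
    qed
    moreover have "is_state B (\<phi> t)" if "t \<ge> 0" for t
    proof (rule is_state_cong[OF star state])
      show "cond_pos B (\<lambda>x. complex_of_real t * \<psi> x)"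
        using \<psi> that unfolding cond_pos_def lin_fun_def by (auto simp: nonneg_complex_iff algebra_simps)
      show "\<phi> t a = cexp (\<lambda>x. complex_of_real t * \<psi> x) a" if "a \<in> sa_carrier B" for a using eq that \<open>t \<ge> 0\<close> by blast
    qed
    ultimately show ?thesis by blast
  qed
  show ?thesis unfolding ex using exists state fwd bwd by blast
qed

text \<open>A universe that carries only the zero algebra may be finite and then admits no code; but
  every linear functional vanishes, which settles all conditions.\<close>

lemma convolution_structure_trivial:
  assumes ind: "is_independence odot" and P: "is_free_product B B P" and \<Delta>: "xhom B (fst P) \<Delta>" and B: "sa_carrier B = {sa_zero B}"
  shows "convolution_structure B (convolution odot B P \<Delta>)"
proof -
  note a = is_free_product_algs[OF P]
  have zero: "\<phi> b = 0" if "lin_fun B \<phi>" "b \<in> sa_carrier B" for \<phi> b using lin_fun_zero[OF a(1) that(1)] that(2) B by simp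
  have lin: "lin_fun B (convolution odot B P \<Delta> \<phi> \<theta>)" if "lin_fun B \<phi>" "lin_fun B \<theta>" for \<phi> \<theta>
    unfolding convolution_def
    by (rule lin_fun_comp[OF \<Delta> natural_product_lin[OF natural_product_if_independence[OF ind] P that]])
  have cong: "lin_fun B \<phi>'" if "lin_fun B \<phi>" "\<And>a. a \<in> sa_carrier B \<Longrightarrow> \<phi>' a = \<phi> a" for \<phi> \<phi>'
    using that is_alg_add_closed[OF a(1)] is_alg_smul_closed[OF a(1)] by (simp add: lin_fun_def)
  have l0: "lin_fun B (\<lambda>_. 0)" by (simp add: lin_fun_def)
  show ?thesis
  proof
    show "is_alg B" by (rule a)
    show "convolution odot B P \<Delta> \<phi>' \<theta>' b = convolution odot B P \<Delta> \<phi> \<theta> b"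
      if "lin_fun B \<phi>" "lin_fun B \<theta>" "\<And>a. a \<in> sa_carrier B \<Longrightarrow> \<phi>' a = \<phi> a" "\<And>a. a \<in> sa_carrier B \<Longrightarrow> \<theta>' a = \<theta> a"
        "b \<in> sa_carrier B" for \<phi> \<theta> \<phi>' \<theta>' b
      using zero[OF lin[OF cong[OF that(1,3)] cong[OF that(2,4)]] that(5)] zero[OF lin[OF that(1,2)] that(5)] by simp
    show "\<exists>f. Pol2 B B f \<and> (\<forall>\<phi> \<theta>. lin_fun B \<phi> \<longrightarrow> lin_fun B \<theta> \<longrightarrow> convolution odot B P \<Delta> \<phi> \<theta> b = f \<phi> \<theta>)"
      if "b \<in> sa_carrier B" for b
      by (rule exI[of _ "\<lambda>_ _. 0"]) (use Pol2_left[OF Pol.const[of B 0]] zero[OF lin that] in simp)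
  qed (simp_all add: lin l0 zero)
qed

theorem mainTheorem7:
  fixes B :: "'v salg" and P :: "'v fprod" and \<Delta> :: "'v \<Rightarrow> 'v" and odot :: "'v uprod"
  assumes "dual_semigroup B P \<Delta>"
    and "positive_independence odot"
  shows "(\<forall>\<psi>. cond_pos B \<psi> \<longrightarrow>
            conv_exp_exists odot B P \<Delta> \<psi> \<and> is_state B (conv_exp odot B P \<Delta> \<psi>)) \<and>
         (\<forall>\<phi> :: real \<Rightarrow> 'v \<Rightarrow> complex.
            (cont_conv_semigroup odot B P \<Delta> \<phi> \<and> (\<forall>t\<ge>0. is_state B (\<phi> t))) \<longleftrightarrow>
            (\<exists>\<psi>. cond_pos B \<psi> \<and>
               (\<forall>t\<ge>0. \<forall>b\<in>sa_carrier B.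
                  \<phi> t b = conv_exp odot B P \<Delta> (\<lambda>x. complex_of_real t * \<psi> x) b)))"
proof (rule schoenberg_if_exp_state)
  have ind: "is_independence odot" using assms(2) by (simp add: positive_independence_def)
  show star: "is_star_alg B" using assms(1) by (simp add: dual_semigroup_def)
  have alg: "is_alg B" using star by (simp add: is_star_alg_def)
  have "convolution_structure B (convolution odot B P \<Delta>) \<and>
    (\<forall>\<psi>. cond_pos B \<psi> \<longrightarrow> is_state B (convolution_structure.cexp (convolution odot B P \<Delta>) \<psi>))"
  \<comment> \<open>A nonzero element is exactly what \<open>coding_exists\<close> needs to make
    room in \<open>'v\<close>.\<close>
  proof (cases "\<exists>b\<in>sa_carrier B. b \<noteq> sa_zero B")
    case True
    then obtain b where b: "b \<in> sa_carrier B" "b \<noteq> sa_zero B" by blast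
    obtain enc :: "('v \<times> nat) fa \<Rightarrow> 'v" where enc: "coding enc" by (rule coding_exists[OF alg b])
    obtain X \<kappa> where hb: "hermitian_basis B X \<kappa>" by (rule hermitian_basis_exists[OF star])
    interpret lifting B X \<kappa> enc P \<Delta>
      by (intro lifting.intro lifting_axioms.intro hb enc assms(1))
    show ?thesis
      using convolution_structure_if_weak_dual[OF ind weak_dual_if_dual_semigroup[OF assms(1)]] is_state_cexp[OF assms(2)] by blast
  next
    case False
    then have B: "sa_carrier B = {sa_zero B}" using is_alg_zero_closed[OF alg] by blast
    have P: "is_free_product B B P" and \<Delta>: "xhom B (fst P) \<Delta>"
      using assms(1) by (simp_all add: dual_semigroup_def is_star_free_product_def star_hom_def alg_hom_iff_xhom)
    have cs: "convolution_structure B (convolution odot B P \<Delta>)" by (rule convolution_structure_trivial[OF ind P \<Delta> B])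
    have "is_state B (convolution_structure.cexp (convolution odot B P \<Delta>) \<psi>)" if \<psi>: "cond_pos B \<psi>" for \<psi>
    proof (rule is_state_cong[OF star is_state_zero])
      have "lin_fun B (convolution_structure.cexp (convolution odot B P \<Delta>) \<psi>)"
        by (rule convolution_structure.lin_cexp[OF cs]) (use \<psi> in \<open>simp add: cond_pos_def\<close>)
      from lin_fun_zero[OF alg this]
      show "convolution_structure.cexp (convolution odot B P \<Delta>) \<psi> a = 0" if "a \<in> sa_carrier B" for a using that B by simp
    qed
    then show ?thesis using cs by blast
  qed
  then show "convolution_structure B (convolution odot B P \<Delta>)"
    "\<And>\<psi>. cond_pos B \<psi> \<Longrightarrow> is_state B (convolution_structure.cexp (convolution odot B P \<Delta>) \<psi>)" by blast+
qed

end
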